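(* Consider the three-body problem of the type of planetary system with two planets. Fix angular frequencies of planets $\varpi_1\ne0$, $\varpi_2\neq0$, $|\varpi_1|\neq|\varpi_2|$, and consider the two-dimensional torus $\Lambda^\circ$ corresponding to the circular motions of planets with frequencies $\varpi_1,\varpi_2$. Put $T:=\frac{2\pi}{|\varpi_2-\varpi_1|}$, $\alpha=2\pi\frac{\varpi_1}{|\varpi_2-\varpi_1|}+2\pi k\in(-\pi,\pi]$ for a suitable $k\in\mathbb Z$. Depending on the ratio of these frequencies, one of the following statements holds. ($\exists$) Suppose that $\varpi_1,\varpi_2$ do not satisfy the special resonance condition $$\frac{\varpi_1}{\varpi_2}\in\Big\{\frac{k}{k+1}\ \Big|\ k\in\mathbb Z\setminus\{-1,0\}\Big\}.\qquad(\mathrm R)$$ Then $\alpha\ne0$ and there exists $\mu_0=\mu_0(m_1,m_2,\varpi_1,\varpi_2)>0$ such that for any values $\mu,\widetilde\varpi_1,\widetilde\varpi_2$ with $|\mu|+|\widetilde\varpi_1-\varpi_1|+|\widetilde\varpi_2-\varpi_2|\le\mu_0$ there exists a two-dimensional torus $\widetilde\Lambda=\widetilde\Lambda(\mu,\widetilde\varpi_1,\widetilde\varpi_2)$ that depends smoothly on the triple $(\mu,\widetilde\varpi_1,\widetilde\varpi_2)$, coincides with $\Lambda^\circ$ if $(\mu,\widetilde\varpi_1,\widetilde\varpi_2)=(0,\varpi_1,\varpi_2)$, and has the following property: if $0<\mu\le\mu_0$ then $\widetilde\Lambda(\mu,\widetilde\varpi_1,\widetilde\varpi_2)$ is the phase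 orbit of a symmetric $(\widetilde T,\widetilde\alpha)$-periodic solution of the problem with parameters $\widetilde T=\frac{2\pi}{|\widetilde\varpi_2-\widetilde\varpi_1|}$, $\widetilde\alpha=2\pi\frac{\widetilde\varpi_1}{|\widetilde\varpi_2-\widetilde\varpi_1|}+2\pi\widetilde k$ for a suitable $\widetilde k\in\mathbb Z$. ($\nexists$) Suppose that $\varpi_1,\varpi_2$ satisfy the special resonance condition (R). Then $\alpha=0$ and, for any numbers $T,D>0$ with $\frac{\varpi_2-\varpi_1}{2\pi}T\in\mathbb Z$, there exist a number $\mu_0=\mu_0(m_1,m_2,\varpi_1,\varpi_2,T,D)>0$ and a neighbourhood $U=U_{m_1,m_2,\varpi_1,\varpi_2,T,D}$ of the torus $\Lambda^\circ$ in the phase space such that, for any parameter value $\mu\in(0,\mu_0]$ of the three-body problem under consideration, $U$ does not contain any $(\widetilde T,\widetilde\alpha)$-periodic orbit with parameters $\widetilde T,\widetilde\alpha$ of the form $|\widetilde T-T|+|\widetilde\alpha|\le D\mu$.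
   Context: **The problem.** Three particles in the Euclidean plane $\mathbb R^2\cong\mathbb C$ with positions $\mathbf r_0$ (Sun), $\mathbf r_1,\mathbf r_2$ (planets), momenta $\mathbf p_0,\mathbf p_1,\mathbf p_2$, masses $1,\mu m_1,\mu m_2$ ($m_1,m_2>0$ fixed, $m_1+m_2=1$; $\mu>0$ small), gravitational constant $g=1/\mu$, moving by Newton's law with the centre of masses at the origin and total momentum zero (the phase space is $8$-dimensional). Fix a scaling parameter $\varpi>0$ and write $\varpi_i=\varpi\Omega_{i0}$; put $\rho=\varpi^{2/3}\mu^{1/3}$. The phase space is given the coordinates $x_i=\rho(\mathbf r_i-\mathbf r_0)$, $\xi_i=\mathbf p_i/\sqrt{\mu\rho}$, $i=1,2$. In them the system is Hamiltonian with symplectic form $\sum_{i=1}^2d\xi_i\wedge dx_i$ and Hamiltonian $$\varpi\Big(\sum_{i=1}^2\Big(\frac{(1+\mu m_i)\xi_i^2}{2m_i}-\frac{m_i}{|x_i|}\Big)+\mu\Big(\langle\xi_1,\xi_2\rangle-\frac{m_1m_2}{|x_1-x_2|}\Big)\Big),$$ which is also defined for $\mu\le0$. The torus $\Lambda^\circ$ is the union of the trajectories of $(x_l,\xi_l)(t)=e^{i\beta_l}\frac{e^{i\varpi_lt}}{\Omega_{l0}^{2/3}}(1,i\Omega_{l0}m_l)$, $l=1,2$, $\beta_l\in\mathbb R/2\pi\mathbb Z$ (with $\mathbb R^2=\mathbb C$). A solution is $(T,\alpha)$-periodic ($T>0$) if for any initial time the positions of all bodies after time $T$ are obtained from the initial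 positions by rotating the plane by the angle $\alpha$ about the centre of masses. Its phase orbit is the union of the phase trajectories of all solutions obtained from it by time shifts and rotations (a two-dimensional torus). A solution is symmetric if there are a line $l$ and a time $t_0$ such that at $t=t_0$ all particles lie on $l$ with velocities orthogonal to $l$. *)

theory Defs
  imports "HOL-Analysis.Analysis"
begin

section \<open>Smooth families of two-dimensional tori\<close>

text \<open>
  For open \<open>S\<close> in a Euclidean space, differentiability together with \<open>C\<^sup>k\<close>-regularity of
  all directional derivatives is \<open>C\<^sup>k\<^sup>+\<^sup>1\<close>-regularity.
\<close>

primrec Ck_on :: "nat \<Rightarrow> ('a::euclidean_space \<Rightarrow> 'b::real_normed_vector) \<Rightarrow> 'a set \<Rightarrow> bool" where
  "Ck_on 0 f S \<longleftrightarrow> continuous_on S f"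
| "Ck_on (Suc k) f S \<longleftrightarrow>
     (\<forall>x\<in>S. f differentiable (at x)) \<and> (\<forall>v. Ck_on k (\<lambda>x. frechet_derivative f (at x) v) S)"

definition smooth_on :: "('a::euclidean_space \<Rightarrow> 'b::real_normed_vector) \<Rightarrow> 'a set \<Rightarrow> bool" where
  "smooth_on f S \<longleftrightarrow> (\<forall>k. Ck_on k f S)"

text \<open>
  \<open>\<Theta>\<close> induces an embedding of the torus \<open>(\<real>/2\<pi>\<int>)\<^sup>2\<close>, given in angular coordinates: doubly
  periodic, injective modulo periods, and an immersion. Its smoothness is imposed below.
\<close>

definition torus_embedding :: "(real \<times> real \<Rightarrow> 'b::euclidean_space) \<Rightarrow> bool" where
  "torus_embedding \<Theta> \<longleftrightarrow>
     (\<forall>a b. \<Theta> (a + 2 * pi, b) = \<Theta> (a, b) \<and> \<Theta> (a, b + 2 * pi) = \<Theta> (a, b)) \<and>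
     inj_on \<Theta> ({0..<2 * pi} \<times> {0..<2 * pi}) \<and>
     (\<forall>\<theta>. inj (frechet_derivative \<Theta> (at \<theta>)))"

text \<open>
  Two-dimensional tori \<open>\<Lambda> p\<close> depending smoothly on \<open>p \<in> P\<close>. The set \<open>P\<close> need not be open, so
  smoothness is required on an open set \<open>W \<supseteq> P\<close>, jointly in the parameter and the angles.
\<close>

definition smooth_torus_family ::
  "'p::euclidean_space set \<Rightarrow> ('p \<Rightarrow> 'b::euclidean_space set) \<Rightarrow> bool" where
  "smooth_torus_family P \<Lambda> \<longleftrightarrow>
     (\<exists>(F :: 'p \<times> real \<times> real \<Rightarrow> 'b) W. open W \<and> P \<subseteq> W \<and> smooth_on F (W \<times> UNIV) \<and>
        (\<forall>p\<in>P. torus_embedding (\<lambda>\<theta>. F (p, \<theta>)) \<and> \<Lambda> p = range (\<lambda>\<theta>. F (p, \<theta>))))"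


section \<open>The three-body problem of planetary type\<close>

text \<open>Body \<open>0\<close> is the Sun, bodies \<open>1\<close> and \<open>2\<close> are the planets.\<close>

definition body_mass :: "real \<Rightarrow> real \<Rightarrow> real \<Rightarrow> nat \<Rightarrow> real" where
  "body_mass \<mu> m1 m2 j = (if j = 0 then 1 else if j = 1 then \<mu> * m1 else \<mu> * m2)"

definition velocity :: "(nat \<Rightarrow> real \<Rightarrow> complex) \<Rightarrow> nat \<Rightarrow> real \<Rightarrow> complex" where
  "velocity r j t = vector_derivative (r j) (at t)"

definition momentum :: "real \<Rightarrow> real \<Rightarrow> real \<Rightarrow> (nat \<Rightarrow> real \<Rightarrow> complex) \<Rightarrow> nat \<Rightarrow> real \<Rightarrow> complex" where
  "momentum \<mu> m1 m2 r j t = body_mass \<mu> m1 m2 j *\<^sub>R velocity r j t"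

text \<open>
  Collisionless solutions on the whole time axis of Newton's equations with gravitational
  constant \<open>1/\<mu>\<close>, in the centre-of-mass frame.
\<close>

definition three_body_solution ::
  "real \<Rightarrow> real \<Rightarrow> real \<Rightarrow> (nat \<Rightarrow> real \<Rightarrow> complex) \<Rightarrow> bool" where
  "three_body_solution \<mu> m1 m2 r \<longleftrightarrow>
     (\<forall>t. inj_on (\<lambda>j. r j t) {..<3}) \<and>
     (\<forall>t. \<forall>j<3. (r j has_vector_derivative velocity r j t) (at t)) \<and>
     (\<forall>t. \<forall>j<3. (velocity r j has_vector_derivative
        (\<Sum>k\<in>{..<3} - {j}. ((1 / \<mu>) * body_mass \<mu> m1 m2 k / cmod (r k t - r j t) ^ 3) *\<^sub>R
           (r k t - r j t))) (at t)) \<and>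
     (\<forall>t. (\<Sum>j<3. body_mass \<mu> m1 m2 j *\<^sub>R r j t) = 0) \<and>
     (\<forall>t. (\<Sum>j<3. momentum \<mu> m1 m2 r j t) = 0)"

definition rel_periodic :: "real \<Rightarrow> real \<Rightarrow> (nat \<Rightarrow> real \<Rightarrow> complex) \<Rightarrow> bool" where
  "rel_periodic T \<alpha> r \<longleftrightarrow> T > 0 \<and> (\<forall>t. \<forall>j<3. r j (t + T) = cis \<alpha> * r j t)"

definition symmetric_solution :: "(nat \<Rightarrow> real \<Rightarrow> complex) \<Rightarrow> bool" where
  "symmetric_solution r \<longleftrightarrow>
     (\<exists>a u t0. u \<noteq> 0 \<and>
        (\<forall>j<3. r j t0 \<in> {a + s *\<^sub>R u | s. True} \<and> inner (velocity r j t0) u = 0))"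


section \<open>Phase space\<close>

text \<open>
  Coordinates \<open>(x\<^sub>1, x\<^sub>2, \<xi>\<^sub>1, \<xi>\<^sub>2)\<close>. The argument \<open>\<omega> > 0\<close> below is the scaling parameter
  entering the coordinates, and \<open>scale \<omega> \<mu>\<close> is the length scale \<open>\<rho> = \<omega>\<^sup>2\<^sup>/\<^sup>3 \<mu>\<^sup>1\<^sup>/\<^sup>3\<close>, used for \<open>\<mu> > 0\<close>.
\<close>

type_synonym phase = "complex \<times> complex \<times> complex \<times> complex"

definition phase_space :: "phase set" where
  "phase_space = {(x1, x2, \<xi>1, \<xi>2). x1 \<noteq> 0 \<and> x2 \<noteq> 0 \<and> x1 \<noteq> x2}"

definition scale :: "real \<Rightarrow> real \<Rightarrow> real" where
  "scale \<omega> \<mu> = \<omega> powr (2/3) * \<mu> powr (1/3)"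

definition phase_point ::
  "real \<Rightarrow> real \<Rightarrow> real \<Rightarrow> real \<Rightarrow> (nat \<Rightarrow> real \<Rightarrow> complex) \<Rightarrow> real \<Rightarrow> phase" where
  "phase_point \<omega> \<mu> m1 m2 r t =
     (let \<rho> = scale \<omega> \<mu> in
       (\<rho> *\<^sub>R (r 1 t - r 0 t),
        \<rho> *\<^sub>R (r 2 t - r 0 t),
        (1 / sqrt (\<mu> * \<rho>)) *\<^sub>R momentum \<mu> m1 m2 r 1 t,
        (1 / sqrt (\<mu> * \<rho>)) *\<^sub>R momentum \<mu> m1 m2 r 2 t))"

definition phase_orbit ::
  "real \<Rightarrow> real \<Rightarrow> real \<Rightarrow> real \<Rightarrow> (nat \<Rightarrow> real \<Rightarrow> complex) \<Rightarrow> phase set" where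
  "phase_orbit \<omega> \<mu> m1 m2 r =
     (\<Union>\<beta>. \<Union>s. range (phase_point \<omega> \<mu> m1 m2 (\<lambda>j t. cis \<beta> * r j (t + s))))"

text \<open>
  \<open>\<omega>l\<close> is the frequency of the planet and \<open>\<Omega> = \<omega>l / \<omega>\<close>. Frequencies may be negative;
  \<open>\<Omega>\<^sup>2\<^sup>/\<^sup>3\<close> denotes the positive real \<open>\<bar>\<Omega>\<bar>\<^sup>2\<^sup>/\<^sup>3\<close>.
\<close>

definition circular_position :: "real \<Rightarrow> real \<Rightarrow> real \<Rightarrow> real \<Rightarrow> complex" where
  "circular_position \<omega> \<omega>l \<beta> t =
     (let \<Omega> = \<omega>l / \<omega> in cis \<beta> * (cis (\<omega>l * t) / of_real (\<bar>\<Omega>\<bar> powr (2/3))))"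

definition circular_momentum :: "real \<Rightarrow> real \<Rightarrow> real \<Rightarrow> real \<Rightarrow> real \<Rightarrow> complex" where
  "circular_momentum \<omega> \<omega>l ml \<beta> t =
     (let \<Omega> = \<omega>l / \<omega> in circular_position \<omega> \<omega>l \<beta> t * (\<i> * of_real (\<Omega> * ml)))"

definition circular_torus :: "real \<Rightarrow> real \<Rightarrow> real \<Rightarrow> real \<Rightarrow> real \<Rightarrow> phase set" where
  "circular_torus \<omega> m1 m2 \<omega>1 \<omega>2 =
     (\<Union>\<beta>1. \<Union>\<beta>2. range (\<lambda>t.
        (circular_position \<omega> \<omega>1 \<beta>1 t, circular_position \<omega> \<omega>2 \<beta>2 t,
         circular_momentum \<omega> \<omega>1 m1 \<beta>1 t, circular_momentum \<omega> \<omega>2 m2 \<beta>2 t)))"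


section \<open>Frequencies\<close>

definition special_resonance :: "real \<Rightarrow> real \<Rightarrow> bool" where
  "special_resonance \<omega>1 \<omega>2 \<longleftrightarrow>
     \<omega>1 / \<omega>2 \<in> {of_int k / (of_int k + 1) | k :: int. k \<notin> {-1, 0}}"

definition parameter_ball :: "real \<Rightarrow> real \<Rightarrow> real \<Rightarrow> (real \<times> real \<times> real) set" where
  "parameter_ball \<mu>0 \<omega>1 \<omega>2 =
     {(\<mu>, v1, v2). \<bar>\<mu>\<bar> + \<bar>v1 - \<omega>1\<bar> + \<bar>v2 - \<omega>2\<bar> \<le> \<mu>0}"

end

theory Submission
  imports Defs "HOL-Complex_Analysis.Complex_Analysis"
begin

text \<open>
  In units in which the heliocentric positions and velocities stay bounded as \<open>\<mu> \<rightarrow> 0\<close>, the planets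
  move as two Kepler problems coupled by terms of order \<open>\<mu>\<close>.

  Existence. Write the planets as circular motions times \<open>1 + w\<^sub>j (\<tau>)\<close> with \<open>w\<^sub>j\<close> a \<open>2\<pi>\<close>-periodic function
  of the relative angle \<open>\<tau> = (\<omega>\<^sub>2 - \<omega>\<^sub>1) t\<close> satisfying \<open>w\<^sub>j (- \<tau>) = cnj (w\<^sub>j \<tau>)\<close>. The linearized
  equation has a unique solution with this symmetry, given by explicit convolution kernels, as long
  as \<open>\<omega>\<^sub>j / (\<omega>\<^sub>2 - \<omega>\<^sub>1)\<close> is not an integer, so the equations for \<open>w\<^sub>1, w\<^sub>2\<close> are solved by the contraction
  principle. With all parameters complexified, the iteration takes place among holomorphic functions,
  and a uniform limit of these is holomorphic; this makes the family of tori smooth.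

  Nonexistence. In the resonant case the frequencies are \<open>k \<nu>\<close> and \<open>(k + 1) \<nu>\<close>. The eccentricity vector
  of the inner planet is constant in the Kepler problem and zero on circular orbits. Over a time
  \<open>T\<close> it changes by \<open>\<mu>\<close> times an integral which, along circular motions, is a nonzero combination of
  two Fourier coefficients of the attraction of the outer planet, whereas for a \<open>(T', \<alpha>')\<close>-periodic
  orbit close to circular it could only change by \<open>o(\<mu>)\<close>.
\<close>

section \<open>Holomorphic functions of several complex variables\<close>

text \<open>The symmetry does two jobs. On functions with
  \<open>cnj (w \<tau>) = w (- \<tau>)\<close> conjugation can be replaced by reflection of \<tau>,
  so the equations become holomorphic in every variable. It also removes the phase shifts
  \<open>w = \<i>c\<close> with real \<open>c\<close> from the kernel of the linearized operator.
  What could remain are the eccentric modes of \<tau>-frequency \<open>\<kappa>\<^sub>j =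
  \<omega>\<^sub>j / (\<omega>\<^sub>2 - \<omega>\<^sub>1)\<close>, periodic only for integral
  \<open>\<kappa>\<^sub>j\<close>. Since \<open>\<kappa>\<^sub>2 = \<kappa>\<^sub>1 + 1\<close>,
  both planets become resonant together, and this is condition (R). In the nonexistence part the
  inner planet is the one to watch: the direct attraction expands in powers of the ratio of the
  radii with coefficients of one sign, while the reaction of the Sun to the outer planet carries
  only the harmonics \<open>k - 1\<close> and \<open>k + 1\<close>, which average out. For the outer
  planet one of these would survive in the resonance 1:2 and compete with the direct term. All
  estimates are made in units that do not contain the scaling parameter; therefore \<mu>0 can be
  chosen before it.\<close>

lemma continuous_on_smult_vec [continuous_intros]:
  fixes f :: "'a::topological_space \<Rightarrow> complex" and g :: "'a \<Rightarrow> complex^'n"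
  assumes "continuous_on A f" "continuous_on A g"
  shows "continuous_on A (\<lambda>x. f x *s g x)"
  unfolding vector_scalar_mult_def
  by (intro continuous_on_vec_lambda continuous_intros assms)

text \<open>Holomorphy is encoded as continuity plus complex differentiability along complex lines,
  so that closure under algebra, limits and integrals comes from one-variable theory. Joint
  differentiability on open sets is recovered in \<open>gholo_has_derivative\<close>.\<close>

definition gholo :: "(complex^'n) set \<Rightarrow> (complex^'n \<Rightarrow> complex) \<Rightarrow> bool" where
  "gholo S f \<longleftrightarrow> continuous_on S f \<and>
     (\<forall>x\<in>S. \<forall>v. (\<lambda>z. f (x + z *s v)) field_differentiable (at 0))"

definition dderiv :: "(complex^'n \<Rightarrow> complex) \<Rightarrow> complex^'n \<Rightarrow> complex^'n \<Rightarrow> complex" where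
  "dderiv f v x = deriv (\<lambda>z. f (x + z *s v)) 0"

lemma gholo_imp_continuous_on: "gholo S f \<Longrightarrow> continuous_on S f"
  by (simp add: gholo_def)

text \<open>The definition differentiates only at the base point; moving the base point to
  \<open>x + z *s v\<close> covers the whole line.\<close>

lemma gholo_line_DERIV:
  assumes "gholo S f" "x + z *s v \<in> S"
  shows "((\<lambda>z. f (x + z *s v)) has_field_derivative dderiv f v (x + z *s v)) (at z)"
proof -
  have "(\<lambda>u. f ((x + z *s v) + u *s v)) field_differentiable (at 0)"
    using assms unfolding gholo_def by blast
  then have "((\<lambda>u. f ((x + z *s v) + u *s v)) has_field_derivative dderiv f v (x + z *s v)) (at (z - z))"
    unfolding dderiv_def by (simp add: DERIV_deriv_iff_field_differentiable)
  then have "((\<lambda>u. f ((x + z *s v) + (u - z) *s v)) has_field_derivative dderiv f v (x + z *s v)) (at z)"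
    using DERIV_shift[of "\<lambda>u. f ((x + z *s v) + u *s v)" "dderiv f v (x + z *s v)" z "-z"] by simp
  moreover have "(\<lambda>u. f ((x + z *s v) + (u - z) *s v)) = (\<lambda>u. f (x + u *s v))"
    by (simp add: algebra_simps vec_eq_iff)
  ultimately show ?thesis by simp
qed

lemma gholo_subset: "gholo S f \<Longrightarrow> T \<subseteq> S \<Longrightarrow> gholo T f"
  unfolding gholo_def by (blast intro: continuous_on_subset)

lemma eventually_line_in:
  fixes S :: "(complex^'n) set"
  assumes "open S" "x \<in> S"
  shows "\<forall>\<^sub>F z in nhds 0. x + z *s v \<in> S"
proof -
  have "continuous_on UNIV (\<lambda>z. x + z *s v)"
    by (intro continuous_intros)
  then have "open ((\<lambda>z. x + z *s v) -` S)"
    using assms(1) continuous_on_open_vimage open_UNIV by (metis Int_UNIV_right)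
  moreover have "0 \<in> (\<lambda>z. x + z *s v) -` S" using assms(2) by simp
  ultimately show ?thesis
    unfolding eventually_nhds by blast
qed

lemma gholo_cong:
  assumes "open S" "gholo S f" "\<And>x. x \<in> S \<Longrightarrow> f x = g x"
  shows "gholo S g"
  unfolding gholo_def
proof (intro conjI ballI allI)
  show "continuous_on S g"
    using assms gholo_imp_continuous_on continuous_on_eq by blast
next
  fix x v assume x: "x \<in> S"
  have ev: "\<forall>\<^sub>F z in nhds 0. f (x + z *s v) = g (x + z *s v)"
    using eventually_line_in[OF assms(1) x, of v] by eventually_elim (rule assms(3))
  have "(\<lambda>z. f (x + z *s v)) field_differentiable (at 0)"
    using assms(2) x unfolding gholo_def by blast
  then show "(\<lambda>z. g (x + z *s v)) field_differentiable (at 0)"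
    unfolding field_differentiable_def using DERIV_cong_ev[OF refl ev refl] by blast
qed

lemma gholo_local:
  assumes "\<And>x. x \<in> S \<Longrightarrow> \<exists>T. open T \<and> x \<in> T \<and> gholo T f"
  shows "gholo S f"
  unfolding gholo_def
proof (intro conjI ballI allI)
  show "continuous_on S f"
    unfolding continuous_on_eq_continuous_within
  proof
    fix x assume "x \<in> S"
    then obtain T where T: "open T" "x \<in> T" "gholo T f" using assms by blast
    then have "continuous (at x) f"
      using gholo_imp_continuous_on continuous_on_eq_continuous_at by blast
    then show "continuous (at x within S) f"
      by (rule continuous_at_imp_continuous_within)
  qed
next
  fix x v assume "x \<in> S"
  then show "(\<lambda>z. f (x + z *s v)) field_differentiable (at 0)"
    using assms unfolding gholo_def by blast
qed

lemma gholo_const [intro, simp]: "gholo S (\<lambda>x. c)"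
  by (simp add: gholo_def)

lemma gholo_component [intro, simp]: "gholo S (\<lambda>x. x $ i)"
  unfolding gholo_def by (auto intro!: continuous_intros derivative_intros)

lemma gholo_add [intro]: "gholo S f \<Longrightarrow> gholo S g \<Longrightarrow> gholo S (\<lambda>x. f x + g x)"
  unfolding gholo_def by (auto intro!: continuous_intros derivative_intros)

lemma gholo_diff [intro]: "gholo S f \<Longrightarrow> gholo S g \<Longrightarrow> gholo S (\<lambda>x. f x - g x)"
  unfolding gholo_def by (auto intro!: continuous_intros derivative_intros)

lemma gholo_uminus [intro]: "gholo S f \<Longrightarrow> gholo S (\<lambda>x. - f x)"
  unfolding gholo_def by (auto intro!: continuous_intros derivative_intros)

lemma gholo_mult [intro]: "gholo S f \<Longrightarrow> gholo S g \<Longrightarrow> gholo S (\<lambda>x. f x * g x)"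
  unfolding gholo_def by (auto intro!: continuous_intros derivative_intros)

lemma gholo_power [intro]: "gholo S f \<Longrightarrow> gholo S (\<lambda>x. f x ^ n)"
  by (induction n) auto

lemma gholo_compose:
  assumes f: "gholo S f" and g: "\<And>x. x \<in> S \<Longrightarrow> g field_differentiable (at (f x))"
  shows "gholo S (\<lambda>x. g (f x))"
  unfolding gholo_def
proof (intro conjI ballI allI)
  have "continuous_on (f ` S) g"
    using g by (intro continuous_at_imp_continuous_on) (auto intro: field_differentiable_imp_continuous_at)
  then show "continuous_on S (\<lambda>x. g (f x))"
    by (rule continuous_on_compose2[OF _ gholo_imp_continuous_on[OF f]]) auto
next
  fix x v assume x: "x \<in> S"
  have "(\<lambda>z. f (x + z *s v)) field_differentiable (at 0)"
    using f x unfolding gholo_def by blast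
  moreover have "g field_differentiable (at (f (x + 0 *s v)))"
    using g[OF x] by simp
  ultimately show "(\<lambda>z. g (f (x + z *s v))) field_differentiable (at 0)"
    using field_differentiable_compose[of "\<lambda>z. f (x + z *s v)" 0 g] by (simp add: o_def)
qed

lemma gholo_inverse [intro]:
  assumes "gholo S f" "\<And>x. x \<in> S \<Longrightarrow> f x \<noteq> 0"
  shows "gholo S (\<lambda>x. inverse (f x))"
  using assms by (intro gholo_compose[where g = inverse] field_differentiable_inverse) auto

lemma gholo_divide [intro]:
  assumes "gholo S f" "gholo S g" "\<And>x. x \<in> S \<Longrightarrow> g x \<noteq> 0"
  shows "gholo S (\<lambda>x. f x / g x)"
  unfolding divide_inverse using assms by (intro gholo_mult gholo_inverse)

lemma gholo_exp [intro]: "gholo S f \<Longrightarrow> gholo S (\<lambda>x. exp (f x))"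
  by (rule gholo_compose[where g = exp]) (auto intro: field_differentiable_within_exp)

text \<open>\<open>L\<close> is the linear part of \<open>A\<close>, so \<open>A\<close> carries
  complex lines to complex lines. Time shifts, the reflection and the removal of the angle are all
  of this kind.\<close>

lemma gholo_affine:
  assumes f: "gholo T f" and A: "continuous_on S A" "A ` S \<subseteq> T"
    and L: "\<And>x v z. A (x + z *s v) = A x + z *s L v"
  shows "gholo S (\<lambda>x. f (A x))"
  unfolding gholo_def
proof (intro conjI ballI allI)
  show "continuous_on S (\<lambda>x. f (A x))"
    using continuous_on_compose2[OF gholo_imp_continuous_on[OF f] A] .
next
  fix x v assume "x \<in> S"
  then show "(\<lambda>z. f (A (x + z *s v))) field_differentiable (at 0)"
    using f A(2) unfolding gholo_def L by blast
qed

text \<open>Weierstrass's theorem on each complex line. It makes the class of deviations closed, so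
  that a fixed point found by iteration is still holomorphic.\<close>

lemma gholo_uniform_limit:
  assumes S: "open S" and F: "\<And>n. gholo S (F n)" and lim: "uniform_limit S F f sequentially"
  shows "gholo S f"
  unfolding gholo_def
proof (intro conjI ballI allI)
  show "continuous_on S f"
    using uniform_limit_theorem[OF _ lim] F gholo_imp_continuous_on by (auto intro: always_eventually)
next
  fix x v assume x: "x \<in> S"
  define U where "U = (\<lambda>z. x + z *s v) -` S"
  have "continuous_on UNIV (\<lambda>z. x + z *s v)"
    by (intro continuous_intros)
  then have U: "open U"
    unfolding U_def using S continuous_on_open_vimage open_UNIV by (metis Int_UNIV_right)
  have "(\<lambda>z. f (x + z *s v)) holomorphic_on U"
  proof (rule holomorphic_uniform_sequence[OF U, of "\<lambda>n z. F n (x + z *s v)"])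
    show "(\<lambda>z. F n (x + z *s v)) holomorphic_on U" for n
      using gholo_line_DERIV[OF F] U unfolding U_def
      by (auto simp: holomorphic_on_open intro!: exI)
  next
    fix z assume "z \<in> U"
    then obtain d where d: "d > 0" "cball z d \<subseteq> U" using U open_contains_cball by blast
    have "uniform_limit (cball z d) (\<lambda>n z. F n (x + z *s v)) (\<lambda>z. f (x + z *s v)) sequentially"
    proof (rule uniform_limitI)
      fix e :: real assume "e > 0"
      from uniform_limitD[OF lim this]
      show "\<forall>\<^sub>F n in sequentially. \<forall>z\<in>cball z d. dist (F n (x + z *s v)) (f (x + z *s v)) < e"
        by eventually_elim (use d U_def in auto)
    qed
    with d show "\<exists>d>0. cball z d \<subseteq> U \<and>
        uniform_limit (cball z d) (\<lambda>n z. F n (x + z *s v)) (\<lambda>z. f (x + z *s v)) sequentially"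
      by blast
  qed
  moreover have "0 \<in> U" using x by (simp add: U_def)
  ultimately show "(\<lambda>z. f (x + z *s v)) field_differentiable (at 0)"
    using U holomorphic_on_imp_differentiable_at by blast
qed

section \<open>Directional derivatives through Cauchy's formula\<close>

lemma deriv_eq_circle_integral:
  fixes g :: "complex \<Rightarrow> complex"
  assumes g: "g holomorphic_on ball 0 R" and r: "0 < r" "r < R"
  shows "deriv g 0 = integral {0..1} (\<lambda>t. g (of_real r * cis (2 * pi * t)) / (of_real r * cis (2 * pi * t)))"
proof -
  have "(g has_field_derivative
      1 / (2 * of_real pi * \<i>) * contour_integral (circlepath 0 r) (\<lambda>u. g u / (u - 0)\<^sup>2)) (at 0)"
  proof (rule Cauchy_derivative_integral_circlepath)
    have "cball 0 r \<subseteq> ball (0::complex) R" using r by auto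
    then show "continuous_on (cball 0 r) g"
      using g holomorphic_on_imp_continuous_on continuous_on_subset by blast
    show "g holomorphic_on ball 0 r"
      using g r by (rule_tac holomorphic_on_subset[OF g]) auto
  qed (use r in auto)
  then have "deriv g 0 = 1 / (2 * of_real pi * \<i>) * contour_integral (circlepath 0 r) (\<lambda>u. g u / (u - 0)\<^sup>2)"
    by (rule DERIV_imp_deriv)
  also have "contour_integral (circlepath 0 r) (\<lambda>u. g u / (u - 0)\<^sup>2) =
      integral {0..1} (\<lambda>t. (2 * of_real pi * \<i>) * (g (of_real r * cis (2 * pi * t)) / (of_real r * cis (2 * pi * t))))"
    unfolding contour_integral_integral
  proof (rule integral_cong)
    fix t :: real
    have e: "circlepath 0 r t = of_real r * cis (2 * pi * t)"
      by (simp add: circlepath cis_conv_exp mult_ac)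
    have v: "vector_derivative (circlepath 0 r) (at t) = 2 * of_real pi * \<i> * (of_real r * cis (2 * pi * t))"
      by (simp add: vector_derivative_circlepath cis_conv_exp mult_ac)
    show "g (circlepath 0 r t) / (circlepath 0 r t - 0)\<^sup>2 * vector_derivative (circlepath 0 r) (at t) =
      (2 * of_real pi * \<i>) * (g (of_real r * cis (2 * pi * t)) / (of_real r * cis (2 * pi * t)))"
      unfolding e v using r by (simp add: power2_eq_square field_simps)
  qed
  finally show ?thesis
    by (simp only: integral_mult_right) simp
qed

lemma norm_smult_vec: "norm (c *s (v::complex^'n)) = cmod c * norm v"
  unfolding norm_vec_def by (simp add: norm_mult L2_set_left_distrib[symmetric] L2_set_right_distrib)

text \<open>Cauchy's formula over the fixed interval \<open>{0..1}\<close>: a derivative becomes an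
  integral of values of \<open>f\<close>, so its dependence on the point is governed by theorems on
  parameter integrals.\<close>

lemma dderiv_eq_circle_integral:
  assumes f: "gholo (ball x R) f" and r: "0 < r" "r * norm v < R"
  shows "dderiv f v x =
    integral {0..1} (\<lambda>t. f (x + (of_real r * cis (2 * pi * t)) *s v) / (of_real r * cis (2 * pi * t)))"
proof (cases "v = 0")
  case False
  then have v: "norm v > 0" by simp
  have "(\<lambda>z. f (x + z *s v)) holomorphic_on ball 0 (R / norm v)"
  proof -
    have "x + z *s v \<in> ball x R" if "cmod z < R / norm v" for z
      using that v by (simp add: dist_norm norm_smult_vec field_simps)
    then show ?thesis
      using gholo_line_DERIV[OF f] by (force simp: holomorphic_on_open)
  qed
  then show ?thesis
    unfolding dderiv_def
    using deriv_eq_circle_integral[of "\<lambda>z. f (x + z *s v)" "R / norm v" r] r v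
    by (simp add: field_simps)
next
  case True
  have "integral {0..1} (\<lambda>t. 1 / (of_real r * cis (2 * pi * t))) = 0"
    using deriv_eq_circle_integral[of "\<lambda>z. 1" "r + 1" r] r by simp
  then have "integral {0..1} (\<lambda>t. f x * (1 / (of_real r * cis (2 * pi * t)))) = 0"
    by (simp only: integral_mult_right mult_zero_right)
  then show ?thesis
    unfolding dderiv_def using True by simp
qed

lemma dderiv_continuous_param:
  fixes \<Phi> :: "real \<Rightarrow> complex^'n \<Rightarrow> complex"
  assumes S: "open S" and c: "continuous_on (T \<times> S) (\<lambda>(t, x). \<Phi> t x)"
    and h: "\<And>t. t \<in> T \<Longrightarrow> gholo S (\<Phi> t)"
  shows "continuous_on (T \<times> S) (\<lambda>(t, x). dderiv (\<Phi> t) v x)"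
  unfolding continuous_on_eq_continuous_within
proof safe
  fix t0 x0 assume t0: "t0 \<in> T" and x0: "x0 \<in> S"
  obtain R where R: "R > 0" "ball x0 R \<subseteq> S" using S x0 open_contains_ball by blast
  define U where "U = ball x0 (R/2)"
  \<comment> \<open>One radius for all centres in the half ball: \<open>r * norm v < R / 2\<close>
    keeps every circle inside \<open>ball x0 R\<close>; the \<open>+ 1\<close> covers
    \<open>v = 0\<close>.\<close>
  define r where "r = R / (4 * (norm v + 1))"
  have np: "norm v + 1 > 0" using norm_ge_zero[of v] by linarith
  have r: "r > 0" using R np by (simp add: r_def)
  have "norm v / (norm v + 1) < 1" using np by simp
  then have "R / 4 * (norm v / (norm v + 1)) < R / 4 * 2" using R(1) by (intro mult_strict_left_mono) auto
  then have rv: "r * norm v < R / 2" using R np by (simp add: r_def field_simps)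
  have inS: "x + (of_real r * cis s) *s v \<in> S" if "x \<in> U" for x s
  proof -
    have "dist x0 (x + (of_real r * cis s) *s v) \<le> dist x0 x + norm ((of_real r * cis s) *s v)"
      by (metis add_diff_cancel_left' dist_norm dist_triangle norm_minus_commute)
    also have "\<dots> < R" using that rv r by (simp add: U_def norm_smult_vec norm_mult)
    finally show ?thesis using R by auto
  qed
  define F where "F = (\<lambda>p::real \<times> (complex^'n). \<lambda>s. \<Phi> (fst p) (snd p + (of_real r * cis (2 * pi * s)) *s v)
                         / (of_real r * cis (2 * pi * s)))"
  have "continuous_on ((T \<times> U) \<times> cbox 0 1) (\<lambda>(p, s). F p s)"
    unfolding F_def case_prod_unfold
    using r inS
    by (intro continuous_intros continuous_on_compose2[OF c[unfolded case_prod_unfold],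
       where f = "\<lambda>q. (fst (fst q), snd (fst q) + (of_real r * cis (2 * pi * snd q)) *s v)", simplified]) auto
  then have cF: "continuous_on (T \<times> U) (\<lambda>p. integral (cbox 0 1) (F p))"
    by (rule integral_continuous_on_param)
  have eq: "integral (cbox 0 1) (F p) = (case p of (t, x) \<Rightarrow> dderiv (\<Phi> t) v x)" if pTU: "p \<in> T \<times> U" for p
  proof -
    obtain t x where p: "p = (t, x)" "t \<in> T" "x \<in> U" using pTU by (cases p) auto
    have "ball x (R/2) \<subseteq> S"
    proof
      fix y assume "y \<in> ball x (R/2)"
      then have "dist x0 y < R" using p(3) dist_triangle[of x0 y x] by (simp add: U_def)
      then show "y \<in> S" using R by auto
    qed
    then have "gholo (ball x (R/2)) (\<Phi> t)" using h[OF p(2)] gholo_subset by blast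
    from dderiv_eq_circle_integral[OF this r rv] show ?thesis by (simp add: p F_def)
  qed
  have "continuous_on (T \<times> U) (\<lambda>(t, x). dderiv (\<Phi> t) v x)"
    using cF eq by (rule continuous_on_eq)
  moreover have "(t0, x0) \<in> T \<times> U" using t0 R by (simp add: U_def)
  ultimately have "continuous (at (t0, x0) within T \<times> U) (\<lambda>(t, x). dderiv (\<Phi> t) v x)"
    by (simp add: continuous_on_eq_continuous_within)
  moreover have "at (t0, x0) within T \<times> U = at (t0, x0) within T \<times> S"
  proof (rule at_within_nhd[of _ "UNIV \<times> U"])
    have "U \<subseteq> S" using R by (auto simp: U_def)
    then show "T \<times> U \<inter> UNIV \<times> U - {(t0, x0)} = T \<times> S \<inter> UNIV \<times> U - {(t0, x0)}" by auto
  qed (use R in \<open>auto simp: U_def open_Times\<close>)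
  ultimately show "continuous (at (t0, x0) within T \<times> S) (\<lambda>(t, x). dderiv (\<Phi> t) v x)" by simp
qed

lemma dderiv_continuous:
  fixes S :: "(complex^'n) set"
  assumes "open S" "gholo S f"
  shows "continuous_on S (dderiv f v)"
proof -
  have "continuous_on ({0::real} \<times> S) (\<lambda>(t, x). dderiv f v x)"
    using assms gholo_imp_continuous_on[OF assms(2)]
    by (intro dderiv_continuous_param[where \<Phi> = "\<lambda>t. f"])
      (auto simp: case_prod_unfold intro!: continuous_on_compose2[where g = f and f = snd] continuous_intros)
  then have "continuous_on S (\<lambda>x. (\<lambda>(t, x). dderiv f v x) (0::real, x))"
    by (rule continuous_on_compose2) (auto intro!: continuous_intros)
  then show ?thesis by simp
qed

text \<open>Differentiation under the integral sign along each line; the derivative of the integrand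
  is jointly continuous by \<open>dderiv_continuous_param\<close>.\<close>

lemma gholo_integral:
  fixes \<Phi> :: "real \<Rightarrow> complex^'n \<Rightarrow> complex"
  assumes S: "open S" and c: "continuous_on ({a..b} \<times> S) (\<lambda>(t, x). \<Phi> t x)"
    and h: "\<And>t. t \<in> {a..b} \<Longrightarrow> gholo S (\<Phi> t)"
  shows "gholo S (\<lambda>x. integral {a..b} (\<lambda>t. \<Phi> t x))"
  unfolding gholo_def
proof (intro conjI ballI allI)
  have "continuous_on (S \<times> cbox a b) (\<lambda>(x, t). \<Phi> t x)"
    unfolding case_prod_unfold
    by (intro continuous_on_compose2[OF c[unfolded case_prod_unfold], where f = "\<lambda>q. (snd q, fst q)", simplified]
        continuous_intros) auto
  then show "continuous_on S (\<lambda>x. integral {a..b} (\<lambda>t. \<Phi> t x))"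
    using integral_continuous_on_param[of S a b "\<lambda>x t. \<Phi> t x"] by simp
next
  fix x v assume x: "x \<in> S"
  have "continuous_on UNIV (\<lambda>z. x + z *s v)"
    by (intro continuous_intros)
  then have "open ((\<lambda>z. x + z *s v) -` S)"
    using S continuous_on_open_vimage open_UNIV by (metis Int_UNIV_right)
  moreover have "0 \<in> (\<lambda>z. x + z *s v) -` S" using x by simp
  ultimately obtain e where e: "e > 0" "ball 0 e \<subseteq> (\<lambda>z. x + z *s v) -` S"
    using open_contains_ball by blast
  have inS: "x + z *s v \<in> S" if "z \<in> ball 0 e" for z :: complex using e that by blast
  have "(\<lambda>z. integral (cbox a b) (\<lambda>t. \<Phi> t (x + z *s v))) holomorphic_on ball 0 e"
  proof (rule leibniz_rule_holomorphic[where fx = "\<lambda>z t. dderiv (\<Phi> t) v (x + z *s v)"])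
    fix z :: complex and t assume z: "z \<in> ball 0 e" and t: "t \<in> cbox a b"
    show "((\<lambda>z. \<Phi> t (x + z *s v)) has_field_derivative dderiv (\<Phi> t) v (x + z *s v)) (at z within ball 0 e)"
      using h t inS[OF z] by (intro has_field_derivative_at_within[OF gholo_line_DERIV]) auto
  next
    fix z :: complex assume z: "z \<in> ball 0 e"
    have "continuous_on (cbox a b) (\<lambda>t. \<Phi> t (x + z *s v))"
      using inS[OF z] continuous_on_compose2[OF c, of "cbox a b" "\<lambda>t. (t, x + z *s v)"]
      by (force intro: continuous_intros)
    then show "(\<lambda>t. \<Phi> t (x + z *s v)) integrable_on cbox a b"
      by (rule integrable_continuous)
  next
    have d: "continuous_on ({a..b} \<times> S) (\<lambda>p. dderiv (\<Phi> (fst p)) v (snd p))"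
      using dderiv_continuous_param[OF S c h, of v] by (simp add: case_prod_unfold)
    show "continuous_on (ball 0 e \<times> cbox a b) (\<lambda>(z, t). dderiv (\<Phi> t) v (x + z *s v))"
      unfolding case_prod_unfold
      using inS
      by (intro continuous_on_compose2[OF d, where f = "\<lambda>q. (snd q, x + fst q *s v)", simplified]
          continuous_intros) auto
  qed auto
  then show "(\<lambda>z. integral {a..b} (\<lambda>t. \<Phi> t (x + z *s v))) field_differentiable (at 0)"
    using e(1) holomorphic_on_imp_differentiable_at by (metis box_real(2) centre_in_ball open_ball)
qed

text \<open>Locally the derivative is a circle integral of translates of \<open>f\<close>, each
  holomorphic in the centre, so \<open>gholo_integral\<close> applies. Iteration gives derivatives
  of all orders.\<close>

lemma gholo_dderiv:
  fixes S :: "(complex^'n) set"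
  assumes S: "open S" and f: "gholo S f"
  shows "gholo S (dderiv f v)"
proof (rule gholo_local)
  fix x0 assume "x0 \<in> S"
  then obtain R where R: "R > 0" "ball x0 R \<subseteq> S" using S open_contains_ball by blast
  define U where "U = ball x0 (R/2)"
  define r where "r = R / (4 * (norm v + 1))"
  have np: "norm v + 1 > 0" using norm_ge_zero[of v] by linarith
  have r: "r > 0" using R np by (simp add: r_def)
  have "norm v / (norm v + 1) < 1" using np by simp
  then have "R / 4 * (norm v / (norm v + 1)) < R / 4 * 2" using R(1) by (intro mult_strict_left_mono) auto
  then have rv: "r * norm v < R / 2" using R np by (simp add: r_def field_simps)
  have inS: "x + (of_real r * cis s) *s v \<in> S" if "x \<in> U" for x s
  proof -
    have "dist x0 (x + (of_real r * cis s) *s v) \<le> dist x0 x + norm ((of_real r * cis s) *s v)"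
      by (metis add_diff_cancel_left' dist_norm dist_triangle norm_minus_commute)
    also have "\<dots> < R" using that rv r by (simp add: U_def norm_smult_vec norm_mult)
    finally show ?thesis using R by auto
  qed
  have "gholo U (\<lambda>x. integral {0..1} (\<lambda>t. f (x + (of_real r * cis (2 * pi * t)) *s v) / (of_real r * cis (2 * pi * t))))"
  proof (rule gholo_integral)
    show "continuous_on ({0..1} \<times> U)
      (\<lambda>(t, x). f (x + (of_real r * cis (2 * pi * t)) *s v) / (of_real r * cis (2 * pi * t)))"
      unfolding case_prod_unfold using r inS
      by (intro continuous_intros continuous_on_compose2[OF gholo_imp_continuous_on[OF f]]) auto
    show "gholo U (\<lambda>x. f (x + (of_real r * cis (2 * pi * t)) *s v) / (of_real r * cis (2 * pi * t)))" for t
      using r inS[of _ "2 * pi * t"]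
      by (intro gholo_divide gholo_const gholo_affine[OF f, where L = "\<lambda>v. v"] continuous_intros)
         (auto simp: add_ac)
  qed (simp add: U_def)
  moreover have "integral {0..1} (\<lambda>t. f (x + (of_real r * cis (2 * pi * t)) *s v) / (of_real r * cis (2 * pi * t)))
       = dderiv f v x" if "x \<in> U" for x
  proof -
    have "ball x (R/2) \<subseteq> S"
    proof
      fix y assume "y \<in> ball x (R/2)"
      then have "dist x0 y < R" using that dist_triangle[of x0 y x] by (simp add: U_def)
      then show "y \<in> S" using R by auto
    qed
    then have "gholo (ball x (R/2)) f" using f gholo_subset by blast
    from dderiv_eq_circle_integral[OF this r rv] show ?thesis by simp
  qed
  ultimately have "gholo U (dderiv f v)"
    using gholo_cong[of U] open_ball unfolding U_def by blast
  then show "\<exists>T. open T \<and> x0 \<in> T \<and> gholo T (dderiv f v)"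
    using R by (intro exI[of _ U]) (auto simp: U_def)
qed

lemma dderiv_smult:
  assumes "gholo S f" "x \<in> S"
  shows "dderiv f (c *s v) x = c * dderiv f v x"
proof -
  have d: "((\<lambda>z. f (x + z *s v)) has_field_derivative dderiv f v x) (at (c * 0))"
    using gholo_line_DERIV[OF assms(1), of x 0 v] assms(2) by simp
  have m: "((\<lambda>z. c * z) has_field_derivative c) (at 0)"
    by (auto intro!: derivative_eq_intros)
  have "((\<lambda>z. f (x + (c * z) *s v)) has_field_derivative dderiv f v x * c) (at 0)"
    using DERIV_chain2[OF d m] .
  moreover have "(\<lambda>z. f (x + (c * z) *s v)) = (\<lambda>z. f (x + z *s (c *s v)))"
    by (simp add: vector_smult_assoc mult.commute)
  ultimately show ?thesis unfolding dderiv_def[of f "c *s v"]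
    by (simp add: DERIV_imp_deriv mult.commute)
qed

text \<open>Additivity in the direction is not part of line-wise differentiability. It comes from
  continuity of \<open>dderiv f w\<close>: passing from \<open>x + z *s v\<close> to
  \<open>x + z *s (v + w)\<close> changes \<open>f\<close> by \<open>z * dderiv f w x\<close> up to
  an error \<open>e * cmod z\<close>, by the mean value inequality.\<close>

lemma dderiv_add:
  fixes S :: "(complex^'n) set"
  assumes S: "open S" and f: "gholo S f" and x: "x \<in> S"
  shows "dderiv f (v + w) x = dderiv f v x + dderiv f w x"
proof -
  define h where "h = (\<lambda>z. f (x + z *s (v + w)) - f (x + z *s v) - z * dderiv f w x)"
  define d where "d = dderiv f (v + w) x - dderiv f v x - dderiv f w x"
  have dh: "(h has_field_derivative d) (at 0)"
    unfolding h_def d_def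
    using gholo_line_DERIV[OF f, of x 0 "v + w"] gholo_line_DERIV[OF f, of x 0 "v"] x
    by (auto intro!: derivative_eq_intros)
  have "norm d \<le> e" if e: "e > 0" for e
  proof -
    have "continuous (at x) (dderiv f w)"
      using dderiv_continuous[OF S f] x S continuous_on_eq_continuous_at by blast
    then obtain \<delta> where \<delta>: "\<delta> > 0" "\<And>y. dist y x < \<delta> \<Longrightarrow> dist (dderiv f w y) (dderiv f w x) < e"
      using e unfolding continuous_at by (auto simp: Lim_at) (metis dist_eq_0_iff)
    obtain R where R: "R > 0" "ball x R \<subseteq> S" using S x open_contains_ball by blast
    define \<rho> where "\<rho> = min \<delta> R / (norm v + norm w + 1)"
    have np: "norm v + norm w + 1 > 0" using norm_ge_zero[of v] norm_ge_zero[of w] by linarith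
    have \<rho>: "\<rho> > 0" using \<delta> R np by (simp add: \<rho>_def)
    have near: "dist (x + z *s v + u *s w) x < min \<delta> R" if "cmod z < \<rho>" "cmod u \<le> cmod z" for z u
    proof -
      have "dist (x + z *s v + u *s w) x \<le> cmod z * norm v + cmod u * norm w"
        using norm_triangle_ineq[of "z *s v" "u *s w"] by (simp add: dist_norm norm_smult_vec)
      also have "\<dots> \<le> cmod z * norm v + cmod z * norm w"
        using that by (intro add_left_mono mult_right_mono) auto
      also have "\<dots> \<le> cmod z * (norm v + norm w + 1)" by (simp add: algebra_simps)
      also have "\<dots> < \<rho> * (norm v + norm w + 1)" using that np by (intro mult_strict_right_mono) auto
      also have "\<dots> = min \<delta> R" using np by (simp add: \<rho>_def)
      finally show ?thesis .
    qed
    have bound: "cmod (h z) \<le> e * cmod z" if z: "cmod z < \<rho>" for z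
    proof -
      define \<phi> where "\<phi> = (\<lambda>u. f (x + z *s v + u *s w) - u * dderiv f w x)"
      have "cmod (\<phi> z - \<phi> 0) \<le> e * cmod (z - 0)"
      proof (rule field_differentiable_bound[where S = "cball 0 (cmod z)"
            and f' = "\<lambda>u. dderiv f w (x + z *s v + u *s w) - dderiv f w x"])
        fix u :: complex assume u: "u \<in> cball 0 (cmod z)"
        then have n: "dist (x + z *s v + u *s w) x < min \<delta> R" using near z by simp
        then have "x + z *s v + u *s w \<in> S" using R by (auto simp: dist_commute)
        then show "(\<phi> has_field_derivative dderiv f w (x + z *s v + u *s w) - dderiv f w x) (at u within cball 0 (cmod z))"
          unfolding \<phi>_def using gholo_line_DERIV[OF f, of "x + z *s v" u w]
          by (auto intro!: derivative_eq_intros intro: has_field_derivative_at_within)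
        show "norm (dderiv f w (x + z *s v + u *s w) - dderiv f w x) \<le> e"
          using \<delta>(2) n by (simp add: dist_norm less_imp_le)
      qed auto
      moreover have "h z = \<phi> z - \<phi> 0"
        by (simp add: h_def \<phi>_def vector_add_ldistrib add.assoc)
      ultimately show ?thesis by simp
    qed
    have "((\<lambda>z. norm ((h (0 + z) - h 0) / z)) \<longlongrightarrow> norm d) (at 0)"
      using dh unfolding DERIV_def by (intro tendsto_norm)
    moreover have "\<forall>\<^sub>F z in at 0. norm ((h (0 + z) - h 0) / z) \<le> e"
      unfolding eventually_at
    proof (intro exI[of _ \<rho>] conjI ballI impI)
      fix z :: complex assume "z \<noteq> 0 \<and> dist z 0 < \<rho>"
      then show "norm ((h (0 + z) - h 0) / z) \<le> e"
        using bound[of z] by (simp add: h_def norm_divide field_simps)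
    qed (rule \<rho>)
    ultimately show ?thesis
      by (rule tendsto_upperbound) simp
  qed
  then have "norm d \<le> 0" by (rule field_le_epsilon) simp
  then show ?thesis by (simp add: d_def algebra_simps)
qed

text \<open>The directional derivative is a combination of finitely many coordinate derivatives,
  each continuous, so the one-dimensional mean value estimate is uniform in the direction; this is
  Frechet differentiability.\<close>

lemma gholo_has_derivative:
  fixes S :: "(complex^'n) set"
  assumes S: "open S" and f: "gholo S f" and x: "x \<in> S"
  shows "(f has_derivative (\<lambda>v. dderiv f v x)) (at x)"
proof -
  have lin: "linear (\<lambda>v. dderiv f v y)" if "y \<in> S" for y
  proof (rule linearI)
    show "dderiv f (v + w) y = dderiv f v y + dderiv f w y" for v w
      by (rule dderiv_add[OF S f that])
    show "dderiv f (r *\<^sub>R v) y = r *\<^sub>R dderiv f v y" for r v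
    proof -
      have "r *\<^sub>R v = of_real r *s v"
        by (simp only: vec_eq_iff vector_scaleR_component vector_smult_component)
          (simp add: scaleR_conv_of_real)
      then show ?thesis using dderiv_smult[OF f that] by (simp add: scaleR_conv_of_real)
    qed
  qed
  have expand: "dderiv f v y = (\<Sum>i\<in>UNIV. v $ i * dderiv f (axis i 1) y)" if "y \<in> S" for v y
  proof -
    have "dderiv f v y = dderiv f (\<Sum>i\<in>UNIV. (v $ i) *s axis i 1) y"
      by (simp add: basis_expansion)
    also have "\<dots> = (\<Sum>i\<in>UNIV. dderiv f ((v $ i) *s axis i 1) y)"
      by (rule linear_sum[OF lin[OF that]])
    finally show ?thesis by (simp add: dderiv_smult[OF f that])
  qed
  show ?thesis
    unfolding has_derivative_at_alt
  proof (intro conjI allI impI)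
    show "bounded_linear (\<lambda>v. dderiv f v x)"
      using lin[OF x] by (simp add: linear_conv_bounded_linear)
    fix e :: real assume e: "e > 0"
    \<comment> \<open>The errors of the coordinate derivatives are added over
      \<open>CARD('n)\<close> indices, each weighted by at most \<open>norm v\<close>.\<close>
    define e' where "e' = e / CARD('n)"
    have e': "e' > 0" using e by (simp add: e'_def)
    have "\<forall>i. \<exists>\<delta>>0. \<forall>y. dist y x < \<delta> \<longrightarrow> dist (dderiv f (axis i 1) y) (dderiv f (axis i 1) x) < e'"
    proof
      fix i
      have "continuous (at x) (dderiv f (axis i 1))"
        using dderiv_continuous[OF S f] x S continuous_on_eq_continuous_at by blast
      then show "\<exists>\<delta>>0. \<forall>y. dist y x < \<delta> \<longrightarrow> dist (dderiv f (axis i 1) y) (dderiv f (axis i 1) x) < e'"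
        using e' unfolding continuous_at by (auto simp: Lim_at) (metis dist_eq_0_iff)
    qed
    then obtain \<delta> where \<delta>: "\<And>i. \<delta> i > 0"
      "\<And>i y. dist y x < \<delta> i \<Longrightarrow> dist (dderiv f (axis i 1) y) (dderiv f (axis i 1) x) < e'" by metis
    obtain R where R: "R > 0" "ball x R \<subseteq> S" using S x open_contains_ball by blast
    define d where "d = min R (Min (range \<delta>))"
    have d0: "d > 0" using R \<delta> by (simp add: d_def)
    have dle: "d \<le> \<delta> i" for i by (simp add: d_def min.coboundedI2)
    show "\<exists>d>0. \<forall>y. norm (y - x) < d \<longrightarrow> norm (f y - f x - dderiv f (y - x) x) \<le> e * norm (y - x)"
    proof (intro exI[of _ d] conjI allI impI d0)
      fix y assume y: "norm (y - x) < d"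
      define v where "v = y - x"
      define \<phi> where "\<phi> = (\<lambda>u. f (x + u *s v) - u * dderiv f v x)"
      have "cmod (\<phi> 1 - \<phi> 0) \<le> (e * norm v) * cmod (1 - 0)"
      proof (rule field_differentiable_bound[where S = "cball 0 1"
            and f' = "\<lambda>u. dderiv f v (x + u *s v) - dderiv f v x"])
        fix u :: complex assume u: "u \<in> cball 0 1"
        have "cmod u * norm v \<le> 1 * norm v" using u by (intro mult_right_mono) auto
        then have n: "dist (x + u *s v) x < d"
          using y unfolding v_def[symmetric] by (simp add: dist_norm norm_smult_vec)
        then have inS: "x + u *s v \<in> S" using R by (auto simp: dist_commute d_def)
        then show "(\<phi> has_field_derivative dderiv f v (x + u *s v) - dderiv f v x) (at u within cball 0 1)"
          unfolding \<phi>_def using gholo_line_DERIV[OF f, of x u v]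
          by (auto intro!: derivative_eq_intros intro: has_field_derivative_at_within)
        have "norm (dderiv f v (x + u *s v) - dderiv f v x) =
           norm (\<Sum>i\<in>UNIV. v $ i * (dderiv f (axis i 1) (x + u *s v) - dderiv f (axis i 1) x))"
          unfolding expand[OF inS, of v] expand[OF x, of v]
          by (simp add: sum_subtractf right_diff_distrib)
        also have "\<dots> \<le> (\<Sum>i\<in>(UNIV::'n set). norm v * e')"
        proof (intro sum_norm_le)
          fix i
          have "dist (dderiv f (axis i 1) (x + u *s v)) (dderiv f (axis i 1) x) < e'"
            using \<delta>(2) n dle[of i] by (meson less_le_trans)
          then show "norm (v $ i * (dderiv f (axis i 1) (x + u *s v) - dderiv f (axis i 1) x)) \<le> norm v * e'"
            unfolding norm_mult by (intro mult_mono Finite_Cartesian_Product.norm_nth_le) (auto simp: dist_norm)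
        qed
        also have "\<dots> = e * norm v" by (simp add: e'_def)
        finally show "norm (dderiv f v (x + u *s v) - dderiv f v x) \<le> e * norm v" .
      qed auto
      then show "norm (f y - f x - dderiv f (y - x) x) \<le> e * norm (y - x)"
        by (simp add: \<phi>_def v_def algebra_simps)
    qed
  qed
qed

section \<open>Smoothness of restrictions to real parameters\<close>

lemma Ck_on_cong:
  assumes "open S" "\<And>x. x \<in> S \<Longrightarrow> f x = g x" "Ck_on k f S"
  shows "Ck_on k g S"
  using assms(2,3)
proof (induction k arbitrary: f g)
  case 0
  then show ?case using continuous_on_eq by auto
next
  case (Suc k)
  have der: "(g has_derivative f') (at x) \<longleftrightarrow> (f has_derivative f') (at x)" if "x \<in> S" for x f'
    using has_derivative_transform_within_open[of f f' x UNIV S g]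
      has_derivative_transform_within_open[of g f' x UNIV S f] that assms(1) Suc.prems(1) by auto
  then have "frechet_derivative g (at x) = frechet_derivative f (at x)" if "x \<in> S" for x
    using that by (simp add: frechet_derivative_def)
  moreover have "g differentiable (at x)" if "x \<in> S" for x
  proof -
    have "f differentiable (at x)" using that Suc.prems(2) by simp
    then show ?thesis using der[OF that] unfolding differentiable_def by blast
  qed
  ultimately show ?case
    using Suc.IH[of "\<lambda>x. frechet_derivative f (at x) v" "\<lambda>x. frechet_derivative g (at x) v" for v] Suc.prems(2)
    by simp
qed

text \<open>The real derivative of the restriction in direction \<open>v\<close> is the restriction
  of \<open>dderiv f (\<iota> v)\<close>, which is holomorphic again. The induction on the order
  therefore never leaves the class, and one holomorphic extension yields smoothness of all
  orders.\<close>

lemma smooth_on_gholo: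
  fixes \<iota> :: "'a::euclidean_space \<Rightarrow> complex^'n"
  assumes S: "open S" and f: "gholo S f" and \<iota>: "bounded_linear \<iota>" and W: "open W" "\<iota> ` W \<subseteq> S"
  shows "smooth_on (\<lambda>p. f (\<iota> p)) W"
  unfolding smooth_on_def
proof
  fix k show "Ck_on k (\<lambda>p. f (\<iota> p)) W"
    using f
  proof (induction k arbitrary: f)
    case 0
    then show ?case
      using W(2) continuous_on_compose2[OF gholo_imp_continuous_on linear_continuous_on[OF \<iota>]] by auto
  next
    case (Suc k)
    have der: "((\<lambda>p. f (\<iota> p)) has_derivative (\<lambda>v. dderiv f (\<iota> v) (\<iota> p))) (at p)" if "p \<in> W" for p
      using has_derivative_compose[OF bounded_linear_imp_has_derivative[OF \<iota>]
          gholo_has_derivative[OF S Suc.prems]] that W(2) by blast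
    have "Ck_on k (\<lambda>p. frechet_derivative (\<lambda>p. f (\<iota> p)) (at p) v) W" for v
    proof (rule Ck_on_cong[OF W(1)])
      show "Ck_on k (\<lambda>p. dderiv f (\<iota> v) (\<iota> p)) W"
        by (rule Suc.IH[OF gholo_dderiv[OF S Suc.prems]])
      show "dderiv f (\<iota> v) (\<iota> p) = frechet_derivative (\<lambda>p. f (\<iota> p)) (at p) v" if "p \<in> W" for p
        using frechet_derivative_at[OF der[OF that]] by metis
    qed
    then show ?case using der by (auto simp: differentiable_def)
  qed
qed

lemma smooth_on_Pair:
  assumes W: "open W" and f: "smooth_on f W" and g: "smooth_on g W"
  shows "smooth_on (\<lambda>x. (f x, g x)) W"
proof -
  have "Ck_on k (\<lambda>x. (f x, g x)) W" if "Ck_on k f W" "Ck_on k g W" for k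
    using that
  proof (induction k arbitrary: f g)
    case 0
    then show ?case by (simp add: continuous_on_Pair)
  next
    case (Suc k)
    have der: "((\<lambda>x. (f x, g x)) has_derivative
         (\<lambda>v. (frechet_derivative f (at x) v, frechet_derivative g (at x) v))) (at x)" if "x \<in> W" for x
      using Suc.prems that by (intro has_derivative_Pair) (auto simp: frechet_derivative_works)
    have "Ck_on k (\<lambda>x. frechet_derivative (\<lambda>x. (f x, g x)) (at x) v) W" for v
    proof (rule Ck_on_cong[OF W])
      show "Ck_on k (\<lambda>x. (frechet_derivative f (at x) v, frechet_derivative g (at x) v)) W"
        by (rule Suc.IH) (use Suc.prems in auto)
      show "(frechet_derivative f (at x) v, frechet_derivative g (at x) v) =
          frechet_derivative (\<lambda>x. (f x, g x)) (at x) v" if "x \<in> W" for x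
        using frechet_derivative_at[OF der[OF that]] by metis
    qed
    then show ?case using der by (auto simp: differentiable_def)
  qed
  then show ?thesis using f g by (simp add: smooth_on_def)
qed

section \<open>Periodic solutions of the linearized equation\<close>

text \<open>A correlation, with argument \<open>\<tau> + \<sigma>\<close>, that sees the kernel on
  one period only. Time shifts then act on \<open>f\<close> alone, and a kernel may jump between
  \<open>2\<pi>\<close> and \<open>0\<close>; the jump acts as a point source.\<close>

definition pconv :: "(real \<Rightarrow> complex) \<Rightarrow> (real \<Rightarrow> complex) \<Rightarrow> real \<Rightarrow> complex" where
  "pconv G f \<tau> = integral {0..2*pi} (\<lambda>\<sigma>. G \<sigma> * f (\<tau> + \<sigma>))"

lemma pconv_shift: "pconv G f (\<tau> + s) = pconv G (\<lambda>t. f (t + s)) \<tau>"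
  unfolding pconv_def by (simp add: add_ac)

lemma pconv_integrable:
  fixes G f :: "real \<Rightarrow> complex"
  assumes "continuous_on UNIV G" "continuous_on UNIV f"
  shows "(\<lambda>\<sigma>. G \<sigma> * f (\<tau> + \<sigma>)) integrable_on {0..2*pi}"
proof (rule integrable_continuous_interval)
  have "continuous_on UNIV (\<lambda>\<sigma>. f (\<tau> + \<sigma>))"
    by (rule continuous_on_compose2[OF assms(2)]) (auto intro!: continuous_intros)
  then have "continuous_on UNIV (\<lambda>\<sigma>. G \<sigma> * f (\<tau> + \<sigma>))"
    by (rule continuous_on_mult[OF assms(1)])
  then show "continuous_on {0..2*pi} (\<lambda>\<sigma>. G \<sigma> * f (\<tau> + \<sigma>))"
    by (rule continuous_on_subset) simp
qed

lemma pconv_diff: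
  assumes "continuous_on UNIV G" "continuous_on UNIV f" "continuous_on UNIV g"
  shows "pconv G f \<tau> - pconv G g \<tau> = pconv G (\<lambda>t. f t - g t) \<tau>"
  unfolding pconv_def
  by (simp add: right_diff_distrib integral_diff[OF pconv_integrable pconv_integrable] assms)

lemma norm_pconv_le:
  assumes "continuous_on UNIV G" "continuous_on UNIV f"
    and "\<And>\<sigma>. \<sigma> \<in> {0..2*pi} \<Longrightarrow> cmod (G \<sigma>) \<le> A" "\<And>t. cmod (f t) \<le> B" "0 \<le> A" "0 \<le> B"
  shows "cmod (pconv G f \<tau>) \<le> 2 * pi * A * B"
proof -
  have "cmod (pconv G f \<tau>) \<le> (A * B) * measure lborel (cbox 0 (2*pi))"
    unfolding pconv_def
  proof (rule has_integral_bound)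
    show "((\<lambda>\<sigma>. G \<sigma> * f (\<tau> + \<sigma>)) has_integral integral {0..2*pi} (\<lambda>\<sigma>. G \<sigma> * f (\<tau> + \<sigma>))) (cbox 0 (2*pi))"
      using integrable_integral[OF pconv_integrable[OF assms(1,2)]] by simp
    show "cmod (G \<sigma> * f (\<tau> + \<sigma>)) \<le> A * B" if "\<sigma> \<in> cbox 0 (2*pi)" for \<sigma>
      unfolding norm_mult using assms that by (intro mult_mono) auto
  qed (use assms in auto)
  then show ?thesis by (simp add: mult_ac)
qed

lemma continuous_pconv:
  assumes "continuous_on UNIV G" "continuous_on UNIV f"
  shows "continuous_on UNIV (pconv G f)"
proof -
  have "continuous_on (UNIV \<times> cbox 0 (2*pi)) (\<lambda>(\<tau>, \<sigma>). G \<sigma> * f (\<tau> + \<sigma>))"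
    unfolding case_prod_unfold
    by (intro continuous_intros continuous_on_compose2[OF assms(1)] continuous_on_compose2[OF assms(2)]) auto
  then have "continuous_on UNIV (\<lambda>\<tau>. integral (cbox 0 (2*pi)) (\<lambda>\<sigma>. G \<sigma> * f (\<tau> + \<sigma>)))"
    by (rule integral_continuous_on_param)
  then show ?thesis by (simp add: pconv_def[abs_def])
qed

lemma pconv_periodic:
  assumes "\<And>t. f (t + 2*pi) = f t"
  shows "pconv G f (\<tau> + 2*pi) = pconv G f \<tau>"
  unfolding pconv_shift assms ..

text \<open>Substitution \<open>\<sigma> \<mapsto> 2\<pi> - \<sigma>\<close>. Kernels symmetric
  about \<pi> thus commute with time reversal, antisymmetric ones anticommute.\<close>

lemma pconv_reflect:
  assumes "\<And>t. f (t + 2*pi) = f t"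
  shows "pconv G f (- \<tau>) = pconv (\<lambda>\<sigma>. G (2*pi - \<sigma>)) (\<lambda>t. f (- t)) \<tau>"
proof -
  define h where "h = (\<lambda>\<sigma>. G \<sigma> * f (- \<tau> + \<sigma>))"
  have "integral {0..2*pi} h = integral {-(2*pi)..0} (\<lambda>x. h (- x))"
    using Henstock_Kurzweil_Integration.integral_reflect_real[of "2*pi" 0 h] unfolding minus_zero by (rule sym)
  also have "\<dots> = integral {0..2*pi} (\<lambda>x. h (2*pi - x))"
    using integral_shift_real_ivl[of "-(2*pi)" "-(2*pi)" 0 "\<lambda>x. h (- x)"] by (simp add: algebra_simps)
  also have "(\<lambda>x. h (2*pi - x)) = (\<lambda>x. G (2*pi - x) * f (- (\<tau> + x)))"
  proof
    fix x
    have "f (- \<tau> + (2*pi - x)) = f (- (\<tau> + x))"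
      using assms[of "- (\<tau> + x)"] by (simp add: algebra_simps)
    then show "h (2*pi - x) = G (2*pi - x) * f (- (\<tau> + x))" by (simp add: h_def)
  qed
  finally show ?thesis by (simp add: pconv_def h_def)
qed

text \<open>Since \<open>f\<close> is merely continuous, the derivative has to fall on the kernel:
  integration by parts against a primitive \<Phi> of \<open>f\<close> gives an expression
  differentiable in \<tau>. The jump of \<open>G\<close> over the period contributes the term with
  \<open>f \<tau>\<close>.\<close>

lemma pconv_has_vector_derivative:
  assumes f: "continuous_on UNIV f" and per: "\<And>t. f (t + 2*pi) = f t"
    and G: "\<And>\<sigma>. (G has_vector_derivative G' \<sigma>) (at \<sigma>)" and G': "continuous_on UNIV G'"
  shows "(pconv G f has_vector_derivative (G (2*pi) - G 0) * f \<tau> - pconv G' f \<tau>) (at \<tau>)"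
proof -
  \<comment> \<open>A primitive is available on compact intervals; this one contains all arguments
    \<open>t + \<sigma>\<close> for \<open>t\<close> within \<open>1/2\<close> of \<tau>.\<close>
  define lo hi where "lo = \<tau> - 1" and "hi = \<tau> + 2*pi + 1"
  obtain \<Phi> where \<Phi>: "\<And>x. x \<in> {lo..hi} \<Longrightarrow> (\<Phi> has_vector_derivative f x) (at x within {lo..hi})"
    using antiderivative_continuous[of lo hi f] f continuous_on_subset by blast
  have \<Phi>': "(\<Phi> has_vector_derivative f x) (at x)" if "x \<in> {lo<..<hi}" for x
    using \<Phi>[of x] that at_within_interior[of x "{lo..hi}"] by simp
  have cG: "continuous_on UNIV G"
    using G by (meson continuous_at_imp_continuous_on has_vector_derivative_continuous)
  define g where "g = (\<lambda>t. G (2*pi) * \<Phi> (t + 2*pi) - G 0 * \<Phi> t - integral (cbox 0 (2*pi)) (\<lambda>\<sigma>. G' \<sigma> * \<Phi> (t + \<sigma>)))"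
  define U where "U = {\<tau> - 1/2 <..< \<tau> + 1/2}"
  have inb: "t + \<sigma> \<in> {lo<..<hi}" if "t \<in> U" "\<sigma> \<in> {0..2*pi}" for t \<sigma>
    using that pi_gt_zero unfolding U_def lo_def hi_def greaterThanLessThan_iff atLeastAtMost_iff by linarith
  have c\<Phi>: "continuous_on {lo<..<hi} \<Phi>"
    using \<Phi>' by (meson continuous_at_imp_continuous_on has_vector_derivative_continuous)
  have eq: "pconv G f t = g t" if t: "t \<in> U" for t
  proof -
    have "((\<lambda>\<sigma>. G' \<sigma> * \<Phi> (t + \<sigma>) + G \<sigma> * f (t + \<sigma>)) has_integral
        G (2*pi) * \<Phi> (t + 2*pi) - G 0 * \<Phi> (t + 0)) {0..2*pi}"
    proof (rule fundamental_theorem_of_calculus)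
      fix \<sigma> assume \<sigma>: "\<sigma> \<in> {0..2*pi}"
      have "((\<lambda>\<sigma>. t + \<sigma>) has_vector_derivative 1) (at \<sigma>)"
        by (auto intro!: derivative_eq_intros)
      from vector_diff_chain_at[OF this \<Phi>'[OF inb[OF t \<sigma>]]]
      have "((\<lambda>\<sigma>. \<Phi> (t + \<sigma>)) has_vector_derivative f (t + \<sigma>)) (at \<sigma>)"
        by (simp add: o_def)
      then have "((\<lambda>\<sigma>. G \<sigma> * \<Phi> (t + \<sigma>)) has_vector_derivative G \<sigma> * f (t + \<sigma>) + G' \<sigma> * \<Phi> (t + \<sigma>)) (at \<sigma>)"
        by (rule has_vector_derivative_mult[OF G])
      then show "((\<lambda>\<sigma>. G \<sigma> * \<Phi> (t + \<sigma>)) has_vector_derivative G' \<sigma> * \<Phi> (t + \<sigma>) + G \<sigma> * f (t + \<sigma>)) (at \<sigma> within {0..2*pi})"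
        by (simp add: add.commute has_vector_derivative_at_within)
    qed auto
    then have "integral {0..2*pi} (\<lambda>\<sigma>. G' \<sigma> * \<Phi> (t + \<sigma>) + G \<sigma> * f (t + \<sigma>)) = G (2*pi) * \<Phi> (t + 2*pi) - G 0 * \<Phi> t"
      by (simp add: integral_unique)
    moreover have "integral {0..2*pi} (\<lambda>\<sigma>. G' \<sigma> * \<Phi> (t + \<sigma>) + G \<sigma> * f (t + \<sigma>)) =
       integral {0..2*pi} (\<lambda>\<sigma>. G' \<sigma> * \<Phi> (t + \<sigma>)) + integral {0..2*pi} (\<lambda>\<sigma>. G \<sigma> * f (t + \<sigma>))"
    proof (rule integral_add)
      show "(\<lambda>\<sigma>. G' \<sigma> * \<Phi> (t + \<sigma>)) integrable_on {0..2*pi}"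
        using inb[OF t]
        by (intro integrable_continuous_interval continuous_on_mult continuous_on_compose2[OF c\<Phi>]
          continuous_on_subset[OF G'] continuous_intros image_subsetI) auto
    qed (rule pconv_integrable[OF cG f])
    ultimately show ?thesis by (simp add: g_def pconv_def algebra_simps)
  qed
  have "((\<lambda>t. integral (cbox 0 (2*pi)) (\<lambda>\<sigma>. G' \<sigma> * \<Phi> (t + \<sigma>))) has_vector_derivative
     integral (cbox 0 (2*pi)) (\<lambda>\<sigma>. G' \<sigma> * f (\<tau> + \<sigma>))) (at \<tau> within U)"
  proof (rule leibniz_rule_vector_derivative)
    fix t \<sigma> assume t: "t \<in> U" and \<sigma>: "\<sigma> \<in> cbox 0 (2*pi)"
    have "((\<lambda>t. t + \<sigma>) has_vector_derivative 1) (at t)"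
      by (auto intro!: derivative_eq_intros)
    from vector_diff_chain_at[OF this \<Phi>'[OF inb[OF t]]]
    have "((\<lambda>t. \<Phi> (t + \<sigma>)) has_vector_derivative f (t + \<sigma>)) (at t)"
      using \<sigma> by (simp add: o_def)
    then show "((\<lambda>t. G' \<sigma> * \<Phi> (t + \<sigma>)) has_vector_derivative G' \<sigma> * f (t + \<sigma>)) (at t within U)"
      by (intro has_vector_derivative_at_within[OF has_vector_derivative_mult_right])
  next
    fix t assume t: "t \<in> U"
    show "(\<lambda>\<sigma>. G' \<sigma> * \<Phi> (t + \<sigma>)) integrable_on cbox 0 (2*pi)"
      using inb[OF t]
      by (intro integrable_continuous continuous_on_mult continuous_on_compose2[OF c\<Phi>]
          continuous_on_subset[OF G'] continuous_intros image_subsetI) auto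
  next
    show "continuous_on (U \<times> cbox 0 (2*pi)) (\<lambda>(t, \<sigma>). G' \<sigma> * f (t + \<sigma>))"
      unfolding case_prod_unfold
      by (intro continuous_intros continuous_on_compose2[OF G'] continuous_on_compose2[OF f]) auto
  qed (auto simp: U_def)
  then have D: "((\<lambda>t. integral (cbox 0 (2*pi)) (\<lambda>\<sigma>. G' \<sigma> * \<Phi> (t + \<sigma>))) has_vector_derivative
     pconv G' f \<tau>) (at \<tau>)"
    using at_within_open[of \<tau> U] by (simp add: U_def pconv_def)
  have "((\<lambda>t. t + 2*pi) has_vector_derivative 1) (at \<tau>)"
    by (auto intro!: derivative_eq_intros)
  from vector_diff_chain_at[OF this \<Phi>'[OF inb[of \<tau> "2*pi"]]]
  have "((\<lambda>t. \<Phi> (t + 2*pi)) has_vector_derivative f (\<tau> + 2*pi)) (at \<tau>)"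
    by (simp add: o_def U_def)
  moreover have "(\<Phi> has_vector_derivative f \<tau>) (at \<tau>)"
    using \<Phi>'[OF inb[of \<tau> 0]] by (simp add: U_def)
  ultimately have "(g has_vector_derivative
     G (2*pi) * f (\<tau> + 2*pi) - G 0 * f \<tau> - pconv G' f \<tau>) (at \<tau>)"
    unfolding g_def
    by (intro has_vector_derivative_diff has_vector_derivative_mult_right D)
  then have "(g has_vector_derivative (G (2*pi) - G 0) * f \<tau> - pconv G' f \<tau>) (at \<tau>)"
    by (simp only: per left_diff_distrib)
  then show ?thesis
    by (rule has_vector_derivative_transform_within_open[of _ _ _ U]) (auto simp: U_def eq)
qed

text \<open>
  Kernels of the mean value, of the primitive with zero mean of the oscillating part, and of the
  periodic solution of \<open>a'' + \<kappa>\<^sup>2 a = f\<close>.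
\<close>

definition mean_kernel :: "real \<Rightarrow> complex" where
  "mean_kernel \<sigma> = 1 / (2 * of_real pi)"

definition prim_kernel :: "real \<Rightarrow> complex" where
  "prim_kernel \<sigma> = of_real ((\<sigma> - pi) / (2 * pi))"

definition osc_kernel :: "complex \<Rightarrow> real \<Rightarrow> complex" where
  "osc_kernel \<kappa> \<sigma> = cos (\<kappa> * of_real (\<sigma> - pi)) / (2 * \<kappa> * sin (\<kappa> * of_real pi))"

definition osc_kernel' :: "complex \<Rightarrow> real \<Rightarrow> complex" where
  "osc_kernel' \<kappa> \<sigma> = - sin (\<kappa> * of_real (\<sigma> - pi)) / (2 * sin (\<kappa> * of_real pi))"

lemma continuous_kernels:
  shows continuous_mean_kernel: "continuous_on A mean_kernel"
    and continuous_prim_kernel: "continuous_on A prim_kernel"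
    and continuous_osc_kernel: "continuous_on A (osc_kernel \<kappa>)"
    and continuous_osc_kernel': "continuous_on A (osc_kernel' \<kappa>)"
  unfolding mean_kernel_def[abs_def] prim_kernel_def[abs_def] osc_kernel_def[abs_def]
    osc_kernel'_def[abs_def] divide_inverse
  by (intro continuous_intros)+

lemma pconv_mean_const:
  assumes "continuous_on UNIV f" "\<And>t. f (t + 2*pi) = f t"
  shows "pconv mean_kernel f \<tau> = pconv mean_kernel f \<tau>'"
proof -
  have "(pconv mean_kernel f has_vector_derivative 0) (at t)" for t
  proof -
    have "pconv (\<lambda>_. 0) f t = 0" by (simp add: pconv_def)
    then show ?thesis
      using pconv_has_vector_derivative[OF assms, of mean_kernel "\<lambda>_. 0" t]
      by (simp add: mean_kernel_def[abs_def])
  qed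
  then have "pconv mean_kernel f constant_on UNIV"
    by (metis UNIV_I constant_on_def convex_UNIV has_vector_derivative_zero_constant has_vector_derivative_at_within)
  then show ?thesis by (auto simp: constant_on_def)
qed

lemma pconv_prim_DERIV:
  assumes "continuous_on UNIV f" "\<And>t. f (t + 2*pi) = f t"
  shows "(pconv prim_kernel f has_vector_derivative f \<tau> - pconv mean_kernel f \<tau>) (at \<tau>)"
proof -
  have "(prim_kernel has_vector_derivative mean_kernel \<sigma>) (at \<sigma>)" for \<sigma>
  proof -
    have "((\<lambda>z. (z - of_real pi) / (2 * of_real pi)) has_field_derivative 1 / (2 * of_real pi)) (at (of_real \<sigma> :: complex))"
      by (auto intro!: derivative_eq_intros)
    from has_vector_derivative_real_field[OF this] show ?thesis
      by (simp add: prim_kernel_def[abs_def] mean_kernel_def)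
  qed
  from pconv_has_vector_derivative[OF assms this continuous_mean_kernel, of \<tau>]
  show ?thesis by (simp add: prim_kernel_def)
qed

lemma osc_kernel_DERIV:
  assumes "\<kappa> \<noteq> 0"
  shows "(osc_kernel \<kappa> has_vector_derivative osc_kernel' \<kappa> \<sigma>) (at \<sigma>)"
proof -
  have "((\<lambda>z. cos (\<kappa> * (z - of_real pi))) has_field_derivative
     - sin (\<kappa> * (of_real \<sigma> - of_real pi)) * \<kappa>) (at (of_real \<sigma>))"
    by (auto intro!: derivative_eq_intros)
  from has_vector_derivative_real_field[OF DERIV_cdivide[OF this], of "2 * \<kappa> * sin (\<kappa> * of_real pi)"]
  show ?thesis using assms
    by (simp add: osc_kernel_def[abs_def] osc_kernel'_def)
qed

lemma osc_kernel'_DERIV: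
  "(osc_kernel' \<kappa> has_vector_derivative - \<kappa>\<^sup>2 * osc_kernel \<kappa> \<sigma>) (at \<sigma>)"
proof -
  have "((\<lambda>z. - sin (\<kappa> * (z - of_real pi))) has_field_derivative
     - cos (\<kappa> * (of_real \<sigma> - of_real pi)) * \<kappa>) (at (of_real \<sigma>))"
    by (auto intro!: derivative_eq_intros)
  from has_vector_derivative_real_field[OF DERIV_cdivide[OF this], of "2 * sin (\<kappa> * of_real pi)"]
  show ?thesis
    by (cases "\<kappa> = 0") (simp_all add: osc_kernel_def osc_kernel'_def[abs_def] power2_eq_square mult.commute)
qed

lemma pconv_osc_DERIV:
  assumes "continuous_on UNIV f" "\<And>t. f (t + 2*pi) = f t" "\<kappa> \<noteq> 0"
  shows "(pconv (osc_kernel \<kappa>) f has_vector_derivative - pconv (osc_kernel' \<kappa>) f \<tau>) (at \<tau>)"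
  using pconv_has_vector_derivative[OF assms(1,2) osc_kernel_DERIV[OF assms(3)] continuous_osc_kernel', of \<tau>]
  by (simp add: osc_kernel_def)

text \<open>\<open>osc_kernel'\<close> jumps by \<open>-1\<close> over the period, which produces
  the source of the oscillator equation. The condition on \<open>sin\<close> is what allows this
  normalization of the jump.\<close>

lemma pconv_osc'_DERIV:
  assumes "continuous_on UNIV f" "\<And>t. f (t + 2*pi) = f t" "sin (\<kappa> * of_real pi) \<noteq> 0"
  shows "(pconv (osc_kernel' \<kappa>) f has_vector_derivative - f \<tau> + \<kappa>\<^sup>2 * pconv (osc_kernel \<kappa>) f \<tau>) (at \<tau>)"
proof -
  have "pconv (\<lambda>\<sigma>. - \<kappa>\<^sup>2 * osc_kernel \<kappa> \<sigma>) f \<tau> = - \<kappa>\<^sup>2 * pconv (osc_kernel \<kappa>) f \<tau>"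
    unfolding pconv_def by (simp add: mult.assoc)
  moreover have "osc_kernel' \<kappa> (2*pi) - osc_kernel' \<kappa> 0 = - 1"
    using assms(3) by (simp add: osc_kernel'_def field_simps)
  ultimately show ?thesis
    using pconv_has_vector_derivative[OF assms(1,2) osc_kernel'_DERIV, of \<kappa> \<tau>]
    by (simp add: continuous_osc_kernel continuous_intros)
qed

lemma kernel_reflect:
  fixes \<kappa> :: complex
  shows
  "mean_kernel (2*pi - \<sigma>) = mean_kernel \<sigma>"
  "prim_kernel (2*pi - \<sigma>) = - prim_kernel \<sigma>"
  "osc_kernel \<kappa> (2*pi - \<sigma>) = osc_kernel \<kappa> \<sigma>"
proof -
  show "mean_kernel (2*pi - \<sigma>) = mean_kernel \<sigma>" by (simp add: mean_kernel_def)
  show "prim_kernel (2*pi - \<sigma>) = - prim_kernel \<sigma>"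
    by (simp add: prim_kernel_def field_simps)
  have "\<kappa> * of_real (2*pi - \<sigma> - pi) = - (\<kappa> * of_real (\<sigma> - pi))" by (simp add: algebra_simps)
  then show "osc_kernel \<kappa> (2*pi - \<sigma>) = osc_kernel \<kappa> \<sigma>"
    unfolding osc_kernel_def by (simp only: cos_minus)
qed

lemma pconv_minus_kernel: "pconv (\<lambda>\<sigma>. - G \<sigma>) f \<tau> = - pconv G f \<tau>"
  unfolding pconv_def by simp

lemma pconv_minus: "pconv G (\<lambda>t. - f t) \<tau> = - pconv G f \<tau>"
  unfolding pconv_def by simp

text \<open>\<open>r\<close> stands for the reflected source. The system behind the formula is
  \<open>a'' + 2\<i>\<kappa>b' - 3\<kappa>\<^sup>2a = s + r\<close>,
  \<open>b'' + 2\<i>\<kappa>a' = s - r\<close>. A constant \<open>K\<close> from integrating the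
  second equation shifts \<open>a\<close> by \<open>- 2\<i>K/\<kappa>\<close> and turns
  \<open>b'\<close> into \<open>c - 3K\<close>; periodicity of \<open>b\<close> requires mean zero,
  so \<open>K\<close> is a third of the mean of \<open>c\<close>. This is the middle term.\<close>

definition lin_sol :: "complex \<Rightarrow> (real \<Rightarrow> complex) \<Rightarrow> (real \<Rightarrow> complex) \<Rightarrow> real \<Rightarrow> complex" where
  "lin_sol \<kappa> s r \<tau> =
     (let d = pconv prim_kernel (\<lambda>t. s t - r t);
          a = pconv (osc_kernel \<kappa>) (\<lambda>t. s t + r t - 2 * \<i> * \<kappa> * d t);
          c = (\<lambda>t. d t - 2 * \<i> * \<kappa> * a t)
      in (a \<tau> - 2 * \<i> / (3 * \<kappa>) * pconv mean_kernel c \<tau> + pconv prim_kernel c \<tau>) / 2)"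

lemma pconv_cnj:
  "cnj (pconv G f \<tau>) = pconv (\<lambda>\<sigma>. cnj (G \<sigma>)) (\<lambda>t. cnj (f t)) \<tau>"
  unfolding pconv_def by (simp add: Henstock_Kurzweil_Integration.integral_cnj)

lemma kernel_cnj:
  "cnj (mean_kernel \<sigma>) = mean_kernel \<sigma>"
  "cnj (prim_kernel \<sigma>) = prim_kernel \<sigma>"
  "cnj (osc_kernel \<kappa> \<sigma>) = osc_kernel (cnj \<kappa>) \<sigma>"
  by (simp_all add: mean_kernel_def prim_kernel_def osc_kernel_def cnj_cos cnj_sin)

text \<open>
  With \<open>a = w + w\<^sup>*\<close> and \<open>b = w - w\<^sup>*\<close> the equation becomes \<open>b'' + 2\<i>\<kappa>a' = s - s\<^sup>*\<close>, which is
  integrated once, and then \<open>a\<close> solves a non-resonant oscillator equation.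
\<close>

lemma lin_sol_solves:
  fixes s :: "real \<Rightarrow> complex"
  assumes s: "continuous_on UNIV s" and per: "\<And>t. s (t + 2*pi) = s t"
    and \<kappa>: "\<kappa> \<noteq> 0" "sin (\<kappa> * of_real pi) \<noteq> 0"
  defines "w \<equiv> lin_sol \<kappa> s (\<lambda>t. s (- t))"
  shows lin_sol_ode: "\<exists>w' w''. (\<forall>t. (w has_vector_derivative w' t) (at t)) \<and>
      (\<forall>t. (w' has_vector_derivative w'' t) (at t)) \<and>
      (\<forall>t. w'' t + 2 * \<i> * \<kappa> * w' t - 3/2 * \<kappa>\<^sup>2 * (w t + w (- t)) = s t)" (is ?ode)
    and lin_sol_cnj: "(\<And>t. cnj (s t) = s (- t)) \<Longrightarrow> cnj \<kappa> = \<kappa> \<Longrightarrow> cnj (w t) = w (- t)"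
proof -
  define r where "r = (\<lambda>t. s (- t))"
  have r: "continuous_on UNIV r"
    unfolding r_def by (intro continuous_on_compose2[OF s] continuous_intros) auto
  have per_r: "r (t + 2*pi) = r t" for t
    using per[of "- t - 2*pi"] by (simp add: r_def)
  define d where "d = pconv prim_kernel (\<lambda>t. s t - r t)"
  define f0 where "f0 = (\<lambda>t. s t + r t - 2 * \<i> * \<kappa> * d t)"
  define a where "a = pconv (osc_kernel \<kappa>) f0"
  define a' where "a' = (\<lambda>t. - pconv (osc_kernel' \<kappa>) f0 t)"
  define c where "c = (\<lambda>t. d t - 2 * \<i> * \<kappa> * a t)"
  define C where "C = pconv mean_kernel c 0"
  define b where "b = pconv prim_kernel c"
  have csr: "continuous_on UNIV (\<lambda>t. s t - r t)" and psr: "\<And>t. s (t + 2*pi) - r (t + 2*pi) = s t - r t"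
    using s r per per_r by (auto intro: continuous_intros)
  have cd: "continuous_on UNIV d" unfolding d_def by (rule continuous_pconv[OF continuous_prim_kernel csr])
  have pd: "d (t + 2*pi) = d t" for t unfolding d_def by (rule pconv_periodic) (rule psr)
  have cf: "continuous_on UNIV f0" unfolding f0_def by (intro continuous_intros s r cd)
  have pf: "f0 (t + 2*pi) = f0 t" for t by (simp add: f0_def per per_r pd)
  have ca: "continuous_on UNIV a" unfolding a_def by (rule continuous_pconv[OF continuous_osc_kernel cf])
  have pa: "a (t + 2*pi) = a t" for t unfolding a_def by (rule pconv_periodic) (rule pf)
  have cc: "continuous_on UNIV c" unfolding c_def by (intro continuous_intros cd ca)
  have pc: "c (t + 2*pi) = c t" for t by (simp add: c_def pd pa)
  have C: "pconv mean_kernel c t = C" for t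
    unfolding C_def by (rule pconv_mean_const[OF cc pc])
  have d_even: "d (- t) = d t" for t
  proof -
    have "d (- t) = pconv (\<lambda>\<sigma>. prim_kernel (2*pi - \<sigma>)) (\<lambda>t. s (- t) - r (- t)) t"
      unfolding d_def by (rule pconv_reflect) (rule psr)
    also have "(\<lambda>t. s (- t) - r (- t)) = (\<lambda>t. - (s t - r t))" by (simp add: r_def)
    finally show ?thesis by (simp only: kernel_reflect pconv_minus_kernel pconv_minus d_def) simp
  qed
  have f_even: "f0 (- t) = f0 t" for t by (simp add: f0_def d_even r_def)
  have a_even: "a (- t) = a t" for t
    unfolding a_def pconv_reflect[of f0, OF pf] kernel_reflect f_even ..
  have c_even: "c (- t) = c t" for t by (simp add: c_def d_even a_even)
  have b_odd: "b (- t) = - b t" for t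
    unfolding b_def pconv_reflect[of c, OF pc] kernel_reflect c_even pconv_minus_kernel ..
  \<comment> \<open>An odd periodic function has mean zero; therefore \<open>d\<close> is an exact
    primitive of \<open>s - r\<close>, without the mean correction of
    \<open>pconv_prim_DERIV\<close>.\<close>
  have mean_zero: "pconv mean_kernel (\<lambda>t. s t - r t) t = 0" for t
  proof -
    have "pconv mean_kernel (\<lambda>t. s t - r t) t = pconv mean_kernel (\<lambda>t. s t - r t) (- t)"
      by (rule pconv_mean_const[OF csr psr])
    also have "\<dots> = pconv (\<lambda>\<sigma>. mean_kernel (2*pi - \<sigma>)) (\<lambda>t. s (- t) - r (- t)) t"
      by (rule pconv_reflect) (rule psr)
    also have "(\<lambda>t. s (- t) - r (- t)) = (\<lambda>t. - (s t - r t))" by (simp add: r_def)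
    finally have "pconv mean_kernel (\<lambda>t. s t - r t) t = - pconv mean_kernel (\<lambda>t. s t - r t) t"
      unfolding kernel_reflect pconv_minus .
    then have "2 * pconv mean_kernel (\<lambda>t. s t - r t) t = 0"
      by (metis add.right_inverse mult_2)
    then show ?thesis by simp
  qed
  have Dd: "(d has_vector_derivative s t - r t) (at t)" for t
    using pconv_prim_DERIV[OF csr psr, of t] by (simp add: d_def mean_zero)
  have Da: "(a has_vector_derivative a' t) (at t)" for t
    unfolding a_def a'_def by (rule pconv_osc_DERIV[OF cf pf \<kappa>(1)])
  have Da': "(a' has_vector_derivative f0 t - \<kappa>\<^sup>2 * a t) (at t)" for t
    using has_vector_derivative_minus[OF pconv_osc'_DERIV[OF cf pf \<kappa>(2), of t]]
    by (simp add: a_def a'_def[abs_def])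
  have Db: "(b has_vector_derivative c t - C) (at t)" for t
    using pconv_prim_DERIV[OF cc pc, of t] by (simp add: b_def C)
  have Dc: "(c has_vector_derivative s t - r t - 2 * \<i> * \<kappa> * a' t) (at t)" for t
    unfolding c_def by (intro has_vector_derivative_diff has_vector_derivative_mult_right Dd Da)
  have w: "w t = (a t - 2 * \<i> / (3 * \<kappa>) * C + b t) / 2" for t
    unfolding w_def lin_sol_def Let_def d_def[symmetric, unfolded r_def] C[symmetric, of t] a_def b_def c_def f0_def
    by (simp add: d_def r_def)
  define w' where "w' = (\<lambda>t. (a' t - 0 + (c t - C)) / 2)"
  define w'' where "w'' = (\<lambda>t. (f0 t - \<kappa>\<^sup>2 * a t - 0 + (s t - r t - 2 * \<i> * \<kappa> * a' t - 0)) / 2)"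
  have "(w has_vector_derivative w' t) (at t)" for t
    unfolding w[abs_def] w'_def
    by (intro has_vector_derivative_divide has_vector_derivative_add has_vector_derivative_diff
      has_vector_derivative_const Da Db)
  moreover have "(w' has_vector_derivative w'' t) (at t)" for t
    unfolding w'_def w''_def
    by (intro has_vector_derivative_divide has_vector_derivative_add has_vector_derivative_diff
      has_vector_derivative_const Da' Dc)
  moreover have "w'' t + 2 * \<i> * \<kappa> * w' t - 3/2 * \<kappa>\<^sup>2 * (w t + w (- t)) = s t" for t
  proof -
    have W: "w t + w (- t) = a t - 2 * \<i> / (3 * \<kappa>) * C"
      unfolding w a_even b_odd by (simp add: field_simps)
    show ?thesis
      unfolding W w'_def w''_def f0_def c_def using \<kappa>(1)
      by (simp add: field_simps power2_eq_square)
  qed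
  ultimately show ?ode by blast
  \<comment> \<open>For real \<kappa> and a source on which conjugation acts as reflection,
    \<open>a\<close> comes out real and even, \<open>b\<close> imaginary and odd, and the constant
    \<open>C\<close> imaginary.\<close>
  assume cs: "\<And>t. cnj (s t) = s (- t)" and c\<kappa>: "cnj \<kappa> = \<kappa>"
  have cd: "cnj (d t) = - d t" for t
  proof -
    have "cnj (d t) = pconv prim_kernel (\<lambda>t. - (s t - r t)) t"
      by (simp add: d_def pconv_cnj kernel_cnj cs r_def)
    then show ?thesis by (simp only: pconv_minus d_def)
  qed
  have ca: "cnj (a t) = a t" for t
    by (simp add: a_def pconv_cnj kernel_cnj c\<kappa> f0_def cs cd r_def add.commute)
  have ccj: "cnj (c t) = - c t" for t
    by (simp add: c_def cd ca c\<kappa>)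
  have "cnj (b t) = - b t"
    by (simp add: b_def pconv_cnj kernel_cnj ccj pconv_minus)
  moreover have "cnj C = - C"
    by (simp add: C_def pconv_cnj kernel_cnj ccj pconv_minus)
  ultimately show "cnj (w t) = w (- t)"
    by (simp add: w a_even b_odd ca c\<kappa>)
qed

section \<open>Uniform bounds for the solution operator\<close>

lemma norm_mean_kernel: "cmod (mean_kernel \<sigma>) \<le> 1 / (2 * pi)"
  by (simp add: mean_kernel_def norm_divide)

lemma norm_prim_kernel:
  assumes "\<sigma> \<in> {0..2*pi}"
  shows "cmod (prim_kernel \<sigma>) \<le> 1/2"
proof -
  have "\<bar>\<sigma> - pi\<bar> \<le> pi" using assms by auto
  then show ?thesis unfolding prim_kernel_def norm_of_real by (simp add: field_simps)
qed

lemma lin_sol_shift: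
  "lin_sol \<kappa> s r (\<tau> + t) = lin_sol \<kappa> (\<lambda>u. s (u + t)) (\<lambda>u. r (u + t)) \<tau>"
  unfolding lin_sol_def Let_def pconv_shift ..

lemma norm_pconv_diff_le:
  assumes "continuous_on UNIV G" "continuous_on UNIV f" "continuous_on UNIV g"
    and "\<And>\<sigma>. \<sigma> \<in> {0..2*pi} \<Longrightarrow> cmod (G \<sigma>) \<le> A" "\<And>t. cmod (f t - g t) \<le> B" "0 \<le> A" "0 \<le> B"
  shows "cmod (pconv G f \<tau> - pconv G g \<tau>) \<le> 2 * pi * A * B"
  unfolding pconv_diff[OF assms(1-3)]
  by (rule norm_pconv_le) (use assms in \<open>auto intro!: continuous_on_diff\<close>)

text \<open>Bound for the map from the source to \<open>a\<close>, with \<open>k\<close> bounding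
  \<kappa> and \<open>A\<close> the kernel: the forcing of the oscillator is at most
  \<open>2 + 4\<pi>k\<close> times the source.\<close>

definition osc_bound :: "real \<Rightarrow> real \<Rightarrow> real" where
  "osc_bound k A = 2 * pi * A * (2 + 4 * pi * k)"

text \<open>The three summands belong to \<open>a\<close>, to the integration constant and to
  \<open>b\<close>; \<open>k'\<close> bounds the inverse of \<kappa>.\<close>

definition lin_bound :: "real \<Rightarrow> real \<Rightarrow> real \<Rightarrow> real" where
  "lin_bound k k' A = (osc_bound k A + 2 / 3 * k' * (2 * pi + 2 * k * osc_bound k A)
      + pi * (2 * pi + 2 * k * osc_bound k A)) / 2"

text \<open>Stated for differences, so that one estimate gives both the bound, by comparison with
  zero, and the contraction.\<close>

lemma norm_lin_sol_diff_le:
  assumes c: "continuous_on UNIV s1" "continuous_on UNIV r1" "continuous_on UNIV s2" "continuous_on UNIV r2"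
    and B: "\<And>t. cmod (s1 t - s2 t) \<le> B" "\<And>t. cmod (r1 t - r2 t) \<le> B"
    and k: "cmod \<kappa> \<le> k" "cmod (inverse \<kappa>) \<le> k'"
    and A: "\<And>\<sigma>. \<sigma> \<in> {0..2*pi} \<Longrightarrow> cmod (osc_kernel \<kappa> \<sigma>) \<le> A"
  shows "cmod (lin_sol \<kappa> s1 r1 \<tau> - lin_sol \<kappa> s2 r2 \<tau>) \<le> lin_bound k k' A * B"
proof -
  have B0: "0 \<le> B" using B(1)[of 0] norm_ge_zero order_trans by blast
  have A0: "0 \<le> A" using order_trans[OF norm_ge_zero A[of 0]] by simp
  have k0: "0 \<le> k" "0 \<le> k'" using k norm_ge_zero order_trans by blast+
  have o0: "0 \<le> osc_bound k A" unfolding osc_bound_def using A0 k0 by (intro mult_nonneg_nonneg) auto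
  define d1 d2 where "d1 = pconv prim_kernel (\<lambda>t. s1 t - r1 t)" and "d2 = pconv prim_kernel (\<lambda>t. s2 t - r2 t)"
  define f1 f2 where "f1 = (\<lambda>t. s1 t + r1 t - 2 * \<i> * \<kappa> * d1 t)" and "f2 = (\<lambda>t. s2 t + r2 t - 2 * \<i> * \<kappa> * d2 t)"
  define a1 a2 where "a1 = pconv (osc_kernel \<kappa>) f1" and "a2 = pconv (osc_kernel \<kappa>) f2"
  define c1 c2 where "c1 = (\<lambda>t. d1 t - 2 * \<i> * \<kappa> * a1 t)" and "c2 = (\<lambda>t. d2 t - 2 * \<i> * \<kappa> * a2 t)"
  have csr: "continuous_on UNIV (\<lambda>t. s1 t - r1 t)" "continuous_on UNIV (\<lambda>t. s2 t - r2 t)"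
    using c by (auto intro!: continuous_on_diff)
  have cd: "continuous_on UNIV d1" "continuous_on UNIV d2"
    unfolding d1_def d2_def by (intro continuous_pconv continuous_prim_kernel csr)+
  have cf: "continuous_on UNIV f1" "continuous_on UNIV f2"
    unfolding f1_def f2_def by (intro continuous_on_add continuous_on_diff continuous_on_mult continuous_on_const c cd)+
  have ca: "continuous_on UNIV a1" "continuous_on UNIV a2"
    unfolding a1_def a2_def by (intro continuous_pconv continuous_osc_kernel cf)+
  have cc: "continuous_on UNIV c1" "continuous_on UNIV c2"
    unfolding c1_def c2_def by (intro continuous_on_diff continuous_on_mult continuous_on_const cd ca)+
  have "cmod (s1 t - r1 t - (s2 t - r2 t)) \<le> 2 * B" for t
    using norm_triangle_ineq4[of "s1 t - s2 t" "r1 t - r2 t"] B[of t] by (simp add: algebra_simps)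
  then have "cmod (d1 t - d2 t) \<le> 2 * pi * (1/2) * (2 * B)" for t
    unfolding d1_def d2_def using B0
    by (intro norm_pconv_diff_le continuous_prim_kernel csr norm_prim_kernel) auto
  then have bd: "cmod (d1 t - d2 t) \<le> 2 * pi * B" for t by (simp add: mult_ac)
  have mk: "cmod (2 * \<i> * \<kappa> * z) \<le> 2 * k * D" if "cmod z \<le> D" for z D
    using that k k0 by (simp add: norm_mult mult_mono)
  have bf: "cmod (f1 t - f2 t) \<le> (2 + 4 * pi * k) * B" for t
  proof -
    have "f1 t - f2 t = (s1 t - s2 t) + (r1 t - r2 t) - 2 * \<i> * \<kappa> * (d1 t - d2 t)"
      by (simp add: f1_def f2_def algebra_simps)
    also have "cmod \<dots> \<le> cmod (s1 t - s2 t) + cmod (r1 t - r2 t) + cmod (2 * \<i> * \<kappa> * (d1 t - d2 t))"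
      by (rule order_trans[OF norm_triangle_ineq4 add_right_mono[OF norm_triangle_ineq]])
    also have "\<dots> \<le> B + B + 2 * k * (2 * pi * B)"
      by (intro add_mono B mk bd)
    finally show ?thesis by (simp add: algebra_simps)
  qed
  have "cmod (a1 t - a2 t) \<le> 2 * pi * A * ((2 + 4 * pi * k) * B)" for t
    unfolding a1_def a2_def
    by (rule norm_pconv_diff_le[OF continuous_osc_kernel cf A bf A0]) (simp_all add: B0 k0)
  then have ba: "cmod (a1 t - a2 t) \<le> osc_bound k A * B" for t by (simp add: osc_bound_def mult_ac)
  define C where "C = (2 * pi + 2 * k * osc_bound k A) * B"
  have C0: "0 \<le> C" unfolding C_def using k0 B0 o0 by (intro mult_nonneg_nonneg add_nonneg_nonneg) auto
  have bc: "cmod (c1 t - c2 t) \<le> C" for t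
  proof -
    have "c1 t - c2 t = (d1 t - d2 t) - 2 * \<i> * \<kappa> * (a1 t - a2 t)"
      by (simp add: c1_def c2_def algebra_simps)
    also have "cmod \<dots> \<le> cmod (d1 t - d2 t) + cmod (2 * \<i> * \<kappa> * (a1 t - a2 t))"
      by (rule norm_triangle_ineq4)
    also have "\<dots> \<le> 2 * pi * B + 2 * k * (osc_bound k A * B)"
      by (intro add_mono bd mk ba)
    finally show ?thesis by (simp add: C_def algebra_simps)
  qed
  have bm: "cmod (pconv mean_kernel c1 \<tau> - pconv mean_kernel c2 \<tau>) \<le> C"
    using norm_pconv_diff_le[OF continuous_mean_kernel cc norm_mean_kernel bc, of \<tau>] C0 by simp
  have bp: "cmod (pconv prim_kernel c1 \<tau> - pconv prim_kernel c2 \<tau>) \<le> pi * C"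
    using norm_pconv_diff_le[OF continuous_prim_kernel cc norm_prim_kernel bc, of \<tau>] C0 by simp
  define u where "u = 2 * \<i> / 3 * inverse \<kappa> * (pconv mean_kernel c1 \<tau> - pconv mean_kernel c2 \<tau>)"
  have inv: "2 * \<i> / (3 * \<kappa>) = 2 * \<i> / 3 * inverse \<kappa>"
    by (cases "\<kappa> = 0") (simp_all add: field_simps)
  have lin: "(a - x * m + p) / 2 - (a' - x * m' + p') / 2 = ((a - a') - x * (m - m') + (p - p')) / 2"
    for a a' x m m' p p' :: complex
    by (simp add: field_simps)
  have "lin_sol \<kappa> s1 r1 \<tau> - lin_sol \<kappa> s2 r2 \<tau> =
     ((a1 \<tau> - a2 \<tau>) - u + (pconv prim_kernel c1 \<tau> - pconv prim_kernel c2 \<tau>)) / 2"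
    unfolding lin_sol_def Let_def d1_def[symmetric] d2_def[symmetric] f1_def[symmetric] f2_def[symmetric]
      a1_def[symmetric] a2_def[symmetric] c1_def[symmetric] c2_def[symmetric] u_def inv
    by (rule lin)
  then have "cmod (lin_sol \<kappa> s1 r1 \<tau> - lin_sol \<kappa> s2 r2 \<tau>) =
      cmod ((a1 \<tau> - a2 \<tau>) - u + (pconv prim_kernel c1 \<tau> - pconv prim_kernel c2 \<tau>)) / 2"
    by (simp only: norm_divide norm_numeral)
  also have "\<dots> \<le> (cmod (a1 \<tau> - a2 \<tau>) + cmod u + cmod (pconv prim_kernel c1 \<tau> - pconv prim_kernel c2 \<tau>)) / 2"
    by (intro divide_right_mono order_trans[OF norm_triangle_ineq add_right_mono[OF norm_triangle_ineq4]]) simp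
  also have "\<dots> \<le> (osc_bound k A * B + 2 / 3 * k' * C + pi * C) / 2"
  proof -
    have "cmod (2 * \<i> / 3 * inverse \<kappa>) \<le> 2 / 3 * k'"
      using k(2) by (simp add: norm_mult norm_divide)
    then have "cmod u \<le> 2 / 3 * k' * C"
      unfolding u_def norm_mult[of "2 * \<i> / 3 * inverse \<kappa>"] using k0 bm by (intro mult_mono) auto
    then show ?thesis by (intro divide_right_mono add_mono ba bp) simp_all
  qed
  also have "\<dots> = lin_bound k k' A * B"
    by (simp add: lin_bound_def C_def algebra_simps)
  finally show ?thesis .
qed

lemma lin_sol_zero [simp]: "lin_sol \<kappa> (\<lambda>t. 0) (\<lambda>t. 0) \<tau> = 0"
  by (simp add: lin_sol_def pconv_def)

lemma lin_bound_nonneg: "0 \<le> k \<Longrightarrow> 0 \<le> k' \<Longrightarrow> 0 \<le> A \<Longrightarrow> 0 \<le> lin_bound k k' A"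
  unfolding lin_bound_def osc_bound_def by simp

section \<open>The linear solution operator with parameters\<close>

text \<open>
  Complexified parameters \<open>\<mu>, \<omega>\<^sub>1, \<omega>\<^sub>2\<close>, the relative angle \<open>Tau\<close> in which all functions are
  \<open>2\<pi>\<close>-periodic, and the rotation angle \<open>Ang\<close>.
\<close>

datatype coord = Mu | V1 | V2 | Tau | Ang

instance coord :: finite
proof
  have "(UNIV :: coord set) = {Mu, V1, V2, Tau, Ang}"
    using coord.exhaust by auto
  then show "finite (UNIV :: coord set)"
    by (metis finite.emptyI finite_insert)
qed

type_synonym pvec = "complex^coord"

definition tshift :: "pvec \<Rightarrow> real \<Rightarrow> pvec" where
  "tshift x t = x + of_real t *s axis Tau 1"

definition treflect :: "pvec \<Rightarrow> pvec" where
  "treflect x = (\<chi> i. if i = Tau then - x $ i else x $ i)"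

lemma tshift_nth [simp]: "tshift x t $ Tau = x $ Tau + of_real t" "i \<noteq> Tau \<Longrightarrow> tshift x t $ i = x $ i"
  by (simp_all add: tshift_def axis_def)

lemma treflect_nth [simp]: "treflect x $ Tau = - x $ Tau" "i \<noteq> Tau \<Longrightarrow> treflect x $ i = x $ i"
  by (simp_all add: treflect_def)

lemma tshift_tshift [simp]: "tshift (tshift x s) t = tshift x (s + t)"
  by (simp add: vec_eq_iff tshift_def axis_def)

lemma tshift_0 [simp]: "tshift x 0 = x"
  by (simp add: tshift_def)

lemma treflect_tshift: "treflect (tshift x t) = tshift (treflect x) (- t)"
  by (simp add: vec_eq_iff treflect_def tshift_def axis_def)

lemma treflect_treflect [simp]: "treflect (treflect x) = x"
  by (simp add: vec_eq_iff treflect_def)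

lemma continuous_tshift [continuous_intros]:
  assumes "continuous_on A f" "continuous_on A g"
  shows "continuous_on A (\<lambda>x. tshift (f x) (g x))"
  unfolding tshift_def using assms by (intro continuous_intros)

lemma continuous_treflect: "continuous_on A treflect"
  unfolding treflect_def[abs_def]
proof (intro continuous_on_vec_lambda)
  fix i show "continuous_on A (\<lambda>x. if i = Tau then - x $ i else x $ i)"
    by (cases "i = Tau") (auto intro!: continuous_intros)
qed

text \<open>Only real shifts are required, so that strips around the real \<tau>-axis
  qualify.\<close>

definition tinvariant :: "pvec set \<Rightarrow> bool" where
  "tinvariant S \<longleftrightarrow> (\<forall>x\<in>S. treflect x \<in> S \<and> (\<forall>t. tshift x t \<in> S))"

lemma gholo_tshift:
  assumes "tinvariant S" "gholo S f"
  shows "gholo S (\<lambda>x. f (tshift x t))"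
  by (rule gholo_affine[OF assms(2), where L = "\<lambda>v. v"])
    (use assms(1) in \<open>auto simp: tinvariant_def tshift_def algebra_simps intro!: continuous_intros\<close>)

lemma gholo_treflect:
  assumes "tinvariant S" "gholo S f"
  shows "gholo S (\<lambda>x. f (treflect x))"
  by (rule gholo_affine[OF assms(2), where L = treflect])
    (use assms(1) in \<open>auto simp: tinvariant_def treflect_def vec_eq_iff intro: continuous_treflect[unfolded treflect_def]\<close>)

lemma continuous_on_line:
  assumes "tinvariant S" "continuous_on S f" "x \<in> S"
  shows "continuous_on UNIV (\<lambda>t. f (tshift x t))"
  using assms by (intro continuous_on_compose2[OF assms(2)] continuous_intros) (auto simp: tinvariant_def)

lemma gholo_pconv:
  assumes S: "open S" and inv: "tinvariant S" and f: "gholo S f"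
    and G: "\<And>\<sigma>. gholo S (\<lambda>x. G x \<sigma>)"
    and cG: "continuous_on ({0..2*pi} \<times> S) (\<lambda>(\<sigma>, x). G x \<sigma>)"
  shows "gholo S (\<lambda>x. pconv (G x) (\<lambda>t. f (tshift x t)) 0)"
  unfolding pconv_def
proof (rule gholo_integral[OF S])
  show "continuous_on ({0..2*pi} \<times> S) (\<lambda>(\<sigma>, x). G x \<sigma> * f (tshift x (0 + \<sigma>)))"
    unfolding case_prod_unfold
    using inv cG[unfolded case_prod_unfold]
    by (intro continuous_intros continuous_on_compose2[OF gholo_imp_continuous_on[OF f]])
      (auto simp: tinvariant_def)
  show "gholo S (\<lambda>x. G x \<sigma> * f (tshift x (0 + \<sigma>)))" for \<sigma>
    by (intro gholo_mult G gholo_tshift[OF inv f])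
qed

text \<open>The convolution runs along the real line through a possibly complex \<tau> and is
  evaluated at its origin. Real translations commute with complexification, so the operator
  preserves holomorphy in all coordinates, \<tau> included.\<close>

definition lin_op :: "(pvec \<Rightarrow> complex) \<Rightarrow> (pvec \<Rightarrow> complex) \<Rightarrow> pvec \<Rightarrow> complex" where
  "lin_op \<kappa> f x = lin_sol (\<kappa> x) (\<lambda>t. f (tshift x t)) (\<lambda>t. f (treflect (tshift x t))) 0"

lemma lin_op_line:
  assumes "\<And>t. \<kappa> (tshift x t) = \<kappa> x"
  shows "lin_op \<kappa> f (tshift x t) = lin_sol (\<kappa> x) (\<lambda>t. f (tshift x t)) (\<lambda>t. f (treflect (tshift x t))) t"
  unfolding lin_op_def assms
  using lin_sol_shift[of "\<kappa> x" "\<lambda>t. f (tshift x t)" "\<lambda>t. f (treflect (tshift x t))" 0 t]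
  by (simp add: add.commute)

lemma gholo_osc_kernel:
  assumes \<kappa>: "gholo S \<kappa>" "\<And>x. x \<in> S \<Longrightarrow> \<kappa> x \<noteq> 0" "\<And>x. x \<in> S \<Longrightarrow> sin (\<kappa> x * of_real pi) \<noteq> 0"
  shows "gholo S (\<lambda>x. osc_kernel (\<kappa> x) \<sigma>)"
    and "continuous_on ({0..2*pi} \<times> S) (\<lambda>(\<sigma>, x). osc_kernel (\<kappa> x) \<sigma>)"
proof -
  have "gholo S (\<lambda>x. cos (\<kappa> x * of_real (\<sigma> - pi)))"
    by (rule gholo_compose[where g = cos]) (auto intro: field_differentiable_at_cos \<kappa>)
  moreover have "gholo S (\<lambda>x. sin (\<kappa> x * of_real pi))"
    by (rule gholo_compose[where g = sin]) (auto intro: field_differentiable_at_sin \<kappa>)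
  ultimately show "gholo S (\<lambda>x. osc_kernel (\<kappa> x) \<sigma>)"
    unfolding osc_kernel_def using \<kappa> by (intro gholo_divide gholo_mult gholo_const) auto
  show "continuous_on ({0..2*pi} \<times> S) (\<lambda>(\<sigma>, x). osc_kernel (\<kappa> x) \<sigma>)"
    unfolding osc_kernel_def case_prod_unfold using \<kappa>
    by (intro continuous_intros continuous_on_compose2[OF gholo_imp_continuous_on[OF \<kappa>(1)]]) auto
qed

text \<open>Because \<kappa> is constant along the line through \<open>x\<close>, each intermediate
  function of \<open>lin_sol\<close> is the restriction to that line of a function of
  \<open>x\<close> (\<open>D\<close>, \<open>F\<close>, \<open>A\<close>, \<open>C\<close>), and
  holomorphy passes from one to the next.\<close>

lemma gholo_lin_op:
  assumes S: "open S" and inv: "tinvariant S" and f: "gholo S f"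
    and \<kappa>: "gholo S \<kappa>" "\<And>x. x \<in> S \<Longrightarrow> \<kappa> x \<noteq> 0" "\<And>x. x \<in> S \<Longrightarrow> sin (\<kappa> x * of_real pi) \<noteq> 0"
    and \<kappa>inv: "\<And>x t. \<kappa> (tshift x t) = \<kappa> x"
  shows "gholo S (lin_op \<kappa> f)"
proof -
  have prim: "gholo S (\<lambda>x. prim_kernel \<sigma>)" "continuous_on ({0..2*pi} \<times> S) (\<lambda>(\<sigma>, x). prim_kernel \<sigma>)"
    and mean: "gholo S (\<lambda>x. mean_kernel \<sigma>)" "continuous_on ({0..2*pi} \<times> S) (\<lambda>(\<sigma>, x). mean_kernel \<sigma>)" for \<sigma>
    unfolding case_prod_unfold
    by (auto intro!: continuous_on_compose2[OF continuous_prim_kernel]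
        continuous_on_compose2[OF continuous_mean_kernel] continuous_intros)
  define D where "D = (\<lambda>x. pconv prim_kernel (\<lambda>t. f (tshift x t) - f (treflect (tshift x t))) 0)"
  define F where "F = (\<lambda>x. f x + f (treflect x) - 2 * \<i> * \<kappa> x * D x)"
  define A where "A = (\<lambda>x. pconv (osc_kernel (\<kappa> x)) (\<lambda>t. F (tshift x t)) 0)"
  define C where "C = (\<lambda>x. D x - 2 * \<i> * \<kappa> x * A x)"
  have fr: "gholo S (\<lambda>x. f (treflect x))"
    by (rule gholo_treflect[OF inv f])
  have D: "gholo S D"
    unfolding D_def
    by (rule gholo_pconv[OF S inv gholo_diff[OF f fr] prim])
  have F: "gholo S F"
    unfolding F_def by (intro gholo_diff gholo_add gholo_mult gholo_const f D \<kappa> fr)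
  have A: "gholo S A"
    unfolding A_def by (rule gholo_pconv[OF S inv F]) (rule gholo_osc_kernel[OF \<kappa>], assumption+)+
  have C: "gholo S C"
    unfolding C_def by (intro gholo_diff gholo_mult gholo_const A D \<kappa>)
  have dline: "pconv prim_kernel (\<lambda>t. f (tshift x t) - f (treflect (tshift x t))) t = D (tshift x t)" for x t
    using pconv_shift[of prim_kernel "\<lambda>t. f (tshift x t) - f (treflect (tshift x t))" 0 t]
    by (simp add: D_def add.commute)
  have aline: "pconv (osc_kernel (\<kappa> x)) (\<lambda>t. F (tshift x t)) t = A (tshift x t)" for x t
    using pconv_shift[of "osc_kernel (\<kappa> x)" "\<lambda>t. F (tshift x t)" 0 t]
    by (simp add: A_def \<kappa>inv add.commute)
  have fline: "f (tshift x t) + f (treflect (tshift x t)) - 2 * \<i> * \<kappa> x * D (tshift x t) = F (tshift x t)" for x t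
    by (simp add: F_def \<kappa>inv)
  have cline: "D (tshift x t) - 2 * \<i> * \<kappa> x * A (tshift x t) = C (tshift x t)" for x t
    by (simp add: C_def \<kappa>inv)
  have eq: "lin_op \<kappa> f = (\<lambda>x. (A x - 2 * \<i> / (3 * \<kappa> x) * pconv mean_kernel (\<lambda>t. C (tshift x t)) 0
      + pconv prim_kernel (\<lambda>t. C (tshift x t)) 0) / 2)"
    unfolding lin_op_def[abs_def] lin_sol_def Let_def dline fline aline cline by simp
  show ?thesis
    unfolding eq using \<kappa>(2)
    by (intro gholo_divide gholo_add gholo_diff gholo_mult gholo_const A \<kappa> gholo_pconv[OF S inv C] prim mean) auto
qed

lemma norm_lin_op_diff_le:
  assumes inv: "tinvariant S" and f: "continuous_on S f" "continuous_on S g" and x: "x \<in> S"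
    and B: "\<And>x. x \<in> S \<Longrightarrow> cmod (f x - g x) \<le> B"
    and k: "cmod (\<kappa> x) \<le> k" "cmod (inverse (\<kappa> x)) \<le> k'"
    and A: "\<And>\<sigma>. \<sigma> \<in> {0..2*pi} \<Longrightarrow> cmod (osc_kernel (\<kappa> x) \<sigma>) \<le> A"
  shows "cmod (lin_op \<kappa> f x - lin_op \<kappa> g x) \<le> lin_bound k k' A * B"
proof -
  have r: "continuous_on UNIV (\<lambda>t. h (treflect (tshift x t)))" if "continuous_on S h" for h :: "pvec \<Rightarrow> complex"
  proof -
    have "treflect ` S \<subseteq> S" using inv by (auto simp: tinvariant_def)
    then have "continuous_on S (\<lambda>x. h (treflect x))"
      by (rule continuous_on_compose2[OF that continuous_treflect])
    from continuous_on_line[OF inv this x] show ?thesis .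
  qed
  have inS: "tshift x t \<in> S" "treflect (tshift x t) \<in> S" for t
    using inv x by (auto simp: tinvariant_def)
  show ?thesis
    unfolding lin_op_def
    by (rule norm_lin_sol_diff_le)
      (use f r k A B inS in \<open>auto intro!: continuous_on_line[OF inv _ x]\<close>)
qed

lemma lin_op_zero [simp]: "lin_op \<kappa> (\<lambda>x. 0) x = 0"
  by (simp add: lin_op_def)

section \<open>Fixed points in a class closed under uniform limits\<close>

text \<open>The contraction principle without a metric space: functions are compared on
  \<open>S\<close> only, by pointwise bounds, and completeness is replaced by closure of the class
  under uniform limits. Accordingly the fixed point equation holds on \<open>S\<close>.\<close>

lemma uniform_contraction_fixed_point:
  fixes T :: "('a \<Rightarrow> 'b::banach) \<Rightarrow> 'a \<Rightarrow> 'b"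
  assumes start: "start \<in> C" and T: "\<And>f. f \<in> C \<Longrightarrow> T f \<in> C"
    and bd: "\<And>f x. f \<in> C \<Longrightarrow> x \<in> S \<Longrightarrow> norm (f x) \<le> M"
    and contr: "\<And>f g B x. f \<in> C \<Longrightarrow> g \<in> C \<Longrightarrow> (\<And>x. x \<in> S \<Longrightarrow> norm (f x - g x) \<le> B) \<Longrightarrow>
       x \<in> S \<Longrightarrow> norm (T f x - T g x) \<le> B / 2"
    and closed: "\<And>F f. (\<And>n::nat. F n \<in> C) \<Longrightarrow> uniform_limit S F f sequentially \<Longrightarrow> f \<in> C"
  shows "\<exists>f\<in>C. \<forall>x\<in>S. T f x = f x"
proof -
  define F where "F n = (T ^^ n) start" for n
  have FC: "F n \<in> C" for n by (induction n) (auto simp: F_def start T)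
  \<comment> \<open>Geometric decay of successive differences; telescoping turns the iterates into a
    series covered by the Weierstrass test.\<close>
  have step: "norm (F (Suc n) x - F n x) \<le> 2 * M * (1/2) ^ n" if "x \<in> S" for n x
    using that
  proof (induction n arbitrary: x)
    case 0
    then show ?case
      using norm_triangle_ineq4[of "F 1 x" "F 0 x"] bd[OF FC 0, of 0] bd[OF FC 0, of 1] by simp
  next
    case (Suc n)
    have "norm (T (F (Suc n)) x - T (F n) x) \<le> (2 * M * (1/2) ^ n) / 2"
      by (rule contr[OF FC FC Suc.IH Suc.prems])
    then show ?case by (simp add: F_def)
  qed
  have "uniformly_convergent_on S (\<lambda>n x. \<Sum>i<n. F (Suc i) x - F i x)"
    by (rule Weierstrass_m_test'[OF step]) (auto intro!: summable_mult summable_geometric)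
  moreover have "(\<Sum>i<n. F (Suc i) x - F i x) = F n x - F 0 x" for n x
    by (rule sum_lessThan_telescope)
  ultimately have "uniformly_convergent_on S (\<lambda>n x. F n x - F 0 x)" by simp
  then obtain h where "uniform_limit S (\<lambda>n x. F n x - F 0 x) h sequentially"
    by (auto simp: uniformly_convergent_on_def)
  then have "uniform_limit S (\<lambda>n x. (F n x - F 0 x) + F 0 x) (\<lambda>x. h x + F 0 x) sequentially"
    by (intro uniform_limit_intros)
  then have lim: "uniform_limit S F (\<lambda>x. h x + F 0 x) sequentially" by simp
  define f where "f = (\<lambda>x. h x + F 0 x)"
  have lim: "uniform_limit S F f sequentially" using lim by (simp add: f_def)
  have fC: "f \<in> C" by (rule closed[OF FC lim])
  have "T f x = f x" if x: "x \<in> S" for x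
  proof -
    have "norm (T f x - f x) \<le> 2 * e" if e: "e > 0" for e
    proof -
      from uniform_limitD[OF lim e] obtain N where N: "\<And>n x. n \<ge> N \<Longrightarrow> x \<in> S \<Longrightarrow> dist (F n x) (f x) < e"
        by (auto simp: eventually_sequentially)
      have "norm (T f x - T (F N) x) \<le> e / 2"
        by (rule contr[OF fC FC _ x]) (use N[of N] in \<open>auto simp: dist_norm norm_minus_commute less_imp_le\<close>)
      moreover have "norm (F (Suc N) x - f x) < e" using N[of "Suc N"] x by (simp add: dist_norm)
      moreover have "T (F N) = F (Suc N)" by (simp add: F_def)
      ultimately show ?thesis
        using norm_triangle_ineq[of "T f x - T (F N) x" "F (Suc N) x - f x"] e by simp
    qed
    from this[of "e/2" for e] have "norm (T f x - f x) \<le> 0"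
      by (intro field_le_epsilon[of "norm (T f x - f x)" 0]) force
    then show ?thesis by simp
  qed
  with fC show ?thesis by blast
qed

section \<open>The gravitational nonlinearity\<close>

text \<open>
  \<open>att z z'\<close> is the holomorphic continuation of \<open>z / \<bar>z\<bar>\<^sup>3\<close>, with \<open>z'\<close> in the role of the conjugate.
\<close>

definition att :: "complex \<Rightarrow> complex \<Rightarrow> complex" where
  "att z z' = z * inverse (csqrt (z * z') ^ 3)"

lemma att_cnj_self: "att z (cnj z) = z / of_real (cmod z ^ 3)"
proof -
  have "csqrt ((of_real (cmod z))\<^sup>2) = of_real (cmod z)"
    by (rule csqrt_square) auto
  then have "csqrt (z * cnj z) = of_real (cmod z)"
    by (simp add: complex_norm_square[symmetric])
  then show ?thesis by (simp add: att_def divide_inverse)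
qed

lemma Re_pos_not_nonpos: "Re z > 0 \<Longrightarrow> z \<notin> \<real>\<^sub>\<le>\<^sub>0"
  by (auto simp: complex_nonpos_Reals_iff)

lemma cnj_att: "Re (z * z') > 0 \<Longrightarrow> cnj (att z z') = att (cnj z) (cnj z')"
  using cnj_csqrt[OF Re_pos_not_nonpos, of "z * z'"] by (simp add: att_def)

lemma field_differentiable_inverse_csqrt_cube:
  assumes "Re z > 0"
  shows "(\<lambda>z. inverse (csqrt z ^ 3)) field_differentiable (at z)"
proof -
  have "z \<noteq> 0" using assms by auto
  then show ?thesis
    by (intro field_differentiable_inverse field_differentiable_power field_differentiable_at_csqrt
        Re_pos_not_nonpos assms) auto
qed

lemma field_differentiable_att:
  assumes "f field_differentiable (at w)" "g field_differentiable (at w)" "Re (f w * g w) > 0"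
  shows "(\<lambda>w. att (f w) (g w)) field_differentiable (at w)"
proof -
  have "(\<lambda>w. f w * g w) field_differentiable (at w)"
    by (intro field_differentiable_mult assms)
  from field_differentiable_compose[OF this field_differentiable_inverse_csqrt_cube[OF assms(3)]]
  show ?thesis unfolding att_def by (intro field_differentiable_mult assms) (simp add: o_def)
qed

lemma gholo_att:
  assumes "gholo S f" "gholo S g" "\<And>x. x \<in> S \<Longrightarrow> Re (f x * g x) > 0"
  shows "gholo S (\<lambda>x. att (f x) (g x))"
  unfolding att_def
  by (intro gholo_mult assms gholo_compose[where g = "\<lambda>z. inverse (csqrt z ^ 3)"]
      field_differentiable_inverse_csqrt_cube)

lemma continuous_on_att:
  assumes "continuous_on S f" "continuous_on S g" "\<And>x. x \<in> S \<Longrightarrow> Re (f x * g x) > 0"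
  shows "continuous_on S (\<lambda>x. att (f x) (g x))"
proof -
  have "continuous_on (UNIV \<inter> {z. Re z > 0}) (\<lambda>z. inverse (csqrt z ^ 3))"
    by (intro continuous_at_imp_continuous_on ballI field_differentiable_imp_continuous_at
      field_differentiable_inverse_csqrt_cube) auto
  then have "continuous_on S (\<lambda>x. inverse (csqrt (f x * g x) ^ 3))"
    by (rule continuous_on_compose2) (use assms in \<open>auto intro!: continuous_intros\<close>)
  then show ?thesis unfolding att_def by (intro continuous_on_mult assms)
qed

text \<open>Linear part of the Kepler force at the circular orbit minus the force itself, with
  \<open>b\<close> in the role of the conjugate of \<open>a\<close>. The linear part is moved into
  the operator inverted by \<open>lin_sol\<close>.\<close>

definition kepler_rem :: "complex \<Rightarrow> complex \<Rightarrow> complex" where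
  "kepler_rem a b = 1 + a - 3/2 * (a + b) - att (1 + a) (1 + b)"

text \<open>The derivative of \<open>z\<^sup>-\<^sup>3\<^sup>/\<^sup>2\<close> at 1 is -3/2, so the
  first-order terms cancel and the remainder is of higher order.\<close>

lemma kepler_rem_small:
  assumes "\<epsilon> > 0"
  obtains \<eta> where "\<eta> > 0"
    "\<And>a b. cmod a \<le> \<eta> \<Longrightarrow> cmod b \<le> \<eta> \<Longrightarrow> cmod (kepler_rem a b) \<le> \<epsilon> * (cmod a + cmod b)"
proof -
  define cub where "cub = (\<lambda>z. inverse (csqrt z ^ 3))"
  have "(cub has_field_derivative - 3/2) (at 1)"
    unfolding cub_def
    by (auto intro!: derivative_eq_intros simp: complex_nonpos_Reals_iff)
  then have "(cub has_derivative (*) (- 3/2)) (at 1)"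
    by (rule has_field_derivative_imp_has_derivative)
  then obtain d where d: "d > 0" "\<And>y. cmod (y - 1) < d \<Longrightarrow>
      cmod (cub y - cub 1 - (- 3/2) * (y - 1)) \<le> \<epsilon> / 6 * cmod (y - 1)"
    unfolding has_derivative_at_alt using assms by (metis zero_less_divide_iff zero_less_numeral)
  \<comment> \<open>\<open>1/2\<close> gives \<open>cmod (1 + a) \<le> 3/2\<close> and
    \<open>cmod u \<le> 2n\<close>; \<open>d / 5\<close> gives
    \<open>cmod u \<le> 4\<eta> < d\<close>; \<open>\<epsilon> / 9\<close> makes the quadratic
    terms, at most \<open>9/2 \<eta>n\<close>, smaller than \<open>\<epsilon>n / 2\<close>.\<close>
  define \<eta> where "\<eta> = min (1/2) (min (d / 5) (\<epsilon> / 9))"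
  have \<eta>: "\<eta> > 0" "\<eta> \<le> 1/2" "\<eta> \<le> d / 5" "\<eta> \<le> \<epsilon> / 9"
    using assms d(1) by (auto simp: \<eta>_def)
  show thesis
  proof (rule that[OF \<eta>(1)])
    fix a b :: complex assume a: "cmod a \<le> \<eta>" and b: "cmod b \<le> \<eta>"
    define n where "n = cmod a + cmod b"
    define u where "u = a + b + a * b"
    have n0: "n \<ge> 0" by (simp add: n_def)
    have ab: "cmod (a * b) \<le> \<eta> * n"
      unfolding norm_mult n_def using a b \<eta>(1)
      by (intro mult_mono) (auto intro: add_increasing)
    have "cmod u \<le> n + \<eta> * n"
      unfolding u_def using norm_triangle_ineq[of "a + b" "a * b"] norm_triangle_ineq[of a b] ab by (simp add: n_def)
    also have "\<dots> \<le> n + 1 * n" using \<eta>(2) n0 by (intro add_left_mono mult_right_mono) auto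
    finally have u: "cmod u \<le> 2 * n" by simp
    have "n \<le> 2 * \<eta>" using a b by (simp add: n_def)
    then have "cmod u < d" using u \<eta>(1,3) d(1) by linarith
    then have R: "cmod (cub (1 + u) - 1 + 3/2 * u) \<le> \<epsilon> / 6 * cmod u"
      using d(2)[of "1 + u"] by (simp add: cub_def algebra_simps)
    have "(1 + a) * (1 + b) = 1 + u" by (simp add: u_def algebra_simps)
    then have e: "kepler_rem a b = - ((1 + a) * (cub (1 + u) - 1 + 3/2 * u)) + 3/2 * (a * b + a * u)"
      by (simp add: kepler_rem_def att_def cub_def u_def algebra_simps)
    have "cmod ((1 + a) * (cub (1 + u) - 1 + 3/2 * u)) \<le> 3/2 * (\<epsilon> / 6 * (2 * n))"
      unfolding norm_mult
    proof (intro mult_mono)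
      show "cmod (1 + a) \<le> 3/2" using norm_triangle_ineq[of 1 a] a \<eta>(2) by simp
      show "cmod (cub (1 + u) - 1 + 3/2 * u) \<le> \<epsilon> / 6 * (2 * n)"
        using R u assms by (meson order_trans mult_left_mono divide_nonneg_nonneg less_imp_le zero_le_numeral)
    qed auto
    moreover have "cmod (3/2 * (a * b + a * u)) \<le> 3/2 * (\<eta> * n + \<eta> * (2 * n))"
    proof -
      have "cmod (a * u) \<le> \<eta> * (2 * n)"
        unfolding norm_mult using a u \<eta>(1) by (intro mult_mono) auto
      then have "cmod (a * b + a * u) \<le> \<eta> * n + \<eta> * (2 * n)"
        using ab norm_triangle_ineq[of "a * b" "a * u"] by linarith
      then show ?thesis unfolding norm_mult[of "3/2"] by simp
    qed
    ultimately have "cmod (kepler_rem a b) \<le> 3/2 * (\<epsilon> / 6 * (2 * n)) + 3/2 * (\<eta> * n + \<eta> * (2 * n))"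
      unfolding e using norm_triangle_le[of "- ((1 + a) * (cub (1 + u) - 1 + 3/2 * u))"] by fastforce
    also have "\<dots> = \<epsilon> / 2 * n + 9/2 * \<eta> * n" by (simp add: algebra_simps)
    also have "\<dots> \<le> \<epsilon> / 2 * n + \<epsilon> / 2 * n"
      using \<eta>(4) n0 by (intro add_left_mono mult_right_mono) auto
    finally show "cmod (kepler_rem a b) \<le> \<epsilon> * (cmod a + cmod b)" by (simp add: n_def)
  qed
qed

lemma compact_closed_nbhd:
  fixes K :: "'a::euclidean_space set"
  assumes K: "compact K" and U: "open U" "K \<subseteq> U"
  obtains \<delta> where "\<delta> > 0" "(\<Union>x\<in>K. cball x \<delta>) \<subseteq> U" "compact (\<Union>x\<in>K. cball x \<delta>)"
proof -
  obtain \<delta> where \<delta>: "\<delta> > 0" "(\<Union>x\<in>K. cball x \<delta>) \<subseteq> U"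
    using compact_subset_open_imp_cball_epsilon_subset[OF K U] .
  have "(\<Union>x\<in>K. cball x \<delta>) = {x + y | x y. x \<in> K \<and> y \<in> cball 0 \<delta>}"
  proof safe
    fix z x assume "x \<in> K" "z \<in> cball x \<delta>"
    then show "\<exists>xa y. z = xa + y \<and> xa \<in> K \<and> y \<in> cball 0 \<delta>"
      by (intro exI[of _ x] exI[of _ "z - x"]) (auto simp: dist_norm norm_minus_commute)
  next
    fix z x y :: 'a assume "x \<in> K" "y \<in> cball 0 \<delta>"
    then show "x + y \<in> (\<Union>x\<in>K. cball x \<delta>)"
      by (intro UN_I[of x]) (auto simp: dist_norm)
  qed
  then have "compact (\<Union>x\<in>K. cball x \<delta>)" using compact_sums[OF K compact_cball[of 0 \<delta>]] by simp
  with \<delta> show thesis by (rule that)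
qed

lemma continuous_compact_nbhd_bound:
  fixes f :: "'a::euclidean_space \<Rightarrow> 'b::real_normed_vector"
  assumes K: "compact K" and U: "open U" "K \<subseteq> U" and f: "continuous_on U f"
  obtains \<delta> B where "\<delta> > 0" "B > 0" "\<And>k z. k \<in> K \<Longrightarrow> dist k z \<le> \<delta> \<Longrightarrow> z \<in> U \<and> norm (f z) \<le> B"
proof -
  obtain \<delta> where \<delta>: "\<delta> > 0" "(\<Union>x\<in>K. cball x \<delta>) \<subseteq> U" and c: "compact (\<Union>x\<in>K. cball x \<delta>)"
    using compact_closed_nbhd[OF K U] .
  then have "bounded (f ` (\<Union>x\<in>K. cball x \<delta>))"
    using f by (intro compact_imp_bounded compact_continuous_image) (auto intro: continuous_on_subset)
  then obtain B where "B > 0" "\<forall>x\<in>(\<Union>x\<in>K. cball x \<delta>). norm (f x) \<le> B"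
    by (auto simp: bounded_pos)
  then show thesis using \<delta> by (intro that[of \<delta> B]) force+
qed

text \<open>
  Differences of the two planets, seen in the frame rotating with one of them: \<open>\<gamma>\<close> is the ratio of
  the radii, \<open>e\<close> the relative phase and \<open>e'\<close> its conjugate, \<open>a, b\<close> and \<open>c, d\<close> the deviations from the
  circular motions and their conjugates.
\<close>

definition pert :: "complex \<Rightarrow> complex \<Rightarrow> complex \<Rightarrow> complex \<Rightarrow> complex \<Rightarrow> complex \<Rightarrow> complex \<Rightarrow> complex" where
  "pert \<gamma> e e' a b c d = att (\<gamma> * e * (1 + c) - (1 + a)) (\<gamma> * e' * (1 + d) - (1 + b))
     - att (\<gamma> * e * (1 + c)) (\<gamma> * e' * (1 + d))"

text \<open>\<open>mo\<close> is the mass of the planet itself and \<open>mt\<close> that of the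
  other one. The last term is the reaction of the Sun to the planet itself; the reaction of the Sun
  to the other planet is the part subtracted in \<open>pert\<close>.\<close>

definition nonlin ::
  "real \<Rightarrow> real \<Rightarrow> complex \<Rightarrow> complex \<Rightarrow> complex \<Rightarrow> complex \<Rightarrow> complex \<Rightarrow> complex \<Rightarrow> complex \<Rightarrow> complex \<Rightarrow> complex" where
  "nonlin mo mt \<mu> \<gamma> e e' a b c d =
     kepler_rem a b + \<mu> * (of_real mt * pert \<gamma> e e' a b c d - of_real mo * att (1 + a) (1 + b))"

text \<open>At real points the three products are squared distances in units of the orbital radius:
  planet to Sun, planet to planet, other planet to Sun. Positive real part keeps
  \<open>csqrt\<close> on its holomorphic branch.\<close>

definition adm :: "complex \<Rightarrow> complex \<Rightarrow> complex \<Rightarrow> complex \<Rightarrow> complex \<Rightarrow> complex \<Rightarrow> complex \<Rightarrow> bool" where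
  "adm \<gamma> e e' a b c d \<longleftrightarrow> Re ((1 + a) * (1 + b)) > 0 \<and>
     Re ((\<gamma> * e * (1 + c) - (1 + a)) * (\<gamma> * e' * (1 + d) - (1 + b))) > 0 \<and>
     Re ((\<gamma> * e * (1 + c)) * (\<gamma> * e' * (1 + d))) > 0"

text \<open>At the circular motions the three products are \<open>1\<close>, the squared distance
  from \<open>1\<close> to a point of the circle of radius \<open>q\<close>, and
  \<open>q\<^sup>2\<close>; the second is positive because \<open>q \<noteq> 1\<close>. Compactness
  of the circle of phases gives one complex neighbourhood and one bound for all \<theta>.\<close>

lemma adm_bound:
  fixes q :: real
  assumes q: "q > 0" "q \<noteq> 1"
  obtains \<delta> B where "\<delta> > 0" "B > 0"
    "\<And>\<theta> \<gamma> e e' a b c d. cmod (\<gamma> - of_real q) \<le> \<delta> \<Longrightarrow> cmod (e - cis \<theta>) \<le> \<delta> \<Longrightarrow> cmod (e' - cis (- \<theta>)) \<le> \<delta> \<Longrightarrow>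
       cmod a \<le> \<delta> \<Longrightarrow> cmod b \<le> \<delta> \<Longrightarrow> cmod c \<le> \<delta> \<Longrightarrow> cmod d \<le> \<delta> \<Longrightarrow>
       adm \<gamma> e e' a b c d \<and> cmod (att (1 + a) (1 + b)) \<le> B \<and> cmod (pert \<gamma> e e' a b c d) \<le> B"
proof -
  define K where "K = (\<lambda>\<theta>. (complex_of_real q, cis \<theta>, cis (- \<theta>), 0::complex, 0::complex, 0::complex, 0::complex)) ` {0..2*pi}"
  define U where "U = {(\<gamma>, e, e', a, b, c, d). adm \<gamma> e e' a b c d}"
  define f where "f = (\<lambda>(\<gamma>, e, e', a, b, c, d). (att (1 + a) (1 + b), pert \<gamma> e e' a b c d))"
  have K: "compact K" unfolding K_def
    by (intro compact_continuous_image continuous_intros) auto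
  have U: "open U" unfolding U_def adm_def case_prod_unfold
    by (intro open_Collect_conj open_Collect_less continuous_intros)
  have KU: "K \<subseteq> U"
  proof
    fix k assume "k \<in> K"
    then obtain \<theta> where k: "k = (of_real q, cis \<theta>, cis (- \<theta>), 0, 0, 0, 0)" by (auto simp: K_def)
    have ne: "of_real q * cis \<theta> \<noteq> 1"
    proof
      assume "of_real q * cis \<theta> = 1"
      then have "cmod (of_real q * cis \<theta>) = 1" by simp
      then show False using q by (simp add: norm_mult)
    qed
    have e1: "(of_real q * cis \<theta> - 1) * (of_real q * cis (- \<theta>) - 1) = complex_of_real (cmod (of_real q * cis \<theta> - 1) ^ 2)"
      unfolding complex_norm_square by (simp add: cis_cnj)
    have e2: "of_real q * cis \<theta> * (of_real q * cis (- \<theta>)) = complex_of_real (q * q)"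
      by (simp add: cis_mult mult.assoc mult.left_commute)
    show "k \<in> U"
      using ne q
      by (simp only: U_def k adm_def mem_Collect_eq case_prod_conv add_0_right mult_1_right e1 e2 Re_complex_of_real) simp
  qed
  have f: "continuous_on U f"
    unfolding f_def U_def case_prod_unfold pert_def
    by (intro continuous_intros continuous_on_att) (auto simp: adm_def)
  obtain \<delta> B where \<delta>: "\<delta> > 0" "B > 0" "\<And>k z. k \<in> K \<Longrightarrow> dist k z \<le> \<delta> \<Longrightarrow> z \<in> U \<and> norm (f z) \<le> B"
    using continuous_compact_nbhd_bound[OF K U KU f] by blast
  have dp: "dist (x1, y1) (x2, y2) \<le> dist x1 x2 + dist y1 y2"
    for x1 x2 :: "'x::metric_space" and y1 y2 :: "'y::metric_space"
    unfolding dist_Pair_Pair by (intro sqrt_sum_squares_le_sum) auto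
  show thesis
  \<comment> \<open>Seven coordinates, and the product metric is at most the sum of the coordinate
    distances.\<close>
  proof (rule that[of "\<delta> / 7" B])
    fix \<theta> :: real and \<gamma> e e' a b c d :: complex
    assume h: "cmod (\<gamma> - of_real q) \<le> \<delta> / 7" "cmod (e - cis \<theta>) \<le> \<delta> / 7" "cmod (e' - cis (- \<theta>)) \<le> \<delta> / 7"
      "cmod a \<le> \<delta> / 7" "cmod b \<le> \<delta> / 7" "cmod c \<le> \<delta> / 7" "cmod d \<le> \<delta> / 7"
    obtain \<theta>' where \<theta>': "\<theta>' \<in> {0..2*pi}" "cis \<theta>' = cis \<theta>"
    proof -
      define k where "k = \<lfloor>\<theta> / (2*pi)\<rfloor>"
      have "of_int k * (2*pi) \<le> \<theta>" "\<theta> < (of_int k + 1) * (2*pi)"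
        using floor_divide_lower[of "2*pi" \<theta>] floor_divide_upper[of "2*pi" \<theta>] by (auto simp: k_def)
      moreover have "cis (\<theta> - of_int k * (2*pi)) = cis \<theta>"
      proof -
        have "cis (of_int k * (2*pi)) = 1" using cis_multiple_2pi[of "of_int k"] by (simp add: mult_ac)
        then show ?thesis by (simp add: cis_divide[symmetric])
      qed
      ultimately show thesis by (intro that[of "\<theta> - of_int k * (2*pi)"]) (auto simp: algebra_simps)
    qed
    have "cis (- \<theta>') = cis (- \<theta>)" using \<theta>'(2) by (metis cis_cnj)
    then have "(of_real q, cis \<theta>, cis (- \<theta>), 0, 0, 0, 0) \<in> K"
      using \<theta>' unfolding K_def by (metis (no_types, lifting) imageI)
    moreover have "dist (complex_of_real q, cis \<theta>, cis (- \<theta>), 0, 0, 0, 0) (\<gamma>, e, e', a, b, c, d) \<le>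
        \<delta> / 7 + (\<delta> / 7 + (\<delta> / 7 + (\<delta> / 7 + (\<delta> / 7 + (\<delta> / 7 + \<delta> / 7)))))"
      using h
      by (intro order_trans[OF dp add_mono] order_trans[OF dp add_mono])
        (auto simp: dist_norm norm_minus_commute)
    ultimately have "(\<gamma>, e, e', a, b, c, d) \<in> U \<and> norm (f (\<gamma>, e, e', a, b, c, d)) \<le> B"
      using \<delta>(3) by auto
    then show "adm \<gamma> e e' a b c d \<and> cmod (att (1 + a) (1 + b)) \<le> B \<and> cmod (pert \<gamma> e e' a b c d) \<le> B"
      using norm_fst_le[of "att (1 + a) (1 + b)" "pert \<gamma> e e' a b c d"] norm_snd_le[of "pert \<gamma> e e' a b c d" "att (1 + a) (1 + b)"]
      by (auto simp: U_def f_def)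
  qed (use \<delta> in auto)
qed

lemma gholo_nonlin:
  assumes "gholo S \<mu>" "gholo S \<gamma>" "gholo S e" "gholo S e'" "gholo S a" "gholo S b" "gholo S c" "gholo S d"
    and "\<And>x. x \<in> S \<Longrightarrow> adm (\<gamma> x) (e x) (e' x) (a x) (b x) (c x) (d x)"
  shows "gholo S (\<lambda>x. nonlin mo mt (\<mu> x) (\<gamma> x) (e x) (e' x) (a x) (b x) (c x) (d x))"
  using assms(9) unfolding nonlin_def kepler_rem_def pert_def adm_def
  by (intro gholo_add gholo_diff gholo_mult gholo_const gholo_att assms(1-8)) auto

lemma field_differentiable_nonlin:
  assumes "a field_differentiable (at w)" "b field_differentiable (at w)"
     "c field_differentiable (at w)" "d field_differentiable (at w)"
    and "adm \<gamma> e e' (a w) (b w) (c w) (d w)"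
  shows "(\<lambda>w. nonlin mo mt \<mu> \<gamma> e e' (a w) (b w) (c w) (d w)) field_differentiable (at w)"
  using assms(5) unfolding nonlin_def kepler_rem_def pert_def adm_def
  by (intro field_differentiable_add field_differentiable_diff field_differentiable_mult
      field_differentiable_const field_differentiable_att assms(1-4)) auto

lemma cnj_nonlin:
  assumes "adm \<gamma> e e' a b c d"
  shows "cnj (nonlin mo mt \<mu> \<gamma> e e' a b c d) =
    nonlin mo mt (cnj \<mu>) (cnj \<gamma>) (cnj e) (cnj e') (cnj a) (cnj b) (cnj c) (cnj d)"
  using assms unfolding nonlin_def kepler_rem_def pert_def adm_def
  by (simp add: cnj_att)

lemma nonlin_zero [simp]: "nonlin mo mt 0 \<gamma> e e' 0 0 0 0 = 0"
  by (simp add: nonlin_def kepler_rem_def att_def)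

text \<open>A bound on the disc of radius \<open>2\<eta>\<close> controls the derivative on the disc
  of radius \<eta> by Cauchy's inequality, so no derivative of the nonlinearity is ever
  computed.\<close>

lemma Cauchy_Lipschitz:
  assumes f: "\<And>z. cmod z \<le> 2 * \<eta> \<Longrightarrow> f field_differentiable (at z)"
    and M: "\<And>z. cmod z \<le> 2 * \<eta> \<Longrightarrow> cmod (f z) \<le> M"
    and \<eta>: "\<eta> > 0" and z: "cmod z \<le> \<eta>" "cmod z' \<le> \<eta>"
  shows "cmod (f z - f z') \<le> M / \<eta> * cmod (z - z')"
proof (rule field_differentiable_bound[where S = "cball 0 \<eta>" and f' = "deriv f"])
  fix w :: complex assume w: "w \<in> cball 0 \<eta>"
  have sub: "cmod u \<le> 2 * \<eta>" if "u \<in> cball w \<eta>" for u :: complex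
    using that w norm_triangle_ineq[of w "u - w"] by (auto simp: dist_norm norm_minus_commute)
  have wd: "f field_differentiable (at w)" using w \<eta> by (intro f) auto
  show "(f has_field_derivative deriv f w) (at w within cball 0 \<eta>)"
    using wd by (simp add: DERIV_deriv_iff_field_differentiable has_field_derivative_at_within)
  have "cmod ((deriv ^^ 1) f w) \<le> fact 1 * M / \<eta> ^ 1"
  proof (rule Cauchy_inequality)
    show "f holomorphic_on ball w \<eta>"
      unfolding holomorphic_on_def
      by (intro ballI field_differentiable_at_within[OF f[OF sub]]) auto
    show "continuous_on (cball w \<eta>) f"
      using f sub by (intro continuous_at_imp_continuous_on ballI field_differentiable_imp_continuous_at) auto
    show "cmod (f x) \<le> M" if "cmod (w - x) = \<eta>" for x
      using that by (intro M sub) (auto simp: dist_norm)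
  qed (rule \<eta>)
  then show "cmod (deriv f w) \<le> M / \<eta>" by simp
qed (use z in auto)

text \<open>One variable is changed at a time. With \<open>M = \<epsilon>\<eta>\<close> the
  Lipschitz constant is \<open>4\<epsilon>\<close>, independent of \<eta>; this is what lets \<eta>
  be fixed after \<epsilon>.\<close>

lemma nonlin_Lipschitz:
  assumes \<eta>: "\<eta> > 0"
    and adm: "\<And>a b c d. cmod a \<le> 2 * \<eta> \<Longrightarrow> cmod b \<le> 2 * \<eta> \<Longrightarrow> cmod c \<le> 2 * \<eta> \<Longrightarrow> cmod d \<le> 2 * \<eta> \<Longrightarrow>
      adm \<gamma> e e' a b c d \<and> cmod (nonlin mo mt \<mu> \<gamma> e e' a b c d) \<le> M"
    and s: "cmod a \<le> \<eta>" "cmod b \<le> \<eta>" "cmod c \<le> \<eta>" "cmod d \<le> \<eta>"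
      "cmod a' \<le> \<eta>" "cmod b' \<le> \<eta>" "cmod c' \<le> \<eta>" "cmod d' \<le> \<eta>"
    and B: "cmod (a - a') \<le> B" "cmod (b - b') \<le> B" "cmod (c - c') \<le> B" "cmod (d - d') \<le> B"
  shows "cmod (nonlin mo mt \<mu> \<gamma> e e' a b c d - nonlin mo mt \<mu> \<gamma> e e' a' b' c' d') \<le> 4 * (M / \<eta>) * B"
proof -
  let ?N = "nonlin mo mt \<mu> \<gamma> e e'"
  have "cmod (?N 0 0 0 0) \<le> M" using adm[of 0 0 0 0] \<eta> by auto
  then have M0: "0 \<le> M" by (rule order_trans[OF norm_ge_zero])
  have le2: "x \<le> 2 * \<eta>" if "x \<le> \<eta>" for x using that \<eta> by simp
  have fd: "(\<lambda>z. z) field_differentiable F" "(\<lambda>z. k) field_differentiable F" for F :: "complex filter" and k :: complex by simp_all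
  have st: "cmod (f z - f z') \<le> M / \<eta> * B"
    if "cmod (z - z') \<le> B" "\<And>z. cmod z \<le> 2 * \<eta> \<Longrightarrow> f field_differentiable (at z)"
      "\<And>z. cmod z \<le> 2 * \<eta> \<Longrightarrow> cmod (f z) \<le> M" "cmod z \<le> \<eta>" "cmod z' \<le> \<eta>" for f z z'
    using Cauchy_Lipschitz[OF that(2,3) \<eta> that(4,5)] that(1) M0 \<eta>
    by (meson order_trans mult_left_mono divide_nonneg_nonneg less_imp_le)
  have "cmod (?N a b c d - ?N a' b c d) \<le> M / \<eta> * B"
    by (rule st[OF B(1), of "\<lambda>z. ?N z b c d"]) (use s adm le2 in \<open>auto intro!: field_differentiable_nonlin fd\<close>)
  moreover have "cmod (?N a' b c d - ?N a' b' c d) \<le> M / \<eta> * B"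
    by (rule st[OF B(2), of "\<lambda>z. ?N a' z c d"]) (use s adm le2 in \<open>auto intro!: field_differentiable_nonlin fd\<close>)
  moreover have "cmod (?N a' b' c d - ?N a' b' c' d) \<le> M / \<eta> * B"
    by (rule st[OF B(3), of "\<lambda>z. ?N a' b' z d"]) (use s adm le2 in \<open>auto intro!: field_differentiable_nonlin fd\<close>)
  moreover have "cmod (?N a' b' c' d - ?N a' b' c' d') \<le> M / \<eta> * B"
    by (rule st[OF B(4), of "\<lambda>z. ?N a' b' c' z"]) (use s adm le2 in \<open>auto intro!: field_differentiable_nonlin fd\<close>)
  moreover have "?N a b c d - ?N a' b' c' d' = (?N a b c d - ?N a' b c d) + ((?N a' b c d - ?N a' b' c d)
      + ((?N a' b' c d - ?N a' b' c' d) + (?N a' b' c' d - ?N a' b' c' d')))" by simp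
  ultimately have "cmod (?N a b c d - ?N a' b' c' d') \<le> M / \<eta> * B + (M / \<eta> * B + (M / \<eta> * B + M / \<eta> * B))"
    by (metis norm_triangle_mono)
  then show ?thesis by (simp add: mult_ac)
qed

section \<open>The fixed point equation for one planet\<close>

definition realpt :: "pvec \<Rightarrow> bool" where
  "realpt x \<longleftrightarrow> (\<forall>i. Im (x $ i) = 0)"

text \<open>Conjugation symmetry is imposed only at real points and is expressed through the
  reflection of \<tau>. The last clause makes the deviation vanish for \<mu> = 0 at all frequencies,
  whence the unperturbed torus is exactly circular.\<close>

definition admissible_dev :: "pvec set \<Rightarrow> real \<Rightarrow> (pvec \<Rightarrow> complex) \<Rightarrow> bool" where
  "admissible_dev S \<eta> f \<longleftrightarrow> gholo S f \<and> (\<forall>x\<in>S. cmod (f x) \<le> \<eta>) \<and>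
     (\<forall>x\<in>S. f (tshift x (2*pi)) = f x) \<and>
     (\<forall>x\<in>S. realpt x \<longrightarrow> cnj (f x) = f (treflect x)) \<and>
     (\<forall>x\<in>S. x $ Mu = 0 \<longrightarrow> f x = 0)"

lemma admissible_dev_limit:
  assumes S: "open S" "tinvariant S" and F: "\<And>n. admissible_dev S \<eta> (F n)"
    and lim: "uniform_limit S F f sequentially"
  shows "admissible_dev S \<eta> f"
proof -
  have pt: "(\<lambda>n. F n x) \<longlonglongrightarrow> f x" if "x \<in> S" for x
    using tendsto_uniform_limitI[OF lim that] .
  have inS: "tshift x t \<in> S" "treflect x \<in> S" if "x \<in> S" for x t
    using S(2) that by (auto simp: tinvariant_def)
  show ?thesis
    unfolding admissible_dev_def
  proof (intro conjI ballI impI)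
    show "gholo S f"
      by (rule gholo_uniform_limit[OF S(1) _ lim]) (use F in \<open>auto simp: admissible_dev_def\<close>)
    fix x assume x: "x \<in> S"
    show "cmod (f x) \<le> \<eta>"
      by (rule tendsto_upperbound[OF tendsto_norm[OF pt[OF x]]]) (use F x in \<open>auto simp: admissible_dev_def\<close>)
    have "(\<lambda>n. F n (tshift x (2*pi))) = (\<lambda>n. F n x)" using F x by (auto simp: admissible_dev_def)
    then show "f (tshift x (2*pi)) = f x"
      using pt[OF inS(1)[OF x], of "2*pi"] pt[OF x] LIMSEQ_unique by metis
    show "cnj (f x) = f (treflect x)" if "realpt x"
    proof -
      have "(\<lambda>n. F n (treflect x)) = (\<lambda>n. cnj (F n x))"
        using F x that by (auto simp: admissible_dev_def)
      then show ?thesis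
        using pt[OF inS(2)[OF x]] tendsto_cnj[OF pt[OF x]] LIMSEQ_unique by metis
    qed
    show "f x = 0" if "x $ Mu = 0"
    proof -
      have "(\<lambda>n. F n x) = (\<lambda>n. 0)" using F x that by (auto simp: admissible_dev_def)
      then show ?thesis using pt[OF x] LIMSEQ_unique tendsto_const by metis
    qed
  qed
qed

text \<open>One locale for both planets: for the second, \<gamma> is inverted and \<open>e\<close>,
  \<open>e'\<close> are exchanged. The constant \<open>1/16\<close> is calibrated to the Lipschitz
  constant \<open>4\<epsilon>\<close> of the nonlinearity: \<open>step\<close> then contracts by
  \<open>1/4\<close>, and the pair of planets, whose norm is at most the sum of the two, by
  \<open>1/2\<close>.\<close>

locale planet =
  fixes S :: "pvec set" and \<kappa> \<gamma> e e' :: "pvec \<Rightarrow> complex" and mo mt \<eta> \<epsilon> k k' A :: real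
  assumes S: "open S" "tinvariant S"
    and \<eta>: "\<eta> > 0"
    and gholo_coeff: "gholo S \<kappa>" "gholo S \<gamma>" "gholo S e" "gholo S e'"
    and \<kappa>_shift: "\<And>x t. \<kappa> (tshift x t) = \<kappa> x"
    and \<gamma>_shift: "\<And>x t. \<gamma> (tshift x t) = \<gamma> x"
    and \<kappa>_reflect: "\<And>x. \<kappa> (treflect x) = \<kappa> x"
    and \<gamma>_reflect: "\<And>x. \<gamma> (treflect x) = \<gamma> x"
    and e_periodic: "\<And>x. e (tshift x (2*pi)) = e x" "\<And>x. e' (tshift x (2*pi)) = e' x"
    and e_reflect: "\<And>x. e (treflect x) = e' x" "\<And>x. e' (treflect x) = e x"
    and real_coeff: "\<And>x. realpt x \<Longrightarrow> x \<in> S \<Longrightarrow> cnj (\<kappa> x) = \<kappa> x \<and> cnj (\<gamma> x) = \<gamma> x \<and> cnj (e x) = e' x"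
    and \<kappa>: "\<And>x. x \<in> S \<Longrightarrow> \<kappa> x \<noteq> 0" "\<And>x. x \<in> S \<Longrightarrow> sin (\<kappa> x * of_real pi) \<noteq> 0"
    and \<kappa>_bound: "\<And>x. x \<in> S \<Longrightarrow> cmod (\<kappa> x) \<le> k" "\<And>x. x \<in> S \<Longrightarrow> cmod (inverse (\<kappa> x)) \<le> k'"
      "\<And>x \<sigma>. x \<in> S \<Longrightarrow> \<sigma> \<in> {0..2*pi} \<Longrightarrow> cmod (osc_kernel (\<kappa> x) \<sigma>) \<le> A"
    and N_bound: "\<And>x a b c d. x \<in> S \<Longrightarrow> cmod a \<le> 2 * \<eta> \<Longrightarrow> cmod b \<le> 2 * \<eta> \<Longrightarrow> cmod c \<le> 2 * \<eta> \<Longrightarrow> cmod d \<le> 2 * \<eta> \<Longrightarrow>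
      adm (\<gamma> x) (e x) (e' x) a b c d \<and> cmod (nonlin mo mt (x $ Mu) (\<gamma> x) (e x) (e' x) a b c d) \<le> \<epsilon> * \<eta>"
    and small: "lin_bound k k' A * (k\<^sup>2 * \<epsilon>) \<le> 1/16" "\<epsilon> > 0" "k \<ge> 0" "k' \<ge> 0" "A \<ge> 0"
begin

text \<open>Where the equation of motion has a conjugate, the value at the reflected point is taken;
  this keeps the source holomorphic.\<close>

definition src :: "(pvec \<Rightarrow> complex) \<Rightarrow> (pvec \<Rightarrow> complex) \<Rightarrow> pvec \<Rightarrow> complex" where
  "src f g x = \<kappa> x ^ 2 * nonlin mo mt (x $ Mu) (\<gamma> x) (e x) (e' x) (f x) (f (treflect x)) (g x) (g (treflect x))"

definition step :: "(pvec \<Rightarrow> complex) \<Rightarrow> (pvec \<Rightarrow> complex) \<Rightarrow> pvec \<Rightarrow> complex" where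
  "step f g = lin_op \<kappa> (src f g)"

lemma inS: "x \<in> S \<Longrightarrow> tshift x t \<in> S" "x \<in> S \<Longrightarrow> treflect x \<in> S"
  using S(2) by (auto simp: tinvariant_def)

lemma periodic_back:
  assumes "admissible_dev S \<eta> f" "x \<in> S"
  shows "f (tshift x (- (2*pi))) = f x"
  using assms(1) inS(1)[OF assms(2), of "- (2*pi)"] unfolding admissible_dev_def
  by (metis add.left_inverse tshift_0 tshift_tshift)

context
  fixes f g assumes f: "admissible_dev S \<eta> f" and g: "admissible_dev S \<eta> g"
begin

lemma dev_le: "x \<in> S \<Longrightarrow> cmod (f x) \<le> \<eta>" "x \<in> S \<Longrightarrow> cmod (f (treflect x)) \<le> \<eta>"
    "x \<in> S \<Longrightarrow> cmod (g x) \<le> \<eta>" "x \<in> S \<Longrightarrow> cmod (g (treflect x)) \<le> \<eta>"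
  using f g inS by (auto simp: admissible_dev_def)

lemma dev_le2: "x \<in> S \<Longrightarrow> cmod (f x) \<le> 2 * \<eta>" "x \<in> S \<Longrightarrow> cmod (f (treflect x)) \<le> 2 * \<eta>"
    "x \<in> S \<Longrightarrow> cmod (g x) \<le> 2 * \<eta>" "x \<in> S \<Longrightarrow> cmod (g (treflect x)) \<le> 2 * \<eta>"
  using dev_le[of x] \<eta> by auto

lemma adm_dev: "x \<in> S \<Longrightarrow> adm (\<gamma> x) (e x) (e' x) (f x) (f (treflect x)) (g x) (g (treflect x))"
  using N_bound dev_le2 by blast

lemma gholo_src: "gholo S (src f g)"
proof -
  have "gholo S f" "gholo S g" using f g by (auto simp: admissible_dev_def)
  then show ?thesis
    unfolding src_def[abs_def]
    using gholo_treflect[OF S(2)] gholo_coeff adm_dev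
    by (intro gholo_mult gholo_power gholo_nonlin) auto
qed

lemma norm_src_le: "x \<in> S \<Longrightarrow> cmod (src f g x) \<le> k\<^sup>2 * (\<epsilon> * \<eta>)"
  unfolding src_def norm_mult norm_power
  using N_bound dev_le2 \<kappa>_bound(1) small by (intro mult_mono power_mono) auto

lemma src_periodic:
  assumes x: "x \<in> S" shows "src f g (tshift x (2*pi)) = src f g x"
proof -
  have per: "h (tshift x (2*pi)) = h x" "h (treflect (tshift x (2*pi))) = h (treflect x)"
    if "admissible_dev S \<eta> h" for h
    using that x periodic_back[OF that inS(2)[OF x]]
    by (auto simp: admissible_dev_def treflect_tshift)
  show ?thesis
    unfolding src_def by (simp add: \<kappa>_shift \<gamma>_shift e_periodic per[OF f] per[OF g])
qed

lemma src_cnj: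
  assumes x: "x \<in> S" "realpt x" shows "cnj (src f g x) = src f g (treflect x)"
proof -
  have rr: "realpt (treflect x)" using x(2) by (simp add: realpt_def treflect_def)
  have c: "cnj (h x) = h (treflect x)" "cnj (h (treflect x)) = h x" if "admissible_dev S \<eta> h" for h
    using that x rr inS(2)[OF x(1)] by (auto simp: admissible_dev_def)
  have "cnj (x $ Mu) = x $ Mu" using x(2) by (simp add: realpt_def complex_eq_iff)
  moreover have "cnj (e' x) = e x" using real_coeff[OF x(2,1)] by (metis complex_cnj_cnj)
  ultimately show ?thesis
    unfolding src_def using cnj_nonlin[OF adm_dev[OF x(1)]] real_coeff[OF x(2,1)]
    by (simp add: c[OF f] c[OF g] \<kappa>_reflect \<gamma>_reflect e_reflect)
qed

text \<open>On a line starting at \<tau> = 0 the reflection is \<open>t \<mapsto> - t\<close>, so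
  \<open>step\<close> is literally \<open>lin_sol\<close> applied to a source and its time
  reversal.\<close>

lemma step_line:
  assumes x0: "x0 \<in> S" "x0 $ Tau = 0"
  defines "s \<equiv> (\<lambda>t. src f g (tshift x0 t))"
  shows "step f g (tshift x0 t) = lin_sol (\<kappa> x0) s (\<lambda>t. s (- t)) t"
    and "continuous_on UNIV s" and "\<And>t. s (t + 2*pi) = s t"
proof -
  have "treflect x0 = x0" using x0(2) by (auto simp: vec_eq_iff treflect_def)
  then show "step f g (tshift x0 t) = lin_sol (\<kappa> x0) s (\<lambda>t. s (- t)) t"
    unfolding step_def s_def using lin_op_line[of \<kappa> x0 "src f g" t] \<kappa>_shift
    by (simp add: treflect_tshift)
  show "continuous_on UNIV s"
    unfolding s_def by (rule continuous_on_line[OF S(2) gholo_imp_continuous_on[OF gholo_src] x0(1)])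
  show "s (t + 2*pi) = s t" for t
    unfolding s_def using src_periodic[OF inS(1)[OF x0(1)], of t] by simp
qed

lemma admissible_step: "admissible_dev S \<eta> (step f g)"
  unfolding admissible_dev_def
proof (intro conjI ballI impI)
  show "gholo S (step f g)"
    unfolding step_def by (rule gholo_lin_op[OF S gholo_src gholo_coeff(1) \<kappa> \<kappa>_shift])
  fix x assume x: "x \<in> S"
  have "cmod (lin_op \<kappa> (src f g) x - lin_op \<kappa> (\<lambda>x. 0) x) \<le> lin_bound k k' A * (k\<^sup>2 * (\<epsilon> * \<eta>))"
    by (rule norm_lin_op_diff_le[OF S(2) gholo_imp_continuous_on[OF gholo_src] _ x])
      (use norm_src_le \<kappa>_bound x in auto)
  also have "\<dots> = lin_bound k k' A * (k\<^sup>2 * \<epsilon>) * \<eta>" by simp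
  also have "\<dots> \<le> 1/16 * \<eta>" using small(1) \<eta> by (intro mult_right_mono) auto
  finally show "cmod (step f g x) \<le> \<eta>" using \<eta> by (simp add: step_def)
  have "src f g (tshift (tshift x (2*pi)) t) = src f g (tshift x t)" for t
    using src_periodic[OF inS(1)[OF x, of t]] by (simp add: add.commute)
  moreover have "src f g (treflect (tshift (tshift x (2*pi)) t)) = src f g (treflect (tshift x t))" for t
    using src_periodic[OF inS(1)[OF inS(2)[OF x], of "- (2*pi) - t"]] by (simp add: treflect_tshift)
  ultimately show "step f g (tshift x (2*pi)) = step f g x"
    unfolding step_def lin_op_def by (simp add: \<kappa>_shift)
  show "step f g x = 0" if "x $ Mu = 0"
  proof -
    have "src f g y = 0" if y: "y \<in> S" "y $ Mu = 0" for y
      using f g y inS(2)[OF y(1)] by (simp add: src_def admissible_dev_def)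
    then have "src f g (tshift x t) = 0" "src f g (treflect (tshift x t)) = 0" for t
      using that x inS by auto
    then show ?thesis unfolding step_def lin_op_def by simp
  qed
  show "cnj (step f g x) = step f g (treflect x)" if r: "realpt x"
  proof -
    \<comment> \<open>The point with \<tau> = 0 on the same line; a real point differs from it by a
      real shift, and the symmetry of \<open>lin_sol\<close> is about time zero.\<close>
    define x0 where "x0 = tshift x (- Re (x $ Tau))"
    define s where "s = (\<lambda>t. src f g (tshift x0 t))"
    have xt: "x = tshift x0 (Re (x $ Tau))" by (simp add: x0_def)
    have t0: "x0 $ Tau = 0"
      using r by (simp add: x0_def realpt_def complex_eq_iff)
    have x0: "x0 \<in> S" unfolding x0_def by (rule inS(1)[OF x])
    have rl: "realpt (tshift x0 t)" for t
      using r by (simp add: x0_def realpt_def tshift_def axis_def)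
    have refl: "treflect (tshift x0 t) = tshift x0 (- t)" for t
      using t0 by (auto simp: vec_eq_iff treflect_def tshift_def axis_def)
    have "cnj (s t) = s (- t)" for t
      unfolding s_def using src_cnj[OF inS(1)[OF x0] rl] by (simp add: refl)
    moreover have "cnj (\<kappa> x0) = \<kappa> x0" using real_coeff[OF rl[of 0]] x0 by simp
    ultimately have "cnj (lin_sol (\<kappa> x0) s (\<lambda>t. s (- t)) t) = lin_sol (\<kappa> x0) s (\<lambda>t. s (- t)) (- t)" for t
      using lin_sol_cnj[OF step_line(2,3)[OF x0 t0] \<kappa>(1)[OF x0] \<kappa>(2)[OF x0]]
      unfolding s_def by blast
    then have "cnj (step f g (tshift x0 t)) = step f g (tshift x0 (- t))" for t
      unfolding s_def using step_line(1)[OF x0 t0] by simp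
    then have "cnj (step f g (tshift x0 t)) = step f g (treflect (tshift x0 t))" for t
      by (simp add: refl)
    then show ?thesis using xt by metis
  qed
qed

end

lemma step_contraction:
  assumes "admissible_dev S \<eta> f" "admissible_dev S \<eta> g" "admissible_dev S \<eta> f2" "admissible_dev S \<eta> g2"
    and B: "\<And>x. x \<in> S \<Longrightarrow> cmod (f x - f2 x) \<le> B" "\<And>x. x \<in> S \<Longrightarrow> cmod (g x - g2 x) \<le> B" and x: "x \<in> S"
  shows "cmod (step f g x - step f2 g2 x) \<le> B / 4"
proof -
  have B0: "0 \<le> B" using order_trans[OF norm_ge_zero B(1)[OF x]] .
  have "cmod (src f g y - src f2 g2 y) \<le> k\<^sup>2 * (4 * \<epsilon> * B)" if y: "y \<in> S" for y
  proof -
    have "cmod (nonlin mo mt (y $ Mu) (\<gamma> y) (e y) (e' y) (f y) (f (treflect y)) (g y) (g (treflect y)) -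
       nonlin mo mt (y $ Mu) (\<gamma> y) (e y) (e' y) (f2 y) (f2 (treflect y)) (g2 y) (g2 (treflect y))) \<le> 4 * (\<epsilon> * \<eta> / \<eta>) * B"
      by (rule nonlin_Lipschitz[OF \<eta> N_bound[OF y]])
        (use dev_le[OF assms(1,2) y] dev_le[OF assms(3,4) y] B y inS in auto)
    then have *: "cmod (nonlin mo mt (y $ Mu) (\<gamma> y) (e y) (e' y) (f y) (f (treflect y)) (g y) (g (treflect y)) -
       nonlin mo mt (y $ Mu) (\<gamma> y) (e y) (e' y) (f2 y) (f2 (treflect y)) (g2 y) (g2 (treflect y))) \<le> 4 * \<epsilon> * B"
      using \<eta> by simp
    show ?thesis
      unfolding src_def right_diff_distrib[symmetric] norm_mult norm_power
      using * \<kappa>_bound(1)[OF y] small(3) by (intro mult_mono power_mono) auto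
  qed
  then have "cmod (lin_op \<kappa> (src f g) x - lin_op \<kappa> (src f2 g2) x) \<le> lin_bound k k' A * (k\<^sup>2 * (4 * \<epsilon> * B))"
    using \<kappa>_bound x gholo_src assms(1-4)
    by (intro norm_lin_op_diff_le[OF S(2)] gholo_imp_continuous_on) auto
  also have "\<dots> = lin_bound k k' A * (k\<^sup>2 * \<epsilon>) * (4 * B)" by (simp add: mult_ac)
  also have "\<dots> \<le> 1/16 * (4 * B)" using small(1) B0 by (intro mult_right_mono) auto
  finally show ?thesis by (simp add: step_def)
qed

end

lemma two_planet_fixed_point:
  assumes "planet S \<kappa>1 \<gamma>1 e1 e1' m1 m2 \<eta> \<epsilon>1 k1 k1' A1" "planet S \<kappa>2 \<gamma>2 e2 e2' m2 m1 \<eta> \<epsilon>2 k2 k2' A2"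
  shows "\<exists>f g. admissible_dev S \<eta> f \<and> admissible_dev S \<eta> g \<and>
    (\<forall>x\<in>S. f x = planet.step \<kappa>1 \<gamma>1 e1 e1' m1 m2 f g x \<and> g x = planet.step \<kappa>2 \<gamma>2 e2 e2' m2 m1 g f x)"
proof -
  interpret p1: planet S \<kappa>1 \<gamma>1 e1 e1' m1 m2 \<eta> \<epsilon>1 k1 k1' A1 by fact
  interpret p2: planet S \<kappa>2 \<gamma>2 e2 e2' m2 m1 \<eta> \<epsilon>2 k2 k2' A2 by fact
  define C where "C = {w. admissible_dev S \<eta> (\<lambda>x. fst (w x)) \<and> admissible_dev S \<eta> (\<lambda>x. snd (w x :: complex \<times> complex))}"
  define T where "T = (\<lambda>w x. (p1.step (\<lambda>x. fst (w x)) (\<lambda>x. snd (w x)) x, p2.step (\<lambda>x. snd (w x)) (\<lambda>x. fst (w x)) x))"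
  have pair_le: "norm z \<le> cmod (fst z) + cmod (snd z)" for z :: "complex \<times> complex"
    unfolding norm_prod_def by (rule sqrt_sum_squares_le_sum) auto
  have norm_le: "cmod (fst z) \<le> norm z" "cmod (snd z) \<le> norm z" for z :: "complex \<times> complex"
    by (metis norm_fst_le prod.collapse) (metis norm_snd_le prod.collapse)
  have "\<exists>w\<in>C. \<forall>x\<in>S. T w x = w x"
  proof (rule uniform_contraction_fixed_point[where M = "2 * \<eta>" and start = "\<lambda>x. 0"])
    show "(\<lambda>x. 0) \<in> C" using p1.\<eta> by (auto simp: C_def admissible_dev_def)
    show "T f \<in> C" if "f \<in> C" for f
      using that p1.admissible_step p2.admissible_step by (auto simp: C_def T_def)
    show "norm (f x) \<le> 2 * \<eta>" if "f \<in> C" "x \<in> S" for f x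
      using pair_le[of "f x"] that by (force simp: C_def admissible_dev_def)
    show "norm (T f x - T g x) \<le> B / 2"
      if fg: "f \<in> C" "g \<in> C" and B: "\<And>x. x \<in> S \<Longrightarrow> norm (f x - g x) \<le> B" and x: "x \<in> S" for f g B x
    proof -
      have B': "cmod (fst (f y) - fst (g y)) \<le> B" "cmod (snd (f y) - snd (g y)) \<le> B" if "y \<in> S" for y
        using B[OF that] norm_le[of "f y - g y"] by auto
      have "cmod (fst (T f x - T g x)) \<le> B / 4"
        using p1.step_contraction[of "\<lambda>x. fst (f x)" "\<lambda>x. snd (f x)" "\<lambda>x. fst (g x)" "\<lambda>x. snd (g x)" B x] fg B' x
        unfolding T_def C_def by simp
      moreover have "cmod (snd (T f x - T g x)) \<le> B / 4"
        using p2.step_contraction[of "\<lambda>x. snd (f x)" "\<lambda>x. fst (f x)" "\<lambda>x. snd (g x)" "\<lambda>x. fst (g x)" B x] fg B' x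
        unfolding T_def C_def by simp
      ultimately show ?thesis using pair_le[of "T f x - T g x"] by simp
    qed
    show "f \<in> C" if F: "\<And>n::nat. F n \<in> C" and lim: "uniform_limit S F f sequentially" for F f
    proof -
      have ul: "uniform_limit S (\<lambda>n x. fst (F n x)) (\<lambda>x. fst (f x)) sequentially"
        "uniform_limit S (\<lambda>n x. snd (F n x)) (\<lambda>x. snd (f x)) sequentially"
        using bounded_linear.uniform_limit[OF bounded_linear_fst lim]
          bounded_linear.uniform_limit[OF bounded_linear_snd lim] by auto
      have FC: "admissible_dev S \<eta> (\<lambda>x. fst (F n x))" "admissible_dev S \<eta> (\<lambda>x. snd (F n x))" for n
        using F[of n] by (auto simp: C_def)
      show ?thesis
        using admissible_dev_limit[OF p1.S FC(1) ul(1)] admissible_dev_limit[OF p1.S FC(2) ul(2)]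
        by (simp add: C_def)
    qed
  qed
  then obtain w where "w \<in> C" "\<And>x. x \<in> S \<Longrightarrow> T w x = w x" by blast
  then show ?thesis
    unfolding C_def T_def
    by (intro exI[of _ "\<lambda>x. fst (w x)"] exI[of _ "\<lambda>x. snd (w x)"]) (metis (mono_tags, lifting) fst_conv mem_Collect_eq snd_conv)
qed

section \<open>Solutions near the circular motions\<close>

definition nu :: "pvec \<Rightarrow> complex" where "nu x = x $ V2 - x $ V1"
definition kap1 :: "pvec \<Rightarrow> complex" where "kap1 x = x $ V1 / nu x"
definition kap2 :: "pvec \<Rightarrow> complex" where "kap2 x = x $ V2 / nu x"
text \<open>Kepler's third law: a continuation of \<open>\<bar>z\<bar> powr (-2/3)\<close> to
  complex frequencies. Squaring before the logarithm treats both senses of revolution alike.\<close>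

definition rad :: "complex \<Rightarrow> complex" where "rad z = exp (- (Ln (z\<^sup>2) / 3))"
definition gam :: "pvec \<Rightarrow> complex" where "gam x = rad (x $ V2) / rad (x $ V1)"
definition ex :: "pvec \<Rightarrow> complex" where "ex x = exp (\<i> * x $ Tau)"
definition ex' :: "pvec \<Rightarrow> complex" where "ex' x = exp (- (\<i> * x $ Tau))"

lemma rad_nonzero [simp]: "rad z \<noteq> 0" by (simp add: rad_def)

lemma rad_of_real:
  assumes "v \<noteq> 0" shows "rad (of_real v) = of_real (\<bar>v\<bar> powr (-2/3))"
proof -
  have "Ln ((of_real v)\<^sup>2) = of_real (ln (v\<^sup>2))"
    using assms by (simp add: Ln_of_real flip: of_real_power)
  also have "ln (v\<^sup>2) = 2 * ln \<bar>v\<bar>"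
    using assms by (metis ln_realpow abs_ge_zero of_nat_numeral power2_abs zero_less_abs_iff)
  finally have "rad (of_real v) = exp (of_real (- (2 * ln \<bar>v\<bar>) / 3))"
    by (simp add: rad_def)
  also have "\<dots> = of_real (exp (- (2 * ln \<bar>v\<bar>) / 3))" by (rule exp_of_real)
  also have "exp (- (2 * ln \<bar>v\<bar>) / 3) = \<bar>v\<bar> powr (-2/3)"
    using assms by (simp add: powr_def mult.commute)
  finally show ?thesis .
qed

lemma rad_cube:
  assumes "v \<noteq> 0" shows "rad (of_real v) ^ 3 * of_real v ^ 2 = 1"
proof -
  have "rad (of_real v) ^ 3 = exp (- Ln ((of_real v)\<^sup>2))"
    by (simp add: rad_def exp_of_nat_mult[symmetric])
  also have "\<dots> = inverse ((of_real v)\<^sup>2)" using assms by (simp add: exp_minus)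
  finally show ?thesis using assms by simp
qed

text \<open>\<delta> and \<open>B\<close> come before \<epsilon>, since they depend only on the
  circular configuration; then \<eta> is restricted by \<epsilon>, and \<mu> by both. Half of
  \<open>\<epsilon>\<eta>\<close> is spent on the Kepler remainder, which is of higher order in the
  deviations, and half on the term with \<mu>.\<close>

lemma nonlin_bound:
  fixes q :: real
  assumes q: "q > 0" "q \<noteq> 1"
  obtains \<delta> B where "\<delta> > 0" "B > 0"
    "\<And>\<epsilon>. \<epsilon> > 0 \<Longrightarrow> \<exists>\<eta>0>0. \<forall>\<eta>. 0 < \<eta> \<longrightarrow> \<eta> \<le> \<eta>0 \<longrightarrow> (\<forall>\<mu> \<theta> \<gamma> e e' a b c d.
       cmod \<mu> * ((\<bar>mt\<bar> + \<bar>mo\<bar>) * B) \<le> \<epsilon> * \<eta> / 2 \<longrightarrow>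
       cmod (\<gamma> - of_real q) \<le> \<delta> \<longrightarrow> cmod (e - cis \<theta>) \<le> \<delta> \<longrightarrow> cmod (e' - cis (- \<theta>)) \<le> \<delta> \<longrightarrow>
       cmod a \<le> 2 * \<eta> \<longrightarrow> cmod b \<le> 2 * \<eta> \<longrightarrow> cmod c \<le> 2 * \<eta> \<longrightarrow> cmod d \<le> 2 * \<eta> \<longrightarrow>
       adm \<gamma> e e' a b c d \<and> cmod (nonlin mo mt \<mu> \<gamma> e e' a b c d) \<le> \<epsilon> * \<eta>)"
proof -
  obtain \<delta> B where \<delta>: "\<delta> > 0" "B > 0"
    and adm: "\<And>\<theta> \<gamma> e e' a b c d. cmod (\<gamma> - of_real q) \<le> \<delta> \<Longrightarrow> cmod (e - cis \<theta>) \<le> \<delta> \<Longrightarrow> cmod (e' - cis (- \<theta>)) \<le> \<delta> \<Longrightarrow>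
       cmod a \<le> \<delta> \<Longrightarrow> cmod b \<le> \<delta> \<Longrightarrow> cmod c \<le> \<delta> \<Longrightarrow> cmod d \<le> \<delta> \<Longrightarrow>
       adm \<gamma> e e' a b c d \<and> cmod (att (1 + a) (1 + b)) \<le> B \<and> cmod (pert \<gamma> e e' a b c d) \<le> B"
    using adm_bound[OF q] by blast
  show thesis
  proof (rule that[OF \<delta>])
    fix \<epsilon> :: real assume \<epsilon>: "\<epsilon> > 0"
    then have "\<epsilon> / 8 > 0" by simp
    then obtain \<eta>1 where \<eta>1: "\<eta>1 > 0" and K: "\<And>a b. cmod a \<le> \<eta>1 \<Longrightarrow> cmod b \<le> \<eta>1 \<Longrightarrow> cmod (kepler_rem a b) \<le> \<epsilon> / 8 * (cmod a + cmod b)"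
      using kepler_rem_small by blast
    show "\<exists>\<eta>0>0. \<forall>\<eta>. 0 < \<eta> \<longrightarrow> \<eta> \<le> \<eta>0 \<longrightarrow> (\<forall>\<mu> \<theta> \<gamma> e e' a b c d.
       cmod \<mu> * ((\<bar>mt\<bar> + \<bar>mo\<bar>) * B) \<le> \<epsilon> * \<eta> / 2 \<longrightarrow>
       cmod (\<gamma> - of_real q) \<le> \<delta> \<longrightarrow> cmod (e - cis \<theta>) \<le> \<delta> \<longrightarrow> cmod (e' - cis (- \<theta>)) \<le> \<delta> \<longrightarrow>
       cmod a \<le> 2 * \<eta> \<longrightarrow> cmod b \<le> 2 * \<eta> \<longrightarrow> cmod c \<le> 2 * \<eta> \<longrightarrow> cmod d \<le> 2 * \<eta> \<longrightarrow>
       adm \<gamma> e e' a b c d \<and> cmod (nonlin mo mt \<mu> \<gamma> e e' a b c d) \<le> \<epsilon> * \<eta>)"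
    proof (intro exI[of _ "min \<eta>1 \<delta> / 2"] conjI allI impI)
      show "min \<eta>1 \<delta> / 2 > 0" using \<eta>1 \<delta> by simp
      fix \<eta> \<theta> :: real and \<mu> \<gamma> e e' a b c d :: complex
      assume \<eta>: "0 < \<eta>" "\<eta> \<le> min \<eta>1 \<delta> / 2" and \<mu>: "cmod \<mu> * ((\<bar>mt\<bar> + \<bar>mo\<bar>) * B) \<le> \<epsilon> * \<eta> / 2"
        and g: "cmod (\<gamma> - of_real q) \<le> \<delta>" "cmod (e - cis \<theta>) \<le> \<delta>" "cmod (e' - cis (- \<theta>)) \<le> \<delta>"
        and s: "cmod a \<le> 2 * \<eta>" "cmod b \<le> 2 * \<eta>" "cmod c \<le> 2 * \<eta>" "cmod d \<le> 2 * \<eta>"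
      have s\<delta>: "cmod a \<le> \<delta>" "cmod b \<le> \<delta>" "cmod c \<le> \<delta>" "cmod d \<le> \<delta>" "cmod a \<le> \<eta>1" "cmod b \<le> \<eta>1"
        using s \<eta> by auto
      note A = adm[OF g s\<delta>(1-4)]
      then show "adm \<gamma> e e' a b c d" by simp
      have "cmod (kepler_rem a b) \<le> \<epsilon> / 8 * (cmod a + cmod b)" by (rule K[OF s\<delta>(5,6)])
      also have "\<dots> \<le> \<epsilon> / 8 * (4 * \<eta>)" using s \<epsilon> by (intro mult_left_mono) auto
      finally have 1: "cmod (kepler_rem a b) \<le> \<epsilon> * \<eta> / 2" by simp
      have "cmod (of_real mt * pert \<gamma> e e' a b c d - of_real mo * att (1 + a) (1 + b)) \<le> \<bar>mt\<bar> * B + \<bar>mo\<bar> * B"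
        by (rule order_trans[OF norm_triangle_ineq4]) (use A in \<open>auto simp: norm_mult intro!: add_mono mult_left_mono\<close>)
      then have "cmod (\<mu> * (of_real mt * pert \<gamma> e e' a b c d - of_real mo * att (1 + a) (1 + b))) \<le> cmod \<mu> * ((\<bar>mt\<bar> + \<bar>mo\<bar>) * B)"
        unfolding norm_mult[of \<mu>] by (intro mult_left_mono) (auto simp: algebra_simps)
      then show "cmod (nonlin mo mt \<mu> \<gamma> e e' a b c d) \<le> \<epsilon> * \<eta>"
        unfolding nonlin_def using 1 \<mu> norm_triangle_ineq[of "kepler_rem a b" "\<mu> * (of_real mt * pert \<gamma> e e' a b c d - of_real mo * att (1 + a) (1 + b))"]
        by linarith
    qed
  qed
qed

lemma eventually_norm_le:
  assumes "isCont f p" shows "\<forall>\<^sub>F z in nhds p. norm (f z) \<le> norm (f p) + 1"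
proof -
  have "((\<lambda>z. norm (f z)) \<longlongrightarrow> norm (f p)) (nhds p)"
    using assms by (intro tendsto_norm) (simp add: isCont_def tendsto_at_iff_tendsto_nhds)
  then have "\<forall>\<^sub>F z in nhds p. norm (f z) < norm (f p) + 1"
    by (rule order_tendstoD) simp
  then show ?thesis by eventually_elim simp
qed

lemma eventually_close:
  assumes "isCont f p" "\<delta> > 0" shows "\<forall>\<^sub>F z in nhds p. dist (f z) (f p) \<le> \<delta>"
proof -
  have "(f \<longlongrightarrow> f p) (nhds p)"
    using assms by (simp add: isCont_def tendsto_at_iff_tendsto_nhds)
  from tendstoD[OF this assms(2)] show ?thesis by eventually_elim simp
qed

lemma eventually_nonzero:
  fixes f :: "'a::t2_space \<Rightarrow> complex"
  assumes "isCont f p" "f p \<noteq> 0" shows "\<forall>\<^sub>F z in nhds p. f z \<noteq> 0"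
  using assms by (intro tendsto_imp_eventually_ne[of f "f p"]) (simp_all add: isCont_def tendsto_at_iff_tendsto_nhds)

lemma eventually_pos:
  fixes f :: "'a::t2_space \<Rightarrow> real"
  assumes "isCont f p" "f p > 0" shows "\<forall>\<^sub>F z in nhds p. f z > 0"
proof -
  have "(f \<longlongrightarrow> f p) (nhds p)"
    using assms by (simp add: isCont_def tendsto_at_iff_tendsto_nhds)
  from order_tendstoD(1)[OF this assms(2)] show ?thesis .
qed

lemma sin_real_pi_nonzero:
  assumes "\<And>n::int. x \<noteq> of_int n" shows "sin (complex_of_real x * of_real pi) \<noteq> 0"
proof
  assume "sin (complex_of_real x * of_real pi) = 0"
  then obtain n :: int where "complex_of_real x * of_real pi = of_real (n * pi)" unfolding sin_eq_0 by blast
  then have "complex_of_real (x * pi) = of_real (n * pi)" by simp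
  then have "x * pi = n * pi" by (simp only: of_real_eq_iff)
  then show False using assms[of n] by simp
qed

text \<open>All conditions are open and hold at the given real frequencies, so by continuity they
  persist for complex frequencies nearby, with the bounds enlarged by 1. Non-integrality of the
  first ratio gives that of the second, which is larger by 1.\<close>

lemma frequency_nbhd:
  fixes o1 o2 \<delta> :: real
  assumes o: "o1 \<noteq> 0" "o2 \<noteq> 0" "o1 \<noteq> o2" and nr: "\<And>n::int. o1 / (o2 - o1) \<noteq> of_int n" and \<delta>: "\<delta> > 0"
  defines "q \<equiv> rad (of_real o2) / rad (of_real o1)"
  obtains d k s where "d > 0" "k \<ge> 0" "s \<ge> 0"
    "\<And>z1 z2. cmod (z1 - of_real o1) < d \<Longrightarrow> cmod (z2 - of_real o2) < d \<Longrightarrow>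
      Re (z1\<^sup>2) > 0 \<and> Re (z2\<^sup>2) > 0 \<and> z1 \<noteq> 0 \<and> z2 \<noteq> 0 \<and> z2 - z1 \<noteq> 0 \<and>
      sin (z1 / (z2 - z1) * of_real pi) \<noteq> 0 \<and> sin (z2 / (z2 - z1) * of_real pi) \<noteq> 0 \<and>
      cmod (z1 / (z2 - z1)) \<le> k \<and> cmod (z2 / (z2 - z1)) \<le> k \<and>
      cmod (inverse (z1 / (z2 - z1))) \<le> k \<and> cmod (inverse (z2 / (z2 - z1))) \<le> k \<and>
      cmod (inverse (sin (z1 / (z2 - z1) * of_real pi))) \<le> s \<and>
      cmod (inverse (sin (z2 / (z2 - z1) * of_real pi))) \<le> s \<and>
      cmod (rad z2 / rad z1 - q) \<le> \<delta> \<and> cmod (inverse (rad z2 / rad z1) - inverse q) \<le> \<delta>"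
proof -
  define p where "p = (complex_of_real o1, complex_of_real o2)"
  have ne: "fst p \<noteq> 0" "snd p \<noteq> 0" "snd p - fst p \<noteq> 0" using o by (auto simp: p_def)
  define f1 f2 where "f1 = (\<lambda>z::complex \<times> complex. fst z / (snd z - fst z))" and "f2 = (\<lambda>z::complex \<times> complex. snd z / (snd z - fst z))"
  have f1p: "f1 p = of_real (o1 / (o2 - o1))" and f2p: "f2 p = of_real (o2 / (o2 - o1))"
    by (simp_all add: f1_def f2_def p_def)
  have f0: "f1 p \<noteq> 0" "f2 p \<noteq> 0" using o by (auto simp: f1p f2p)
  have nr2: "o2 / (o2 - o1) \<noteq> of_int n" for n :: int
  proof
    assume "o2 / (o2 - o1) = of_int n"
    moreover have "o2 / (o2 - o1) = o1 / (o2 - o1) + 1" using o by (simp add: field_simps)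
    ultimately have "o1 / (o2 - o1) = of_int (n - 1)" by simp
    then show False using nr by blast
  qed
  have s0: "sin (f1 p * of_real pi) \<noteq> 0" "sin (f2 p * of_real pi) \<noteq> 0"
    unfolding f1p f2p by (rule sin_real_pi_nonzero[OF nr]) (rule sin_real_pi_nonzero[OF nr2])
  have cf: "isCont f1 p" "isCont f2 p" unfolding f1_def f2_def using ne by (auto intro!: continuous_intros)
  have ci: "isCont (\<lambda>z. inverse (f1 z)) p" "isCont (\<lambda>z. inverse (f2 z)) p"
    using cf f0 by (auto intro!: continuous_intros)
  have cs: "isCont (\<lambda>z. sin (f1 z * of_real pi)) p" "isCont (\<lambda>z. sin (f2 z * of_real pi)) p"
    using cf by (auto intro!: continuous_intros)
  have csi: "isCont (\<lambda>z. inverse (sin (f1 z * of_real pi))) p" "isCont (\<lambda>z. inverse (sin (f2 z * of_real pi))) p"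
    using cs s0 by (auto intro!: continuous_intros)
  have sq: "Re ((fst p)\<^sup>2) > 0" "Re ((snd p)\<^sup>2) > 0" using o by (auto simp: p_def simp flip: of_real_power)
  have cl: "isCont (\<lambda>z. rad (fst z)) p" "isCont (\<lambda>z. rad (snd z)) p"
    unfolding rad_def using sq by (auto intro!: continuous_intros isCont_Ln' simp: complex_nonpos_Reals_iff)
  have cq: "isCont (\<lambda>z. rad (snd z) / rad (fst z)) p" "isCont (\<lambda>z. inverse (rad (snd z) / rad (fst z))) p"
    using cl by (auto intro!: continuous_intros)
  have cr: "\<forall>\<^sub>F z in nhds p. Re ((fst z)\<^sup>2) > 0" "\<forall>\<^sub>F z in nhds p. Re ((snd z)\<^sup>2) > 0"
  proof -
    have "isCont (\<lambda>z::complex \<times> complex. Re ((fst z)\<^sup>2)) p" "isCont (\<lambda>z::complex \<times> complex. Re ((snd z)\<^sup>2)) p"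
      by (auto intro!: continuous_intros)
    then show "\<forall>\<^sub>F z in nhds p. Re ((fst z)\<^sup>2) > 0" "\<forall>\<^sub>F z in nhds p. Re ((snd z)\<^sup>2) > 0"
      using eventually_pos[where p = p and f = "\<lambda>z. Re ((fst z)\<^sup>2)"]
        eventually_pos[where p = p and f = "\<lambda>z. Re ((snd z)\<^sup>2)"] sq by simp_all
  qed
  define k where "k = max (max (cmod (f1 p) + 1) (cmod (f2 p) + 1)) (max (cmod (inverse (f1 p)) + 1) (cmod (inverse (f2 p)) + 1))"
  define s where "s = max (cmod (inverse (sin (f1 p * of_real pi))) + 1) (cmod (inverse (sin (f2 p * of_real pi))) + 1)"
  have nz: "isCont (\<lambda>z::complex \<times> complex. fst z) p" "isCont (\<lambda>z::complex \<times> complex. snd z) p" "isCont (\<lambda>z::complex \<times> complex. snd z - fst z) p"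
    by (auto intro!: continuous_intros)
  have "\<forall>\<^sub>F z in nhds p. Re ((fst z)\<^sup>2) > 0 \<and> Re ((snd z)\<^sup>2) > 0 \<and> fst z \<noteq> 0 \<and> snd z \<noteq> 0 \<and> snd z - fst z \<noteq> 0 \<and>
      sin (f1 z * of_real pi) \<noteq> 0 \<and> sin (f2 z * of_real pi) \<noteq> 0 \<and>
      cmod (f1 z) \<le> k \<and> cmod (f2 z) \<le> k \<and> cmod (inverse (f1 z)) \<le> k \<and> cmod (inverse (f2 z)) \<le> k \<and>
      cmod (inverse (sin (f1 z * of_real pi))) \<le> s \<and> cmod (inverse (sin (f2 z * of_real pi))) \<le> s \<and>
      cmod (rad (snd z) / rad (fst z) - q) \<le> \<delta> \<and> cmod (inverse (rad (snd z) / rad (fst z)) - inverse q) \<le> \<delta>"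
    using cr eventually_nonzero[OF nz(1) ne(1)] eventually_nonzero[OF nz(2) ne(2)] eventually_nonzero[OF nz(3) ne(3)]
      eventually_nonzero[OF cs(1) s0(1)] eventually_nonzero[OF cs(2) s0(2)]
      eventually_norm_le[OF cf(1)] eventually_norm_le[OF cf(2)] eventually_norm_le[OF ci(1)] eventually_norm_le[OF ci(2)]
      eventually_norm_le[OF csi(1)] eventually_norm_le[OF csi(2)]
      eventually_close[OF cq(1) \<delta>] eventually_close[OF cq(2) \<delta>]
    by eventually_elim (simp add: k_def s_def q_def p_def dist_norm max.coboundedI1 max.coboundedI2)
  then obtain D where D: "D > 0" "\<And>z. dist z p < D \<Longrightarrow> Re ((fst z)\<^sup>2) > 0 \<and> Re ((snd z)\<^sup>2) > 0 \<and> fst z \<noteq> 0 \<and> snd z \<noteq> 0 \<and> snd z - fst z \<noteq> 0 \<and>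
      sin (f1 z * of_real pi) \<noteq> 0 \<and> sin (f2 z * of_real pi) \<noteq> 0 \<and>
      cmod (f1 z) \<le> k \<and> cmod (f2 z) \<le> k \<and> cmod (inverse (f1 z)) \<le> k \<and> cmod (inverse (f2 z)) \<le> k \<and>
      cmod (inverse (sin (f1 z * of_real pi))) \<le> s \<and> cmod (inverse (sin (f2 z * of_real pi))) \<le> s \<and>
      cmod (rad (snd z) / rad (fst z) - q) \<le> \<delta> \<and> cmod (inverse (rad (snd z) / rad (fst z)) - inverse q) \<le> \<delta>"
    unfolding eventually_nhds_metric by blast
  show thesis
  proof (rule that[of "D / 2" k s])
    show "k \<ge> 0" "s \<ge> 0" unfolding k_def s_def
      by (intro max.coboundedI1 add_nonneg_nonneg norm_ge_zero zero_le_one)+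
    fix z1 z2 :: complex assume z: "cmod (z1 - of_real o1) < D / 2" "cmod (z2 - of_real o2) < D / 2"
    have "dist (z1, z2) p \<le> dist z1 (of_real o1) + dist z2 (of_real o2)"
      unfolding p_def dist_Pair_Pair by (rule sqrt_sum_squares_le_sum) auto
    then have "dist (z1, z2) p < D" using z by (simp add: dist_norm)
    from D(2)[OF this] show "Re (z1\<^sup>2) > 0 \<and> Re (z2\<^sup>2) > 0 \<and> z1 \<noteq> 0 \<and> z2 \<noteq> 0 \<and> z2 - z1 \<noteq> 0 \<and>
      sin (z1 / (z2 - z1) * of_real pi) \<noteq> 0 \<and> sin (z2 / (z2 - z1) * of_real pi) \<noteq> 0 \<and>
      cmod (z1 / (z2 - z1)) \<le> k \<and> cmod (z2 / (z2 - z1)) \<le> k \<and>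
      cmod (inverse (z1 / (z2 - z1))) \<le> k \<and> cmod (inverse (z2 / (z2 - z1))) \<le> k \<and>
      cmod (inverse (sin (z1 / (z2 - z1) * of_real pi))) \<le> s \<and>
      cmod (inverse (sin (z2 / (z2 - z1) * of_real pi))) \<le> s \<and>
      cmod (rad z2 / rad z1 - q) \<le> \<delta> \<and> cmod (inverse (rad z2 / rad z1) - inverse q) \<le> \<delta>"
      unfolding f1_def f2_def fst_conv snd_conv .
  qed (use D in auto)
qed

lemma norm_osc_kernel_le:
  assumes "cmod \<kappa> \<le> k" "cmod (inverse \<kappa>) \<le> k'" "cmod (inverse (sin (\<kappa> * of_real pi))) \<le> s"
    "\<sigma> \<in> {0..2*pi}" "0 \<le> k" "0 \<le> k'" "0 \<le> s"
  shows "cmod (osc_kernel \<kappa> \<sigma>) \<le> exp (k * pi) * (k' * s)"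
proof -
  have "osc_kernel \<kappa> \<sigma> = cos (\<kappa> * of_real (\<sigma> - pi)) * (inverse \<kappa> * inverse (sin (\<kappa> * of_real pi))) / 2"
    by (simp add: osc_kernel_def divide_simps)
  then have "cmod (osc_kernel \<kappa> \<sigma>) = cmod (cos (\<kappa> * of_real (\<sigma> - pi))) * (cmod (inverse \<kappa>) * cmod (inverse (sin (\<kappa> * of_real pi)))) / 2"
    by (simp only: norm_mult norm_divide norm_numeral)
  also have "\<dots> \<le> exp (k * pi) * (k' * s) / 2"
  proof (intro divide_right_mono mult_mono)
    have "\<bar>\<sigma> - pi\<bar> \<le> pi" using assms(4) by auto
    then have "cmod (\<kappa> * of_real (\<sigma> - pi)) \<le> k * pi"
      unfolding norm_mult norm_of_real using assms by (intro mult_mono) auto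
    then show "cmod (cos (\<kappa> * of_real (\<sigma> - pi))) \<le> exp (k * pi)"
      using norm_cos_le order_trans exp_le_cancel_iff by blast
  qed (use assms in auto)
  also have "\<dots> \<le> exp (k * pi) * (k' * s)"
    using assms by simp
  finally show ?thesis .
qed

text \<open>\<tau> ranges over a strip, because Cauchy estimates in \<tau> need room of fixed width;
  the angle \<open>Ang\<close> is unrestricted.\<close>

definition pdom :: "real \<Rightarrow> real \<Rightarrow> real \<Rightarrow> real \<Rightarrow> pvec set" where
  "pdom o1 o2 d \<beta> = {x. cmod (x $ Mu) < d \<and> cmod (x $ V1 - of_real o1) < d \<and>
     cmod (x $ V2 - of_real o2) < d \<and> \<bar>Im (x $ Tau)\<bar> < \<beta>}"

lemma open_pdom: "open (pdom o1 o2 d \<beta>)"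
  unfolding pdom_def
  by (intro open_Collect_conj open_Collect_less continuous_intros)

lemma tinvariant_pdom: "tinvariant (pdom o1 o2 d \<beta>)"
  by (auto simp: tinvariant_def pdom_def)

lemma real_coeffs:
  assumes "realpt x" "x $ V1 \<noteq> 0" "x $ V2 \<noteq> 0"
  shows "cnj (kap1 x) = kap1 x" "cnj (kap2 x) = kap2 x" "cnj (gam x) = gam x" "cnj (ex x) = ex' x" "cnj (ex' x) = ex x"
proof -
  have c: "x $ i = of_real (Re (x $ i))" for i
    using assms(1) by (simp add: realpt_def complex_eq_iff)
  have ci: "cnj (x $ i) = x $ i" for i using c[of i] by (metis complex_cnj_complex_of_real)
  have nz: "Re (x $ V1) \<noteq> 0" "Re (x $ V2) \<noteq> 0" using assms(2,3) c by (metis of_real_0)+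
  show "cnj (kap1 x) = kap1 x" "cnj (kap2 x) = kap2 x" by (simp_all add: kap1_def kap2_def nu_def ci)
  have "rad (x $ V1) = of_real (\<bar>Re (x $ V1)\<bar> powr (-2/3))" "rad (x $ V2) = of_real (\<bar>Re (x $ V2)\<bar> powr (-2/3))"
    using rad_of_real[OF nz(1)] rad_of_real[OF nz(2)] c[of V1] c[of V2] by simp_all
  then show "cnj (gam x) = gam x" by (simp add: gam_def)
  show "cnj (ex x) = ex' x" "cnj (ex' x) = ex x" by (simp_all add: ex_def ex'_def exp_cnj ci)
qed

lemma gholo_rad:
  assumes "gholo S f" "\<And>x. x \<in> S \<Longrightarrow> Re ((f x)\<^sup>2) > 0"
  shows "gholo S (\<lambda>x. rad (f x))"
proof (rule gholo_compose[OF assms(1)])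
  show "rad field_differentiable (at (f x))" if "x \<in> S" for x
  proof -
    have "(f x)\<^sup>2 \<notin> \<real>\<^sub>\<le>\<^sub>0" using assms(2)[OF that] by (auto simp: complex_nonpos_Reals_iff)
    then have "\<exists>D. (rad has_field_derivative D) (at (f x))"
      unfolding rad_def[abs_def] by (auto intro!: exI derivative_eq_intros)
    then show ?thesis by (simp add: field_differentiable_def)
  qed
qed

lemma ex_shift: "ex (tshift x (2*pi)) = ex x" "ex' (tshift x (2*pi)) = ex' x"
proof -
  have "\<i> * (2 * of_real pi) = \<i> * (complex_of_real pi * 2)" by simp
  then have e: "exp (\<i> * (2 * complex_of_real pi)) = 1" using exp_two_pi_i' by metis
  show "ex (tshift x (2*pi)) = ex x" "ex' (tshift x (2*pi)) = ex' x"
    unfolding ex_def ex'_def by (simp_all add: distrib_left exp_add exp_diff e del: exp_two_pi_i')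
qed

lemma ex_near_circle:
  assumes "\<bar>exp (- Im (x $ Tau)) - 1\<bar> \<le> \<delta>" "\<bar>exp (Im (x $ Tau)) - 1\<bar> \<le> \<delta>"
  shows "cmod (ex x - cis (Re (x $ Tau))) \<le> \<delta>" "cmod (ex' x - cis (- Re (x $ Tau))) \<le> \<delta>"
proof -
  have "ex x = of_real (exp (- Im (x $ Tau))) * cis (Re (x $ Tau))"
    by (simp add: ex_def exp_eq_polar)
  then have "ex x - cis (Re (x $ Tau)) = of_real (exp (- Im (x $ Tau)) - 1) * cis (Re (x $ Tau))"
    by (simp add: algebra_simps)
  then show "cmod (ex x - cis (Re (x $ Tau))) \<le> \<delta>" using assms(1) by (simp only: norm_mult norm_of_real norm_cis) simp
  have "ex' x = of_real (exp (Im (x $ Tau))) * cis (- Re (x $ Tau))"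
    by (simp add: ex'_def exp_eq_polar)
  then have "ex' x - cis (- Re (x $ Tau)) = of_real (exp (Im (x $ Tau)) - 1) * cis (- Re (x $ Tau))"
    by (simp add: algebra_simps)
  then show "cmod (ex' x - cis (- Re (x $ Tau))) \<le> \<delta>" using assms(2) by (simp only: norm_mult norm_of_real norm_cis) simp
qed

text \<open>\<open>s = 1\<close> for planet 1 and \<open>s = -1\<close> for planet 2, since each
  sees the relative phase of the other with opposite sign. Conjugates appear as values at
  \<open>- t\<close>.\<close>

definition orbit_ode ::
  "real \<Rightarrow> real \<Rightarrow> real \<Rightarrow> complex \<Rightarrow> complex \<Rightarrow> (real \<Rightarrow> complex) \<Rightarrow> (real \<Rightarrow> complex) \<Rightarrow> (real \<Rightarrow> complex) \<Rightarrow> complex \<Rightarrow> bool" where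
  "orbit_ode s mo mt \<kappa> \<gamma> u v u' \<mu> \<longleftrightarrow> (\<forall>t. (u has_vector_derivative u' t) (at t)) \<and>
     (\<exists>u''. \<forall>t. (u' has_vector_derivative u'' t) (at t) \<and>
       u'' t + 2 * \<i> * \<kappa> * u' t - 3/2 * \<kappa>\<^sup>2 * (u t + u (- t)) =
       \<kappa>\<^sup>2 * nonlin mo mt \<mu> \<gamma> (cis (s * t)) (cis (- (s * t))) (u t) (u (- t)) (v t) (v (- t)))"

text \<open>A fixed point equals \<open>lin_sol\<close> of its own source, so it is twice
  differentiable in time. Its first derivative must then coincide with the holomorphic directional
  derivative, the form needed for smooth dependence of the velocities on the parameters.\<close>

lemma (in planet) step_ode:
  assumes f: "admissible_dev S \<eta> f" and g: "admissible_dev S \<eta> g" and eq: "\<And>x. x \<in> S \<Longrightarrow> f x = step f g x"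
    and x0: "x0 \<in> S" "x0 $ Tau = 0"
    and e: "\<And>t. e (tshift x0 t) = cis (s * t)" "\<And>t. e' (tshift x0 t) = cis (- (s * t))"
  shows "orbit_ode s mo mt (\<kappa> x0) (\<gamma> x0) (\<lambda>t. f (tshift x0 t)) (\<lambda>t. g (tshift x0 t))
    (\<lambda>t. dderiv f (axis Tau 1) (tshift x0 t)) (x0 $ Mu)"
proof -
  define sf where "sf = (\<lambda>t. src f g (tshift x0 t))"
  define u where "u = (\<lambda>t. f (tshift x0 t))"
  have us: "u = lin_sol (\<kappa> x0) sf (\<lambda>t. sf (- t))"
    unfolding u_def sf_def using step_line(1)[OF f g x0] eq inS(1)[OF x0(1)] by auto
  have refl: "treflect (tshift x0 t) = tshift x0 (- t)" for t
    using x0(2) by (auto simp: vec_eq_iff treflect_def tshift_def axis_def)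
  have csf: "continuous_on UNIV sf" "\<And>t. sf (t + 2*pi) = sf t"
    unfolding sf_def by (rule step_line(2,3)[OF f g x0])+
  have d: "(u has_vector_derivative dderiv f (axis Tau 1) (tshift x0 t)) (at t)" for t
  proof -
    have "((\<lambda>z. f (x0 + z *s axis Tau 1)) has_field_derivative dderiv f (axis Tau 1) (tshift x0 t)) (at (of_real t))"
      unfolding tshift_def by (rule gholo_line_DERIV) (use f inS(1)[OF x0(1), of t] in \<open>auto simp: admissible_dev_def tshift_def\<close>)
    from has_vector_derivative_real_field[OF this] show ?thesis by (simp add: u_def tshift_def)
  qed
  obtain u' u'' where u: "\<And>t. (u has_vector_derivative u' t) (at t)" "\<And>t. (u' has_vector_derivative u'' t) (at t)"
    "\<And>t. u'' t + 2 * \<i> * \<kappa> x0 * u' t - 3/2 * (\<kappa> x0)\<^sup>2 * (u t + u (- t)) = sf t"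
    using lin_sol_ode[OF csf \<kappa>(1)[OF x0(1)] \<kappa>(2)[OF x0(1)]] unfolding us[symmetric] by blast
  have "u' = (\<lambda>t. dderiv f (axis Tau 1) (tshift x0 t))"
    using vector_derivative_unique_at[OF u(1) d] by auto
  moreover have "sf t = (\<kappa> x0)\<^sup>2 * nonlin mo mt (x0 $ Mu) (\<gamma> x0) (cis (s * t)) (cis (- (s * t))) (u t) (u (- t)) (g (tshift x0 t)) (g (tshift x0 (- t)))" for t
    by (simp add: sf_def src_def \<kappa>_shift \<gamma>_shift e refl u_def)
  ultimately show ?thesis
    using u unfolding orbit_ode_def u_def by (intro conjI allI exI[of _ u'']) simp_all
qed

text \<open>The order of the choices avoids circularity: \<delta> depends on the configuration, the
  bounds \<open>k\<close>, \<open>s\<close> on \<delta>, \<epsilon> on these bounds, \<beta> on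
  \<delta>, \<eta> on \<epsilon> and \<beta>, and the size \<open>d\<close> of the parameter domain
  on all of them.\<close>

lemma deviations_exist:
  fixes o1 o2 m1 m2 :: real
  assumes o: "o1 \<noteq> 0" "o2 \<noteq> 0" "\<bar>o1\<bar> \<noteq> \<bar>o2\<bar>" and nr: "\<And>n::int. o1 / (o2 - o1) \<noteq> of_int n"
  obtains d \<beta> \<eta> f g where "d > 0" "d \<le> 1/2" "\<beta> > 0" "0 < \<eta>" "\<eta> \<le> 1/32" "\<eta> \<le> \<beta>/32"
    "admissible_dev (pdom o1 o2 d \<beta>) \<eta> f" "admissible_dev (pdom o1 o2 d \<beta>) \<eta> g"
    "\<And>x. x \<in> pdom o1 o2 d \<beta> \<Longrightarrow> Re ((x $ V1)\<^sup>2) > 0 \<and> Re ((x $ V2)\<^sup>2) > 0 \<and> x $ V1 \<noteq> 0 \<and> x $ V2 \<noteq> 0 \<and> nu x \<noteq> 0"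
    "\<And>x a b c d'. x \<in> pdom o1 o2 d \<beta> \<Longrightarrow> cmod a \<le> \<eta> \<Longrightarrow> cmod b \<le> \<eta> \<Longrightarrow> cmod c \<le> \<eta> \<Longrightarrow> cmod d' \<le> \<eta> \<Longrightarrow>
       adm (gam x) (ex x) (ex' x) a b c d'"
    "\<And>x0. x0 \<in> pdom o1 o2 d \<beta> \<Longrightarrow> x0 $ Tau = 0 \<Longrightarrow>
       orbit_ode 1 m1 m2 (kap1 x0) (gam x0) (\<lambda>t. f (tshift x0 t)) (\<lambda>t. g (tshift x0 t))
         (\<lambda>t. dderiv f (axis Tau 1) (tshift x0 t)) (x0 $ Mu) \<and>
       orbit_ode (-1) m2 m1 (kap2 x0) (inverse (gam x0)) (\<lambda>t. g (tshift x0 t)) (\<lambda>t. f (tshift x0 t))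
         (\<lambda>t. dderiv g (axis Tau 1) (tshift x0 t)) (x0 $ Mu)"
proof -
  have o': "o1 \<noteq> o2" using o(3) by auto
  define q where "q = \<bar>o2\<bar> powr (-2/3) / \<bar>o1\<bar> powr (-2/3)"
  have q: "q > 0" "q \<noteq> 1" "inverse q > 0" "inverse q \<noteq> 1"
  proof -
    show "q > 0" "inverse q > 0" using o by (simp_all add: q_def)
    have "\<bar>o2\<bar> powr (-2/3) \<noteq> \<bar>o1\<bar> powr (-2/3)"
      using o powr_inj[of "\<bar>o2\<bar>" "-2/3" "\<bar>o1\<bar>"]
      by (smt (verit) divide_less_0_iff powr_less_mono2_neg zero_less_abs_iff)
    then show "q \<noteq> 1" "inverse q \<noteq> 1" using o by (auto simp: q_def)
  qed
  have qc: "rad (of_real o2) / rad (of_real o1) = of_real q" using o by (simp add: q_def rad_of_real)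
  obtain \<delta>1 B1 where \<delta>1: "\<delta>1 > 0" "B1 > 0" and N1: "\<And>\<epsilon>. \<epsilon> > 0 \<Longrightarrow> \<exists>\<eta>0>0. \<forall>\<eta>. 0 < \<eta> \<longrightarrow> \<eta> \<le> \<eta>0 \<longrightarrow> (\<forall>\<mu> \<theta> \<gamma> e e' a b c d.
       cmod \<mu> * ((\<bar>m2\<bar> + \<bar>m1\<bar>) * B1) \<le> \<epsilon> * \<eta> / 2 \<longrightarrow>
       cmod (\<gamma> - of_real q) \<le> \<delta>1 \<longrightarrow> cmod (e - cis \<theta>) \<le> \<delta>1 \<longrightarrow> cmod (e' - cis (- \<theta>)) \<le> \<delta>1 \<longrightarrow>
       cmod a \<le> 2 * \<eta> \<longrightarrow> cmod b \<le> 2 * \<eta> \<longrightarrow> cmod c \<le> 2 * \<eta> \<longrightarrow> cmod d \<le> 2 * \<eta> \<longrightarrow>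
       adm \<gamma> e e' a b c d \<and> cmod (nonlin m1 m2 \<mu> \<gamma> e e' a b c d) \<le> \<epsilon> * \<eta>)"
    using nonlin_bound[OF q(1,2), of m2 m1] by blast
  obtain \<delta>2 B2 where \<delta>2: "\<delta>2 > 0" "B2 > 0" and N2: "\<And>\<epsilon>. \<epsilon> > 0 \<Longrightarrow> \<exists>\<eta>0>0. \<forall>\<eta>. 0 < \<eta> \<longrightarrow> \<eta> \<le> \<eta>0 \<longrightarrow> (\<forall>\<mu> \<theta> \<gamma> e e' a b c d.
       cmod \<mu> * ((\<bar>m1\<bar> + \<bar>m2\<bar>) * B2) \<le> \<epsilon> * \<eta> / 2 \<longrightarrow>
       cmod (\<gamma> - of_real (inverse q)) \<le> \<delta>2 \<longrightarrow> cmod (e - cis \<theta>) \<le> \<delta>2 \<longrightarrow> cmod (e' - cis (- \<theta>)) \<le> \<delta>2 \<longrightarrow>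
       cmod a \<le> 2 * \<eta> \<longrightarrow> cmod b \<le> 2 * \<eta> \<longrightarrow> cmod c \<le> 2 * \<eta> \<longrightarrow> cmod d \<le> 2 * \<eta> \<longrightarrow>
       adm \<gamma> e e' a b c d \<and> cmod (nonlin m2 m1 \<mu> \<gamma> e e' a b c d) \<le> \<epsilon> * \<eta>)"
    using nonlin_bound[OF q(3,4), of m1 m2] by blast
  define \<delta> where "\<delta> = min \<delta>1 \<delta>2"
  have \<delta>: "\<delta> > 0" "\<delta> \<le> \<delta>1" "\<delta> \<le> \<delta>2" using \<delta>1 \<delta>2 by (auto simp: \<delta>_def)
  obtain d0 k s where d0: "d0 > 0" and ks: "k \<ge> 0" "s \<ge> 0" and F:
    "\<And>z1 z2. cmod (z1 - of_real o1) < d0 \<Longrightarrow> cmod (z2 - of_real o2) < d0 \<Longrightarrow>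
      Re (z1\<^sup>2) > 0 \<and> Re (z2\<^sup>2) > 0 \<and> z1 \<noteq> 0 \<and> z2 \<noteq> 0 \<and> z2 - z1 \<noteq> 0 \<and>
      sin (z1 / (z2 - z1) * of_real pi) \<noteq> 0 \<and> sin (z2 / (z2 - z1) * of_real pi) \<noteq> 0 \<and>
      cmod (z1 / (z2 - z1)) \<le> k \<and> cmod (z2 / (z2 - z1)) \<le> k \<and>
      cmod (inverse (z1 / (z2 - z1))) \<le> k \<and> cmod (inverse (z2 / (z2 - z1))) \<le> k \<and>
      cmod (inverse (sin (z1 / (z2 - z1) * of_real pi))) \<le> s \<and>
      cmod (inverse (sin (z2 / (z2 - z1) * of_real pi))) \<le> s \<and>
      cmod (rad z2 / rad z1 - rad (of_real o2) / rad (of_real o1)) \<le> \<delta> \<and>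
      cmod (inverse (rad z2 / rad z1) - inverse (rad (of_real o2) / rad (of_real o1))) \<le> \<delta>"
    using frequency_nbhd[OF o(1,2) o' nr \<delta>(1)] by blast
  define A where "A = exp (k * pi) * (k * s)"
  have A0: "A \<ge> 0" using ks by (simp add: A_def)
  define L where "L = lin_bound k k A * k\<^sup>2"
  have L0: "L \<ge> 0" unfolding L_def using lin_bound_nonneg[OF ks(1) ks(1) A0] by simp
  \<comment> \<open>\<open>L\<close> is only known to be nonnegative; \<open>L + 1\<close> is a safe
    denominator and still gives \<open>L * \<epsilon> \<le> 1/16\<close>.\<close>
  define \<epsilon> where "\<epsilon> = 1 / (16 * (L + 1))"
  have \<epsilon>: "\<epsilon> > 0" using L0 by (simp add: \<epsilon>_def)
  have "L * \<epsilon> \<le> 1/16" using L0 by (simp add: \<epsilon>_def field_simps)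
  then have small: "lin_bound k k A * (k\<^sup>2 * \<epsilon>) \<le> 1/16" by (simp add: L_def mult_ac)
  obtain \<beta> where \<beta>: "\<beta> > 0" "\<And>t. \<bar>t\<bar> < \<beta> \<Longrightarrow> \<bar>exp t - 1\<bar> \<le> \<delta>"
  proof -
    have "\<forall>\<^sub>F t in nhds (0::real). dist (exp t) (exp 0) \<le> \<delta>"
      by (rule eventually_close[OF _ \<delta>(1)]) (auto intro!: continuous_intros)
    then show thesis using that unfolding eventually_nhds_metric by (auto simp: dist_norm)
  qed
  obtain \<eta>1 where \<eta>1: "\<eta>1 > 0" and N1: "\<And>\<eta> \<mu> \<theta> \<gamma> e e' a b c d. 0 < \<eta> \<Longrightarrow> \<eta> \<le> \<eta>1 \<Longrightarrow>
       cmod \<mu> * ((\<bar>m2\<bar> + \<bar>m1\<bar>) * B1) \<le> \<epsilon> * \<eta> / 2 \<Longrightarrow>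
       cmod (\<gamma> - of_real q) \<le> \<delta>1 \<Longrightarrow> cmod (e - cis \<theta>) \<le> \<delta>1 \<Longrightarrow> cmod (e' - cis (- \<theta>)) \<le> \<delta>1 \<Longrightarrow>
       cmod a \<le> 2 * \<eta> \<Longrightarrow> cmod b \<le> 2 * \<eta> \<Longrightarrow> cmod c \<le> 2 * \<eta> \<Longrightarrow> cmod d \<le> 2 * \<eta> \<Longrightarrow>
       adm \<gamma> e e' a b c d \<and> cmod (nonlin m1 m2 \<mu> \<gamma> e e' a b c d) \<le> \<epsilon> * \<eta>"
    using N1[OF \<epsilon>] by metis
  obtain \<eta>2 where \<eta>2: "\<eta>2 > 0" and N2: "\<And>\<eta> \<mu> \<theta> \<gamma> e e' a b c d. 0 < \<eta> \<Longrightarrow> \<eta> \<le> \<eta>2 \<Longrightarrow>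
       cmod \<mu> * ((\<bar>m1\<bar> + \<bar>m2\<bar>) * B2) \<le> \<epsilon> * \<eta> / 2 \<Longrightarrow>
       cmod (\<gamma> - of_real (inverse q)) \<le> \<delta>2 \<Longrightarrow> cmod (e - cis \<theta>) \<le> \<delta>2 \<Longrightarrow> cmod (e' - cis (- \<theta>)) \<le> \<delta>2 \<Longrightarrow>
       cmod a \<le> 2 * \<eta> \<Longrightarrow> cmod b \<le> 2 * \<eta> \<Longrightarrow> cmod c \<le> 2 * \<eta> \<Longrightarrow> cmod d \<le> 2 * \<eta> \<Longrightarrow>
       adm \<gamma> e e' a b c d \<and> cmod (nonlin m2 m1 \<mu> \<gamma> e e' a b c d) \<le> \<epsilon> * \<eta>"
    using N2[OF \<epsilon>] by metis
  \<comment> \<open>\<open>1/32\<close> and \<open>\<beta>/32\<close> serve the later proof that the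
    tori are embedded: they bound the deviations by \<open>1/32\<close> and, through Cauchy's
    inequality, their \<tau>-derivatives by \<open>1/16\<close>.\<close>
  define \<eta> where "\<eta> = min (min \<eta>1 \<eta>2) (min (1/32) (\<beta>/32))"
  have \<eta>: "\<eta> > 0" "\<eta> \<le> \<eta>1" "\<eta> \<le> \<eta>2" "\<eta> \<le> 1/32" "\<eta> \<le> \<beta>/32"
    using \<eta>1 \<eta>2 \<beta> by (auto simp: \<eta>_def)
  define Q where "Q = (\<bar>m1\<bar> + \<bar>m2\<bar>) * (B1 + B2) + 1"
  have Q0: "Q > 0" unfolding Q_def using \<delta>1 \<delta>2 by (intro add_nonneg_pos mult_nonneg_nonneg) auto
  \<comment> \<open>The last bound makes the \<mu>-term of the nonlinearity at most half of
    \<open>\<epsilon>\<eta>\<close>; \<open>1/2\<close> keeps \<open>1 + \<mu>\<close> away from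
    zero.\<close>
  define d where "d = min (min d0 (1/2)) (\<epsilon> * \<eta> / 2 / Q)"
  have d: "d > 0" "d \<le> d0" "d \<le> \<epsilon> * \<eta> / 2 / Q" "d \<le> 1/2" using d0 \<epsilon> \<eta>(1) Q0 by (auto simp: d_def)
  define S where "S = pdom o1 o2 d \<beta>"
  have V: "cmod (x $ V1 - of_real o1) < d0" "cmod (x $ V2 - of_real o2) < d0" if "x \<in> S" for x
    using that d by (auto simp: S_def pdom_def)
  have E: "cmod (ex x - cis (Re (x $ Tau))) \<le> \<delta>" "cmod (ex' x - cis (- Re (x $ Tau))) \<le> \<delta>" if "x \<in> S" for x
    using ex_near_circle[of x \<delta>] \<beta>(2)[of "Im (x $ Tau)"] \<beta>(2)[of "- Im (x $ Tau)"] that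
    by (auto simp: S_def pdom_def)
  have M: "cmod (x $ Mu) * ((\<bar>m2\<bar> + \<bar>m1\<bar>) * B1) \<le> \<epsilon> * \<eta> / 2" "cmod (x $ Mu) * ((\<bar>m1\<bar> + \<bar>m2\<bar>) * B2) \<le> \<epsilon> * \<eta> / 2" if "x \<in> S" for x
  proof -
    have "cmod (x $ Mu) \<le> d" using that by (auto simp: S_def pdom_def)
    then have "cmod (x $ Mu) * Q \<le> d * Q" using Q0 by (intro mult_right_mono) auto
    also have "\<dots> \<le> \<epsilon> * \<eta> / 2 / Q * Q" using d(3) Q0 by (intro mult_right_mono) auto
    finally have *: "cmod (x $ Mu) * Q \<le> \<epsilon> * \<eta> / 2" using Q0 by simp
    have "(\<bar>m2\<bar> + \<bar>m1\<bar>) * B1 \<le> Q" "(\<bar>m1\<bar> + \<bar>m2\<bar>) * B2 \<le> Q"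
      using \<delta>1(2) \<delta>2(2) by (auto simp: Q_def algebra_simps intro!: add_nonneg_nonneg mult_nonneg_nonneg)
    then show "cmod (x $ Mu) * ((\<bar>m2\<bar> + \<bar>m1\<bar>) * B1) \<le> \<epsilon> * \<eta> / 2" "cmod (x $ Mu) * ((\<bar>m1\<bar> + \<bar>m2\<bar>) * B2) \<le> \<epsilon> * \<eta> / 2"
      using * by (meson mult_left_mono norm_ge_zero order_trans)+
  qed
  have G: "cmod (gam x - of_real q) \<le> \<delta>1" "cmod (inverse (gam x) - of_real (inverse q)) \<le> \<delta>2" if "x \<in> S" for x
    using F[OF V[OF that]] \<delta> by (auto simp: gam_def qc)
  have S: "open S" "tinvariant S" unfolding S_def by (rule open_pdom tinvariant_pdom)+
  have gh: "gholo S nu" "gholo S kap1" "gholo S kap2" "gholo S gam" "gholo S (\<lambda>x. inverse (gam x))" "gholo S ex" "gholo S ex'"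
  proof -
    show nu: "gholo S nu" unfolding nu_def[abs_def] by auto
    have nz: "nu x \<noteq> 0" if "x \<in> S" for x using F[OF V[OF that]] by (simp add: nu_def)
    show "gholo S kap1" "gholo S kap2" unfolding kap1_def[abs_def] kap2_def[abs_def]
      by (auto intro!: gholo_divide nu nz)
    show g: "gholo S gam" unfolding gam_def[abs_def]
      using F[OF V] by (auto intro!: gholo_divide gholo_rad)
    show "gholo S (\<lambda>x. inverse (gam x))"
      by (rule gholo_inverse[OF g]) (simp add: gam_def)
    show "gholo S ex" "gholo S ex'" unfolding ex_def[abs_def] ex'_def[abs_def]
      by (auto intro!: gholo_exp gholo_mult gholo_uminus)
  qed
  have sh: "nu (tshift x t) = nu x" "kap1 (tshift x t) = kap1 x" "kap2 (tshift x t) = kap2 x" "gam (tshift x t) = gam x"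
    "nu (treflect x) = nu x" "kap1 (treflect x) = kap1 x" "kap2 (treflect x) = kap2 x" "gam (treflect x) = gam x"
    "ex (treflect x) = ex' x" "ex' (treflect x) = ex x" for x t
    by (simp_all add: nu_def kap1_def kap2_def gam_def ex_def ex'_def)
  have K: "kap1 x \<noteq> 0" "kap2 x \<noteq> 0" "sin (kap1 x * of_real pi) \<noteq> 0" "sin (kap2 x * of_real pi) \<noteq> 0"
    "cmod (kap1 x) \<le> k" "cmod (kap2 x) \<le> k" "cmod (inverse (kap1 x)) \<le> k" "cmod (inverse (kap2 x)) \<le> k"
    "cmod (inverse (sin (kap1 x * of_real pi))) \<le> s" "cmod (inverse (sin (kap2 x * of_real pi))) \<le> s"
    if "x \<in> S" for x
    using F[OF V[OF that]] by (auto simp: kap1_def kap2_def nu_def)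
  have osc: "cmod (osc_kernel (kap1 x) \<sigma>) \<le> A" "cmod (osc_kernel (kap2 x) \<sigma>) \<le> A" if "x \<in> S" "\<sigma> \<in> {0..2*pi}" for x \<sigma>
    unfolding A_def using K[OF that(1)] ks that(2) by (auto intro!: norm_osc_kernel_le)
  have rc: "cnj (kap1 x) = kap1 x" "cnj (kap2 x) = kap2 x" "cnj (gam x) = gam x" "cnj (ex x) = ex' x" "cnj (ex' x) = ex x"
    if "realpt x" "x \<in> S" for x
    using real_coeffs[OF that(1)] F[OF V[OF that(2)]] by auto
  have NB1: "adm (gam x) (ex x) (ex' x) a b c d' \<and> cmod (nonlin m1 m2 (x $ Mu) (gam x) (ex x) (ex' x) a b c d') \<le> \<epsilon> * \<eta>"
    if "x \<in> S" "cmod a \<le> 2 * \<eta>" "cmod b \<le> 2 * \<eta>" "cmod c \<le> 2 * \<eta>" "cmod d' \<le> 2 * \<eta>" for x a b c d'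
    by (rule N1[of \<eta> "x $ Mu" "gam x" "ex x" "Re (x $ Tau)"])
      (use that \<eta> M[OF that(1)] G[OF that(1)] E[OF that(1)] \<delta> in auto)
  have NB2: "adm (inverse (gam x)) (ex' x) (ex x) a b c d' \<and> cmod (nonlin m2 m1 (x $ Mu) (inverse (gam x)) (ex' x) (ex x) a b c d') \<le> \<epsilon> * \<eta>"
    if "x \<in> S" "cmod a \<le> 2 * \<eta>" "cmod b \<le> 2 * \<eta>" "cmod c \<le> 2 * \<eta>" "cmod d' \<le> 2 * \<eta>" for x a b c d'
    by (rule N2[of \<eta> "x $ Mu" "inverse (gam x)" "ex' x" "- Re (x $ Tau)"])
      (use that \<eta> M[OF that(1)] G[OF that(1)] E[OF that(1)] \<delta> in auto)
  have p1: "planet S kap1 gam ex ex' m1 m2 \<eta> \<epsilon> k k A"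
    by unfold_locales (use S \<eta> gh sh ex_shift rc K osc NB1 small \<epsilon> ks A0 in auto)
  have p2: "planet S kap2 (\<lambda>x. inverse (gam x)) ex' ex m2 m1 \<eta> \<epsilon> k k A"
    by unfold_locales (use S \<eta> gh sh ex_shift rc K osc NB2 small \<epsilon> ks A0 in auto)
  obtain f g where f: "admissible_dev S \<eta> f" and g: "admissible_dev S \<eta> g"
    and eq: "\<And>x. x \<in> S \<Longrightarrow> f x = planet.step kap1 gam ex ex' m1 m2 f g x"
      "\<And>x. x \<in> S \<Longrightarrow> g x = planet.step kap2 (\<lambda>x. inverse (gam x)) ex' ex m2 m1 g f x"
    using two_planet_fixed_point[OF p1 p2] by blast
  have line: "ex (tshift x0 t) = cis t" "ex' (tshift x0 t) = cis (- t)" if "x0 $ Tau = 0" for x0 t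
    using that by (simp_all add: ex_def ex'_def cis_conv_exp)
  show thesis
  proof (rule that[OF d(1,4) \<beta>(1) \<eta>(1) \<eta>(4) \<eta>(5) f[unfolded S_def] g[unfolded S_def]])
    fix x assume "x \<in> pdom o1 o2 d \<beta>"
    then have x: "x \<in> S" by (simp add: S_def)
    show "Re ((x $ V1)\<^sup>2) > 0 \<and> Re ((x $ V2)\<^sup>2) > 0 \<and> x $ V1 \<noteq> 0 \<and> x $ V2 \<noteq> 0 \<and> nu x \<noteq> 0"
      using F[OF V[OF x]] by (simp add: nu_def)
    show "adm (gam x) (ex x) (ex' x) a b c d'"
      if "cmod a \<le> \<eta>" "cmod b \<le> \<eta>" "cmod c \<le> \<eta>" "cmod d' \<le> \<eta>" for a b c d'
      using NB1[OF x, of a b c d'] that \<eta>(1) by auto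
    assume t0: "x $ Tau = 0"
    show "orbit_ode 1 m1 m2 (kap1 x) (gam x) (\<lambda>t. f (tshift x t)) (\<lambda>t. g (tshift x t))
         (\<lambda>t. dderiv f (axis Tau 1) (tshift x t)) (x $ Mu) \<and>
       orbit_ode (-1) m2 m1 (kap2 x) (inverse (gam x)) (\<lambda>t. g (tshift x t)) (\<lambda>t. f (tshift x t))
         (\<lambda>t. dderiv g (axis Tau 1) (tshift x t)) (x $ Mu)"
      using planet.step_ode[OF p1 f g eq(1) x t0, of 1] planet.step_ode[OF p2 g f eq(2) x t0, of "-1"]
      by (simp add: line[OF t0])
  qed
qed

text \<open>Cauchy's inequality on the disc of radius \<open>\<beta>/2\<close>, which lies in the
  strip because \<tau> is real at the centre.\<close>

lemma dev_derivative_le: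
  assumes f: "admissible_dev (pdom o1 o2 d \<beta>) \<eta> f" and x: "x \<in> pdom o1 o2 d \<beta>" "Im (x $ Tau) = 0"
    and \<eta>: "\<eta> \<le> \<beta> / 32" "\<beta> > 0"
  shows "cmod (dderiv f (axis Tau 1) x) \<le> 1/16"
proof -
  define h where "h = (\<lambda>z. f (x + z *s axis Tau 1))"
  have inD: "x + z *s axis Tau 1 \<in> pdom o1 o2 d \<beta>" if "cmod z < \<beta>" for z
    using x that abs_Im_le_cmod[of z] by (auto simp: pdom_def axis_def)
  have g: "gholo (pdom o1 o2 d \<beta>) f" and b: "\<And>x. x \<in> pdom o1 o2 d \<beta> \<Longrightarrow> cmod (f x) \<le> \<eta>"
    using f by (auto simp: admissible_dev_def)
  have h: "h holomorphic_on ball 0 \<beta>"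
    unfolding h_def using gholo_line_DERIV[OF g inD] by (auto simp: holomorphic_on_open intro!: exI)
  have "cmod ((deriv ^^ 1) h 0) \<le> fact 1 * \<eta> / (\<beta> / 2) ^ 1"
  proof (rule Cauchy_inequality)
    show "h holomorphic_on ball 0 (\<beta> / 2)" using h \<eta> by (rule_tac holomorphic_on_subset[OF h]) auto
    show "continuous_on (cball 0 (\<beta> / 2)) h"
      using holomorphic_on_imp_continuous_on[OF h] \<eta> by (rule_tac continuous_on_subset) auto
    show "cmod (h z) \<le> \<eta>" if "cmod (0 - z) = \<beta> / 2" for z
      unfolding h_def using that \<eta> by (intro b inD) auto
  qed (use \<eta> in auto)
  then have "cmod (dderiv f (axis Tau 1) x) \<le> \<eta> / (\<beta> / 2)" by (simp add: dderiv_def h_def)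
  also have "\<dots> \<le> 1/16" using \<eta> by (simp add: field_simps)
  finally show ?thesis .
qed

section \<open>Heliocentric form of Newton's equations\<close>

definition cubed :: "complex \<Rightarrow> complex" where
  "cubed z = z / of_real (cmod z ^ 3)"

lemma cubed_scale: "cubed (of_real c * cis \<phi> * z) = of_real c / of_real (\<bar>c\<bar> ^ 3) * cis \<phi> * cubed z"
  by (simp add: cubed_def norm_mult power_mult_distrib)

lemma cubed_minus: "cubed (- z) = - cubed z"
  by (simp add: cubed_def)

lemma cubed_scaleR: "cubed (c *\<^sub>R z) = (c / \<bar>c\<bar> ^ 3) *\<^sub>R cubed z"
  using cubed_scale[of c 0 z] by (simp add: scaleR_conv_of_real)

text \<open>Substituting \<open>X = A e\<^sup>i\<^sup>v\<^sup>t (1 + u (\<nu>t))\<close> into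
  Newton's law and cancelling the rotating factor gives \<open>orbit_ode\<close>; here this is read
  backwards. Kepler's law \<open>A\<^sup>3v\<^sup>2 = 1\<close> turns the factor
  \<open>v\<^sup>2\<close> into the scaling of the inverse-square force, and
  \<open>v' = v + s\<nu>\<close> moves the other planet into the same rotating frame.\<close>

lemma newton_planet:
  fixes v v' \<nu> A A' s mo mt \<mu> :: real
  assumes ode: "orbit_ode s mo mt (of_real (v / \<nu>)) (of_real (A' / A)) u w u' (of_real \<mu>)"
    and \<nu>: "\<nu> \<noteq> 0" and v': "v' = v + s * \<nu>" and A: "A > 0" "A ^ 3 * v\<^sup>2 = 1"
    and cnj: "\<And>t. cnj (u t) = u (- t)" "\<And>t. cnj (w t) = w (- t)"
  defines "X \<equiv> \<lambda>t. of_real A * cis (v * t) * (1 + u (\<nu> * t))"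
    and "Y \<equiv> \<lambda>t. of_real A' * cis (v' * t) * (1 + w (\<nu> * t))"
    and "X' \<equiv> \<lambda>t. of_real A * cis (v * t) * (\<i> * of_real v * (1 + u (\<nu> * t)) + of_real \<nu> * u' (\<nu> * t))"
  shows "(X has_vector_derivative X' t) (at t)"
    and "(X' has_vector_derivative - of_real (1 + \<mu> * mo) * cubed (X t)
       + of_real (\<mu> * mt) * (cubed (Y t - X t) - cubed (Y t))) (at t)"
proof -
  obtain u'' where Du: "\<And>t. (u has_vector_derivative u' t) (at t)" "\<And>t. (u' has_vector_derivative u'' t) (at t)"
    and eq: "\<And>t. u'' t + 2 * \<i> * of_real (v / \<nu>) * u' t - 3/2 * (of_real (v / \<nu>))\<^sup>2 * (u t + u (- t)) =
       (of_real (v / \<nu>))\<^sup>2 * nonlin mo mt (of_real \<mu>) (of_real (A' / A)) (cis (s * t)) (cis (- (s * t))) (u t) (u (- t)) (w t) (w (- t))"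
    using ode unfolding orbit_ode_def by blast
  have lin: "((\<lambda>t. \<nu> * t) has_vector_derivative \<nu>) (at t)" for t
    by (auto intro!: derivative_eq_intros)
  have Dun: "((\<lambda>t. u (\<nu> * t)) has_vector_derivative of_real \<nu> * u' (\<nu> * t)) (at t)"
    "((\<lambda>t. u' (\<nu> * t)) has_vector_derivative of_real \<nu> * u'' (\<nu> * t)) (at t)" for t
    using vector_diff_chain_at[OF lin Du(1)] vector_diff_chain_at[OF lin Du(2)]
    by (simp_all add: o_def scaleR_conv_of_real)
  have Dc: "((\<lambda>t. of_real A * cis (v * t)) has_vector_derivative of_real A * (\<i> * of_real v * cis (v * t))) (at t)" for t
  proof -
    have "((\<lambda>z. exp (\<i> * (of_real v * z))) has_field_derivative exp (\<i> * (of_real v * of_real t)) * (\<i> * of_real v)) (at (of_real t))"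
      by (auto intro!: derivative_eq_intros)
    from has_vector_derivative_real_field[OF this]
    have "((\<lambda>t. cis (v * t)) has_vector_derivative \<i> * of_real v * cis (v * t)) (at t)"
      by (simp add: cis_conv_exp mult_ac)
    then show ?thesis by (rule has_vector_derivative_mult_right)
  qed
  show "(X has_vector_derivative X' t) (at t)"
  proof -
    have "(X has_vector_derivative of_real A * cis (v * t) * (0 + of_real \<nu> * u' (\<nu> * t))
        + of_real A * (\<i> * of_real v * cis (v * t)) * (1 + u (\<nu> * t))) (at t)"
      unfolding X_def
      by (intro has_vector_derivative_mult Dc has_vector_derivative_add has_vector_derivative_const Dun)
    then show ?thesis by (simp add: X'_def algebra_simps)
  qed
  define \<tau> where "\<tau> = \<nu> * t"
  define N where "N = of_real mt * pert (of_real (A' / A)) (cis (s * \<tau>)) (cis (- (s * \<tau>))) (u \<tau>) (u (- \<tau>)) (w \<tau>) (w (- \<tau>))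
     - of_real mo * att (1 + u \<tau>) (1 + u (- \<tau>))"
  have D2: "(X' has_vector_derivative of_real A * cis (v * t) * (\<i> * of_real v * (0 + of_real \<nu> * u' \<tau>) + of_real \<nu> * (of_real \<nu> * u'' \<tau>))
        + of_real A * (\<i> * of_real v * cis (v * t)) * (\<i> * of_real v * (1 + u \<tau>) + of_real \<nu> * u' \<tau>)) (at t)"
    unfolding X'_def \<tau>_def
    by (intro has_vector_derivative_mult has_vector_derivative_mult_right Dc has_vector_derivative_add has_vector_derivative_const Dun)
  have nz: "complex_of_real \<nu> \<noteq> 0" "complex_of_real A \<noteq> 0" using \<nu> A by auto
  \<comment> \<open>Multiplication by \<open>\<nu>\<^sup>2\<close> returns from the relative angle
    to time; the linear terms of \<open>kepler_rem\<close> then cancel against those of the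
    operator, leaving the full Kepler force.\<close>
  have e1: "of_real \<nu> ^ 2 * u'' \<tau> + 2 * \<i> * of_real v * of_real \<nu> * u' \<tau> - of_real v ^ 2 * (1 + u \<tau>) =
     of_real v ^ 2 * (- att (1 + u \<tau>) (1 + u (- \<tau>)) + of_real \<mu> * N)"
  proof -
    have a1: "of_real \<nu> ^ 2 * (u'' \<tau> + 2 * \<i> * of_real (v / \<nu>) * u' \<tau> - 3/2 * (of_real (v / \<nu>))\<^sup>2 * (u \<tau> + u (- \<tau>))) =
       of_real \<nu> ^ 2 * ((of_real (v / \<nu>))\<^sup>2 * (kepler_rem (u \<tau>) (u (- \<tau>)) + of_real \<mu> * N))"
      unfolding eq by (simp add: nonlin_def N_def)
    have a2: "of_real \<nu> ^ 2 * (u'' \<tau> + 2 * \<i> * of_real (v / \<nu>) * u' \<tau> - 3/2 * (of_real (v / \<nu>))\<^sup>2 * (u \<tau> + u (- \<tau>))) =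
       of_real \<nu> ^ 2 * u'' \<tau> + 2 * \<i> * of_real v * of_real \<nu> * u' \<tau> - 3/2 * of_real v ^ 2 * (u \<tau> + u (- \<tau>))"
      using nz by (simp add: field_simps power2_eq_square)
    have a3: "of_real \<nu> ^ 2 * ((of_real (v / \<nu>))\<^sup>2 * (kepler_rem (u \<tau>) (u (- \<tau>)) + of_real \<mu> * N)) =
       of_real v ^ 2 * (kepler_rem (u \<tau>) (u (- \<tau>)) + of_real \<mu> * N)"
      using nz by (simp add: field_simps power2_eq_square)
    have "of_real \<nu> ^ 2 * u'' \<tau> + 2 * \<i> * of_real v * of_real \<nu> * u' \<tau> - 3/2 * of_real v ^ 2 * (u \<tau> + u (- \<tau>)) =
       of_real v ^ 2 * (kepler_rem (u \<tau>) (u (- \<tau>)) + of_real \<mu> * N)"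
      using a1 unfolding a2 a3 .
    then have "of_real \<nu> ^ 2 * u'' \<tau> + 2 * \<i> * of_real v * of_real \<nu> * u' \<tau> =
       3/2 * of_real v ^ 2 * (u \<tau> + u (- \<tau>)) + of_real v ^ 2 * (kepler_rem (u \<tau>) (u (- \<tau>)) + of_real \<mu> * N)"
      by (simp only: diff_eq_eq add.commute)
    then show ?thesis by (simp add: kepler_rem_def algebra_simps)
  qed
  have attX: "of_real A * cis (v * t) * of_real v ^ 2 * att z z' = cubed (of_real A * cis (v * t) * z)" if "z' = cnj z" for z z'
  proof -
    have "complex_of_real A ^ 3 * of_real v ^ 2 = 1" using A(2) by (metis of_real_1 of_real_mult of_real_power)
    then have "complex_of_real A * of_real v ^ 2 = of_real A / of_real A ^ 3"
      using nz by (simp add: field_simps power3_eq_cube)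
    then have "cubed (of_real A * cis (v * t) * z) = (of_real A * of_real v ^ 2) * cis (v * t) * cubed z"
      unfolding cubed_scale using A(1) by simp
    then show ?thesis unfolding that att_cnj_self cubed_def by (simp add: mult_ac)
  qed
  have cu: "1 + u (- \<tau>) = cnj (1 + u \<tau>)" "1 + w (- \<tau>) = cnj (1 + w \<tau>)" by (simp_all add: cnj)
  define C where "C = of_real (A' / A) * cis (s * \<tau>) * (1 + w \<tau>)"
  have C': "of_real (A' / A) * cis (- (s * \<tau>)) * (1 + w (- \<tau>)) = cnj C"
    by (simp add: C_def cis_cnj cnj)
  have YC: "Y t = of_real A * cis (v * t) * C"
  proof -
    have "cis (v' * t) = cis (v * t) * cis (s * \<tau>)" by (simp add: cis_mult v' \<tau>_def algebra_simps)
    then show ?thesis using nz by (simp add: Y_def C_def \<tau>_def)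
  qed
  have XC: "X t = of_real A * cis (v * t) * (1 + u \<tau>)" by (simp add: X_def \<tau>_def)
  have YX: "Y t - X t = of_real A * cis (v * t) * (C - (1 + u \<tau>))"
    unfolding YC XC by (simp only: right_diff_distrib)
  have N: "N = of_real mt * (att (C - (1 + u \<tau>)) (cnj (C - (1 + u \<tau>))) - att C (cnj C)) - of_real mo * att (1 + u \<tau>) (cnj (1 + u \<tau>))"
    unfolding N_def pert_def C_def[symmetric] C' cu(1) complex_cnj_diff ..
  have "of_real A * cis (v * t) * (\<i> * of_real v * (0 + of_real \<nu> * u' \<tau>) + of_real \<nu> * (of_real \<nu> * u'' \<tau>))
        + of_real A * (\<i> * of_real v * cis (v * t)) * (\<i> * of_real v * (1 + u \<tau>) + of_real \<nu> * u' \<tau>)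
     = of_real A * cis (v * t) * (of_real \<nu> ^ 2 * u'' \<tau> + 2 * \<i> * of_real v * of_real \<nu> * u' \<tau> - of_real v ^ 2 * (1 + u \<tau>))"
    by (simp add: algebra_simps power2_eq_square)
  also have "\<dots> = - (of_real A * cis (v * t) * of_real v ^ 2 * att (1 + u \<tau>) (cnj (1 + u \<tau>)))
      + of_real \<mu> * (of_real mt * (of_real A * cis (v * t) * of_real v ^ 2 * att (C - (1 + u \<tau>)) (cnj (C - (1 + u \<tau>)))
         - of_real A * cis (v * t) * of_real v ^ 2 * att C (cnj C))
         - of_real mo * (of_real A * cis (v * t) * of_real v ^ 2 * att (1 + u \<tau>) (cnj (1 + u \<tau>))))"
    unfolding e1 N cu(1) by (simp only: algebra_simps mult_minus_right)
  also have "\<dots> = - cubed (X t) + of_real \<mu> * (of_real mt * (cubed (Y t - X t) - cubed (Y t)) - of_real mo * cubed (X t))"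
    unfolding attX[OF refl] YX unfolding XC YC ..
  also have "\<dots> = - of_real (1 + \<mu> * mo) * cubed (X t) + of_real (\<mu> * mt) * (cubed (Y t - X t) - cubed (Y t))"
    by (simp add: algebra_simps)
  finally show "(X' has_vector_derivative - of_real (1 + \<mu> * mo) * cubed (X t)
       + of_real (\<mu> * mt) * (cubed (Y t - X t) - cubed (Y t))) (at t)"
    using D2 by simp
qed

lemma lessThan_3: "{..<3::nat} = {0, 1, 2}" by auto

lemma cubed_conv_scaleR: "(c / cmod z ^ 3) *\<^sub>R z = of_real c * cubed z"
  by (simp add: cubed_def scaleR_conv_of_real)

text \<open>Barycentric positions from the heliocentric \<open>x1\<close>, \<open>x2\<close>, for
  total mass \<open>1 + \<mu>\<close>, that is \<open>m1 + m2 = 1\<close>. By linearity the same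
  formula serves velocities and accelerations.\<close>

definition bary :: "real \<Rightarrow> real \<Rightarrow> real \<Rightarrow> complex \<Rightarrow> complex \<Rightarrow> nat \<Rightarrow> complex" where
  "bary \<mu> m1 m2 x1 x2 j = (if j = 0 then 0 else if j = 1 then x1 else x2)
     - of_real (\<mu> / (1 + \<mu>)) * (of_real m1 * x1 + of_real m2 * x2)"

lemma bary_DERIV:
  assumes "(X1 has_vector_derivative d1) (at t)" "(X2 has_vector_derivative d2) (at t)"
  shows "((\<lambda>t. bary \<mu> m1 m2 (X1 t) (X2 t) j) has_vector_derivative bary \<mu> m1 m2 d1 d2 j) (at t)"
proof -
  have "((\<lambda>t. if j = 0 then 0 else if j = 1 then X1 t else X2 t) has_vector_derivative
      (if j = 0 then 0 else if j = 1 then d1 else d2)) (at t)"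
    using assms by auto
  then show ?thesis
    unfolding bary_def
    by (intro has_vector_derivative_diff has_vector_derivative_mult_right has_vector_derivative_add assms)
qed

text \<open>The length factor \<open>c = \<mu>\<^sup>-\<^sup>1\<^sup>/\<^sup>3\<close> satisfies
  \<open>c\<^sup>3\<mu> = 1\<close> and so absorbs the gravitational constant
  \<open>1/\<mu>\<close>; the rest is the passage from heliocentric to barycentric
  coordinates.\<close>

lemma three_body_solution_bary:
  fixes \<mu> m1 m2 :: real
  assumes \<mu>: "\<mu> > 0" and m: "m1 + m2 = 1"
    and D1: "\<And>t. (X1 has_vector_derivative X1' t) (at t)" and D2: "\<And>t. (X2 has_vector_derivative X2' t) (at t)"
    and E1: "\<And>t. (X1' has_vector_derivative - of_real (1 + \<mu> * m1) * cubed (X1 t)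
       + of_real (\<mu> * m2) * (cubed (X2 t - X1 t) - cubed (X2 t))) (at t)"
    and E2: "\<And>t. (X2' has_vector_derivative - of_real (1 + \<mu> * m2) * cubed (X2 t)
       + of_real (\<mu> * m1) * (cubed (X1 t - X2 t) - cubed (X1 t))) (at t)"
    and nc: "\<And>t. X1 t \<noteq> 0" "\<And>t. X2 t \<noteq> 0" "\<And>t. X1 t \<noteq> X2 t"
  defines "c \<equiv> inverse (\<mu> powr (1/3))"
  defines "r \<equiv> \<lambda>j t. of_real c * bary \<mu> m1 m2 (X1 t) (X2 t) j"
  shows "three_body_solution \<mu> m1 m2 r"
    and "velocity r j t = of_real c * bary \<mu> m1 m2 (X1' t) (X2' t) j"
proof -
  have c: "c > 0" using \<mu> by (simp add: c_def)
  have "(\<mu> powr (1/3)) ^ 3 = \<mu>" using \<mu> by (simp add: powr_power)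
  then have c3: "c ^ 3 * \<mu> = 1" using \<mu> by (simp add: c_def power_inverse)
  have Dr: "(r j has_vector_derivative of_real c * bary \<mu> m1 m2 (X1' t) (X2' t) j) (at t)" for j t
    unfolding r_def by (intro has_vector_derivative_mult_right bary_DERIV D1 D2)
  have vel: "velocity r j t = of_real c * bary \<mu> m1 m2 (X1' t) (X2' t) j" for j t
    unfolding velocity_def by (rule vector_derivative_at[OF Dr])
  then show "velocity r j t = of_real c * bary \<mu> m1 m2 (X1' t) (X2' t) j" .
  define P1 where "P1 = (\<lambda>t. - of_real (1 + \<mu> * m1) * cubed (X1 t) + of_real (\<mu> * m2) * (cubed (X2 t - X1 t) - cubed (X2 t)))"
  define P2 where "P2 = (\<lambda>t. - of_real (1 + \<mu> * m2) * cubed (X2 t) + of_real (\<mu> * m1) * (cubed (X1 t - X2 t) - cubed (X1 t)))"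
  have Dv: "(velocity r j has_vector_derivative of_real c * bary \<mu> m1 m2 (P1 t) (P2 t) j) (at t)" for j t
    unfolding vel[abs_def] P1_def P2_def by (intro has_vector_derivative_mult_right bary_DERIV E1 E2)
  have df: "r 1 t - r 0 t = c *\<^sub>R X1 t" "r 2 t - r 0 t = c *\<^sub>R X2 t" "r 0 t - r 1 t = c *\<^sub>R (- X1 t)"
    "r 0 t - r 2 t = c *\<^sub>R (- X2 t)" "r 2 t - r 1 t = c *\<^sub>R (X2 t - X1 t)" "r 1 t - r 2 t = c *\<^sub>R (X1 t - X2 t)" for t
    by (simp_all add: r_def bary_def scaleR_conv_of_real algebra_simps)
  have cc: "cubed (c *\<^sub>R z) = of_real (\<mu> * c) * cubed z" for z
  proof -
    have "c / \<bar>c\<bar> ^ 3 = \<mu> * c"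
      using c c3 by (simp add: field_simps)
    then show ?thesis unfolding cubed_scaleR by (simp add: scaleR_conv_of_real)
  qed
  have cdf: "cubed (r 1 t - r 0 t) = of_real (\<mu> * c) * cubed (X1 t)" "cubed (r 2 t - r 0 t) = of_real (\<mu> * c) * cubed (X2 t)"
    "cubed (r 0 t - r 1 t) = - (of_real (\<mu> * c) * cubed (X1 t))" "cubed (r 0 t - r 2 t) = - (of_real (\<mu> * c) * cubed (X2 t))"
    "cubed (r 2 t - r 1 t) = of_real (\<mu> * c) * cubed (X2 t - X1 t)" "cubed (r 1 t - r 2 t) = of_real (\<mu> * c) * cubed (X1 t - X2 t)" for t
    unfolding df cc cubed_minus mult_minus_right by (rule refl)+
  have "m2 = 1 - m1" using m by simp
  then have mm: "complex_of_real m2 = 1 - of_real m1" by simp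
  have mu1: "1 + complex_of_real \<mu> \<noteq> 0" "complex_of_real \<mu> \<noteq> 0" using \<mu> by (auto simp: complex_eq_iff)
  \<comment> \<open>The mutual attractions of the planets cancel in the weighted sum. What remains
    is the pull of the Sun enlarged by \<open>1 + \<mu>\<close>, which cancels the denominator in
    \<open>bary\<close>.\<close>
  have sumP: "of_real m1 * P1 t + of_real m2 * P2 t = - (1 + of_real \<mu>) * (of_real m1 * cubed (X1 t) + of_real m2 * cubed (X2 t))" for t
  proof -
    have "cubed (X1 t - X2 t) = - cubed (X2 t - X1 t)" by (simp add: cubed_def norm_minus_commute diff_divide_distrib)
    then show ?thesis unfolding P1_def P2_def by (simp add: mm algebra_simps)
  qed
  have cen: "of_real (\<mu> / (1 + \<mu>)) * (of_real m1 * P1 t + of_real m2 * P2 t) = - (of_real \<mu> * (of_real m1 * cubed (X1 t) + of_real m2 * cubed (X2 t)))" for t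
  proof -
    have "of_real (\<mu> / (1 + \<mu>)) * (- (1 + of_real \<mu>) * z) = - (of_real \<mu> * z)" for z :: complex
      using mu1 by (simp add: field_simps)
    then show ?thesis unfolding sumP .
  qed
  have b: "bary \<mu> m1 m2 (P1 t) (P2 t) j = (if j = 0 then 0 else if j = 1 then P1 t else P2 t)
      + of_real \<mu> * (of_real m1 * cubed (X1 t) + of_real m2 * cubed (X2 t))" for j t
    unfolding bary_def cen by simp
  have newton: "of_real c * bary \<mu> m1 m2 (P1 t) (P2 t) j =
     (\<Sum>k\<in>{..<3} - {j}. ((1 / \<mu>) * body_mass \<mu> m1 m2 k / cmod (r k t - r j t) ^ 3) *\<^sub>R (r k t - r j t))" if "j < 3" for j t
  proof -
    consider "j = 0" | "j = 1" | "j = 2" using \<open>j < 3\<close> by linarith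
    then show ?thesis
    proof cases
      case 1
      then have "{..<3} - {j} = {1, 2}" by auto
      then show ?thesis
        using mu1 unfolding cubed_conv_scaleR b
        by (simp add: 1 cdf body_mass_def algebra_simps del: One_nat_def)
    next
      case 2
      then have "{..<3} - {j} = {0, 2}" by auto
      then show ?thesis
        using mu1 unfolding cubed_conv_scaleR b
        by (simp add: 2 cdf body_mass_def P1_def algebra_simps del: One_nat_def)
    next
      case 3
      then have "{..<3} - {j} = {0, 1}" by auto
      then show ?thesis
        using mu1 unfolding cubed_conv_scaleR b
        by (simp add: 3 cdf body_mass_def P2_def algebra_simps del: One_nat_def)
    qed
  qed
  have zero: "(\<Sum>j<3. body_mass \<mu> m1 m2 j *\<^sub>R (of_real c * bary \<mu> m1 m2 x y j)) = 0" for x y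
  proof -
    have "(\<Sum>j<3. body_mass \<mu> m1 m2 j *\<^sub>R (of_real c * bary \<mu> m1 m2 x y j)) =
      of_real c * (of_real \<mu> * (of_real m1 * x + of_real m2 * y)
        - (1 + of_real \<mu> * (of_real m1 + of_real m2)) * (of_real (\<mu> / (1 + \<mu>)) * (of_real m1 * x + of_real m2 * y)))"
    proof -
      define q where "q = complex_of_real (\<mu> / (1 + \<mu>))"
      show ?thesis
        unfolding lessThan_3 bary_def q_def[symmetric]
        by (simp add: body_mass_def scaleR_conv_of_real algebra_simps)
    qed
    also have "\<dots> = 0" unfolding mm using mu1 by simp
    finally show ?thesis .
  qed
  show "three_body_solution \<mu> m1 m2 r"
    unfolding three_body_solution_def
  proof (intro conjI allI impI)
    show "inj_on (\<lambda>j. r j t) {..<3}" for t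
    proof -
      have "r 0 t \<noteq> r 1 t" "r 0 t \<noteq> r 2 t" "r 1 t \<noteq> r 2 t"
        using df[of t] nc[of t] c by (metis cancel_comm_monoid_add_class.diff_cancel scaleR_eq_0_iff less_irrefl right_minus_eq)+
      then show ?thesis unfolding lessThan_3 by (auto simp: inj_on_def)
    qed
    show "(r j has_vector_derivative velocity r j t) (at t)" if "j < 3" for t j
      unfolding vel by (rule Dr)
    show "(velocity r j has_vector_derivative (\<Sum>k\<in>{..<3} - {j}. ((1 / \<mu>) * body_mass \<mu> m1 m2 k / cmod (r k t - r j t) ^ 3) *\<^sub>R (r k t - r j t))) (at t)" if "j < 3" for t j
      unfolding newton[OF that, symmetric] by (rule Dv)
    show "(\<Sum>j<3. body_mass \<mu> m1 m2 j *\<^sub>R r j t) = 0" for t unfolding r_def by (rule zero)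
    show "(\<Sum>j<3. momentum \<mu> m1 m2 r j t) = 0" for t unfolding momentum_def vel by (rule zero)
  qed
qed

text \<open>Once positions and velocities are multiplied by
  \<open>\<mu>\<^sup>1\<^sup>/\<^sup>3\<close>, the remaining factors contain only \<omega> and the
  masses. Hence the tori can be written down by formulas that make sense for \<mu> \<le> 0.\<close>

lemma phase_point_scaled:
  assumes "\<omega> > 0" "\<mu> > 0"
  shows "phase_point \<omega> \<mu> m1 m2 r t =
    ((\<omega> powr (2/3) * \<mu> powr (1/3)) *\<^sub>R (r 1 t - r 0 t), (\<omega> powr (2/3) * \<mu> powr (1/3)) *\<^sub>R (r 2 t - r 0 t),
     (m1 * \<omega> powr (-1/3) * \<mu> powr (1/3)) *\<^sub>R velocity r 1 t, (m2 * \<omega> powr (-1/3) * \<mu> powr (1/3)) *\<^sub>R velocity r 2 t)"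
proof -
  have "\<mu> * scale \<omega> \<mu> = (\<omega> powr (1/3) * \<mu> powr (2/3)) ^ 2"
    using assms by (simp add: scale_def power_mult_distrib powr_power powr_add[symmetric] powr_mult_base)
  then have "sqrt (\<mu> * scale \<omega> \<mu>) = \<omega> powr (1/3) * \<mu> powr (2/3)" by simp
  then have "1 / sqrt (\<mu> * scale \<omega> \<mu>) * \<mu> = \<omega> powr (-1/3) * \<mu> powr (1/3)"
    using assms by (simp add: powr_minus_divide divide_simps) (simp add: powr_add[symmetric] mult.assoc)
  then have sc: "1 / sqrt (\<mu> * scale \<omega> \<mu>) * (\<mu> * m) = m * \<omega> powr (-1/3) * \<mu> powr (1/3)" for m
    by (metis mult.assoc mult.commute)
  have "(1 / sqrt (\<mu> * scale \<omega> \<mu>)) *\<^sub>R (\<mu> * m) *\<^sub>R z = (m * \<omega> powr (-1/3) * \<mu> powr (1/3)) *\<^sub>R z" for m and z :: complex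
    unfolding scaleR_scaleR sc ..
  then show ?thesis
    unfolding phase_point_def Let_def momentum_def body_mass_def
    by (simp only: scale_def if_True if_False refl one_neq_zero zero_neq_numeral numeral_eq_one_iff semiring_norm)
qed

section \<open>The family of invariant tori\<close>

lemma half_le_sin:
  fixes y :: real
  assumes "0 \<le> y" "y \<le> pi / 2" shows "y / 2 \<le> sin y"
proof (cases "y \<le> pi / 3")
  case True
  have "sin 0 - 0 / 2 \<le> sin y - y / 2"
  proof (rule DERIV_nonneg_imp_nondecreasing[OF assms(1)])
    fix x assume x: "0 \<le> x" "x \<le> y"
    have "cos (pi / 3) \<le> cos x" using x True pi_gt_zero by (intro cos_monotone_0_pi_le) auto
    then show "\<exists>D. ((\<lambda>y. sin y - y / 2) has_real_derivative D) (at x) \<and> 0 \<le> D"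
      by (intro exI[of _ "cos x - 1 / 2"]) (auto intro!: derivative_eq_intros simp: cos_60)
  qed
  then show ?thesis by simp
next
  case False
  have "sin (pi / 3) \<le> sin y" using False assms pi_gt_zero by (intro sin_monotone_2pi_le) auto
  moreover have "sqrt 3 / 2 \<ge> pi / 4" using pi_less_4
  proof -
    have "pi \<le> 3.2" using pi_approx by simp
    moreover have "1.7 \<le> sqrt 3" by (rule real_le_rsqrt) (simp add: power2_eq_square)
    ultimately show ?thesis by simp
  qed
  ultimately show ?thesis using assms by (simp add: sin_60)
qed

lemma cis_dist_lower:
  fixes x y :: real
  assumes "\<bar>x - y\<bar> \<le> pi" shows "\<bar>x - y\<bar> / 2 \<le> cmod (cis x - cis y)"
proof -
  define m z where "m = (x + y) / 2" and "z = (x - y) / 2"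
  have xy: "x = m + z" "y = m - z" by (simp_all add: m_def z_def field_simps)
  have "cis x - cis y = 2 * \<i> * of_real (sin z) * cis m"
    unfolding xy by (simp add: complex_eq_iff cos_add sin_add cos_diff sin_diff)
  then have "cmod (cis x - cis y) = 2 * \<bar>sin z\<bar>" by (simp add: norm_mult)
  moreover have "\<bar>z\<bar> / 2 \<le> \<bar>sin z\<bar>"
  proof -
    have z: "\<bar>z\<bar> \<le> pi / 2" using assms by (simp add: z_def)
    show ?thesis
    proof (cases "z \<ge> 0")
      case True then show ?thesis using half_le_sin[of z] z by simp
    next
      case False then show ?thesis using half_le_sin[of "- z"] z by simp
    qed
  qed
  ultimately show ?thesis by (simp add: z_def)
qed

text \<open>The slowly varying factors \<open>p, q\<close> cannot compensate the rotation of the relative phase.\<close>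

lemma perturbed_rotation_inj:
  fixes p q :: "real \<Rightarrow> complex"
  assumes D: "\<And>t. (p has_vector_derivative p' t) (at t)" "\<And>t. (q has_vector_derivative q' t) (at t)"
    and b: "\<And>t. cmod (p t) \<le> 1/32" "\<And>t. cmod (q t) \<le> 1/32" "\<And>t. cmod (p' t) \<le> 1/16" "\<And>t. cmod (q' t) \<le> 1/16"
    and eq: "cis x * (1 + q x) * (1 + p y) = cis y * (1 + q y) * (1 + p x)" and xy: "\<bar>x - y\<bar> \<le> pi"
  shows "x = y"
proof -
  have lip: "cmod (h x - h y) \<le> 1/16 * \<bar>x - y\<bar>"
    if "\<And>t. (h has_vector_derivative h' t) (at t)" "\<And>t. cmod (h' t) \<le> 1/16" for h h' :: "real \<Rightarrow> complex"
  proof -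
    have "onorm (\<lambda>s. s *\<^sub>R h' t) \<le> 1/16" for t
    proof (rule onorm_le)
      fix s :: real
      have "\<bar>s\<bar> * cmod (h' t) \<le> \<bar>s\<bar> * (1/16)" by (intro mult_left_mono that) auto
      then show "norm (s *\<^sub>R h' t) \<le> 1/16 * norm s" by simp
    qed
    then show ?thesis
      using differentiable_bound[of UNIV h "\<lambda>t s. s *\<^sub>R h' t" "1/16" x y] that(1)
      by (simp add: has_vector_derivative_def)
  qed
  have lp: "cmod (p x - p y) \<le> 1/16 * \<bar>x - y\<bar>" by (rule lip[OF D(1) b(3)])
  have lq: "cmod (q x - q y) \<le> 1/16 * \<bar>x - y\<bar>" by (rule lip[OF D(2) b(4)])
  have up: "cmod (1 + h) \<le> 33/32" "31/32 \<le> cmod (1 + h)" if "cmod h \<le> 1/32" for h :: complex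
    using norm_triangle_ineq[of 1 h] norm_diff_ineq[of 1 h] that by auto
  have "(cis x - cis y) * ((1 + q x) * (1 + p y)) = cis y * ((1 + q y) * (p x - p y) - (q x - q y) * (1 + p y))"
    using eq by (simp add: algebra_simps)
  then have "cmod (cis x - cis y) * (cmod (1 + q x) * cmod (1 + p y)) =
      cmod ((1 + q y) * (p x - p y) - (q x - q y) * (1 + p y))"
    by (metis norm_mult norm_cis mult_1)
  also have "\<dots> \<le> 33/32 * (1/16 * \<bar>x - y\<bar>) + 1/16 * \<bar>x - y\<bar> * (33/32)"
    by (rule order_trans[OF norm_triangle_ineq4])
      (unfold norm_mult, intro add_mono mult_mono lp lq up b, auto)
  finally have 1: "cmod (cis x - cis y) * (cmod (1 + q x) * cmod (1 + p y)) \<le> 33/256 * \<bar>x - y\<bar>" by simp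
  \<comment> \<open>The constant on the left is about 0.47 and exceeds the \<open>33/256\<close> of
    the upper bound, so \<open>x - y\<close> must vanish.\<close>
  have "\<bar>x - y\<bar> / 2 * (31/32 * (31/32)) \<le> cmod (cis x - cis y) * (cmod (1 + q x) * cmod (1 + p y))"
    by (intro mult_mono cis_dist_lower[OF xy] up b) auto
  with 1 have "\<bar>x - y\<bar> / 2 * (31/32 * (31/32)) \<le> 33/256 * \<bar>x - y\<bar>" by linarith
  then show ?thesis by simp
qed

text \<open>Points of a half-open period may be almost \<open>2\<pi>\<close> apart; shifting one by
  a period brings them within \<pi>, and the equality obtained in that case contradicts the
  range.\<close>

lemma perturbed_rotation_inj_period:
  fixes p q :: "real \<Rightarrow> complex"
  assumes D: "\<And>t. (p has_vector_derivative p' t) (at t)" "\<And>t. (q has_vector_derivative q' t) (at t)"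
    and b: "\<And>t. cmod (p t) \<le> 1/32" "\<And>t. cmod (q t) \<le> 1/32" "\<And>t. cmod (p' t) \<le> 1/16" "\<And>t. cmod (q' t) \<le> 1/16"
    and eq: "cis x * (1 + q x) * (1 + p y) = cis y * (1 + q y) * (1 + p x)"
    and per: "\<And>t. p (t + 2*pi) = p t" "\<And>t. q (t + 2*pi) = q t"
    and xy: "x \<in> {0..<2*pi}" "y \<in> {0..<2*pi}"
  shows "x = y"
proof -
  have main: "x = z" if "\<bar>x - z\<bar> \<le> pi" "p z = p y" "q z = q y" "cis z = cis y" for z
    by (rule perturbed_rotation_inj[OF D b]) (use eq that in simp_all)
  have c: "cis (y + 2*pi) = cis y" "cis (y - 2*pi) = cis y"
    using cos_periodic[of "y - 2*pi"] sin_periodic[of "y - 2*pi"] by (simp_all add: complex_eq_iff)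
  have per': "p (y - 2*pi) = p y" "q (y - 2*pi) = q y" using per[of "y - 2*pi"] by simp_all
  consider "\<bar>x - y\<bar> \<le> pi" | "x - y > pi" | "y - x > pi" by linarith
  then show ?thesis
  proof cases
    case 1 then show ?thesis by (rule main) simp_all
  next
    case 2
    then have "x = y + 2*pi" using xy by (intro main per c) auto
    then show ?thesis using xy by auto
  next
    case 3
    then have "x = y - 2*pi" using xy by (intro main per' c) auto
    then show ?thesis using xy by auto
  qed
qed

section \<open>Parametrization of the tori by two angles\<close>

definition emb :: "(real \<times> real \<times> real) \<times> real \<times> real \<Rightarrow> pvec" where
  "emb q = (case q of ((\<mu>, v1, v2), a, b) \<Rightarrow>
     (\<chi> i. of_real (case i of Mu \<Rightarrow> \<mu> | V1 \<Rightarrow> v1 | V2 \<Rightarrow> v2 | Tau \<Rightarrow> b | Ang \<Rightarrow> a)))"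

lemma emb_nth [simp]:
  "emb ((\<mu>, v1, v2), a, b) $ Mu = of_real \<mu>" "emb ((\<mu>, v1, v2), a, b) $ V1 = of_real v1"
  "emb ((\<mu>, v1, v2), a, b) $ V2 = of_real v2" "emb ((\<mu>, v1, v2), a, b) $ Tau = of_real b"
  "emb ((\<mu>, v1, v2), a, b) $ Ang = of_real a"
  by (simp_all add: emb_def)

lemma bounded_linear_emb: "bounded_linear emb"
proof -
  have "linear emb"
  proof (rule linearI)
    show "emb (x + y) = emb x + emb y" for x y
      by (cases x rule: prod.exhaust; cases y rule: prod.exhaust)
        (auto simp: emb_def vec_eq_iff split: prod.splits coord.splits)
    show "emb (r *\<^sub>R x) = r *\<^sub>R emb x" for r x
      by (auto simp: emb_def vec_eq_iff scaleR_conv_of_real[where 'a = complex] split: prod.splits coord.splits)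
  qed
  then show ?thesis by (simp add: linear_conv_bounded_linear)
qed

text \<open>The fixed point lives on a domain with a coordinate \<open>Ang\<close>, and
  \<open>admissible_dev\<close> does not restrict its dependence on it. Evaluating at angle zero
  makes the equivariance under rotations exact.\<close>

definition noang :: "pvec \<Rightarrow> pvec" where
  "noang x = (\<chi> i. if i = Ang then 0 else x $ i)"

lemma noang_nth [simp]: "noang x $ Ang = 0" "i \<noteq> Ang \<Longrightarrow> noang x $ i = x $ i"
  by (simp_all add: noang_def)

lemma noang_emb: "noang (emb (p, a, b)) = emb (p, 0, b)"
  by (cases p) (auto simp: noang_def emb_def vec_eq_iff split: coord.splits)

lemma tshift_emb: "tshift (emb (p, a, b)) t = emb (p, a, b + t)"
  by (cases p) (auto simp: tshift_def axis_def emb_def vec_eq_iff split: coord.splits)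

lemma treflect_emb: "treflect (emb (p, a, b)) = emb (p, a, - b)"
  by (cases p) (auto simp: treflect_def emb_def vec_eq_iff split: coord.splits)

lemma realpt_emb: "realpt (emb q)"
  by (auto simp: realpt_def emb_def split: prod.splits)

definition tpos :: "coord \<Rightarrow> (pvec \<Rightarrow> complex) \<Rightarrow> (pvec \<Rightarrow> complex) \<Rightarrow> pvec \<Rightarrow> complex" where
  "tpos i \<phi> h x = rad (x $ i) * exp (\<i> * \<phi> x) * (1 + h (noang x))"

text \<open>The derivative of \<open>tpos\<close> along the linear flow \<open>Ang' = V1\<close>,
  \<open>Tau' = nu\<close>: the phases \<open>Ang\<close> and \<open>Ang + Tau\<close> then advance
  with the frequencies \<open>V1\<close> and \<open>V2\<close>.\<close>

definition tvel :: "coord \<Rightarrow> (pvec \<Rightarrow> complex) \<Rightarrow> (pvec \<Rightarrow> complex) \<Rightarrow> pvec \<Rightarrow> complex" where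
  "tvel i \<phi> h x = rad (x $ i) * exp (\<i> * \<phi> x) *
     (\<i> * x $ i * (1 + h (noang x)) + nu x * dderiv h (axis Tau 1) (noang x))"

locale deviations =
  fixes o1 o2 m1 m2 d \<beta> \<eta> :: real and f g :: "pvec \<Rightarrow> complex"
  assumes o: "o1 \<noteq> 0" "o2 \<noteq> 0"
    and d: "d > 0" "d \<le> 1/2" and \<beta>: "\<beta> > 0" and \<eta>: "0 < \<eta>" "\<eta> \<le> 1/32" "\<eta> \<le> \<beta>/32"
    and f: "admissible_dev (pdom o1 o2 d \<beta>) \<eta> f" and g: "admissible_dev (pdom o1 o2 d \<beta>) \<eta> g"
    and freq: "\<And>x. x \<in> pdom o1 o2 d \<beta> \<Longrightarrow> Re ((x $ V1)\<^sup>2) > 0 \<and> Re ((x $ V2)\<^sup>2) > 0 \<and> x $ V1 \<noteq> 0 \<and> x $ V2 \<noteq> 0 \<and> nu x \<noteq> 0"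
    and admd: "\<And>x a b c d'. x \<in> pdom o1 o2 d \<beta> \<Longrightarrow> cmod a \<le> \<eta> \<Longrightarrow> cmod b \<le> \<eta> \<Longrightarrow> cmod c \<le> \<eta> \<Longrightarrow> cmod d' \<le> \<eta> \<Longrightarrow>
       adm (gam x) (ex x) (ex' x) a b c d'"
    and ode: "\<And>x0. x0 \<in> pdom o1 o2 d \<beta> \<Longrightarrow> x0 $ Tau = 0 \<Longrightarrow>
       orbit_ode 1 m1 m2 (kap1 x0) (gam x0) (\<lambda>t. f (tshift x0 t)) (\<lambda>t. g (tshift x0 t))
         (\<lambda>t. dderiv f (axis Tau 1) (tshift x0 t)) (x0 $ Mu) \<and>
       orbit_ode (-1) m2 m1 (kap2 x0) (inverse (gam x0)) (\<lambda>t. g (tshift x0 t)) (\<lambda>t. f (tshift x0 t))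
         (\<lambda>t. dderiv g (axis Tau 1) (tshift x0 t)) (x0 $ Mu)"
begin

abbreviation "S \<equiv> pdom o1 o2 d \<beta>"

text \<open>An open set around the closed parameter ball, as demanded by
  \<open>smooth_torus_family\<close>.\<close>

definition W :: "(real \<times> real \<times> real) set" where
  "W = {(\<mu>, v1, v2). \<bar>\<mu>\<bar> < d \<and> \<bar>v1 - o1\<bar> < d \<and> \<bar>v2 - o2\<bar> < d}"

lemma open_W: "open W"
  unfolding W_def case_prod_unfold by (intro open_Collect_conj open_Collect_less continuous_intros)

lemma emb_S: "p \<in> W \<Longrightarrow> emb (p, \<theta>) \<in> S"
  using \<beta> by (cases p; cases \<theta>) (auto simp: W_def pdom_def simp flip: of_real_diff)

lemma noang_S: "x \<in> S \<Longrightarrow> noang x \<in> S"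
  by (simp add: pdom_def)

lemma gholo_noang:
  assumes h: "gholo S h" shows "gholo S (\<lambda>x. h (noang x))"
proof -
  have c: "continuous_on S noang"
    unfolding noang_def[abs_def]
  proof (intro continuous_on_vec_lambda)
    fix i show "continuous_on S (\<lambda>x. if i = Ang then 0 else x $ i)"
      by (cases "i = Ang") (auto intro!: continuous_intros)
  qed
  have "noang ` S \<subseteq> S" using noang_S by auto
  moreover have "noang (x + z *s v) = noang x + z *s noang v" for x v z
    by (simp add: noang_def vec_eq_iff)
  ultimately show ?thesis by (rule gholo_affine[OF h c])
qed

lemma gholo_tpos_tvel:
  assumes h: "gholo S h" and \<phi>: "gholo S \<phi>" and i: "i = V1 \<or> i = V2"
  shows "gholo S (tpos i \<phi> h)" "gholo S (tvel i \<phi> h)"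
proof -
  have r: "gholo S (\<lambda>x. rad (x $ i))" using freq i by (intro gholo_rad) auto
  have e: "gholo S (\<lambda>x. exp (\<i> * \<phi> x))" by (intro gholo_exp gholo_mult gholo_const \<phi>)
  have n: "gholo S nu" unfolding nu_def[abs_def] by auto
  show "gholo S (tpos i \<phi> h)"
    unfolding tpos_def[abs_def] by (intro gholo_mult gholo_add gholo_const r e gholo_noang h)
  show "gholo S (tvel i \<phi> h)"
    unfolding tvel_def[abs_def]
    by (intro gholo_mult gholo_add gholo_const r e n gholo_noang h gholo_component gholo_dderiv open_pdom)
qed

abbreviation "\<phi>1 \<equiv> \<lambda>x::pvec. x $ Ang"
abbreviation "\<phi>2 \<equiv> \<lambda>x::pvec. x $ Ang + x $ Tau"

text \<open>Minus the barycentric velocity of the Sun; subtracting it turns heliocentric velocities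
  of the planets into barycentric ones. It stays regular for \<mu> \<le> 0 because
  \<open>d \<le> 1/2\<close>.\<close>

definition tmean :: "pvec \<Rightarrow> complex" where
  "tmean x = x $ Mu / (1 + x $ Mu) * (of_real m1 * tvel V1 \<phi>1 f x + of_real m2 * tvel V2 \<phi>2 g x)"

text \<open>The scaling parameter enters only here, through constant factors; the deviations and
  \<open>d\<close> do not involve it, so \<mu>0 is uniform in it.\<close>

definition torus_map :: "real \<Rightarrow> (real \<times> real \<times> real) \<times> real \<times> real \<Rightarrow> phase" where
  "torus_map \<omega> q = (let x = emb q in
     (of_real (\<omega> powr (2/3)) * tpos V1 \<phi>1 f x, of_real (\<omega> powr (2/3)) * tpos V2 \<phi>2 g x,
      of_real (m1 * \<omega> powr (-1/3)) * (tvel V1 \<phi>1 f x - tmean x),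
      of_real (m2 * \<omega> powr (-1/3)) * (tvel V2 \<phi>2 g x - tmean x)))"

lemma smooth_torus_map: "smooth_on (torus_map \<omega>) (W \<times> UNIV)"
proof -
  have fg: "gholo S f" "gholo S g" using f g by (auto simp: admissible_dev_def)
  have \<phi>: "gholo S \<phi>1" "gholo S \<phi>2" by auto
  have p: "gholo S (tpos V1 \<phi>1 f)" "gholo S (tpos V2 \<phi>2 g)" "gholo S (tvel V1 \<phi>1 f)" "gholo S (tvel V2 \<phi>2 g)"
    using gholo_tpos_tvel[OF fg(1) \<phi>(1)] gholo_tpos_tvel[OF fg(2) \<phi>(2)] by auto
  have mz: "1 + x $ Mu \<noteq> 0" if "x \<in> S" for x
  proof
    assume "1 + x $ Mu = 0"
    then have "x $ Mu = -1" by (simp add: eq_neg_iff_add_eq_0 add.commute)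
    then show False using that d by (simp add: pdom_def)
  qed
  have m: "gholo S tmean"
    unfolding tmean_def[abs_def] by (intro gholo_mult gholo_divide gholo_add gholo_const gholo_component p mz)
  have op: "open (W \<times> (UNIV :: (real \<times> real) set))" by (intro open_Times open_W open_UNIV)
  have sub: "emb ` (W \<times> UNIV) \<subseteq> S" using emb_S by auto
  note sm = smooth_on_gholo[OF open_pdom _ bounded_linear_emb op sub]
  show ?thesis
    unfolding torus_map_def Let_def
    by (intro smooth_on_Pair op sm[of "\<lambda>x. of_real (\<omega> powr (2/3)) * tpos V1 \<phi>1 f x"]
      sm[of "\<lambda>x. of_real (\<omega> powr (2/3)) * tpos V2 \<phi>2 g x"]
      sm[of "\<lambda>x. of_real (m1 * \<omega> powr (-1/3)) * (tvel V1 \<phi>1 f x - tmean x)"]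
      sm[of "\<lambda>x. of_real (m2 * \<omega> powr (-1/3)) * (tvel V2 \<phi>2 g x - tmean x)"]
      gholo_mult gholo_diff gholo_const p m)
qed

section \<open>Embedding and dynamics for fixed real parameters\<close>

context
  fixes \<mu> v1 v2 :: real
  assumes p: "(\<mu>, v1, v2) \<in> W"
begin

abbreviation "pp \<equiv> (\<mu>, v1, v2)"

definition "u1 t = f (emb (pp, 0, t))"
definition "u2 t = g (emb (pp, 0, t))"
definition "du1 t = dderiv f (axis Tau 1) (emb (pp, 0, t))"
definition "du2 t = dderiv g (axis Tau 1) (emb (pp, 0, t))"
definition "A1 = \<bar>v1\<bar> powr (-2/3)"
definition "A2 = \<bar>v2\<bar> powr (-2/3)"

lemma v_nonzero: "v1 \<noteq> 0" "v2 \<noteq> 0" "v2 - v1 \<noteq> 0"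
  using freq[OF emb_S[OF p, of "(0, 0)"]] by (auto simp: nu_def simp flip: of_real_diff)

lemma A_pos: "A1 > 0" "A2 > 0"
  using v_nonzero by (auto simp: A1_def A2_def)

lemma A_cube: "A1 ^ 3 * v1\<^sup>2 = 1" "A2 ^ 3 * v2\<^sup>2 = 1"
proof -
  have "(\<bar>v\<bar> powr (-2/3)) ^ 3 * v\<^sup>2 = 1" if "v \<noteq> 0" for v :: real
  proof -
    have "complex_of_real ((\<bar>v\<bar> powr (-2/3)) ^ 3 * v\<^sup>2) = 1"
      using rad_cube[OF that] by (simp add: rad_of_real[OF that])
    then show ?thesis by (simp only: of_real_eq_1_iff)
  qed
  then show "A1 ^ 3 * v1\<^sup>2 = 1" "A2 ^ 3 * v2\<^sup>2 = 1" using v_nonzero by (auto simp: A1_def A2_def)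
qed

lemma rad_v: "rad (of_real v1) = of_real A1" "rad (of_real v2) = of_real A2"
  using v_nonzero by (auto simp: A1_def A2_def rad_of_real)

lemma orbit_odes:
  "orbit_ode 1 m1 m2 (of_real (v1 / (v2 - v1))) (of_real (A2 / A1)) u1 u2 du1 (of_real \<mu>)"
  "orbit_ode (-1) m2 m1 (of_real (v2 / (v2 - v1))) (of_real (A1 / A2)) u2 u1 du2 (of_real \<mu>)"
proof -
  have "gam (emb (pp, 0, 0)) = of_real (A2 / A1)" by (simp add: gam_def rad_v)
  moreover have "inverse (gam (emb (pp, 0, 0))) = of_real (A1 / A2)" by (simp add: gam_def rad_v)
  ultimately show
    "orbit_ode 1 m1 m2 (of_real (v1 / (v2 - v1))) (of_real (A2 / A1)) u1 u2 du1 (of_real \<mu>)"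
    "orbit_ode (-1) m2 m1 (of_real (v2 / (v2 - v1))) (of_real (A1 / A2)) u2 u1 du2 (of_real \<mu>)"
    using ode[OF emb_S[OF p, of "(0, 0)"]]
    by (auto simp: tshift_emb kap1_def kap2_def nu_def u1_def[abs_def] u2_def[abs_def] du1_def[abs_def] du2_def[abs_def])
qed

lemma u_DERIV: "(u1 has_vector_derivative du1 t) (at t)" "(u2 has_vector_derivative du2 t) (at t)"
  using orbit_odes by (auto simp: orbit_ode_def)

lemma u_cnj: "cnj (u1 t) = u1 (- t)" "cnj (u2 t) = u2 (- t)"
  using f g emb_S[OF p] realpt_emb by (auto simp: admissible_dev_def u1_def u2_def treflect_emb)

lemma u_periodic: "u1 (t + 2*pi) = u1 t" "u2 (t + 2*pi) = u2 t"
proof -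
  have "f (tshift (emb (pp, 0, t)) (2*pi)) = f (emb (pp, 0, t))" "g (tshift (emb (pp, 0, t)) (2*pi)) = g (emb (pp, 0, t))"
    using f g emb_S[OF p] by (auto simp: admissible_dev_def)
  then show "u1 (t + 2*pi) = u1 t" "u2 (t + 2*pi) = u2 t" by (simp_all add: tshift_emb u1_def u2_def)
qed

lemma du_periodic: "du1 (t + 2*pi) = du1 t" "du2 (t + 2*pi) = du2 t"
proof -
  have per: "h' (t + 2*pi) = h' t" if D: "\<And>t. (h has_vector_derivative h' t) (at t)" and h: "\<And>t. h (t + 2*pi) = h t"
    for h h' :: "real \<Rightarrow> complex"
  proof -
    have "((\<lambda>t. t + 2*pi) has_vector_derivative 1) (at t)" by (auto intro!: derivative_eq_intros)
    from vector_diff_chain_at[OF this D] have "(h has_vector_derivative h' (t + 2*pi)) (at t)"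
      by (simp add: o_def h)
    then show ?thesis using D vector_derivative_unique_at by blast
  qed
  show "du1 (t + 2*pi) = du1 t" by (rule per[OF u_DERIV(1) u_periodic(1)])
  show "du2 (t + 2*pi) = du2 t" by (rule per[OF u_DERIV(2) u_periodic(2)])
qed

lemma du_cnj: "cnj (du1 t) = - du1 (- t)" "cnj (du2 t) = - du2 (- t)"
proof -
  have gen: "cnj (h' t) = - h' (- t)" if D: "\<And>t. (h has_vector_derivative h' t) (at t)" and h: "\<And>t. cnj (h t) = h (- t)"
    for h h' :: "real \<Rightarrow> complex"
  proof -
    have "((\<lambda>t. - t) has_vector_derivative - 1) (at t)" by (auto intro!: derivative_eq_intros)
    from vector_diff_chain_at[OF this D] have 1: "((\<lambda>t. h (- t)) has_vector_derivative - h' (- t)) (at t)"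
      by (simp add: o_def)
    have "((\<lambda>t. cnj (h t)) has_vector_derivative cnj (h' t)) (at t)"
      by (rule bounded_linear.has_vector_derivative[OF bounded_linear_cnj D])
    then show ?thesis using 1 vector_derivative_unique_at unfolding h by blast
  qed
  show "cnj (du1 t) = - du1 (- t)" by (rule gen[OF u_DERIV(1) u_cnj(1)])
  show "cnj (du2 t) = - du2 (- t)" by (rule gen[OF u_DERIV(2) u_cnj(2)])
qed

lemma u_bounds: "cmod (u1 t) \<le> \<eta>" "cmod (u2 t) \<le> \<eta>" "cmod (u1 t) \<le> 1/32" "cmod (u2 t) \<le> 1/32"
    "cmod (du1 t) \<le> 1/16" "cmod (du2 t) \<le> 1/16"
proof -
  show 1: "cmod (u1 t) \<le> \<eta>" "cmod (u2 t) \<le> \<eta>"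
    using f g emb_S[OF p] by (auto simp: admissible_dev_def u1_def u2_def)
  then show "cmod (u1 t) \<le> 1/32" "cmod (u2 t) \<le> 1/32" using \<eta> by auto
  show "cmod (du1 t) \<le> 1/16" "cmod (du2 t) \<le> 1/16"
    unfolding du1_def du2_def using dev_derivative_le[OF f emb_S[OF p] _ \<eta>(3) \<beta>]
      dev_derivative_le[OF g emb_S[OF p] _ \<eta>(3) \<beta>] by auto
qed

lemma one_plus_u: "1 + u1 t \<noteq> 0" "1 + u2 t \<noteq> 0"
proof -
  have "1 + h \<noteq> 0" if "cmod h \<le> 1/32" for h :: complex
  proof
    assume "1 + h = 0"
    then have "h = - 1" by (simp add: eq_neg_iff_add_eq_0 add.commute)
    then show False using that by simp
  qed
  then show "1 + u1 t \<noteq> 0" "1 + u2 t \<noteq> 0" using u_bounds(3,4) by blast+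
qed

definition "pos1 a b = of_real A1 * cis a * (1 + u1 b)"
definition "pos2 a b = of_real A2 * cis (a + b) * (1 + u2 b)"
definition "vel1 a b = of_real A1 * cis a * (\<i> * of_real v1 * (1 + u1 b) + of_real (v2 - v1) * du1 b)"
definition "vel2 a b = of_real A2 * cis (a + b) * (\<i> * of_real v2 * (1 + u2 b) + of_real (v2 - v1) * du2 b)"

lemma torus_map_eq:
  "torus_map \<omega> (pp, a, b) =
    (of_real (\<omega> powr (2/3)) * pos1 a b, of_real (\<omega> powr (2/3)) * pos2 a b,
     of_real (m1 * \<omega> powr (-1/3)) * bary \<mu> m1 m2 (vel1 a b) (vel2 a b) 1,
     of_real (m2 * \<omega> powr (-1/3)) * bary \<mu> m1 m2 (vel1 a b) (vel2 a b) 2)"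
  unfolding torus_map_def Let_def tmean_def tpos_def tvel_def noang_emb
  by (simp add: rad_v nu_def bary_def pos1_def pos2_def vel1_def vel2_def u1_def u2_def du1_def du2_def cis_conv_exp)

text \<open>A collision of the planets would annihilate the second product in \<open>adm\<close>,
  whose real part is positive.\<close>

lemma pos_distinct: "pos1 a b \<noteq> 0" "pos2 a b \<noteq> 0" "pos1 a b \<noteq> pos2 a b"
proof -
  show "pos1 a b \<noteq> 0" "pos2 a b \<noteq> 0" using A_pos one_plus_u by (auto simp: pos1_def pos2_def)
  have "adm (of_real (A2 / A1)) (cis b) (cis (- b)) (u1 b) (u1 (- b)) (u2 b) (u2 (- b))"
    using admd[OF emb_S[OF p, of "(0, b)"], of "u1 b" "u1 (- b)" "u2 b" "u2 (- b)"] u_bounds(1,2)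
    by (simp add: gam_def rad_v ex_def ex'_def cis_conv_exp)
  then have "Re ((of_real (A2 / A1) * cis b * (1 + u2 b) - (1 + u1 b)) * (of_real (A2 / A1) * cis (- b) * (1 + u2 (- b)) - (1 + u1 (- b)))) > 0"
    unfolding adm_def by blast
  then have ne: "of_real (A2 / A1) * cis b * (1 + u2 b) \<noteq> 1 + u1 b"
    by (metis cancel_comm_monoid_add_class.diff_cancel less_irrefl mult_zero_left zero_complex.sel(1))
  show "pos1 a b \<noteq> pos2 a b"
  proof
    assume "pos1 a b = pos2 a b"
    then have "cis a * (of_real A1 * (1 + u1 b)) = cis a * (of_real A2 * cis b * (1 + u2 b))"
      by (simp add: pos1_def pos2_def mult_ac flip: cis_mult)
    then have "of_real A1 * (1 + u1 b) = of_real A2 * cis b * (1 + u2 b)" by simp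
    then show False using ne A_pos by (simp add: field_simps)
  qed
qed

lemma torus_map_phase_space: "\<omega> > 0 \<Longrightarrow> torus_map \<omega> (pp, a, b) \<in> phase_space"
  using pos_distinct[of a b] by (simp add: torus_map_eq phase_space_def)

lemma cis_add_2pi: "cis (x + 2*pi) = cis x" by (simp add: complex_eq_iff)

lemma torus_map_periodic:
  "torus_map \<omega> (pp, a + 2*pi, b) = torus_map \<omega> (pp, a, b)"
  "torus_map \<omega> (pp, a, b + 2*pi) = torus_map \<omega> (pp, a, b)"
proof -
  have s: "a + 2*pi + b = a + b + 2*pi" "a + (b + 2*pi) = a + b + 2*pi" by simp_all
  show "torus_map \<omega> (pp, a + 2*pi, b) = torus_map \<omega> (pp, a, b)"
    unfolding torus_map_eq pos1_def pos2_def vel1_def vel2_def s cis_add_2pi ..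
  show "torus_map \<omega> (pp, a, b + 2*pi) = torus_map \<omega> (pp, a, b)"
    unfolding torus_map_eq pos1_def pos2_def vel1_def vel2_def s cis_add_2pi u_periodic du_periodic ..
qed

text \<open>The quotient of the two positions depends on \<open>b\<close> only and is a perturbed
  rotation, which determines \<open>b\<close>; the first position then determines
  \<open>a\<close>.\<close>

lemma torus_map_inj:
  assumes \<omega>: "\<omega> > 0"
  shows "inj_on (\<lambda>\<theta>. torus_map \<omega> (pp, \<theta>)) ({0..<2*pi} \<times> {0..<2*pi})"
proof (rule inj_onI)
  fix \<theta> \<theta>' assume \<theta>: "\<theta> \<in> {0..<2*pi} \<times> {0..<2*pi}" "\<theta>' \<in> {0..<2*pi} \<times> {0..<2*pi}"
    and eq: "torus_map \<omega> (pp, \<theta>) = torus_map \<omega> (pp, \<theta>')"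
  obtain a b a' b' where ab: "\<theta> = (a, b)" "\<theta>' = (a', b')" by (cases \<theta>; cases \<theta>')
  have rng: "a \<in> {0..<2*pi}" "b \<in> {0..<2*pi}" "a' \<in> {0..<2*pi}" "b' \<in> {0..<2*pi}" using \<theta> ab by auto
  have e: "pos1 a b = pos1 a' b'" "pos2 a b = pos2 a' b'"
    using eq \<omega> unfolding ab torus_map_eq by auto
  have "pos2 a b * pos1 a' b' = pos2 a' b' * pos1 a b" unfolding e ..
  then have "(of_real A1 * of_real A2 * cis a * cis a') * (cis b * (1 + u2 b) * (1 + u1 b')) =
     (of_real A1 * of_real A2 * cis a * cis a') * (cis b' * (1 + u2 b') * (1 + u1 b))"
    unfolding pos1_def pos2_def cis_mult[symmetric] by (simp only: mult_ac)
  then have "cis b * (1 + u2 b) * (1 + u1 b') = cis b' * (1 + u2 b') * (1 + u1 b)"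
    using A_pos by simp
  then have b: "b = b'"
    by (rule perturbed_rotation_inj_period[OF u_DERIV u_bounds(3-6) _ u_periodic rng(2,4)])
  have "cis a * (of_real A1 * (1 + u1 b)) = cis a' * (of_real A1 * (1 + u1 b))"
    using e(1) unfolding pos1_def b by (simp only: mult_ac)
  then have "cis a = cis a'" using A_pos one_plus_u by simp
  then have "a = a'"
    by (intro perturbed_rotation_inj_period[where p = "\<lambda>_. 0" and q = "\<lambda>_. 0" and p' = "\<lambda>_. 0" and q' = "\<lambda>_. 0"] rng) auto
  then show "\<theta> = \<theta>'" using ab b by simp
qed

lemma has_vector_derivative_cis_line:
  "((\<lambda>r. cis (a + r * s)) has_vector_derivative cis (a + r * s) * (\<i> * of_real s)) (at r)"
proof -
  have "((\<lambda>z. exp (\<i> * (of_real a + z * of_real s))) has_field_derivative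
      exp (\<i> * (of_real a + of_real r * of_real s)) * (\<i> * of_real s)) (at (of_real r))"
    by (auto intro!: derivative_eq_intros)
  from has_vector_derivative_real_field[OF this] show ?thesis by (simp add: cis_conv_exp)
qed

lemma pos_line_DERIV:
  "((\<lambda>r. pos1 (a + r * s) (b + r * t)) has_vector_derivative
     of_real A1 * cis (a + r * s) * (\<i> * of_real s * (1 + u1 (b + r * t)) + of_real t * du1 (b + r * t))) (at r)"
  "((\<lambda>r. pos2 (a + r * s) (b + r * t)) has_vector_derivative
     of_real A2 * cis (a + b + r * (s + t)) * (\<i> * of_real (s + t) * (1 + u2 (b + r * t)) + of_real t * du2 (b + r * t))) (at r)"
proof -
  have lin: "((\<lambda>r. b + r * t) has_vector_derivative t) (at r)" by (auto intro!: derivative_eq_intros)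
  have Du: "((\<lambda>r. u1 (b + r * t)) has_vector_derivative of_real t * du1 (b + r * t)) (at r)"
    "((\<lambda>r. u2 (b + r * t)) has_vector_derivative of_real t * du2 (b + r * t)) (at r)"
    using vector_diff_chain_at[OF lin u_DERIV(1)] vector_diff_chain_at[OF lin u_DERIV(2)]
    by (simp_all add: o_def scaleR_conv_of_real)
  have "((\<lambda>r. of_real A1 * (cis (a + r * s) * (1 + u1 (b + r * t)))) has_vector_derivative
     of_real A1 * (cis (a + r * s) * (0 + of_real t * du1 (b + r * t)) + cis (a + r * s) * (\<i> * of_real s) * (1 + u1 (b + r * t)))) (at r)"
    by (intro has_vector_derivative_mult_right has_vector_derivative_mult has_vector_derivative_add
        has_vector_derivative_const Du has_vector_derivative_cis_line)
  then show "((\<lambda>r. pos1 (a + r * s) (b + r * t)) has_vector_derivative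
     of_real A1 * cis (a + r * s) * (\<i> * of_real s * (1 + u1 (b + r * t)) + of_real t * du1 (b + r * t))) (at r)"
    unfolding pos1_def by (simp add: algebra_simps)
  have s: "a + r * s + (b + r * t) = a + b + r * (s + t)" for r by (simp add: algebra_simps)
  have "((\<lambda>r. of_real A2 * (cis (a + b + r * (s + t)) * (1 + u2 (b + r * t)))) has_vector_derivative
     of_real A2 * (cis (a + b + r * (s + t)) * (0 + of_real t * du2 (b + r * t)) + cis (a + b + r * (s + t)) * (\<i> * of_real (s + t)) * (1 + u2 (b + r * t)))) (at r)"
    by (intro has_vector_derivative_mult_right has_vector_derivative_mult has_vector_derivative_add
        has_vector_derivative_const Du has_vector_derivative_cis_line)
  then show "((\<lambda>r. pos2 (a + r * s) (b + r * t)) has_vector_derivative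
     of_real A2 * cis (a + b + r * (s + t)) * (\<i> * of_real (s + t) * (1 + u2 (b + r * t)) + of_real t * du2 (b + r * t))) (at r)"
    unfolding pos2_def s by (simp only: distrib_left mult_ac add_0 add.commute)
qed

text \<open>The two position components suffice. A null direction \<open>(s, t)\<close> makes both
  \<open>s\<close> and \<open>s + t\<close> small compared with \<open>t\<close>, because the
  factors \<open>1 + u\<close> are near 1 and the derivatives of \<open>u\<close> are at most
  \<open>1/16\<close>; hence \<open>t = 0\<close> and then \<open>s = 0\<close>.\<close>

lemma torus_map_immersion:
  assumes \<omega>: "\<omega> > 0"
  shows "inj (frechet_derivative (\<lambda>\<theta>. torus_map \<omega> (pp, \<theta>)) (at \<theta>))"
proof -
  define \<Theta> where "\<Theta> = (\<lambda>\<theta>. torus_map \<omega> (pp, \<theta>))"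
  define D where "D = frechet_derivative \<Theta> (at \<theta>)"
  obtain a b where \<theta>: "\<theta> = (a, b)" by (cases \<theta>)
  have "Ck_on (Suc 0) (torus_map \<omega>) (W \<times> UNIV)" using smooth_torus_map unfolding smooth_on_def by blast
  then have "torus_map \<omega> differentiable (at (pp, \<theta>))" using p by (cases \<theta>) auto
  then obtain D' where "(torus_map \<omega> has_derivative D') (at (pp, \<theta>))" by (auto simp: differentiable_def)
  moreover have "((\<lambda>\<theta>. (pp, \<theta>)) has_derivative (\<lambda>v. (0, v))) (at \<theta>)"
    by (intro has_derivative_Pair has_derivative_const has_derivative_ident[unfolded id_def])
  ultimately have "\<Theta> differentiable (at \<theta>)"
    unfolding \<Theta>_def differentiable_def using has_derivative_compose by blast
  then have D: "(\<Theta> has_derivative D) (at \<theta>)" unfolding D_def using frechet_derivative_works by blast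
  then have lin: "linear D" using has_derivative_linear by blast
  have "v = 0" if v: "D v = 0" for v
  proof -
    obtain s t where st: "v = (s, t)" by (cases v)
    define \<gamma> where "\<gamma> = (\<lambda>r::real. (a + r * s, b + r * t))"
    have "(\<gamma> has_vector_derivative (s, t)) (at 0)"
      unfolding \<gamma>_def by (intro has_vector_derivative_Pair) (auto intro!: derivative_eq_intros)
    then have hd: "((\<lambda>r. \<Theta> (\<gamma> r)) has_derivative (\<lambda>r. D (r *\<^sub>R (s, t)))) (at 0)"
      unfolding has_vector_derivative_def
      using D has_derivative_compose[of \<gamma> "\<lambda>r. r *\<^sub>R (s, t)" 0 UNIV \<Theta> D] by (simp add: \<gamma>_def \<theta>)
    have "D (r *\<^sub>R (s, t)) = 0" for r using v unfolding linear_scale[OF lin] st by simp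
    then have vd: "((\<lambda>r. \<Theta> (\<gamma> r)) has_vector_derivative 0) (at 0)"
      using hd by (simp only: has_vector_derivative_def scaleR_zero_right)
    have c: "complex_of_real (\<omega> powr (2/3)) \<noteq> 0" using \<omega> by simp
    have h0: "((\<lambda>r. of_real (\<omega> powr (2/3)) * pos1 (a + r * s) (b + r * t)) has_vector_derivative 0) (at 0)"
      using bounded_linear.has_vector_derivative[OF bounded_linear_fst vd]
      by (simp add: \<Theta>_def \<gamma>_def torus_map_eq)
    have h1: "((\<lambda>r. of_real (\<omega> powr (2/3)) * pos1 (a + r * s) (b + r * t)) has_vector_derivative
       of_real (\<omega> powr (2/3)) * (of_real A1 * cis (a + 0 * s) * (\<i> * of_real s * (1 + u1 (b + 0 * t)) + of_real t * du1 (b + 0 * t)))) (at 0)"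
      by (intro has_vector_derivative_mult_right pos_line_DERIV)
    have "of_real (\<omega> powr (2/3)) * (of_real A1 * cis (a + 0 * s) * (\<i> * of_real s * (1 + u1 (b + 0 * t)) + of_real t * du1 (b + 0 * t))) = 0"
      by (rule vector_derivative_unique_at[OF h1 h0])
    then have z1: "\<i> * of_real s * (1 + u1 b) + of_real t * du1 b = 0" using c A_pos by simp
    have h2: "((\<lambda>r. of_real (\<omega> powr (2/3)) * pos2 (a + r * s) (b + r * t)) has_vector_derivative 0) (at 0)"
      using bounded_linear.has_vector_derivative[OF bounded_linear_fst
          bounded_linear.has_vector_derivative[OF bounded_linear_snd vd]]
      by (simp add: \<Theta>_def \<gamma>_def torus_map_eq)
    have h3: "((\<lambda>r. of_real (\<omega> powr (2/3)) * pos2 (a + r * s) (b + r * t)) has_vector_derivative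
       of_real (\<omega> powr (2/3)) * (of_real A2 * cis (a + b + 0 * (s + t)) * (\<i> * of_real (s + t) * (1 + u2 (b + 0 * t)) + of_real t * du2 (b + 0 * t)))) (at 0)"
      by (intro has_vector_derivative_mult_right pos_line_DERIV)
    have "of_real (\<omega> powr (2/3)) * (of_real A2 * cis (a + b + 0 * (s + t)) * (\<i> * of_real (s + t) * (1 + u2 (b + 0 * t)) + of_real t * du2 (b + 0 * t))) = 0"
      by (rule vector_derivative_unique_at[OF h3 h2])
    then have z2: "\<i> * of_real (s + t) * (1 + u2 b) + of_real t * du2 b = 0" using c A_pos by simp
    have small: "\<bar>x\<bar> * (31/32) \<le> \<bar>t\<bar> * (1/16)"
      if "\<i> * of_real x * (1 + h) + of_real t * h' = 0" "cmod h \<le> 1/32" "cmod h' \<le> 1/16" for x h h'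
    proof -
      have "\<i> * of_real x * (1 + h) = - (of_real t * h')" using that(1) by (simp add: eq_neg_iff_add_eq_0)
      then have e: "\<bar>x\<bar> * cmod (1 + h) = \<bar>t\<bar> * cmod h'"
        by (metis norm_minus_cancel norm_mult norm_ii norm_of_real mult_1)
      have "31/32 \<le> cmod (1 + h)" using norm_diff_ineq[of 1 h] that(2) by simp
      then have "\<bar>x\<bar> * (31/32) \<le> \<bar>x\<bar> * cmod (1 + h)" by (intro mult_left_mono) auto
      also have "\<dots> \<le> \<bar>t\<bar> * (1/16)" unfolding e using that(3) by (intro mult_left_mono) auto
      finally show ?thesis .
    qed
    have s1: "\<bar>s\<bar> * (31/32) \<le> \<bar>t\<bar> * (1/16)" by (rule small[OF z1 u_bounds(3,5)])
    have s2: "\<bar>s + t\<bar> * (31/32) \<le> \<bar>t\<bar> * (1/16)" by (rule small[OF z2 u_bounds(4,6)])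
    have "\<bar>t\<bar> \<le> \<bar>s + t\<bar> + \<bar>s\<bar>" by linarith
    moreover have "z = 0" if "z \<le> w + y" "y * (31/32) \<le> z * (1/16)" "w * (31/32) \<le> z * (1/16)" "0 \<le> z" for w y z :: real
      using that by linarith
    ultimately have "\<bar>t\<bar> = 0" using s1 s2 abs_ge_zero by blast
    then show "v = 0" using s1 by (simp add: st zero_prod_def)
  qed
  then show ?thesis
    using linear_injective_0[OF lin] unfolding D_def \<Theta>_def by blast
qed

lemma torus_embedding_torus_map: "\<omega> > 0 \<Longrightarrow> torus_embedding (\<lambda>\<theta>. torus_map \<omega> (pp, \<theta>))"
  unfolding torus_embedding_def
  using torus_map_periodic torus_map_inj torus_map_immersion by blast

lemma torus_map_circular:
  assumes \<omega>: "\<omega> > 0" and \<mu>: "\<mu> = 0"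
  shows "range (\<lambda>\<theta>. torus_map \<omega> (pp, \<theta>)) = circular_torus \<omega> m1 m2 v1 v2"
proof -
  have "emb (pp, 0, t) $ Mu = 0" for t by (simp add: \<mu>)
  then have "u1 t = 0" "u2 t = 0" for t
    using f g emb_S[OF p] unfolding admissible_dev_def u1_def u2_def by blast+
  then have u0: "u1 = (\<lambda>t. 0)" "u2 = (\<lambda>t. 0)" by auto
  have "du1 t = 0" "du2 t = 0" for t
    by (rule vector_derivative_unique_at[OF u_DERIV(1)[unfolded u0] has_vector_derivative_const])
      (rule vector_derivative_unique_at[OF u_DERIV(2)[unfolded u0] has_vector_derivative_const])
  then have du0: "du1 = (\<lambda>t. 0)" "du2 = (\<lambda>t. 0)" by auto
  have A: "\<omega> powr (2/3) * \<bar>v\<bar> powr (-2/3) = inverse (\<bar>v / \<omega>\<bar> powr (2/3))" for v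
    using \<omega> by (simp add: powr_divide powr_minus_divide abs_divide divide_simps)
  have o3: "\<omega> powr (-1/3) = \<omega> powr (2/3) / \<omega>"
    using \<omega> powr_diff[of \<omega> "2/3" 1] by simp
  define c1 c2 where "c1 = complex_of_real (inverse (\<bar>v1 / \<omega>\<bar> powr (2/3)))" and "c2 = complex_of_real (inverse (\<bar>v2 / \<omega>\<bar> powr (2/3)))"
  have "of_real (\<omega> powr (2/3)) * of_real A1 = c1" "of_real (\<omega> powr (2/3)) * of_real A2 = c2"
    unfolding c1_def c2_def A1_def A2_def by (simp_all only: A flip: of_real_mult)
  then have eq: "torus_map \<omega> (pp, a, b) = (c1 * cis a, c2 * cis (a + b), c1 * cis a * (\<i> * of_real (v1 / \<omega> * m1)),
     c2 * cis (a + b) * (\<i> * of_real (v2 / \<omega> * m2)))" for a b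
    unfolding torus_map_eq pos1_def pos2_def vel1_def vel2_def u0 du0 bary_def o3
    unfolding \<mu> by (auto simp: field_simps)
  have circ: "circular_position \<omega> v1 \<beta>' t = c1 * cis (\<beta>' + v1 * t)" "circular_position \<omega> v2 \<beta>' t = c2 * cis (\<beta>' + v2 * t)" for \<beta>' t
  proof -
    have "cis x * (cis y / of_real k) = of_real (inverse k) * cis (x + y)" for x y k
      by (simp only: cis_mult[symmetric] divide_inverse of_real_inverse mult_ac)
    then show "circular_position \<omega> v1 \<beta>' t = c1 * cis (\<beta>' + v1 * t)" "circular_position \<omega> v2 \<beta>' t = c2 * cis (\<beta>' + v2 * t)"
      unfolding circular_position_def Let_def c1_def c2_def by blast+
  qed
  show ?thesis
  proof (intro equalityI subsetI)
    fix y assume "y \<in> range (\<lambda>\<theta>. torus_map \<omega> (pp, \<theta>))"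
    then obtain a b where y: "y = torus_map \<omega> (pp, a, b)" by auto
    have "torus_map \<omega> (pp, a, b) = (circular_position \<omega> v1 a 0, circular_position \<omega> v2 (a + b) 0,
      circular_momentum \<omega> v1 m1 a 0, circular_momentum \<omega> v2 m2 (a + b) 0)"
      unfolding circular_momentum_def Let_def circ eq by simp
    then show "y \<in> circular_torus \<omega> m1 m2 v1 v2"
      unfolding circular_torus_def y by blast
  next
    fix y assume "y \<in> circular_torus \<omega> m1 m2 v1 v2"
    then obtain \<beta>1 \<beta>2 t where "y = (circular_position \<omega> v1 \<beta>1 t, circular_position \<omega> v2 \<beta>2 t,
      circular_momentum \<omega> v1 m1 \<beta>1 t, circular_momentum \<omega> v2 m2 \<beta>2 t)"
      unfolding circular_torus_def by blast
    then have "y = torus_map \<omega> (pp, \<beta>1 + v1 * t, \<beta>2 + v2 * t - (\<beta>1 + v1 * t))"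
      unfolding circular_momentum_def Let_def circ eq by simp
    then show "y \<in> range (\<lambda>\<theta>. torus_map \<omega> (pp, \<theta>))" by blast
  qed
qed

text \<open>The motion is the straight line \<open>a = v1 t\<close>, \<open>b = (v2 - v1) t\<close>
  on the torus. Time shifts sweep \<open>b\<close> and rotations sweep \<open>a\<close>, so the
  phase orbit is the whole torus.\<close>

lemma torus_map_dynamics:
  assumes \<omega>: "\<omega> > 0" and \<mu>: "\<mu> > 0" and m: "m1 + m2 = 1"
  shows "\<exists>r. three_body_solution \<mu> m1 m2 r \<and> symmetric_solution r \<and>
     rel_periodic (2 * pi / \<bar>v2 - v1\<bar>) (2 * pi * (v1 / \<bar>v2 - v1\<bar>)) r \<and>
     range (\<lambda>\<theta>. torus_map \<omega> (pp, \<theta>)) = phase_orbit \<omega> \<mu> m1 m2 r"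
proof -
  define \<nu> where "\<nu> = v2 - v1"
  have \<nu>: "\<nu> \<noteq> 0" using v_nonzero by (simp add: \<nu>_def)
  define X1 where "X1 = (\<lambda>t. of_real A1 * cis (v1 * t) * (1 + u1 (\<nu> * t)))"
  define X2 where "X2 = (\<lambda>t. of_real A2 * cis (v2 * t) * (1 + u2 (\<nu> * t)))"
  define X1' where "X1' = (\<lambda>t. of_real A1 * cis (v1 * t) * (\<i> * of_real v1 * (1 + u1 (\<nu> * t)) + of_real \<nu> * du1 (\<nu> * t)))"
  define X2' where "X2' = (\<lambda>t. of_real A2 * cis (v2 * t) * (\<i> * of_real v2 * (1 + u2 (\<nu> * t)) + of_real \<nu> * du2 (\<nu> * t)))"
  have v: "v2 = v1 + 1 * \<nu>" "v1 = v2 + (-1) * \<nu>" by (simp_all add: \<nu>_def)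
  note np1 = newton_planet[OF orbit_odes(1)[folded \<nu>_def] \<nu> v(1) A_pos(1) A_cube(1) u_cnj]
  note np2 = newton_planet[OF orbit_odes(2)[folded \<nu>_def] \<nu> v(2) A_pos(2) A_cube(2) u_cnj(2) u_cnj(1)]
  have n1: "(X1 has_vector_derivative X1' t) (at t)"
    "(X1' has_vector_derivative - of_real (1 + \<mu> * m1) * cubed (X1 t)
       + of_real (\<mu> * m2) * (cubed (X2 t - X1 t) - cubed (X2 t))) (at t)" for t
    unfolding X1_def X2_def X1'_def by (rule np1)+
  have n2: "(X2 has_vector_derivative X2' t) (at t)"
    "(X2' has_vector_derivative - of_real (1 + \<mu> * m2) * cubed (X2 t)
       + of_real (\<mu> * m1) * (cubed (X1 t - X2 t) - cubed (X1 t))) (at t)" for t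
    unfolding X1_def X2_def X2'_def by (rule np2)+
  have XP: "X1 t = pos1 (v1 * t) (\<nu> * t)" "X2 t = pos2 (v1 * t) (\<nu> * t)" "X1' t = vel1 (v1 * t) (\<nu> * t)" "X2' t = vel2 (v1 * t) (\<nu> * t)" for t
    by (simp_all add: X1_def X2_def X1'_def X2'_def pos1_def pos2_def vel1_def vel2_def \<nu>_def algebra_simps)
  define c where "c = inverse (\<mu> powr (1/3))"
  define r where "r = (\<lambda>j t. of_real c * bary \<mu> m1 m2 (X1 t) (X2 t) j)"
  note sol = three_body_solution_bary[OF \<mu> m n1(1) n2(1) n1(2) n2(2), folded c_def, folded r_def]
  have nc: "X1 t \<noteq> 0" "X2 t \<noteq> 0" "X1 t \<noteq> X2 t" for t using pos_distinct by (auto simp: XP)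
  note tb = sol(1)[OF nc] and vel = sol(2)[OF nc]
  have rv: "(r j has_vector_derivative velocity r j t) (at t)" if "j < 3" for j t
    using tb that unfolding three_body_solution_def by blast
  have B: "cis b * bary \<mu> m1 m2 x y j = bary \<mu> m1 m2 (cis b * x) (cis b * y) j" for b x y j
    by (simp add: bary_def algebra_simps)
  \<comment> \<open>At time zero the reflection symmetry makes all positions real and all velocities
    imaginary; the line is the real axis.\<close>
  have "symmetric_solution r"
  proof -
    have u0: "Im (u1 0) = 0" "Im (u2 0) = 0" "Re (du1 0) = 0" "Re (du2 0) = 0"
      using u_cnj[of 0] du_cnj[of 0] by (auto simp: complex_eq_iff)
    have "Im (r j 0) = 0" "Re (velocity r j 0) = 0" for j
      unfolding vel by (simp_all add: r_def bary_def X1_def X2_def X1'_def X2'_def u0)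
    then show ?thesis
      unfolding symmetric_solution_def
      by (intro exI[of _ 0] exI[of _ 1]) (auto simp: inner_complex_def complex_eq_iff intro!: exI[of _ "Re (r _ 0)"])
  qed
  moreover have "rel_periodic (2 * pi / \<bar>v2 - v1\<bar>) (2 * pi * (v1 / \<bar>v2 - v1\<bar>)) r"
  proof -
    define T \<alpha> where "T = 2 * pi / \<bar>\<nu>\<bar>" and "\<alpha> = 2 * pi * (v1 / \<bar>\<nu>\<bar>)"
    have \<alpha>: "\<alpha> = v1 * T" by (simp add: T_def \<alpha>_def)
    \<comment> \<open>The relative angle makes one full turn, in the direction given by the sign of
      \<nu>, so the deviations and the relative phase return.\<close>
    have "\<nu> * T = 2*pi \<or> \<nu> * T = - (2*pi)" using \<nu> by (auto simp: T_def abs_if)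
    then have per: "u1 (\<nu> * (t + T)) = u1 (\<nu> * t)" "u2 (\<nu> * (t + T)) = u2 (\<nu> * t)" "cis (\<nu> * (t + T)) = cis (\<nu> * t)" for t
      using u_periodic[of "\<nu> * t"] u_periodic[of "\<nu> * t - 2*pi"] cis_add_2pi[of "\<nu> * t"] cis_add_2pi[of "\<nu> * t - 2*pi"]
      by (auto simp: distrib_left)
    have "v2 = v1 + \<nu>" by (simp add: \<nu>_def)
    then have v2c: "cis (v2 * s) = cis (v1 * s) * cis (\<nu> * s)" for s by (simp add: cis_mult distrib_right)
    have v1c: "cis (v1 * (t + T)) = cis \<alpha> * cis (v1 * t)" for t by (simp add: \<alpha> cis_mult algebra_simps)
    have XT: "X1 (t + T) = cis \<alpha> * X1 t" "X2 (t + T) = cis \<alpha> * X2 t" for t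
      unfolding X1_def X2_def per v2c v1c by simp_all
    have "r j (t + T) = cis \<alpha> * r j t" for j t
      unfolding r_def XT B[symmetric] by (simp only: mult_ac)
    moreover have "T > 0" using \<nu> by (simp add: T_def)
    ultimately show ?thesis unfolding rel_periodic_def T_def \<alpha>_def \<nu>_def by blast
  qed
  moreover have "range (\<lambda>\<theta>. torus_map \<omega> (pp, \<theta>)) = phase_orbit \<omega> \<mu> m1 m2 r"
  proof -
    have pp: "phase_point \<omega> \<mu> m1 m2 (\<lambda>j t. cis b * r j (t + s)) t = torus_map \<omega> (pp, b + v1 * (t + s), \<nu> * (t + s))" for b s t
    proof -
      have lin: "((\<lambda>t. t + s) has_vector_derivative 1) (at t)" by (auto intro!: derivative_eq_intros)
      have "((\<lambda>t. cis b * r j (t + s)) has_vector_derivative cis b * velocity r j (t + s)) (at t)" if "j < 3" for j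
        using vector_diff_chain_at[OF lin rv[OF that, of "t + s"]]
        by (intro has_vector_derivative_mult_right) (simp add: o_def)
      then have vr: "velocity (\<lambda>j t. cis b * r j (t + s)) j t = cis b * velocity r j (t + s)" if "j < 3" for j
        unfolding velocity_def[of "\<lambda>j t. cis b * r j (t + s)"] using vector_derivative_at that by blast
      have rd: "r 1 t - r 0 t = of_real c * X1 t" "r 2 t - r 0 t = of_real c * X2 t" for t
        by (simp_all add: r_def bary_def algebra_simps)
      have cm: "\<mu> powr (1/3) * c = 1" using \<mu> by (simp add: c_def)
      then have cm': "complex_of_real (\<mu> powr (1/3)) * of_real c = 1" by (metis of_real_1 of_real_mult)
      have P: "cis b * pos1 a e = pos1 (b + a) e" "cis b * pos2 a e = pos2 (b + a) e"
        "cis b * vel1 a e = vel1 (b + a) e" "cis b * vel2 a e = vel2 (b + a) e" for a e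
        by (simp_all add: pos1_def pos2_def vel1_def vel2_def cis_mult[symmetric] mult_ac)

      have k: "(x * \<mu> powr (1/3)) *\<^sub>R (cis b * (of_real c * z)) = of_real x * (cis b * z)" for x z
      proof -
        have "(x * \<mu> powr (1/3)) *\<^sub>R (cis b * (of_real c * z)) = of_real x * (of_real (\<mu> powr (1/3)) * of_real c) * (cis b * z)"
          by (simp add: scaleR_conv_of_real mult_ac)
        then show ?thesis by (simp only: cm' mult_1_right)
      qed
      have d: "cis b * r 1 (t + s) - cis b * r 0 (t + s) = cis b * (of_real c * X1 (t + s))"
        "cis b * r 2 (t + s) - cis b * r 0 (t + s) = cis b * (of_real c * X2 (t + s))"
        by (simp_all only: rd flip: right_diff_distrib)
      have v12: "velocity (\<lambda>j t. cis b * r j (t + s)) 1 t = cis b * (of_real c * bary \<mu> m1 m2 (X1' (t + s)) (X2' (t + s)) 1)"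
         "velocity (\<lambda>j t. cis b * r j (t + s)) 2 t = cis b * (of_real c * bary \<mu> m1 m2 (X1' (t + s)) (X2' (t + s)) 2)"
        using vr[of 1] vr[of 2] by (simp_all add: vel)
      show ?thesis
        unfolding phase_point_scaled[OF \<omega> \<mu>] d v12 k torus_map_eq XP P B by (simp add: mult_ac)
    qed
    show ?thesis
    proof (intro equalityI subsetI)
      fix y assume "y \<in> range (\<lambda>\<theta>. torus_map \<omega> (pp, \<theta>))"
      then obtain a b where y: "y = torus_map \<omega> (pp, a, b)" by auto
      \<comment> \<open>Time \<open>b / \<nu>\<close> brings the relative angle to \<open>b\<close>;
        the rotation then corrects the common angle.\<close>
      have "y = phase_point \<omega> \<mu> m1 m2 (\<lambda>j t. cis (a - v1 * (b / \<nu>)) * r j (t + 0)) (b / \<nu>)"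
        unfolding pp y using \<nu> by simp
      then show "y \<in> phase_orbit \<omega> \<mu> m1 m2 r" unfolding phase_orbit_def by blast
    next
      fix y assume "y \<in> phase_orbit \<omega> \<mu> m1 m2 r"
      then show "y \<in> range (\<lambda>\<theta>. torus_map \<omega> (pp, \<theta>))"
        unfolding phase_orbit_def pp by auto
    qed
  qed
  ultimately show ?thesis using tb by blast
qed

end

end

lemma existence_half:
  fixes m1 m2 o1 o2 :: real
  assumes m: "m1 + m2 = 1" and o: "o1 \<noteq> 0" "o2 \<noteq> 0" "\<bar>o1\<bar> \<noteq> \<bar>o2\<bar>" and nr: "\<And>n::int. o1 / (o2 - o1) \<noteq> of_int n"
  shows "\<exists>\<mu>0>0. \<forall>\<omega>>0. \<exists>\<Lambda> :: real \<times> real \<times> real \<Rightarrow> phase set.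
           smooth_torus_family (parameter_ball \<mu>0 o1 o2) \<Lambda> \<and>
           (\<forall>p \<in> parameter_ball \<mu>0 o1 o2. \<Lambda> p \<subseteq> phase_space) \<and>
           \<Lambda> (0, o1, o2) = circular_torus \<omega> m1 m2 o1 o2 \<and>
           (\<forall>\<mu> v1 v2. (\<mu>, v1, v2) \<in> parameter_ball \<mu>0 o1 o2 \<longrightarrow> 0 < \<mu> \<longrightarrow> \<mu> \<le> \<mu>0 \<longrightarrow>
              (\<exists>r T' \<alpha>'. \<exists>k'::int.
                 T' = 2 * pi / \<bar>v2 - v1\<bar> \<and>
                 \<alpha>' = 2 * pi * (v1 / \<bar>v2 - v1\<bar>) + 2 * pi * of_int k' \<and>
                 three_body_solution \<mu> m1 m2 r \<and>
                 symmetric_solution r \<and>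
                 rel_periodic T' \<alpha>' r \<and>
                 \<Lambda> (\<mu>, v1, v2) = phase_orbit \<omega> \<mu> m1 m2 r))"
proof -
  obtain d \<beta> \<eta> f g where dev: "d > 0" "d \<le> 1/2" "\<beta> > 0" "0 < \<eta>" "\<eta> \<le> 1/32" "\<eta> \<le> \<beta>/32"
    "admissible_dev (pdom o1 o2 d \<beta>) \<eta> f" "admissible_dev (pdom o1 o2 d \<beta>) \<eta> g"
    "\<And>x. x \<in> pdom o1 o2 d \<beta> \<Longrightarrow> Re ((x $ V1)\<^sup>2) > 0 \<and> Re ((x $ V2)\<^sup>2) > 0 \<and> x $ V1 \<noteq> 0 \<and> x $ V2 \<noteq> 0 \<and> nu x \<noteq> 0"
    "\<And>x a b c d'. x \<in> pdom o1 o2 d \<beta> \<Longrightarrow> cmod a \<le> \<eta> \<Longrightarrow> cmod b \<le> \<eta> \<Longrightarrow> cmod c \<le> \<eta> \<Longrightarrow> cmod d' \<le> \<eta> \<Longrightarrow>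
       adm (gam x) (ex x) (ex' x) a b c d'"
    "\<And>x0. x0 \<in> pdom o1 o2 d \<beta> \<Longrightarrow> x0 $ Tau = 0 \<Longrightarrow>
       orbit_ode 1 m1 m2 (kap1 x0) (gam x0) (\<lambda>t. f (tshift x0 t)) (\<lambda>t. g (tshift x0 t))
         (\<lambda>t. dderiv f (axis Tau 1) (tshift x0 t)) (x0 $ Mu) \<and>
       orbit_ode (-1) m2 m1 (kap2 x0) (inverse (gam x0)) (\<lambda>t. g (tshift x0 t)) (\<lambda>t. f (tshift x0 t))
         (\<lambda>t. dderiv g (axis Tau 1) (tshift x0 t)) (x0 $ Mu)"
    by (rule deviations_exist[OF o nr, of m1 m2]) blast
  interpret D: deviations o1 o2 m1 m2 d \<beta> \<eta> f g
    by (rule deviations.intro[OF o(1,2) dev])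
  have PW: "parameter_ball (d/2) o1 o2 \<subseteq> D.W"
  proof clarify
    fix \<mu> v1 v2 assume "(\<mu>, v1, v2) \<in> parameter_ball (d/2) o1 o2"
    then have "\<bar>\<mu>\<bar> + \<bar>v1 - o1\<bar> + \<bar>v2 - o2\<bar> < d" using dev(1) by (simp add: parameter_ball_def)
    then show "(\<mu>, v1, v2) \<in> D.W"
      using abs_ge_zero[of \<mu>] abs_ge_zero[of "v1 - o1"] abs_ge_zero[of "v2 - o2"]
      unfolding D.W_def mem_Collect_eq case_prod_conv by (intro conjI; linarith)
  qed
  show ?thesis
  proof (intro exI[of _ "d/2"] conjI allI impI)
    show "d / 2 > 0" using dev(1) by simp
    fix \<omega> :: real assume \<omega>: "\<omega> > 0"
    define \<Lambda> where "\<Lambda> = (\<lambda>p. range (\<lambda>\<theta>. D.torus_map \<omega> (p, \<theta>)))"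
    have "smooth_torus_family (parameter_ball (d/2) o1 o2) \<Lambda>"
      unfolding smooth_torus_family_def
    proof (intro exI[of _ "D.torus_map \<omega>"] exI[of _ D.W] conjI ballI)
      show "open D.W" "parameter_ball (d/2) o1 o2 \<subseteq> D.W" "smooth_on (D.torus_map \<omega>) (D.W \<times> UNIV)"
        by (rule D.open_W PW D.smooth_torus_map)+
      fix p assume "p \<in> parameter_ball (d/2) o1 o2"
      then have "p \<in> D.W" using PW by blast
      then show "torus_embedding (\<lambda>\<theta>. D.torus_map \<omega> (p, \<theta>))"
        using D.torus_embedding_torus_map[OF _ \<omega>] by (cases p) auto
      show "\<Lambda> p = range (\<lambda>\<theta>. D.torus_map \<omega> (p, \<theta>))" by (simp add: \<Lambda>_def)
    qed
    moreover have "\<Lambda> p \<subseteq> phase_space" if "p \<in> parameter_ball (d/2) o1 o2" for p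
      using that PW D.torus_map_phase_space[OF _ \<omega>] by (cases p) (auto simp: \<Lambda>_def)
    moreover have "\<Lambda> (0, o1, o2) = circular_torus \<omega> m1 m2 o1 o2"
      unfolding \<Lambda>_def by (rule D.torus_map_circular[OF _ \<omega> refl]) (use dev(1) in \<open>simp add: D.W_def\<close>)
    moreover have "\<exists>r T' \<alpha>'. \<exists>k'::int.
                 T' = 2 * pi / \<bar>v2 - v1\<bar> \<and>
                 \<alpha>' = 2 * pi * (v1 / \<bar>v2 - v1\<bar>) + 2 * pi * of_int k' \<and>
                 three_body_solution \<mu> m1 m2 r \<and>
                 symmetric_solution r \<and>
                 rel_periodic T' \<alpha>' r \<and>
                 \<Lambda> (\<mu>, v1, v2) = phase_orbit \<omega> \<mu> m1 m2 r"
      if pb: "(\<mu>, v1, v2) \<in> parameter_ball (d/2) o1 o2" and \<mu>: "\<mu> > 0" for \<mu> v1 v2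
    proof -
      have "(\<mu>, v1, v2) \<in> D.W" using pb PW by blast
      from D.torus_map_dynamics[OF this \<omega> \<mu> m] obtain r where "three_body_solution \<mu> m1 m2 r" "symmetric_solution r"
        "rel_periodic (2 * pi / \<bar>v2 - v1\<bar>) (2 * pi * (v1 / \<bar>v2 - v1\<bar>)) r" "\<Lambda> (\<mu>, v1, v2) = phase_orbit \<omega> \<mu> m1 m2 r"
        unfolding \<Lambda>_def by blast
      then show ?thesis by (intro exI[of _ r] exI[of _ "0::int"] exI conjI) (auto)
    qed
    ultimately show "\<exists>\<Lambda> :: real \<times> real \<times> real \<Rightarrow> phase set.
           smooth_torus_family (parameter_ball (d/2) o1 o2) \<Lambda> \<and>
           (\<forall>p \<in> parameter_ball (d/2) o1 o2. \<Lambda> p \<subseteq> phase_space) \<and>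
           \<Lambda> (0, o1, o2) = circular_torus \<omega> m1 m2 o1 o2 \<and>
           (\<forall>\<mu> v1 v2. (\<mu>, v1, v2) \<in> parameter_ball (d/2) o1 o2 \<longrightarrow> 0 < \<mu> \<longrightarrow> \<mu> \<le> d/2 \<longrightarrow>
              (\<exists>r T' \<alpha>'. \<exists>k'::int.
                 T' = 2 * pi / \<bar>v2 - v1\<bar> \<and>
                 \<alpha>' = 2 * pi * (v1 / \<bar>v2 - v1\<bar>) + 2 * pi * of_int k' \<and>
                 three_body_solution \<mu> m1 m2 r \<and>
                 symmetric_solution r \<and>
                 rel_periodic T' \<alpha>' r \<and>
                 \<Lambda> (\<mu>, v1, v2) = phase_orbit \<omega> \<mu> m1 m2 r))"
      by blast
  qed
qed

section \<open>A Fourier integral of the perturbing force\<close>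

lemma integral_sums:
  fixes f :: "nat \<Rightarrow> real \<Rightarrow> complex"
  assumes c: "\<And>n. continuous_on {a..b} (f n)" and bd: "\<And>n t. t \<in> {a..b} \<Longrightarrow> cmod (f n t) \<le> M n"
    and M: "summable M" and s: "\<And>t. t \<in> {a..b} \<Longrightarrow> (\<lambda>n. f n t) sums F t"
  shows "continuous_on {a..b} F" and "(\<lambda>n. integral {a..b} (f n)) sums integral {a..b} F"
proof -
  have "uniform_limit {a..b} (\<lambda>n t. \<Sum>i<n. f i t) (\<lambda>t. \<Sum>i. f i t) sequentially"
    by (rule Weierstrass_m_test[OF bd M])
  moreover have "(\<Sum>i. f i t) = F t" if "t \<in> {a..b}" for t
    using s[OF that] by (simp add: sums_iff)
  ultimately have u: "uniform_limit {a..b} (\<lambda>n t. \<Sum>i<n. f i t) F sequentially"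
    using uniform_limit_cong'[of "{a..b}" "\<lambda>n t. \<Sum>i<n. f i t" "\<lambda>n t. \<Sum>i<n. f i t" "\<lambda>t. \<Sum>i. f i t" F sequentially] by auto
  have cs: "continuous_on {a..b} (\<lambda>t. \<Sum>i<n. f i t)" for n by (intro continuous_on_sum c)
  show "continuous_on {a..b} F"
    by (rule uniform_limit_theorem[OF _ u]) (auto intro!: always_eventually cs)
  obtain I J where IJ: "\<And>n. ((\<lambda>t. \<Sum>i<n. f i t) has_integral I n) {a..b}" "(F has_integral J) {a..b}" "I \<longlonglongrightarrow> J"
    using uniform_limit_integral[OF u cs] by auto
  have "I n = (\<Sum>i<n. integral {a..b} (f i))" for n
    using integral_unique[OF IJ(1)[of n]]
      Henstock_Kurzweil_Integration.integral_sum[of "{..<n}" f "{a..b}"] integrable_continuous_interval[OF c] by auto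
  then have "I = (\<lambda>n. \<Sum>i<n. integral {a..b} (f i))" by auto
  then show "(\<lambda>n. integral {a..b} (f n)) sums integral {a..b} F"
    using IJ(3) integral_unique[OF IJ(2)] by (simp add: sums_def)
qed

lemma has_vector_derivative_cis_affine:
  "((\<lambda>t. cis (a + b * t)) has_vector_derivative \<i> * of_real b * cis (a + b * t)) (at t within S)"
proof -
  have "((\<lambda>z. exp (\<i> * (of_real a + of_real b * z))) has_field_derivative
      exp (\<i> * (of_real a + of_real b * of_real t)) * (\<i> * of_real b)) (at (of_real t))"
    by (auto intro!: derivative_eq_intros)
  from has_vector_derivative_real_field[OF this, of S] show ?thesis by (simp add: cis_conv_exp mult_ac)
qed

lemma integral_cis_multiple:
  fixes \<nu> T c :: real and j :: int
  assumes T: "T > 0" and \<nu>: "\<nu> \<noteq> 0" and per: "\<nu> * T / (2 * pi) \<in> \<int>"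
  shows "integral {0..T} (\<lambda>t. cis (of_int j * (\<nu> * t + c))) = (if j = 0 then of_real T else 0)"
proof (cases "j = 0")
  case True
  then show ?thesis using T by (simp add: scaleR_conv_of_real)
next
  case False
  obtain n where n: "\<nu> * T / (2 * pi) = of_int n" using per by (auto elim: Ints_cases)
  have T': "j * (\<nu> * T) = 2 * pi * of_int (j * n)"
    using n by (simp add: field_simps)
  define k where "k = 1 / (\<i> * of_real (j * \<nu>))"
  have k: "k * (\<i> * of_real (j * \<nu>)) = 1" using False \<nu> by (simp add: k_def)
  have "((\<lambda>t. cis (of_int j * (\<nu> * t + c))) has_integral
      k * cis (j * c + j * \<nu> * T) - k * cis (j * c + j * \<nu> * 0)) {0..T}"
  proof (rule fundamental_theorem_of_calculus)
    fix t :: real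
    have "k * (\<i> * of_real (j * \<nu>) * cis (j * c + j * \<nu> * t)) = cis (of_int j * (\<nu> * t + c))"
      by (subst mult.assoc[symmetric], subst k) (simp add: algebra_simps)
    then show "((\<lambda>t. k * cis (j * c + j * \<nu> * t)) has_vector_derivative cis (of_int j * (\<nu> * t + c))) (at t within {0..T})"
      using has_vector_derivative_mult_right[OF has_vector_derivative_cis_affine[of "j * c" "j * \<nu>" t "{0..T}"], of k] by simp
  qed (use T in auto)
  moreover have "cis (j * c + j * \<nu> * T) = cis (j * c + j * \<nu> * 0)"
  proof -
    have "cis (j * (\<nu> * T)) = 1" unfolding T' by (rule cis_multiple_2pi) simp
    then show ?thesis by (simp add: mult.assoc flip: cis_mult)
  qed
  ultimately show ?thesis using False by (simp add: integral_unique)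
qed

text \<open>Taylor coefficients of \<open>(1 - z)\<^sup>-\<^sup>1\<^sup>/\<^sup>2\<close>, followed
  by those of \<open>(1 - z)\<^sup>-\<^sup>3\<^sup>/\<^sup>2\<close>; see
  \<open>coeff_series\<close>.\<close>

definition half_coeff :: "nat \<Rightarrow> real" where "half_coeff n = pochhammer (1/2) n / fact n"
definition three_half_coeff :: "nat \<Rightarrow> real" where "three_half_coeff n = pochhammer (3/2) n / fact n"

lemma coeff_pos: "half_coeff n > 0" "three_half_coeff n > 0"
  by (simp_all add: half_coeff_def three_half_coeff_def pochhammer_pos)

text \<open>Consecutive coefficients have ratio \<open>(m + 1/2) / (m + 1)\<close>, below 1; for the
  other sequence it is \<open>(m + 3/2) / (m + 1)\<close>, above 1.\<close>

lemma half_coeff_antimono: "half_coeff (n + i) \<le> half_coeff n"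
proof (induction i)
  case (Suc i)
  have "half_coeff (Suc m) \<le> half_coeff m" for m
  proof -
    have "half_coeff (Suc m) = half_coeff m * ((1/2 + m) / (m + 1))"
      by (simp add: half_coeff_def pochhammer_Suc field_simps)
    also have "\<dots> \<le> half_coeff m * 1"
      using coeff_pos[of m] by (intro mult_left_mono) (auto simp: field_simps)
    finally show ?thesis by simp
  qed
  from this[of "n + i"] Suc show ?case by simp
qed simp

lemma three_half_coeff_mono: "three_half_coeff n \<le> three_half_coeff (n + i)"
proof (induction i)
  case (Suc i)
  have "three_half_coeff m \<le> three_half_coeff (Suc m)" for m
  proof -
    have "three_half_coeff m * 1 \<le> three_half_coeff m * ((3/2 + m) / (m + 1))"
      using coeff_pos[of m] by (intro mult_left_mono) (auto simp: field_simps)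
    also have "\<dots> = three_half_coeff (Suc m)"
      by (simp add: three_half_coeff_def pochhammer_Suc field_simps)
    finally show ?thesis by simp
  qed
  from this[of "n + i"] Suc show ?case by simp
qed simp

lemma one_minus_powr_series:
  fixes z :: complex and a :: real
  assumes "cmod z < 1"
  shows "(\<lambda>n. of_real (pochhammer a n / fact n) * z ^ n) sums (1 - z) powr (- of_real a)"
proof -
  have "((- of_real a) gchoose n) * (- z) ^ n = of_real (pochhammer a n / fact n) * z ^ n" for n
    by (simp add: gbinomial_pochhammer pochhammer_of_real power_minus[of z] flip: mult.assoc power_add mult_2_right)
  with gen_binomial_complex[of "- z" "- of_real a"] assms show ?thesis by simp
qed

lemma coeff_series:
  fixes z :: complex
  assumes "cmod z < 1"
  shows "(\<lambda>n. of_real (half_coeff n) * z ^ n) sums (1 - z) powr (- 1/2)"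
    and "(\<lambda>n. of_real (three_half_coeff n) * z ^ n) sums (1 - z) powr (- 3/2)"
  using one_minus_powr_series[OF assms, of "1/2"] one_minus_powr_series[OF assms, of "3/2"]
  by (simp_all add: half_coeff_def three_half_coeff_def)

lemma coeff_summable:
  fixes s :: real assumes "0 \<le> s" "s < 1"
  shows "summable (\<lambda>n. half_coeff n * s ^ n)" "summable (\<lambda>n. three_half_coeff n * s ^ n)"
proof -
  have "cmod (of_real s) < 1" using assms by simp
  from coeff_series[OF this] have "summable (\<lambda>n. complex_of_real (half_coeff n * s ^ n))"
    "summable (\<lambda>n. complex_of_real (three_half_coeff n * s ^ n))" by (auto simp: sums_iff)
  then show "summable (\<lambda>n. half_coeff n * s ^ n)" "summable (\<lambda>n. three_half_coeff n * s ^ n)"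
    by (simp_all only: summable_complex_of_real)
qed

text \<open>Since \<open>\<bar>w\<bar>\<^sup>-\<^sup>3\<close> is the product of the powers -3/2 of
  \<open>w\<close> and \<open>cnj w\<close>, the force splits into a power series in
  \<open>z\<close> times one in \<open>cnj z\<close>, which makes all Fourier coefficients
  explicit.\<close>

lemma cubed_one_minus:
  assumes "cmod z < 1"
  shows "cubed (1 - z) = (1 - z) powr (- 1/2) * (1 - cnj z) powr (- 3/2)"
proof -
  define w where "w = 1 - z"
  have "Re z < 1" using complex_Re_le_cmod[of z] assms by linarith
  then have w: "Re w > 0" by (simp add: w_def)
  then have w0: "w \<noteq> 0" "w \<notin> \<real>\<^sub>\<le>\<^sub>0" by (auto simp: complex_nonpos_Reals_iff)
  have cw: "1 - cnj z = cnj w" by (simp add: w_def)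
  have "w powr (- 1/2) * cnj w powr (- 3/2) = exp (- 1/2 * Ln w + - 3/2 * cnj (Ln w))"
    using w0 by (simp add: powr_def cnj_Ln flip: exp_add)
  also have "- 1/2 * Ln w + - 3/2 * cnj (Ln w) = Ln w - of_real (3 * Re (Ln w))"
    by (simp add: complex_eq_iff)
  also have "exp \<dots> = w / of_real (exp (3 * ln (cmod w)))"
    using w0 by (simp add: exp_diff exp_of_real[symmetric])
  also have "exp (3 * ln (cmod w)) = cmod w ^ 3"
    using w0 exp_of_nat_mult[of 3 "ln (cmod w)"] by simp
  finally show ?thesis unfolding cw w_def[symmetric] cubed_def by simp
qed

text \<open>Orthogonality of exponentials over a whole number of periods picks out the single term
  \<open>n = - j\<close>; for positive \<open>j\<close> there is none.\<close>

lemma integral_cis_powr: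
  fixes \<nu> T c s :: real and j :: int
  assumes T: "T > 0" and \<nu>: "\<nu> \<noteq> 0" and per: "\<nu> * T / (2 * pi) \<in> \<int>" and s: "0 < s" "s < 1"
  shows "continuous_on {0..T} (\<lambda>t. (1 - of_real s * cis (\<nu> * t + c)) powr (- 3/2))"
    and "integral {0..T} (\<lambda>t. cis (of_int j * (\<nu> * t + c)) * (1 - of_real s * cis (\<nu> * t + c)) powr (- 3/2))
     = of_real (if j \<le> 0 then T * three_half_coeff (nat (- j)) * s ^ nat (- j) else 0)"
proof -
  define f where "f = (\<lambda>(j::int) n t. of_real (three_half_coeff n * s ^ n) * cis (of_int (j + int n) * (\<nu> * t + c)))"
  have cf: "continuous_on {0..T} (f j n)" for j n
    unfolding f_def cis_conv_exp by (intro continuous_intros)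
  have bf: "cmod (f j n t) \<le> three_half_coeff n * s ^ n" for j n t
    using s coeff_pos[of n] by (simp add: f_def norm_mult norm_power abs_mult)
  have sf: "(\<lambda>n. f j n t) sums (cis (of_int j * (\<nu> * t + c)) * (1 - of_real s * cis (\<nu> * t + c)) powr (- 3/2))" for j t
  proof -
    have "cmod (of_real s * cis (\<nu> * t + c)) < 1" using s by (simp add: norm_mult)
    from sums_mult[OF coeff_series(2)[OF this], of "cis (of_int j * (\<nu> * t + c))"]
    moreover have "cis (of_int j * (\<nu> * t + c)) * (of_real (three_half_coeff n) * (of_real s * cis (\<nu> * t + c)) ^ n) = f j n t" for n
    proof -
      have "cis (of_int (j + int n) * (\<nu> * t + c)) = cis (of_int j * (\<nu> * t + c)) * cis (\<nu> * t + c) ^ n"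
        unfolding Complex.DeMoivre cis_mult by (rule arg_cong[where f = cis]) (simp add: algebra_simps)
      then show ?thesis unfolding f_def by (simp add: power_mult_distrib)
    qed
    ultimately show ?thesis by simp
  qed
  note isums = integral_sums[OF cf bf coeff_summable(2)[OF less_imp_le[OF s(1)] s(2)] sf]
  show "continuous_on {0..T} (\<lambda>t. (1 - of_real s * cis (\<nu> * t + c)) powr (- 3/2))"
    using isums(1)[of 0] by simp
  have "integral {0..T} (f j n) = (if n = nat (- j) then (if j \<le> 0 then of_real (T * three_half_coeff n * s ^ n) else 0) else 0)" for n
    unfolding f_def
    using integral_cis_multiple[OF T \<nu> per, of "j + int n" c] by auto
  with isums(2)[of j] have "(\<lambda>n. if n = nat (- j) then (if j \<le> 0 then of_real (T * three_half_coeff n * s ^ n) else 0) else 0) sums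
    integral {0..T} (\<lambda>t. cis (of_int j * (\<nu> * t + c)) * (1 - of_real s * cis (\<nu> * t + c)) powr (- 3/2))" by simp
  from sums_unique2[OF this sums_single[of "nat (- j)" "\<lambda>n. if j \<le> 0 then of_real (T * three_half_coeff n * s ^ n) else 0"]]
  show "integral {0..T} (\<lambda>t. cis (of_int j * (\<nu> * t + c)) * (1 - of_real s * cis (\<nu> * t + c)) powr (- 3/2))
     = of_real (if j \<le> 0 then T * three_half_coeff (nat (- j)) * s ^ nat (- j) else 0)" by simp
qed

text \<open>Expanding the other factor of the force shifts the index to \<open>j - n\<close>, and
  \<open>integral_cis_powr\<close> evaluates each term. All terms are nonnegative, and the phase
  \<open>c\<close> has disappeared, so later bounds are uniform in it.\<close>

lemma integral_cis_cubed:
  fixes \<nu> T c s :: real and j :: int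
  assumes T: "T > 0" and \<nu>: "\<nu> \<noteq> 0" and per: "\<nu> * T / (2 * pi) \<in> \<int>" and s: "0 < s" "s < 1"
  shows "(\<lambda>n. complex_of_real (if j \<le> int n then half_coeff n * s ^ n * (T * three_half_coeff (nat (int n - j)) * s ^ nat (int n - j)) else 0))
     sums integral {0..T} (\<lambda>t. cis (of_int j * (\<nu> * t + c)) * cubed (1 - of_real s * cis (- (\<nu> * t + c))))"
proof -
  define h where "h t = (1 - of_real s * cis (\<nu> * t + c)) powr (- 3/2)" for t
  note ch = integral_cis_powr(1)[OF assms, of c, folded h_def]
  have "compact (h ` {0..T})" by (intro compact_continuous_image ch) simp
  then obtain B where B: "B > 0" "\<And>t. t \<in> {0..T} \<Longrightarrow> cmod (h t) \<le> B"
    using compact_imp_bounded bounded_pos by (metis image_eqI)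
  define f where "f = (\<lambda>n t. of_real (half_coeff n * s ^ n) * (cis (of_int (j - int n) * (\<nu> * t + c)) * h t))"
  have cf: "continuous_on {0..T} (f n)" for n
    unfolding f_def cis_conv_exp by (intro continuous_intros ch)
  have bf: "cmod (f n t) \<le> half_coeff n * s ^ n * B" if "t \<in> {0..T}" for n t
    using s coeff_pos[of n] B(2)[OF that] by (simp add: f_def norm_mult norm_power abs_mult mult_left_mono)
  have sf: "(\<lambda>n. f n t) sums (cis (of_int j * (\<nu> * t + c)) * cubed (1 - of_real s * cis (- (\<nu> * t + c))))" for t
  proof -
    have l: "cmod (of_real s * cis (- (\<nu> * t + c))) < 1" using s by (simp add: norm_mult)
    have "cubed (1 - of_real s * cis (- (\<nu> * t + c))) = (1 - of_real s * cis (- (\<nu> * t + c))) powr (- 1/2) * h t"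
      unfolding cubed_one_minus[OF l] h_def by (simp add: cis_cnj add.commute)
    then have "cis (of_int j * (\<nu> * t + c)) * cubed (1 - of_real s * cis (- (\<nu> * t + c))) =
      cis (of_int j * (\<nu> * t + c)) * h t * (1 - of_real s * cis (- (\<nu> * t + c))) powr (- 1/2)"
      by (simp only: mult_ac)
    moreover have "cis (of_int j * (\<nu> * t + c)) * h t * (of_real (half_coeff n) * (of_real s * cis (- (\<nu> * t + c))) ^ n) = f n t" for n
    proof -
      have "cis (of_int (j - int n) * (\<nu> * t + c)) = cis (of_int j * (\<nu> * t + c)) * cis (- (\<nu> * t + c)) ^ n"
        unfolding Complex.DeMoivre cis_mult by (rule arg_cong[where f = cis]) (simp add: algebra_simps)
      then show ?thesis unfolding f_def by (simp add: power_mult_distrib)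
    qed
    ultimately show ?thesis
      using sums_mult[OF coeff_series(1)[OF l], of "cis (of_int j * (\<nu> * t + c)) * h t"] by (simp add: mult.assoc)
  qed
  have "integral {0..T} (f n) = of_real (if j \<le> int n then half_coeff n * s ^ n * (T * three_half_coeff (nat (int n - j)) * s ^ nat (int n - j)) else 0)" for n
    unfolding f_def Henstock_Kurzweil_Integration.integral_mult_right
      integral_cis_powr(2)[OF assms, of "j - int n" c, folded h_def] by simp
  with integral_sums(2)[OF cf bf summable_mult2[OF coeff_summable(1)[OF less_imp_le[OF s(1)] s(2)], of B] sf]
  show ?thesis by simp
qed

text \<open>
  All Fourier coefficients of \<open>(1 - z)\<^sup>-\<^sup>1\<^sup>/\<^sup>2 (1 - cnj z)\<^sup>-\<^sup>3\<^sup>/\<^sup>2\<close> on a circle are positive, and the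
  monotonicity of the two coefficient sequences compares the ones with opposite indices.
\<close>

lemma fourier_cubed:
  fixes \<nu> T A A' :: real and k :: int
  assumes T: "T > 0" and \<nu>: "\<nu> \<noteq> 0" and per: "\<nu> * T / (2 * pi) \<in> \<int>" and A: "0 < A" "A < A'" and k: "k \<le> - 2"
  obtains L where "L > 0" "\<And>c. L \<le> cmod
    (3 * integral {0..T} (\<lambda>t. cis (of_int k * (\<nu> * t + c)) * cubed (of_real A' * cis (\<nu> * t + c) - of_real A))
     - integral {0..T} (\<lambda>t. cis (of_int k * (\<nu> * t + c)) * cnj (cubed (of_real A' * cis (\<nu> * t + c) - of_real A))))"
proof -
  define s where "s = A / A'"
  have s: "0 < s" "s < 1" using A by (auto simp: s_def)
  define q where "q = complex_of_real (A' / A' ^ 3)"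
  define J where "J j c = integral {0..T} (\<lambda>t. cis (of_int j * (\<nu> * t + c)) * cubed (1 - of_real s * cis (- (\<nu> * t + c))))" for j :: int and c
  have cub: "cubed (of_real A' * cis \<phi> - of_real A) = q * cis \<phi> * cubed (1 - of_real s * cis (- \<phi>))" for \<phi>
  proof -
    have "cis \<phi> * cis (- \<phi>) = 1" by (simp add: cis_mult)
    then have "of_real A' * cis \<phi> - of_real A = of_real A' * cis \<phi> * (1 - of_real s * cis (- \<phi>))"
      using A by (simp add: s_def right_diff_distrib mult_ac)
    then show ?thesis using A by (simp add: cubed_scale q_def)
  qed
  have I1: "integral {0..T} (\<lambda>t. cis (of_int k * (\<nu> * t + c)) * cubed (of_real A' * cis (\<nu> * t + c) - of_real A)) = q * J (k + 1) c" for c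
  proof -
    have "cis (of_int k * \<phi>) * (q * cis \<phi> * z) = q * (cis (of_int (k + 1) * \<phi>) * z)" for \<phi> z
      by (simp add: distrib_right cis_mult[symmetric])
    then show ?thesis unfolding J_def cub by (simp only: Henstock_Kurzweil_Integration.integral_mult_right)
  qed
  have I2: "integral {0..T} (\<lambda>t. cis (of_int k * (\<nu> * t + c)) * cnj (cubed (of_real A' * cis (\<nu> * t + c) - of_real A))) = q * cnj (J (1 - k) c)" for c
  proof -
    have "cis (of_int k * \<phi>) * cnj (q * cis \<phi> * z) = q * cnj (cis (of_int (1 - k) * \<phi>) * z)" for \<phi> z
    proof -
      have "cis (of_int (1 - k) * \<phi>) = cis \<phi> * cis (- (of_int k * \<phi>))"
        by (simp add: cis_mult algebra_simps)
      then show ?thesis by (simp add: q_def cis_cnj)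
    qed
    then show ?thesis unfolding J_def cub
      by (simp only: Henstock_Kurzweil_Integration.integral_mult_right Henstock_Kurzweil_Integration.integral_cnj)
  qed
  \<comment> \<open>The two Fourier indices become \<open>-K\<close> and \<open>K + 2\<close>:
    opposite signs, the positive one being larger by 2 in modulus, which favours the first series in
    every term.\<close>
  define K where "K = nat (- k - 1)"
  have K: "k + 1 = - int K" "1 - k = int (K + 2)" using k by (auto simp: K_def)
  define p where "p n = half_coeff n * s ^ n * (T * three_half_coeff (n + K) * s ^ (n + K))" for n
  define p' where "p' n = half_coeff (n + (K + 2)) * s ^ (n + (K + 2)) * (T * three_half_coeff n * s ^ n)" for n
  have S1: "(\<lambda>n. complex_of_real (p n)) sums J (k + 1) c" for c
  proof -
    have "nat (int n - - int K) = n + K" for n by simp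
    with integral_cis_cubed[OF T \<nu> per s, of "k + 1" c] show ?thesis unfolding J_def[symmetric] K p_def by simp
  qed
  have S2: "(\<lambda>n. complex_of_real (p' n)) sums J (1 - k) c" for c
  proof -
    have "(\<lambda>n. complex_of_real (if int (K + 2) \<le> int n then half_coeff n * s ^ n * (T * three_half_coeff (nat (int n - int (K + 2))) * s ^ nat (int n - int (K + 2))) else 0)) sums J (1 - k) c"
      using integral_cis_cubed[OF T \<nu> per s, of "1 - k" c] unfolding J_def[symmetric] K .
    \<comment> \<open>The first \<open>K + 2\<close> terms vanish; dropping them aligns the series
      with \<open>p'\<close>.\<close>
    then show ?thesis
      by (subst (asm) sums_zero_iff_shift[symmetric, of "K + 2"]) (simp_all add: p'_def)
  qed
  have sm: "summable p" "summable p'"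
    using S1[of 0] S2[of 0] summable_complex_of_real by (metis sums_summable)+
  have J: "J (k + 1) c = of_real (suminf p)" "J (1 - k) c = of_real (suminf p')" for c
    using sums_unique2[OF S1] sums_unique2[OF S2] sm[THEN summable_sums] by (simp_all add: sums_of_real)
  have pp: "p n > 0" for n using coeff_pos s T by (simp add: p_def)
  have "p' n \<le> p n" for n
  proof -
    have "half_coeff (n + (K + 2)) * three_half_coeff n * s ^ ((n + (K + 2)) + n) \<le>
      half_coeff n * three_half_coeff (n + K) * s ^ (n + (n + K))"
      using s coeff_pos[of n] coeff_pos[of "n + (K + 2)"] coeff_pos[of "n + K"]
      by (intro mult_mono half_coeff_antimono three_half_coeff_mono power_decreasing) auto
    then have "T * (half_coeff (n + (K + 2)) * three_half_coeff n * s ^ ((n + (K + 2)) + n)) \<le>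
      T * (half_coeff n * three_half_coeff (n + K) * s ^ (n + (n + K)))" using T by (intro mult_left_mono) auto
    then show ?thesis unfolding p_def p'_def power_add[of s "n + (K + 2)" n] power_add[of s n "n + K"] by (simp only: mult_ac)
  qed
  then have le: "suminf p' \<le> suminf p" using sm by (intro suminf_le)
  have pos: "suminf p > 0" by (intro suminf_pos sm pp)
  show thesis
  proof (rule that[of "cmod q * (2 * suminf p)"])
    show "cmod q * (2 * suminf p) > 0" using pos A by (simp add: q_def)
    fix c
    have "3 * (q * J (k + 1) c) - q * cnj (J (1 - k) c) = q * of_real (3 * suminf p - suminf p')"
      unfolding J by (simp add: algebra_simps)
    moreover have "2 * suminf p \<le> \<bar>3 * suminf p - suminf p'\<bar>" using le pos by linarith
    ultimately show "cmod q * (2 * suminf p) \<le> cmod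
    (3 * integral {0..T} (\<lambda>t. cis (of_int k * (\<nu> * t + c)) * cubed (of_real A' * cis (\<nu> * t + c) - of_real A))
     - integral {0..T} (\<lambda>t. cis (of_int k * (\<nu> * t + c)) * cnj (cubed (of_real A' * cis (\<nu> * t + c) - of_real A))))"
      unfolding I1 I2 by (simp only: norm_mult norm_of_real mult_left_mono norm_ge_zero)
  qed
qed

section \<open>The eccentricity vector of the inner planet\<close>

lemma norm_diff_le_derivative:
  fixes f :: "real \<Rightarrow> complex"
  assumes "a \<le> b" and D: "\<And>t. t \<in> {a..b} \<Longrightarrow> (f has_vector_derivative f' t) (at t)"
    and B: "\<And>t. t \<in> {a..b} \<Longrightarrow> cmod (f' t) \<le> B"
  shows "cmod (f b - f a) \<le> B * (b - a)"
proof -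
  have "(f' has_integral (f b - f a)) {a..b}"
    using assms(1) D by (intro fundamental_theorem_of_calculus) (auto intro: has_vector_derivative_at_within)
  moreover have "0 \<le> B" using B[of a] assms(1) norm_ge_zero[of "f' a"] by (meson atLeastAtMost_iff order_refl order_trans)
  ultimately show ?thesis
    using has_integral_bound_real[of B "{}" f' "f b - f a" a b] B assms(1) by simp
qed

lemma continuous_compact_nbhd_close:
  fixes f :: "'a::euclidean_space \<Rightarrow> 'b::real_normed_vector"
  assumes K: "compact K" and U: "open U" "K \<subseteq> U" and f: "continuous_on U f" and "\<eta> > 0"
  obtains \<delta> where "\<delta> > 0" "\<And>k z. k \<in> K \<Longrightarrow> dist k z \<le> \<delta> \<Longrightarrow> z \<in> U \<and> dist (f k) (f z) \<le> \<eta>"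
proof -
  obtain d where d: "d > 0" "(\<Union>x\<in>K. cball x d) \<subseteq> U" "compact (\<Union>x\<in>K. cball x d)"
    using compact_closed_nbhd[OF K U] .
  have "uniformly_continuous_on (\<Union>x\<in>K. cball x d) f"
    using d f by (intro compact_uniformly_continuous) (auto intro: continuous_on_subset)
  then obtain e where e: "e > 0" "\<And>x y. x \<in> (\<Union>x\<in>K. cball x d) \<Longrightarrow> y \<in> (\<Union>x\<in>K. cball x d) \<Longrightarrow> dist y x < e \<Longrightarrow> dist (f y) (f x) < \<eta>"
    unfolding uniformly_continuous_on_def using \<open>\<eta> > 0\<close> by meson
  show thesis
  proof (rule that[of "min d (e / 2)"])
    show "min d (e / 2) > 0" using d e by simp
    fix k z assume h: "k \<in> K" "dist k z \<le> min d (e / 2)"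
    then have "z \<in> (\<Union>x\<in>K. cball x d)" "k \<in> (\<Union>x\<in>K. cball x d)"
      using UN_I[OF h(1), of _ "\<lambda>x. cball x d"] h(2) d(1) by auto
    moreover have "dist k z < e" using h e(1) by simp
    ultimately show "z \<in> U \<and> dist (f k) (f z) \<le> \<eta>"
      using e(2)[of z k] d(2) by (meson less_imp_le subsetD)
  qed
qed

text \<open>The Laplace-Runge-Lenz vector \<open>v \<times> L - x / \<bar>x\<bar>\<close> of the
  Kepler problem with unit constant, in complex notation; \<open>Im (cnj x * v)\<close> is the
  angular momentum.\<close>

definition ecc :: "complex \<Rightarrow> complex \<Rightarrow> complex" where
  "ecc x v = - \<i> * of_real (Im (cnj x * v)) * v - x / of_real (cmod x)"

definition planet_force :: "real \<Rightarrow> real \<Rightarrow> complex \<Rightarrow> complex \<Rightarrow> complex" where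
  "planet_force m m' x y = - of_real m * cubed x + of_real m' * (cubed (y - x) - cubed y)"

text \<open>Variation of the eccentricity vector under an additional acceleration \<open>q\<close>,
  through the angular momentum and through the velocity.\<close>

definition ecc_rate :: "complex \<Rightarrow> complex \<Rightarrow> complex \<Rightarrow> complex" where
  "ecc_rate x v q = - \<i> * of_real (Im (cnj x * q)) * v - \<i> * of_real (Im (cnj x * v)) * q"

text \<open>The central force leaves the angular momentum unchanged, and its remaining contribution
  cancels against the derivative of \<open>x / \<bar>x\<bar>\<close> (the fact \<open>key\<close>).
  Only the perturbation survives, with its factor \<mu>.\<close>

lemma ecc_DERIV:
  fixes \<mu> :: real
  assumes X: "(X has_vector_derivative V t) (at t)" and V: "(V has_vector_derivative - cubed (X t) + of_real \<mu> * q) (at t)"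
    and nz: "X t \<noteq> 0"
  shows "((\<lambda>t. ecc (X t) (V t)) has_vector_derivative of_real \<mu> * ecc_rate (X t) (V t) q) (at t)"
proof -
  define a where "a = - cubed (X t) + of_real \<mu> * q"
  have V': "(V has_vector_derivative a) (at t)" using V by (simp add: a_def)
  have Re: "((\<lambda>t. Re (f t)) has_real_derivative Re f') (at t)" and Im: "((\<lambda>t. Im (f t)) has_real_derivative Im f') (at t)"
    if "(f has_vector_derivative f') (at t)" for f f'
    using bounded_linear.has_vector_derivative[OF bounded_linear_Re that]
      bounded_linear.has_vector_derivative[OF bounded_linear_Im that]
    by (simp_all add: has_real_derivative_iff_has_vector_derivative)
  define x v where "x = X t" and "v = V t"
  have x0: "x \<noteq> 0" using nz by (simp add: x_def)
  have p: "(Re x)\<^sup>2 + (Im x)\<^sup>2 > 0" using x0 by (simp add: complex_neq_0)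
  define n where "n = inverse (cmod x)"
  have n: "n > 0" "n\<^sup>2 * (cmod x)\<^sup>2 = 1" using x0 by (simp_all add: n_def field_simps)
  have N: "((\<lambda>t. inverse (cmod (X t))) has_real_derivative - (n ^ 3 * Re (cnj x * v))) (at t)"
  proof -
    define G where "G t = (Re (X t))\<^sup>2 + (Im (X t))\<^sup>2" for t
    define y where "y = Re (cnj x * v)"
    have G: "(G has_real_derivative 2 * y) (at t)"
      unfolding G_def y_def x_def v_def by (auto intro!: derivative_eq_intros X)
    have n': "n = inverse (sqrt (G t))" by (simp add: n_def G_def cmod_def x_def)
    have "G t > 0" using p by (simp add: G_def x_def)
    then have "((\<lambda>t. inverse (sqrt (G t))) has_real_derivative - (n ^ 3 * y)) (at t)"
      unfolding n' by (auto intro!: derivative_eq_intros G simp: power3_eq_cube power2_eq_square field_simps)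
    then show ?thesis by (simp add: cmod_def G_def y_def)
  qed
  have h: "((\<lambda>t. Im (cnj (X t) * V t)) has_real_derivative Im (cnj x * a)) (at t)"
    unfolding x_def
    by (auto intro!: derivative_eq_intros X V' simp: algebra_simps)
  have D: "((\<lambda>t. (- \<i>) * (Im (cnj (X t) * V t) *\<^sub>R V t) - inverse (cmod (X t)) *\<^sub>R X t) has_vector_derivative
     (- \<i>) * (Im (cnj x * v) *\<^sub>R a + Im (cnj x * a) *\<^sub>R v) - (n *\<^sub>R v + (- (n ^ 3 * Re (cnj x * v))) *\<^sub>R x)) (at t)"
    using has_vector_derivative_diff[OF has_vector_derivative_mult_right[OF has_vector_derivative_scaleR[OF h V'], of "- \<i>"]
        has_vector_derivative_scaleR[OF N X]]
    by (simp add: x_def v_def n_def)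
  have cu: "cubed x = of_real (n ^ 3) * x" by (simp add: cubed_def n_def divide_inverse power_inverse)
  have xx: "cnj x * x = of_real ((cmod x)\<^sup>2)" by (simp only: complex_norm_square mult.commute)
  have ia: "Im (cnj x * a) = \<mu> * Im (cnj x * q)"
  proof -
    have "cnj x * a = - of_real (n ^ 3 * (cmod x)\<^sup>2) + of_real \<mu> * (cnj x * q)"
      using xx unfolding a_def x_def[symmetric] cu by (simp add: algebra_simps)
    then show ?thesis by simp
  qed
  have key: "of_real (n ^ 3 * Re (cnj x * v)) * x + \<i> * of_real (Im (cnj x * v)) * (of_real (n ^ 3) * x) = of_real n * v"
  proof -
    have "of_real (n ^ 3 * Re (cnj x * v)) * x + \<i> * of_real (Im (cnj x * v)) * (of_real (n ^ 3) * x) =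
      of_real (n ^ 3) * x * (of_real (Re (cnj x * v)) + \<i> * of_real (Im (cnj x * v)))"
      unfolding of_real_mult by (simp only: distrib_left mult_ac)
    also have "\<dots> = of_real (n ^ 3) * (cnj x * x) * v"
      unfolding complex_eq[symmetric] by (simp only: mult_ac)
    also have "\<dots> = of_real (n * (n\<^sup>2 * (cmod x)\<^sup>2)) * v" unfolding xx by (simp add: power3_eq_cube power2_eq_square mult_ac)
    finally show ?thesis by (simp add: n(2))
  qed
  have "(- \<i>) * (Im (cnj x * v) *\<^sub>R a + Im (cnj x * a) *\<^sub>R v) - (n *\<^sub>R v + (- (n ^ 3 * Re (cnj x * v))) *\<^sub>R x)
      = of_real \<mu> * ecc_rate x v q"
    using key unfolding ia ecc_rate_def unfolding a_def x_def[symmetric] cu scaleR_conv_of_real of_real_minus of_real_mult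
    by (simp add: algebra_simps)
  moreover have "(\<lambda>t. (- \<i>) * (Im (cnj (X t) * V t) *\<^sub>R V t) - inverse (cmod (X t)) *\<^sub>R X t) = (\<lambda>t. ecc (X t) (V t))"
    by (simp add: ecc_def scaleR_conv_of_real fun_eq_iff divide_inverse mult_ac)
  ultimately show ?thesis using D by (simp add: x_def v_def)
qed

text \<open>Undoing the rotation leaves a curve of speed at most \<epsilon>, and the phase is read
  off from \<open>X 0\<close>. The error grows linearly in time, which is harmless on a bounded
  interval.\<close>

lemma near_circle:
  fixes w :: real
  assumes D: "\<And>t. (X has_vector_derivative V t) (at t)"
    and A: "\<And>t. \<bar>cmod (X t) - A\<bar> \<le> \<epsilon>" and V: "\<And>t. cmod (V t - \<i> * of_real w * X t) \<le> \<epsilon>"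
  obtains \<beta> where "\<And>t. t \<ge> 0 \<Longrightarrow> cmod (X t - of_real A * cis (\<beta> + w * t)) \<le> \<epsilon> * (1 + t)"
proof (rule that[of "Arg (X 0)"])
  fix t :: real assume t: "t \<ge> 0"
  define Z where "Z t = cis (0 + (- w) * t) * X t" for t
  have "(Z has_vector_derivative cis (0 + (- w) * t) * V t + \<i> * of_real (- w) * cis (0 + (- w) * t) * X t) (at t)" for t
    unfolding Z_def by (rule has_vector_derivative_mult[OF has_vector_derivative_cis_affine D])
  moreover have "cis (0 + (- w) * t) * V t + \<i> * of_real (- w) * cis (0 + (- w) * t) * X t = cis (0 + (- w) * t) * (V t - \<i> * of_real w * X t)" for t
    by (simp add: algebra_simps)
  ultimately have "cmod (Z t - Z 0) \<le> \<epsilon> * (t - 0)"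
    using V by (intro norm_diff_le_derivative[OF t]) (auto simp: norm_mult)
  moreover have "cmod (Z 0 - of_real A * cis (Arg (X 0))) \<le> \<epsilon>"
  proof -
    have "Z 0 = of_real (cmod (X 0)) * cis (Arg (X 0))"
      using rcis_cmod_Arg[of "X 0"] by (simp add: Z_def rcis_def)
    then have "Z 0 - of_real A * cis (Arg (X 0)) = of_real (cmod (X 0) - A) * cis (Arg (X 0))"
      by (simp add: left_diff_distrib)
    then show ?thesis using A[of 0] by (simp only: norm_mult norm_of_real norm_cis mult_1_right)
  qed
  ultimately have "cmod (Z t - of_real A * cis (Arg (X 0))) \<le> \<epsilon> * (1 + t)"
    using norm_triangle_ineq[of "Z t - Z 0" "Z 0 - of_real A * cis (Arg (X 0))"] by (simp add: distrib_left)
  moreover have "X t - of_real A * cis (Arg (X 0) + w * t) = cis (w * t) * (Z t - of_real A * cis (Arg (X 0)))"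
  proof -
    have "cis (w * t) * cis (0 + (- w) * t) = 1" by (simp add: cis_mult)
    then have "cis (w * t) * Z t = X t" unfolding Z_def by (simp only: mult.assoc[symmetric] mult_1)
    then show ?thesis by (simp add: right_diff_distrib cis_mult[symmetric] mult_ac)
  qed
  ultimately show "cmod (X t - of_real A * cis (Arg (X 0) + w * t)) \<le> \<epsilon> * (1 + t)"
    by (simp add: norm_mult)
qed

lemma continuous_on_cubed [continuous_intros]:
  fixes f :: "'a::topological_space \<Rightarrow> complex"
  assumes "continuous_on S f" "\<And>x. x \<in> S \<Longrightarrow> f x \<noteq> 0"
  shows "continuous_on S (\<lambda>x. cubed (f x))"
  unfolding cubed_def using assms by (intro continuous_intros) auto

text \<open>In the frame of the inner planet the force depends only on the relative angle. The
  correction of the central force and the indirect term carry the harmonics \<open>k\<close>,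
  \<open>k + 1\<close>, \<open>k - 1\<close>, all nonzero for \<open>k \<le> - 2\<close>, and
  integrate to zero; the direct attraction leaves the combination treated in
  \<open>fourier_cubed\<close>.\<close>

lemma circular_ecc_integral:
  fixes \<nu> T A A' m m' w w' :: real and k :: int
  assumes T: "T > 0" and \<nu>: "\<nu> \<noteq> 0" and per: "\<nu> * T / (2 * pi) \<in> \<int>" and A: "0 < A" "A < A'" and k: "k \<le> - 2"
    and w: "w = k * \<nu>" "w' = (k + 1) * \<nu>" and m': "m' > 0"
  obtains L where "L > 0" "\<And>\<beta> \<beta>'. \<exists>I. ((\<lambda>t. ecc_rate (of_real A * cis (\<beta> + w * t)) (\<i> * of_real w * (of_real A * cis (\<beta> + w * t)))
       (planet_force m m' (of_real A * cis (\<beta> + w * t)) (of_real A' * cis (\<beta>' + w' * t)))) has_integral I) {0..T} \<and> L \<le> cmod I"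
proof -
  obtain L where L: "L > 0" "\<And>c. L \<le> cmod
    (3 * integral {0..T} (\<lambda>t. cis (of_int k * (\<nu> * t + c)) * cubed (of_real A' * cis (\<nu> * t + c) - of_real A))
     - integral {0..T} (\<lambda>t. cis (of_int k * (\<nu> * t + c)) * cnj (cubed (of_real A' * cis (\<nu> * t + c) - of_real A))))"
    using fourier_cubed[OF T \<nu> per A k] by blast
  have w0: "w \<noteq> 0" using w k \<nu> by auto
  show thesis
  proof (rule that[of "\<bar>w\<bar> * A\<^sup>2 / 2 * m' * L"])
    show "\<bar>w\<bar> * A\<^sup>2 / 2 * m' * L > 0" using w0 A m' L by simp
    fix \<beta> \<beta>' :: real
    define c where "c = \<beta>' - \<beta>"
    define a0 a1 where "a0 = complex_of_real (A / A ^ 3)" and "a1 = complex_of_real (A' / A' ^ 3)"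
    define F where "F t = cubed (of_real A' * cis (\<nu> * t + c) - of_real A)" for t
    define e where "e j t = cis (of_int j * (\<nu> * t + c))" for j :: int and t
    have ne: "of_real A' * cis (\<nu> * t + c) - of_real A \<noteq> 0" for t
    proof
      assume "of_real A' * cis (\<nu> * t + c) - of_real A = 0"
      then have "cmod (of_real A' * cis (\<nu> * t + c)) = cmod (of_real A)" by simp
      then show False using A by (simp add: norm_mult)
    qed
    have ce: "continuous_on {0..T} (e j)" for j unfolding e_def cis_conv_exp by (intro continuous_intros)
    have cF: "continuous_on {0..T} F"
      unfolding F_def by (intro continuous_intros ne)
    have ie: "(e j has_integral 0) {0..T}" if "j \<noteq> 0" for j
      using integrable_integral[OF integrable_continuous_interval[OF ce[of j]]] integral_cis_multiple[OF T \<nu> per, of j c] that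
      by (simp add: e_def[abs_def])
    define J J' where "J = integral {0..T} (\<lambda>t. e k t * F t)" and "J' = integral {0..T} (\<lambda>t. e k t * cnj (F t))"
    have iF: "((\<lambda>t. e k t * F t) has_integral J) {0..T}" "((\<lambda>t. e k t * cnj (F t)) has_integral J') {0..T}"
      unfolding J_def J'_def by (intro integrable_integral integrable_continuous_interval continuous_intros ce cF)+
    define S where "S t = (of_real m' * 3) * (e k t * F t) - of_real m' * (e k t * cnj (F t)) - of_real m * 2 * a0 * e k t
      - (of_real m' * a1 * 3) * e (k + 1) t + of_real m' * a1 * e (k - 1) t" for t
    have iS: "(S has_integral (of_real m' * 3) * J - of_real m' * J' - of_real m * 2 * a0 * 0 - (of_real m' * a1 * 3) * 0 + of_real m' * a1 * 0) {0..T}"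
      unfolding S_def using k
      by (intro has_integral_add has_integral_diff has_integral_mult_right iF ie) auto
    define C where "C = - (\<i> * of_real (w * A\<^sup>2 / 2)) * cis (\<beta> - k * c)"
    have "((\<lambda>t. C * S t) has_integral C * (of_real m' * (3 * J - J'))) {0..T}"
      using has_integral_mult_right[OF iS, of C] by (simp add: algebra_simps)
    moreover have "C * S t = ecc_rate (of_real A * cis (\<beta> + w * t)) (\<i> * of_real w * (of_real A * cis (\<beta> + w * t)))
       (planet_force m m' (of_real A * cis (\<beta> + w * t)) (of_real A' * cis (\<beta>' + w' * t)))" for t
    proof -
      define u where "u = cis (\<beta> + w * t)"
      define z where "z = cis (\<nu> * t + c)"
      have uu: "cnj u * u = 1" by (simp add: u_def cis_cnj cis_mult)
      have Y: "of_real A' * cis (\<beta>' + w' * t) = u * (of_real A' * z)"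
        unfolding u_def z_def by (simp add: cis_mult w c_def algebra_simps)
      have cs: "cubed (u * x) = u * cubed x" for x using cubed_scale[of 1 "\<beta> + w * t" x] by (simp add: u_def)
      have cA: "cubed (of_real A * u) = u * a0" "cubed (of_real A' * z) = a1 * z"
        using A cubed_scale[of A "\<beta> + w * t" 1] cubed_scale[of A' "\<nu> * t + c" 1]
        by (simp_all add: u_def z_def a0_def a1_def cubed_def norm_mult)
      define P where "P = - of_real m * a0 + of_real m' * (F t - a1 * z)"
      have q: "planet_force m m' (of_real A * u) (u * (of_real A' * z)) = u * P"
      proof -
        have sub: "u * (of_real A' * z) - of_real A * u = u * (of_real A' * z - of_real A)" by (simp add: algebra_simps)
        have "cubed (u * (of_real A' * z) - of_real A * u) = u * F t" unfolding sub cs F_def z_def[symmetric] ..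
        then show ?thesis unfolding planet_force_def cs cA P_def by (simp add: algebra_simps)
      qed
      have i1: "cnj (of_real A * u) * (u * P) = of_real A * P"
        using uu by (simp add: mult_ac)
      have i2: "cnj (of_real A * u) * (\<i> * of_real w * (of_real A * u)) = \<i> * of_real (w * A\<^sup>2)"
      proof -
        have "cnj (of_real A * u) * (\<i> * of_real w * (of_real A * u)) = \<i> * of_real (w * A\<^sup>2) * (cnj u * u)"
          by (simp add: power2_eq_square mult_ac)
        then show ?thesis by (simp add: uu)
      qed
      have "ecc_rate (of_real A * u) (\<i> * of_real w * (of_real A * u)) (u * P) =
         of_real (w * A\<^sup>2) * u * (of_real (Im P) - \<i> * P)"
        unfolding ecc_rate_def i1 i2 by (simp add: power2_eq_square algebra_simps)
      \<comment> \<open>This is \<open>2 Im P - \<i> Re P\<close>: the transverse force enters twice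
        as strongly as the radial one, which is the origin of the factor 3 in
        \<open>fourier_cubed\<close>.\<close>
      also have "of_real (Im P) - \<i> * P = - (\<i> / 2) * (3 * P - cnj P)"
        by (simp add: complex_eq_iff)
      also have "of_real (w * A\<^sup>2) * u * (- (\<i> / 2) * (3 * P - cnj P)) = - (\<i> * of_real (w * A\<^sup>2 / 2)) * u * (3 * P - cnj P)"
        by simp
      also have "\<dots> = C * (e k t * (3 * P - cnj P))"
      proof -
        have "u = cis (\<beta> - k * c) * e k t"
          by (simp add: u_def e_def cis_mult w algebra_simps)
        then show ?thesis by (simp only: C_def mult_ac)
      qed
      also have "e k t * (3 * P - cnj P) = S t"
      proof -
        have "e (k + 1) t = e k t * z" "e (k - 1) t = e k t * cnj z"
          by (simp_all add: e_def z_def cis_mult cis_cnj algebra_simps)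
        then show ?thesis
          unfolding S_def P_def by (simp add: a0_def a1_def algebra_simps)
      qed
      finally show ?thesis unfolding Y u_def[symmetric] q by simp
    qed
    moreover have "\<bar>w\<bar> * A\<^sup>2 / 2 * m' * L \<le> cmod (C * (of_real m' * (3 * J - J')))"
    proof -
      have "L \<le> cmod (3 * J - J')" using L(2)[of c] unfolding J_def J'_def e_def F_def .
      then have "\<bar>w\<bar> * A\<^sup>2 / 2 * m' * L \<le> \<bar>w\<bar> * A\<^sup>2 / 2 * m' * cmod (3 * J - J')"
        using m' by (intro mult_left_mono) auto
      also have "\<dots> = cmod (C * (of_real m' * (3 * J - J')))"
        using m' by (simp add: C_def norm_mult norm_divide norm_power abs_mult)
      finally show ?thesis .
    qed
    ultimately show "\<exists>I. ((\<lambda>t. ecc_rate (of_real A * cis (\<beta> + w * t)) (\<i> * of_real w * (of_real A * cis (\<beta> + w * t)))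
       (planet_force m m' (of_real A * cis (\<beta> + w * t)) (of_real A' * cis (\<beta>' + w' * t)))) has_integral I) {0..T} \<and>
       \<bar>w\<bar> * A\<^sup>2 / 2 * m' * L \<le> cmod I" by auto
  qed
qed

text \<open>Phases are left free: the velocity is compared with that of a circular motion through
  the actual position, which makes the condition invariant under rotations and time shifts.\<close>

definition near_circular :: "real \<Rightarrow> real \<Rightarrow> real \<Rightarrow> (real \<Rightarrow> complex) \<Rightarrow> (real \<Rightarrow> complex) \<Rightarrow> bool" where
  "near_circular w A \<epsilon> X V \<longleftrightarrow> (\<forall>t. (X has_vector_derivative V t) (at t) \<and>
     \<bar>cmod (X t) - A\<bar> \<le> \<epsilon> \<and> cmod (V t - \<i> * of_real w * X t) \<le> \<epsilon>)"

definition planet_pair :: "real \<Rightarrow> real \<Rightarrow> real \<Rightarrow> (real \<Rightarrow> complex) \<Rightarrow> (real \<Rightarrow> complex) \<Rightarrow> (real \<Rightarrow> complex) \<Rightarrow> bool" where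
  "planet_pair \<mu> m m' X V Y \<longleftrightarrow>
     (\<forall>t. (V has_vector_derivative - cubed (X t) + of_real \<mu> * planet_force m m' (X t) (Y t)) (at t))"

lemma dist_triple_le:
  fixes a a' :: "'a::metric_space" and b b' :: "'b::metric_space" and c c' :: "'c::metric_space"
  shows "dist (a, b, c) (a', b', c') \<le> dist a a' + (dist b b' + dist c c')"
proof -
  have "dist (x, y) (x', y') \<le> dist x x' + dist y y'" for x x' :: "'x::metric_space" and y y' :: "'y::metric_space"
    unfolding dist_Pair_Pair by (intro sqrt_sum_squares_le_sum) auto
  from this[of a "(b, c)" a' "(b', c')"] this[of b c b' c'] show ?thesis by linarith
qed

lemma ecc_circular:
  fixes w A :: real
  assumes "A > 0" "A ^ 3 * w\<^sup>2 = 1" "cmod x = A"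
  shows "ecc x (\<i> * of_real w * x) = 0"
proof -
  have "cnj x * x = of_real (A\<^sup>2)" unfolding assms(3)[symmetric] by (simp only: complex_norm_square mult.commute)
  then have e: "cnj x * (\<i> * of_real w * x) = \<i> * of_real (w * A\<^sup>2)" by (simp add: mult_ac)
  have "ecc x (\<i> * of_real w * x) = of_real (w\<^sup>2 * A\<^sup>2 - 1 / A) * x"
    unfolding ecc_def e assms(3) by (simp add: power2_eq_square algebra_simps)
  moreover have "w\<^sup>2 * A\<^sup>2 - 1 / A = 0" using assms(1,2) by (simp add: field_simps power3_eq_cube power2_eq_square)
  ultimately show ?thesis by simp
qed

lemma cmod_cis_minus_one_le: "cmod (cis x - 1) \<le> \<bar>x\<bar>"
  using dist_exp_i_1[of x] abs_sin_x_le_abs_x[of "x / 2"] by (simp add: cis_conv_exp)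

text \<open>Up to time \<open>T\<close> the eccentricity vector changes by \<mu> times an integral
  close to one of modulus at least \<open>L\<close>. Relative periodicity makes it return at
  \<open>T'\<close> up to a rotation by an angle of order \<mu>, and it is itself at most \<eta>, so
  that change is at most \<open>D * \<mu> * \<eta>\<close>; the defect \<open>T' - T\<close> costs
  only order \<open>\<mu>\<^sup>2\<close>.\<close>

lemma inner_planet_obstruction:
  fixes w w' A A' m m' \<nu> T D :: real and k :: int
  assumes m': "m' > 0" and A: "0 < A" "A < A'" and w: "w = k * \<nu>" "w' = (k + 1) * \<nu>" and k: "k \<le> - 2" and \<nu>: "\<nu> \<noteq> 0"
    and Aw: "A ^ 3 * w\<^sup>2 = 1" and T: "T > 0" and D: "D > 0" and per: "\<nu> * T / (2 * pi) \<in> \<int>"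
  shows "\<exists>\<epsilon>>0. \<exists>\<mu>0>0. \<forall>\<mu> X V Y W T' \<alpha>'. 0 < \<mu> \<longrightarrow> \<mu> \<le> \<mu>0 \<longrightarrow> planet_pair \<mu> m m' X V Y \<longrightarrow>
     near_circular w A \<epsilon> X V \<longrightarrow> near_circular w' A' \<epsilon> Y W \<longrightarrow> (\<forall>t. X (t + T') = cis \<alpha>' * X t) \<longrightarrow> T' > 0 \<longrightarrow>
     \<not> \<bar>T' - T\<bar> + \<bar>\<alpha>'\<bar> \<le> D * \<mu>"
proof -
  obtain L where L: "L > 0" "\<And>\<beta> \<beta>'. \<exists>I. ((\<lambda>t. ecc_rate (of_real A * cis (\<beta> + w * t)) (\<i> * of_real w * (of_real A * cis (\<beta> + w * t)))
       (planet_force m m' (of_real A * cis (\<beta> + w * t)) (of_real A' * cis (\<beta>' + w' * t)))) has_integral I) {0..T} \<and> L \<le> cmod I"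
    using circular_ecc_integral[OF T \<nu> per A k w m', of m] by blast
  define H where "H = (\<lambda>(x, v, y). (ecc_rate x v (planet_force m m' x y), ecc x v))"
  define U where "U = {(x, v, y). x \<noteq> (0::complex) \<and> y \<noteq> (0::complex) \<and> x \<noteq> y} \<inter> (UNIV :: (complex \<times> complex \<times> complex) set)"
  define K where "K = (\<lambda>(x, y). (x, \<i> * of_real w * x, y)) ` (sphere 0 A \<times> sphere (0::complex) A')"
  have K: "compact K" unfolding K_def
    by (intro compact_continuous_image compact_Times compact_sphere) (simp add: case_prod_unfold, intro continuous_intros)
  have KI: "(x, \<i> * of_real w * x, y) \<in> K" if "cmod x = A" "cmod y = A'" for x y
    using that by (auto simp: K_def intro!: image_eqI[of _ _ "(x, y)"])
  have U: "open U"
    unfolding U_def case_prod_unfold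
    by (intro open_Int open_UNIV open_Collect_conj open_Collect_neq continuous_intros)
  have KU: "K \<subseteq> U" using A by (auto simp: K_def U_def)
  have cH: "continuous_on U H"
    unfolding H_def case_prod_unfold ecc_rate_def planet_force_def ecc_def
    by (intro continuous_intros) (auto simp: U_def)
  \<comment> \<open>For \<mu> \<le> 1 the defect is at most \<open>D\<close>, so
    \<open>{0..Tm}\<close> contains both \<open>T\<close> and \<open>T'\<close>.\<close>
  define Tm where "Tm = T + D"
  \<comment> \<open>The errors \<open>D * \<eta>\<close> and \<open>\<eta> * T\<close> add up to
    \<open>L / 4\<close>; the choice of \<mu>0 bounds the third one, \<open>B * D * \<mu>\<close>,
    by \<open>L / 4\<close> as well, so that together they stay below \<open>L\<close>.\<close>
  define \<eta> where "\<eta> = L / (4 * Tm)"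
  have Tm: "Tm > 0" "T \<le> Tm" using T D by (auto simp: Tm_def)
  have \<eta>: "\<eta> > 0" "Tm * \<eta> = L / 4" using L(1) Tm by (auto simp: \<eta>_def)
  obtain \<delta>1 where \<delta>1: "\<delta>1 > 0" "\<And>k z. k \<in> K \<Longrightarrow> dist k z \<le> \<delta>1 \<Longrightarrow> z \<in> U \<and> dist (H k) (H z) \<le> \<eta>"
    using continuous_compact_nbhd_close[OF K U KU cH \<eta>(1)] by blast
  obtain \<delta>2 B where \<delta>2: "\<delta>2 > 0" "B > 0" "\<And>k z. k \<in> K \<Longrightarrow> dist k z \<le> \<delta>2 \<Longrightarrow> z \<in> U \<and> norm (H z) \<le> B"
    using continuous_compact_nbhd_bound[OF K U KU cH] by blast
  define \<delta> where "\<delta> = min \<delta>1 \<delta>2"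
  \<comment> \<open>Two positions and one velocity each contribute an error
    \<open>\<epsilon> (1 + Tm)\<close>; replacing \<open>X\<close> by the circular motion in the
    velocity adds \<open>\<bar>w\<bar>\<close> times as much.\<close>
  define C where "C = (1 + Tm) * (3 + \<bar>w\<bar>)"
  have C: "C > 0" using Tm by (simp add: C_def)
  define \<epsilon> where "\<epsilon> = \<delta> / C"
  have \<epsilon>: "\<epsilon> > 0" "\<epsilon> * C = \<delta>" using C \<delta>1(1) \<delta>2(1) by (auto simp: \<epsilon>_def \<delta>_def)
  define \<mu>0 where "\<mu>0 = min 1 (L / (4 * B * D))"
  have \<mu>0: "\<mu>0 > 0" using L(1) \<delta>2(2) D by (simp add: \<mu>0_def)
  have main: False
    if \<mu>: "0 < \<mu>" "\<mu> \<le> \<mu>0" and eq: "planet_pair \<mu> m m' X V Y" and nX: "near_circular w A \<epsilon> X V" and nY: "near_circular w' A' \<epsilon> Y W"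
      and X': "\<And>t. X (t + T') = cis \<alpha>' * X t" and T': "T' > 0" "\<bar>T' - T\<bar> + \<bar>\<alpha>'\<bar> \<le> D * \<mu>" for \<mu> X V Y W T' \<alpha>'
  proof -
    have dX: "(X has_vector_derivative V t) (at t)" for t using nX by (simp add: near_circular_def)
    have eV: "(V has_vector_derivative - cubed (X t) + of_real \<mu> * planet_force m m' (X t) (Y t)) (at t)" for t
      using eq by (simp add: planet_pair_def)
    have clV: "cmod (V t - \<i> * of_real w * X t) \<le> \<epsilon>" for t using nX by (simp add: near_circular_def)
    obtain \<beta> where \<beta>: "\<And>t. t \<ge> 0 \<Longrightarrow> cmod (X t - of_real A * cis (\<beta> + w * t)) \<le> \<epsilon> * (1 + t)"
      using near_circle[of X V A \<epsilon> w] nX unfolding near_circular_def by blast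
    obtain \<beta>' where \<beta>': "\<And>t. t \<ge> 0 \<Longrightarrow> cmod (Y t - of_real A' * cis (\<beta>' + w' * t)) \<le> \<epsilon> * (1 + t)"
      using near_circle[of Y W A' \<epsilon> w'] nY unfolding near_circular_def by blast
    define Xc Yc where "Xc t = of_real A * cis (\<beta> + w * t)" and "Yc t = of_real A' * cis (\<beta>' + w' * t)" for t
    have inK: "(Xc t, \<i> * of_real w * Xc t, Yc t) \<in> K" for t
      using A by (intro KI) (simp_all add: Xc_def Yc_def norm_mult)
    have cl: "dist (Xc t, \<i> * of_real w * Xc t, Yc t) (X t, V t, Y t) \<le> \<delta>" if t: "t \<in> {0..Tm}" for t
    proof -
      have 1: "\<epsilon> * (1 + t) \<le> \<epsilon> * (1 + Tm)" using t \<epsilon>(1) by (intro mult_left_mono) auto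
      have x: "dist (Xc t) (X t) \<le> \<epsilon> * (1 + Tm)" "dist (Yc t) (Y t) \<le> \<epsilon> * (1 + Tm)"
        using \<beta>[of t] \<beta>'[of t] t 1 by (auto simp: Xc_def Yc_def dist_norm norm_minus_commute)
      have ve: "V t - \<i> * of_real w * Xc t = (V t - \<i> * of_real w * X t) + \<i> * of_real w * (X t - Xc t)" by (simp add: algebra_simps)
      have "dist (\<i> * of_real w * Xc t) (V t) = cmod (V t - \<i> * of_real w * Xc t)" by (simp only: dist_norm norm_minus_commute)
      also have "\<dots> \<le> cmod (V t - \<i> * of_real w * X t) + cmod (\<i> * of_real w * (X t - Xc t))"
        unfolding ve by (rule norm_triangle_ineq)
      also have "\<dots> \<le> \<epsilon> + \<bar>w\<bar> * dist (Xc t) (X t)"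
        using clV[of t] by (simp add: dist_norm norm_minus_commute norm_mult)
      also have "\<dots> \<le> \<epsilon> * (1 + Tm) + \<bar>w\<bar> * (\<epsilon> * (1 + Tm))"
        using x(1) Tm \<epsilon>(1) by (intro add_mono mult_left_mono) auto
      finally have v: "dist (\<i> * of_real w * Xc t) (V t) \<le> \<epsilon> * (1 + Tm) + \<bar>w\<bar> * (\<epsilon> * (1 + Tm))" .
      have "\<epsilon> * (1 + Tm) + ((\<epsilon> * (1 + Tm) + \<bar>w\<bar> * (\<epsilon> * (1 + Tm))) + \<epsilon> * (1 + Tm)) = \<delta>"
        unfolding \<epsilon>(2)[symmetric] C_def by (simp add: algebra_simps)
      then show ?thesis
        using x v dist_triple_le[of "Xc t" "\<i> * of_real w * Xc t" "Yc t" "X t" "V t" "Y t"] by linarith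
    qed
    define G E where "G t = ecc_rate (X t) (V t) (planet_force m m' (X t) (Y t))" and "E t = ecc (X t) (V t)" for t
    define Gc where "Gc t = ecc_rate (Xc t) (\<i> * of_real w * Xc t) (planet_force m m' (Xc t) (Yc t))" for t
    have HE: "H (X t, V t, Y t) = (G t, E t)" "H (Xc t, \<i> * of_real w * Xc t, Yc t) = (Gc t, 0)" for t
      using ecc_circular[OF A(1) Aw, of "Xc t"] A by (simp_all add: H_def G_def E_def Gc_def Xc_def norm_mult)
    have X0: "X t \<noteq> 0" if "t \<in> {0..Tm}" for t
      using \<delta>1(2)[OF inK, of t "(X t, V t, Y t)"] cl[OF that] by (auto simp: U_def \<delta>_def)
    have G1: "cmod (G t - Gc t) \<le> \<eta>" "cmod (E t) \<le> \<eta>" if "t \<in> {0..Tm}" for t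
    proof -
      have "dist (Gc t, 0) (G t, E t) \<le> \<eta>"
        using \<delta>1(2)[OF inK, of t "(X t, V t, Y t)"] cl[OF that] unfolding HE by (simp add: \<delta>_def)
      then show "cmod (G t - Gc t) \<le> \<eta>" "cmod (E t) \<le> \<eta>"
        using dist_fst_le[of "(Gc t, 0::complex)" "(G t, E t)"] dist_snd_le[of "(Gc t, 0::complex)" "(G t, E t)"]
        by (auto simp: dist_norm norm_minus_commute)
    qed
    have G2: "cmod (G t) \<le> B" if "t \<in> {0..Tm}" for t
    proof -
      have "norm (G t, E t) \<le> B"
        using \<delta>2(3)[OF inK, of t "(X t, V t, Y t)"] cl[OF that] unfolding HE by (simp add: \<delta>_def)
      then show ?thesis using norm_fst_le[of "G t" "E t"] by simp
    qed
    have dE: "(E has_vector_derivative of_real \<mu> * G t) (at t)" if "t \<in> {0..Tm}" for t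
      unfolding E_def G_def by (rule ecc_DERIV[OF dX eV X0[OF that]])
    have "D * \<mu> \<le> D * 1" using \<mu> D by (intro mult_left_mono) (auto simp: \<mu>0_def)
    then have TT: "\<bar>T' - T\<bar> \<le> D * \<mu>" "\<bar>\<alpha>'\<bar> \<le> D * \<mu>" "T' \<le> Tm" using T'(2) by (auto simp: Tm_def)
    have V': "V (0 + T') = cis \<alpha>' * V 0"
    proof -
      have "((\<lambda>t. X (t + T')) has_vector_derivative V (0 + T')) (at 0)"
      proof -
        have "((\<lambda>t. t + T') has_vector_derivative 1) (at 0)" by (auto intro!: derivative_eq_intros)
        from vector_diff_chain_at[OF this dX[of "0 + T'"]] show ?thesis by (simp add: o_def)
      qed
      moreover have "((\<lambda>t. X (t + T')) has_vector_derivative cis \<alpha>' * V 0) (at 0)"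
        unfolding X' by (rule has_vector_derivative_mult_right[OF dX])
      ultimately show ?thesis by (rule vector_derivative_unique_at)
    qed
    have "E T' = cis \<alpha>' * E 0"
    proof -
      have inv: "cnj (cis \<alpha>' * x) * (cis \<alpha>' * v) = cnj x * v" for x v
      proof -
        have "cnj (cis \<alpha>') * cis \<alpha>' = 1" by (simp add: cis_cnj cis_mult)
        moreover have "cnj (cis \<alpha>' * x) * (cis \<alpha>' * v) = (cnj (cis \<alpha>') * cis \<alpha>') * (cnj x * v)" by (simp add: mult_ac)
        ultimately show ?thesis by simp
      qed
      have "ecc (cis \<alpha>' * x) (cis \<alpha>' * v) = cis \<alpha>' * ecc x v" for x v
        unfolding ecc_def inv by (simp add: norm_mult right_diff_distrib)
      then show ?thesis using V' X'[of 0] by (simp add: E_def)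
    qed
    then have "E T' - E 0 = (cis \<alpha>' - 1) * E 0" by (simp add: algebra_simps)
    then have "cmod (E T' - E 0) = cmod (cis \<alpha>' - 1) * cmod (E 0)" by (simp only: norm_mult)
    also have "\<dots> \<le> D * \<mu> * \<eta>"
      using cmod_cis_minus_one_le[of \<alpha>'] TT(2) G1(2)[of 0] Tm by (intro mult_mono) auto
    finally have E1: "cmod (E T' - E 0) \<le> D * \<mu> * \<eta>" .
    have lip: "cmod (E b - E a) \<le> (\<mu> * B) * (b - a)" if "a \<le> b" "0 \<le> a" "b \<le> Tm" for a b
      using that \<mu>(1) G2 by (intro norm_diff_le_derivative[OF that(1) dE]) (auto simp: norm_mult)
    have "cmod (E T - E T') \<le> (\<mu> * B) * \<bar>T' - T\<bar>"
      using lip[of T T'] lip[of T' T] T T'(1) TT(3) Tm by (cases "T \<le> T'") (auto simp: norm_minus_commute)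
    also have "\<dots> \<le> (\<mu> * B) * (D * \<mu>)" using \<mu> \<delta>2(2) TT(1) by (intro mult_left_mono) auto
    finally have E3: "cmod (E T - E T') \<le> (\<mu> * B) * (D * \<mu>)" .
    have "cmod (E T - E 0) \<le> cmod (E T - E T') + cmod (E T' - E 0)"
      using norm_triangle_ineq[of "E T - E T'" "E T' - E 0"] by simp
    moreover have "(\<mu> * B) * (D * \<mu>) + D * \<mu> * \<eta> = \<mu> * (B * D * \<mu> + D * \<eta>)" by (simp add: algebra_simps)
    ultimately have E2: "cmod (E T - E 0) \<le> \<mu> * (B * D * \<mu> + D * \<eta>)" using E1 E3 by linarith
    have "((\<lambda>t. of_real \<mu> * G t) has_integral (E T - E 0)) {0..T}"
      by (rule fundamental_theorem_of_calculus, use T in simp, rule has_vector_derivative_at_within, rule dE) (use Tm in auto)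
    from has_integral_mult_right[OF this, of "1 / of_real \<mu>"]
    have IG: "(G has_integral (E T - E 0) / of_real \<mu>) {0..T}" using \<mu> by simp
    have nI: "cmod ((E T - E 0) / of_real \<mu>) \<le> B * D * \<mu> + D * \<eta>"
      using E2 \<mu> by (simp add: norm_divide divide_le_eq mult.commute)
    obtain I where I: "(Gc has_integral I) {0..T}" "L \<le> cmod I"
      using L(2)[of \<beta> \<beta>'] unfolding Gc_def Xc_def Yc_def by blast
    have "cmod ((E T - E 0) / of_real \<mu> - I) \<le> \<eta> * T"
      using has_integral_bound_real[OF _ _ has_integral_diff[OF IG I(1)], of \<eta> "{}"] G1(1) \<eta>(1) T Tm by auto
    then have "L \<le> B * D * \<mu> + D * \<eta> + \<eta> * T"
      using I(2) nI norm_triangle_ineq4[of "(E T - E 0) / of_real \<mu>" "(E T - E 0) / of_real \<mu> - I"] by simp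
    moreover have "D * \<eta> + \<eta> * T = L / 4" using \<eta>(2) by (simp add: Tm_def algebra_simps)
    moreover have "B * D * \<mu> \<le> L / 4"
    proof -
      have "\<mu> \<le> L / (4 * B * D)" using \<mu> by (simp add: \<mu>0_def)
      then show ?thesis using \<delta>2(2) D by (simp add: field_simps)
    qed
    ultimately show False using L(1) by linarith
  qed
  show ?thesis
    by (rule exI[of _ \<epsilon>], rule conjI[OF \<epsilon>(1)], rule exI[of _ \<mu>0], rule conjI[OF \<mu>0]) (use main in blast)
qed

section \<open>Nonexistence\<close>

text \<open>Formulated for both planets on an equal footing, so that the inner one can be selected
  by the sign of the resonance; the scaling parameter does not occur.\<close>

definition no_near_return :: "real \<Rightarrow> real \<Rightarrow> real \<Rightarrow> real \<Rightarrow> real \<Rightarrow> real \<Rightarrow> real \<Rightarrow> real \<Rightarrow> bool" where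
  "no_near_return m1 m2 w1 w2 A1 A2 T D \<longleftrightarrow> (\<exists>\<epsilon>>0. \<exists>\<mu>0>0. \<forall>\<mu> X1 V1 X2 V2 T' \<alpha>'. 0 < \<mu> \<longrightarrow> \<mu> \<le> \<mu>0 \<longrightarrow>
     planet_pair \<mu> m1 m2 X1 V1 X2 \<longrightarrow> planet_pair \<mu> m2 m1 X2 V2 X1 \<longrightarrow>
     near_circular w1 A1 \<epsilon> X1 V1 \<longrightarrow> near_circular w2 A2 \<epsilon> X2 V2 \<longrightarrow>
     (\<forall>t. X1 (t + T') = cis \<alpha>' * X1 t \<and> X2 (t + T') = cis \<alpha>' * X2 t) \<longrightarrow> T' > 0 \<longrightarrow>
     \<not> \<bar>T' - T\<bar> + \<bar>\<alpha>'\<bar> \<le> D * \<mu>)"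

text \<open>With lengths multiplied by \<open>\<mu>\<^sup>1\<^sup>/\<^sup>3\<close> the
  gravitational constant becomes 1, and subtracting the acceleration of the Sun leaves a
  perturbation of order \<mu>. The last claim rests on zero total momentum: the velocity of the Sun
  is a combination of those of the planets with a factor \<mu>.\<close>

lemma heliocentric:
  fixes \<mu> m1 m2 :: real
  assumes \<mu>: "\<mu> > 0" and sol: "three_body_solution \<mu> m1 m2 r"
  defines "c \<equiv> \<mu> powr (1/3)"
  defines "X \<equiv> \<lambda>j t. c *\<^sub>R (r j t - r 0 t)" and "V \<equiv> \<lambda>j t. c *\<^sub>R (velocity r j t - velocity r 0 t)"
  shows "j < 3 \<Longrightarrow> (X j has_vector_derivative V j t) (at t)"
    and "planet_pair \<mu> m1 m2 (X 1) (V 1) (X 2)" "planet_pair \<mu> m2 m1 (X 2) (V 2) (X 1)"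
    and "j < 3 \<Longrightarrow> V j t = c *\<^sub>R velocity r j t + \<mu> *\<^sub>R (m1 *\<^sub>R (c *\<^sub>R velocity r 1 t) + m2 *\<^sub>R (c *\<^sub>R velocity r 2 t))"
proof -
  have c: "c > 0" "c ^ 3 = \<mu>" using \<mu> by (auto simp: c_def powr_power)
  have D: "(r j has_vector_derivative velocity r j t) (at t)" if "j < 3" for j t
    using sol that unfolding three_body_solution_def by blast
  have N: "(velocity r j has_vector_derivative (\<Sum>k\<in>{..<3} - {j}. of_real ((1 / \<mu>) * body_mass \<mu> m1 m2 k) * cubed (r k t - r j t))) (at t)"
    if "j < 3" for j t
    using sol that unfolding three_body_solution_def cubed_conv_scaleR[symmetric] by blast
  show "(X j has_vector_derivative V j t) (at t)" if "j < 3" for j t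
    unfolding X_def V_def using D[OF that] D[of 0]
    by (auto intro!: derivative_eq_intros bounded_linear.has_vector_derivative[OF bounded_linear_scaleR_right])
  have cm: "cubed (x - y) = - cubed (y - x)" for x y using cubed_minus[of "y - x"] by simp
  have i0: "{..<3} - {0::nat} = {1, 2}" "{..<3} - {1::nat} = {0, 2}" "{..<3} - {2::nat} = {0, 1}" by auto
  have N0: "(velocity r 0 has_vector_derivative of_real m1 * cubed (r 1 t - r 0 t) + of_real m2 * cubed (r 2 t - r 0 t)) (at t)" for t
    using N[of 0 t] \<mu> unfolding i0 by (simp add: body_mass_def del: One_nat_def)
  have N1: "(velocity r 1 has_vector_derivative - of_real (1 / \<mu>) * cubed (r 1 t - r 0 t) + of_real m2 * cubed (r 2 t - r 1 t)) (at t)" for t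
    using N[of 1 t] \<mu> cm[of "r 0 t" "r 1 t"] unfolding i0 by (simp add: body_mass_def del: One_nat_def)
  have N2: "(velocity r 2 has_vector_derivative - of_real (1 / \<mu>) * cubed (r 2 t - r 0 t) + of_real m1 * cubed (r 1 t - r 2 t)) (at t)" for t
    using N[of 2 t] \<mu> cm[of "r 0 t" "r 2 t"] unfolding i0 by (simp add: body_mass_def del: One_nat_def)
  have cc: "of_real \<mu> * cubed (c *\<^sub>R z) = of_real c * cubed z" for z
  proof -
    have "\<mu> * (c / \<bar>c\<bar> ^ 3) = c" using c \<mu> by simp
    then have e: "complex_of_real \<mu> * of_real (c / \<bar>c\<bar> ^ 3) = of_real c" by (simp only: of_real_mult[symmetric])
    show ?thesis unfolding cubed_scaleR unfolding scaleR_conv_of_real mult.assoc[symmetric] e ..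
  qed
  have cX: "of_real c * cubed (r 1 t - r 0 t) = of_real \<mu> * cubed (X 1 t)" "of_real c * cubed (r 2 t - r 0 t) = of_real \<mu> * cubed (X 2 t)"
    "of_real c * cubed (r 2 t - r 1 t) = of_real \<mu> * cubed (X 2 t - X 1 t)" "of_real c * cubed (r 1 t - r 2 t) = of_real \<mu> * cubed (X 1 t - X 2 t)" for t
    unfolding X_def cc[symmetric] scaleR_diff_right[symmetric] by simp_all
  have mu: "complex_of_real \<mu> * of_real (1 / \<mu>) = 1" using \<mu> by simp
  have dV: "(V j has_vector_derivative of_real c * a - of_real c * b) (at t)"
    if "(velocity r j has_vector_derivative a) (at t)" "(velocity r 0 has_vector_derivative b) (at t)" for j a b t
  proof -
    have "((\<lambda>t. of_real c * velocity r j t - of_real c * velocity r 0 t) has_vector_derivative of_real c * a - of_real c * b) (at t)"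
      by (intro has_vector_derivative_diff has_vector_derivative_mult_right that)
    then show ?thesis by (simp add: V_def scaleR_conv_of_real right_diff_distrib)
  qed
  have lin1: "- i * (M * x) + b * (M * y) - a * (M * x) - b * (M * z) = - (M * i) * x + M * (- a * x + b * (y - z))"
    and lin2: "- i * (M * x) + a * (M * y) - a * (M * z) - b * (M * x) = - (M * i) * x + M * (- b * x + a * (y - z))"
    for i M x y z a b :: complex
    by (simp_all add: algebra_simps)
  show "planet_pair \<mu> m1 m2 (X 1) (V 1) (X 2)"
    unfolding planet_pair_def
  proof
    fix t
    have "of_real c * (- of_real (1 / \<mu>) * cubed (r 1 t - r 0 t) + of_real m2 * cubed (r 2 t - r 1 t))
       - of_real c * (of_real m1 * cubed (r 1 t - r 0 t) + of_real m2 * cubed (r 2 t - r 0 t))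
       = - of_real (1 / \<mu>) * (of_real c * cubed (r 1 t - r 0 t)) + of_real m2 * (of_real c * cubed (r 2 t - r 1 t))
         - of_real m1 * (of_real c * cubed (r 1 t - r 0 t)) - of_real m2 * (of_real c * cubed (r 2 t - r 0 t))"
      by (simp add: algebra_simps)
    also have "\<dots> = - (of_real \<mu> * of_real (1 / \<mu>)) * cubed (X 1 t) + of_real \<mu> * planet_force m1 m2 (X 1 t) (X 2 t)"
      unfolding cX planet_force_def by (rule lin1)
    finally show "(V 1 has_vector_derivative - cubed (X 1 t) + of_real \<mu> * planet_force m1 m2 (X 1 t) (X 2 t)) (at t)"
      using dV[OF N1 N0, of t] unfolding mu by simp
  qed
  show "planet_pair \<mu> m2 m1 (X 2) (V 2) (X 1)"
    unfolding planet_pair_def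
  proof
    fix t
    have "of_real c * (- of_real (1 / \<mu>) * cubed (r 2 t - r 0 t) + of_real m1 * cubed (r 1 t - r 2 t))
       - of_real c * (of_real m1 * cubed (r 1 t - r 0 t) + of_real m2 * cubed (r 2 t - r 0 t))
       = - of_real (1 / \<mu>) * (of_real c * cubed (r 2 t - r 0 t)) + of_real m1 * (of_real c * cubed (r 1 t - r 2 t))
         - of_real m1 * (of_real c * cubed (r 1 t - r 0 t)) - of_real m2 * (of_real c * cubed (r 2 t - r 0 t))"
      by (simp add: algebra_simps)
    also have "\<dots> = - (of_real \<mu> * of_real (1 / \<mu>)) * cubed (X 2 t) + of_real \<mu> * planet_force m2 m1 (X 2 t) (X 1 t)"
      unfolding cX planet_force_def by (rule lin2)
    finally show "(V 2 has_vector_derivative - cubed (X 2 t) + of_real \<mu> * planet_force m2 m1 (X 2 t) (X 1 t)) (at t)"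
      using dV[OF N2 N0, of t] unfolding mu by simp
  qed
  show "V j t = c *\<^sub>R velocity r j t + \<mu> *\<^sub>R (m1 *\<^sub>R (c *\<^sub>R velocity r 1 t) + m2 *\<^sub>R (c *\<^sub>R velocity r 2 t))" if "j < 3" for j t
  proof -
    have "(\<Sum>j<3. momentum \<mu> m1 m2 r j t) = 0" using sol by (simp add: three_body_solution_def)
    then have "velocity r 0 t + ((\<mu> * m1) *\<^sub>R velocity r 1 t + (\<mu> * m2) *\<^sub>R velocity r 2 t) = 0"
      unfolding lessThan_3 by (simp add: momentum_def body_mass_def add.assoc del: One_nat_def)
    then have e: "velocity r 0 t = - ((\<mu> * m1) *\<^sub>R velocity r 1 t + (\<mu> * m2) *\<^sub>R velocity r 2 t)"
      by (simp add: add_eq_0_iff2)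
    show ?thesis unfolding V_def e diff_minus_eq_add by (simp add: scaleR_add_right mult_ac)
  qed
qed

section \<open>Resonance as integrality of the frequency ratio\<close>

lemma special_resonance_iff:
  assumes "w1 \<noteq> 0" "w2 \<noteq> 0" "\<bar>w1\<bar> \<noteq> \<bar>w2\<bar>"
  shows "special_resonance w1 w2 \<longleftrightarrow> (\<exists>k::int. k \<noteq> 0 \<and> k \<noteq> - 1 \<and> w1 = of_int k * (w2 - w1))"
proof -
  have "w1 / w2 = of_int k / (of_int k + 1) \<longleftrightarrow> w1 = of_int k * (w2 - w1)" if "k \<noteq> - 1" for k :: int
  proof -
    have "real_of_int k + 1 \<noteq> 0" using that by linarith
    then show ?thesis using assms(2) by (auto simp: field_simps)
  qed
  then show ?thesis unfolding special_resonance_def by (simp add: conj_commute) metis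
qed

text \<open>The excluded values \<open>0\<close> and \<open>-1\<close> of the integer would mean a
  vanishing frequency, so resonance is exactly integrality of the ratio, which is the obstruction
  met by the linear solver.\<close>

lemma frequency_ratio_int:
  assumes "w1 \<noteq> 0" "w2 \<noteq> 0" "\<bar>w1\<bar> \<noteq> \<bar>w2\<bar>"
  shows "special_resonance w1 w2 \<longleftrightarrow> w1 / (w2 - w1) \<in> \<int>"
proof -
  have d: "w2 - w1 \<noteq> 0" using assms by auto
  have "k \<noteq> 0 \<and> k \<noteq> - 1" if "w1 = of_int k * (w2 - w1)" for k :: int
    using that assms by auto
  then have "special_resonance w1 w2 \<longleftrightarrow> (\<exists>k::int. w1 = of_int k * (w2 - w1))"
    unfolding special_resonance_iff[OF assms] by blast
  also have "\<dots> \<longleftrightarrow> (\<exists>k::int. w1 / (w2 - w1) = of_int k)" using d by (simp add: field_simps)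
  finally show ?thesis by (auto simp: Ints_def)
qed

lemma powr_two_thirds_cube: "v \<noteq> 0 \<Longrightarrow> (\<bar>v\<bar> powr (-2/3)) ^ 3 * v\<^sup>2 = (1::real)"
proof -
  assume v: "v \<noteq> 0"
  have "(\<bar>v\<bar> powr (-2/3)) ^ 3 = \<bar>v\<bar> powr (- 2)" using v powr_power[of "\<bar>v\<bar>" "-2/3" 3] by simp
  also have "\<dots> = inverse (v\<^sup>2)" using v powr_minus[of "\<bar>v\<bar>" 2] by simp
  finally show ?thesis using v by simp
qed

text \<open>The inner planet is the faster one: planet 1 for \<open>k \<le> - 2\<close> and planet 2
  for \<open>k \<ge> 1\<close>.\<close>

lemma resonance_no_near_return:
  assumes m: "m1 > 0" "m2 > 0" and w: "w1 \<noteq> 0" "w2 \<noteq> 0" "\<bar>w1\<bar> \<noteq> \<bar>w2\<bar>" and res: "special_resonance w1 w2"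
    and T: "T > 0" and D: "D > 0" and per: "(w2 - w1) / (2 * pi) * T \<in> \<int>"
  shows "no_near_return m1 m2 w1 w2 (\<bar>w1\<bar> powr (-2/3)) (\<bar>w2\<bar> powr (-2/3)) T D"
proof -
  define \<nu> where "\<nu> = w2 - w1"
  have \<nu>: "\<nu> \<noteq> 0" using w by (auto simp: \<nu>_def)
  obtain k :: int where k: "k \<noteq> 0" "k \<noteq> - 1" "w1 = of_int k * \<nu>"
    using res special_resonance_iff[OF w] unfolding \<nu>_def by blast
  have w2: "w2 = (k + 1) * \<nu>" using k(3) by (simp add: \<nu>_def algebra_simps)
  have per1: "\<nu> * T / (2 * pi) \<in> \<int>" using per by (simp add: \<nu>_def)
  have "(- \<nu>) * T / (2 * pi) = - (\<nu> * T / (2 * pi))" by simp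
  then have per': "\<nu> * T / (2 * pi) \<in> \<int>" "(- \<nu>) * T / (2 * pi) \<in> \<int>"
    using per1 Ints_minus[OF per1] by (simp_all only:)
  have pos: "\<bar>w1\<bar> powr (-2/3) > 0" "\<bar>w2\<bar> powr (-2/3) > 0" and \<nu>': "- \<nu> \<noteq> 0" using w \<nu> by auto
  note cube = powr_two_thirds_cube[OF w(1)] powr_two_thirds_cube[OF w(2)]
  have mono: "\<bar>b\<bar> powr (-2/3) > \<bar>a\<bar> powr (-2/3)" if "\<bar>b\<bar> < \<bar>a\<bar>" "b \<noteq> 0" for a b :: real
    using that by (intro powr_less_mono2_neg) auto
  consider "k \<le> - 2" | "k \<ge> 1" using k by linarith
  then show ?thesis
  proof cases
    case 1
    have "\<bar>w2\<bar> < \<bar>w1\<bar>" using 1 \<nu> unfolding k(3) w2 abs_mult by (intro mult_strict_right_mono) auto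
    from inner_planet_obstruction[OF m(2) pos(1) mono[OF this w(2)] k(3) w2 1 \<nu> cube(1) T D per'(1), of m1]
    obtain \<epsilon> \<mu>0 where "\<epsilon> > 0" "\<mu>0 > 0" and h: "\<forall>\<mu> X V Y W T' \<alpha>'. 0 < \<mu> \<longrightarrow> \<mu> \<le> \<mu>0 \<longrightarrow> planet_pair \<mu> m1 m2 X V Y \<longrightarrow>
     near_circular w1 (\<bar>w1\<bar> powr (-2/3)) \<epsilon> X V \<longrightarrow> near_circular w2 (\<bar>w2\<bar> powr (-2/3)) \<epsilon> Y W \<longrightarrow> (\<forall>t. X (t + T') = cis \<alpha>' * X t) \<longrightarrow> T' > 0 \<longrightarrow>
     \<not> \<bar>T' - T\<bar> + \<bar>\<alpha>'\<bar> \<le> D * \<mu>" by blast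
    show ?thesis unfolding no_near_return_def
      by (rule exI[of _ \<epsilon>], rule conjI[OF \<open>\<epsilon> > 0\<close>], rule exI[of _ \<mu>0], rule conjI[OF \<open>\<mu>0 > 0\<close>]) (use h in blast)
  next
    case 2
    \<comment> \<open>Exchanging the planets reverses \<nu>, and the frequencies are again
      consecutive multiples of it, now with \<open>k' \<le> - 2\<close>.\<close>
    define k' where "k' = - (k + 1)"
    have k': "k' \<le> - 2" "w2 = k' * (- \<nu>)" "w1 = (k' + 1) * (- \<nu>)"
      using 2 k(3) w2 by (auto simp: k'_def algebra_simps)
    have "\<bar>w1\<bar> < \<bar>w2\<bar>" using 2 \<nu> unfolding k(3) w2 abs_mult by (intro mult_strict_right_mono) auto
    from inner_planet_obstruction[OF m(1) pos(2) mono[OF this w(1)] k'(2) k'(3) k'(1) \<nu>' cube(2) T D per'(2), of m2]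
    obtain \<epsilon> \<mu>0 where "\<epsilon> > 0" "\<mu>0 > 0" and h: "\<forall>\<mu> X V Y W T' \<alpha>'. 0 < \<mu> \<longrightarrow> \<mu> \<le> \<mu>0 \<longrightarrow> planet_pair \<mu> m2 m1 X V Y \<longrightarrow>
     near_circular w2 (\<bar>w2\<bar> powr (-2/3)) \<epsilon> X V \<longrightarrow> near_circular w1 (\<bar>w1\<bar> powr (-2/3)) \<epsilon> Y W \<longrightarrow> (\<forall>t. X (t + T') = cis \<alpha>' * X t) \<longrightarrow> T' > 0 \<longrightarrow>
     \<not> \<bar>T' - T\<bar> + \<bar>\<alpha>'\<bar> \<le> D * \<mu>" by blast
    show ?thesis unfolding no_near_return_def
      by (rule exI[of _ \<epsilon>], rule conjI[OF \<open>\<epsilon> > 0\<close>], rule exI[of _ \<mu>0], rule conjI[OF \<open>\<mu>0 > 0\<close>]) (use h in blast)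
  qed
qed

text \<open>The tolerances carry the powers of \<omega> of the respective coordinates, so that after
  rescaling they become one \<epsilon> independent of \<omega>. Momenta are compared with the
  circular value at the actual position, which avoids mentioning phases.\<close>

definition torus_nbhd :: "real \<Rightarrow> real \<Rightarrow> real \<Rightarrow> real \<Rightarrow> real \<Rightarrow> real \<Rightarrow> real \<Rightarrow> real \<Rightarrow> phase set" where
  "torus_nbhd \<omega> m1 m2 w1 w2 A1 A2 \<epsilon> = phase_space \<inter> {p.
     \<bar>cmod (fst p) - A1 * \<omega> powr (2/3)\<bar> < \<epsilon> * \<omega> powr (2/3) \<and>
     \<bar>cmod (fst (snd p)) - A2 * \<omega> powr (2/3)\<bar> < \<epsilon> * \<omega> powr (2/3) \<and>
     cmod (fst (snd (snd p)) - fst p * (\<i> * of_real (w1 / \<omega> * m1))) < \<epsilon> * (m1 * \<omega> powr (-1/3)) \<and>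
     cmod (snd (snd (snd p)) - fst (snd p) * (\<i> * of_real (w2 / \<omega> * m2))) < \<epsilon> * (m2 * \<omega> powr (-1/3))}"

lemma open_torus_nbhd: "open (torus_nbhd \<omega> m1 m2 w1 w2 A1 A2 \<epsilon>)"
  unfolding torus_nbhd_def phase_space_def case_prod_unfold
  by (intro open_Int open_Collect_conj open_Collect_neq open_Collect_less continuous_intros)

lemma circular_torus_subset_nbhd:
  assumes \<omega>: "\<omega> > 0" and m: "m1 > 0" "m2 > 0" and w: "w1 \<noteq> 0" "w2 \<noteq> 0" "\<bar>w1\<bar> \<noteq> \<bar>w2\<bar>" and \<epsilon>: "\<epsilon> > 0"
  shows "circular_torus \<omega> m1 m2 w1 w2 \<subseteq> torus_nbhd \<omega> m1 m2 w1 w2 (\<bar>w1\<bar> powr (-2/3)) (\<bar>w2\<bar> powr (-2/3)) \<epsilon>"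
proof
  fix p assume "p \<in> circular_torus \<omega> m1 m2 w1 w2"
  then obtain \<beta>1 \<beta>2 t where p: "p = (circular_position \<omega> w1 \<beta>1 t, circular_position \<omega> w2 \<beta>2 t,
      circular_momentum \<omega> w1 m1 \<beta>1 t, circular_momentum \<omega> w2 m2 \<beta>2 t)"
    unfolding circular_torus_def by blast
  have n: "cmod (circular_position \<omega> w \<beta> t) = \<bar>w\<bar> powr (-2/3) * \<omega> powr (2/3)" for w \<beta>
    using \<omega> by (simp add: circular_position_def Let_def norm_mult norm_divide powr_divide powr_minus_divide divide_simps)
  have W: "\<omega> powr (2/3) > 0" "\<omega> powr (-1/3) > 0" using \<omega> by auto
  have pos: "\<bar>w1\<bar> powr (-2/3) > 0" "\<bar>w2\<bar> powr (-2/3) > 0" using w by auto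
  have "\<bar>w1\<bar> powr (-2/3) \<noteq> \<bar>w2\<bar> powr (-2/3)"
    using w powr_inj[of "\<bar>w1\<bar>" "\<bar>w2\<bar>"] powr_less_mono2_neg[of "-2/3" "\<bar>w1\<bar>" "\<bar>w2\<bar>"] powr_less_mono2_neg[of "-2/3" "\<bar>w2\<bar>" "\<bar>w1\<bar>"]
    by (cases "\<bar>w1\<bar> < \<bar>w2\<bar>") auto
  then have "cmod (circular_position \<omega> w1 \<beta>1 t) \<noteq> cmod (circular_position \<omega> w2 \<beta>2 t)"
    "cmod (circular_position \<omega> w1 \<beta>1 t) > 0" "cmod (circular_position \<omega> w2 \<beta>2 t) > 0"
    unfolding n using W pos by auto
  then have "p \<in> phase_space" unfolding p phase_space_def by auto
  then show "p \<in> torus_nbhd \<omega> m1 m2 w1 w2 (\<bar>w1\<bar> powr (-2/3)) (\<bar>w2\<bar> powr (-2/3)) \<epsilon>"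
    unfolding torus_nbhd_def p using W \<epsilon> m by (simp add: n circular_momentum_def Let_def)
qed

lemma phase_point_in_nbhd:
  assumes \<omega>: "\<omega> > 0" and \<mu>: "\<mu> > 0" and m: "m1 > 0" "m2 > 0"
    and U: "phase_point \<omega> \<mu> m1 m2 r t \<in> torus_nbhd \<omega> m1 m2 w1 w2 A1 A2 \<epsilon>"
  defines "c \<equiv> \<mu> powr (1/3)"
  shows "\<bar>cmod (c *\<^sub>R (r 1 t - r 0 t)) - A1\<bar> \<le> \<epsilon>" "\<bar>cmod (c *\<^sub>R (r 2 t - r 0 t)) - A2\<bar> \<le> \<epsilon>"
    "cmod (c *\<^sub>R velocity r 1 t - \<i> * of_real w1 * (c *\<^sub>R (r 1 t - r 0 t))) \<le> \<epsilon>"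
    "cmod (c *\<^sub>R velocity r 2 t - \<i> * of_real w2 * (c *\<^sub>R (r 2 t - r 0 t))) \<le> \<epsilon>"
proof -
  define W g where "W = \<omega> powr (2/3)" and "g = \<omega> powr (-1/3)"
  have W: "W > 0" "g > 0" "W / \<omega> = g" using \<omega> powr_diff[of \<omega> "2/3" 1] by (auto simp: W_def g_def)
  have pos: "\<bar>cmod x - A\<bar> \<le> \<epsilon>" if "\<bar>cmod (W *\<^sub>R x) - A * W\<bar> < \<epsilon> * W" for x A
  proof -
    have "cmod (W *\<^sub>R x) - A * W = (cmod x - A) * W" using W(1) by (simp add: algebra_simps)
    then have "\<bar>cmod x - A\<bar> * W < \<epsilon> * W" using that W(1) by (simp add: abs_mult)
    then show ?thesis using W(1) by simp
  qed
  have vel: "cmod (y - \<i> * of_real w * x) \<le> \<epsilon>"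
    if "cmod ((m * g) *\<^sub>R y - W *\<^sub>R x * (\<i> * of_real (w / \<omega> * m))) < \<epsilon> * (m * g)" "m > 0" for x y w m
  proof -
    have "W *\<^sub>R x * (\<i> * of_real (w / \<omega> * m)) = of_real (m * (W / \<omega>)) * (\<i> * of_real w * x)"
      by (simp add: scaleR_conv_of_real)
    then have "(m * g) *\<^sub>R y - W *\<^sub>R x * (\<i> * of_real (w / \<omega> * m)) = (m * g) *\<^sub>R (y - \<i> * of_real w * x)"
      unfolding W(3) by (simp add: scaleR_conv_of_real right_diff_distrib)
    then have "cmod ((m * g) *\<^sub>R y - W *\<^sub>R x * (\<i> * of_real (w / \<omega> * m))) = cmod (y - \<i> * of_real w * x) * (m * g)"
      using that(2) W(2) by simp
    moreover have "m * g > 0" using that(2) W(2) by simp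
    ultimately show ?thesis using that(1) by (metis less_eq_real_def mult_less_cancel_right_pos)
  qed
  have sc: "phase_point \<omega> \<mu> m1 m2 r t = (W *\<^sub>R (c *\<^sub>R (r 1 t - r 0 t)), W *\<^sub>R (c *\<^sub>R (r 2 t - r 0 t)),
     (m1 * g) *\<^sub>R (c *\<^sub>R velocity r 1 t), (m2 * g) *\<^sub>R (c *\<^sub>R velocity r 2 t))"
    unfolding phase_point_scaled[OF \<omega> \<mu>] W_def g_def c_def by simp
  note u = U[unfolded torus_nbhd_def sc W_def[symmetric] g_def[symmetric], simplified fst_conv snd_conv Int_iff mem_Collect_eq]
  show "\<bar>cmod (c *\<^sub>R (r 1 t - r 0 t)) - A1\<bar> \<le> \<epsilon>" "\<bar>cmod (c *\<^sub>R (r 2 t - r 0 t)) - A2\<bar> \<le> \<epsilon>"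
    by (rule pos, use u in blast)+
  show "cmod (c *\<^sub>R velocity r 1 t - \<i> * of_real w1 * (c *\<^sub>R (r 1 t - r 0 t))) \<le> \<epsilon>"
    by (rule vel[of m1]) (use u m in blast)+
  show "cmod (c *\<^sub>R velocity r 2 t - \<i> * of_real w2 * (c *\<^sub>R (r 2 t - r 0 t))) \<le> \<epsilon>"
    by (rule vel[of m2]) (use u m in blast)+
qed

text \<open>The neighbourhood controls momenta, hence barycentric velocities, whereas the
  obstruction is heliocentric; the two differ by the velocity of the Sun, which is of order
  \<mu>.\<close>

lemma nonexistence_half:
  assumes m: "m1 > 0" "m2 > 0" "m1 + m2 = 1" and w: "w1 \<noteq> 0" "w2 \<noteq> 0" "\<bar>w1\<bar> \<noteq> \<bar>w2\<bar>" and res: "special_resonance w1 w2"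
    and T: "T > 0" and D: "D > 0" and per: "(w2 - w1) / (2 * pi) * T \<in> \<int>"
  shows "\<exists>\<mu>0>0. \<forall>\<omega>>0. \<exists>U :: phase set.
              open U \<and> circular_torus \<omega> m1 m2 w1 w2 \<subseteq> U \<and> U \<subseteq> phase_space \<and>
              (\<forall>\<mu>. 0 < \<mu> \<and> \<mu> \<le> \<mu>0 \<longrightarrow>
                 \<not> (\<exists>r T' \<alpha>'.
                      three_body_solution \<mu> m1 m2 r \<and>
                      rel_periodic T' \<alpha>' r \<and>
                      \<bar>T' - T\<bar> + \<bar>\<alpha>'\<bar> \<le> D * \<mu> \<and>
                      phase_orbit \<omega> \<mu> m1 m2 r \<subseteq> U))"
proof -
  define A1 A2 where "A1 = \<bar>w1\<bar> powr (-2/3)" and "A2 = \<bar>w2\<bar> powr (-2/3)"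
  obtain e \<mu>a where e: "e > 0" "\<mu>a > 0" and h: "\<And>\<mu> X1 V1 X2 V2 T' \<alpha>'. 0 < \<mu> \<longrightarrow> \<mu> \<le> \<mu>a \<longrightarrow>
     planet_pair \<mu> m1 m2 X1 V1 X2 \<longrightarrow> planet_pair \<mu> m2 m1 X2 V2 X1 \<longrightarrow>
     near_circular w1 A1 e X1 V1 \<longrightarrow> near_circular w2 A2 e X2 V2 \<longrightarrow>
     (\<forall>t. X1 (t + T') = cis \<alpha>' * X1 t \<and> X2 (t + T') = cis \<alpha>' * X2 t) \<longrightarrow> T' > 0 \<longrightarrow>
     \<not> \<bar>T' - T\<bar> + \<bar>\<alpha>'\<bar> \<le> D * \<mu>"
    using resonance_no_near_return[OF m(1,2) w res T D per] unfolding no_near_return_def A1_def[symmetric] A2_def[symmetric] by blast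
  \<comment> \<open>One half for the size of the neighbourhood, one half for the velocity of the
    Sun.\<close>
  define \<epsilon> where "\<epsilon> = e / 2"
  define K where "K = m1 * (\<epsilon> + \<bar>w1\<bar> * (A1 + \<epsilon>)) + m2 * (\<epsilon> + \<bar>w2\<bar> * (A2 + \<epsilon>))"
  have \<epsilon>: "\<epsilon> > 0" "\<epsilon> + \<epsilon> = e" using e by (auto simp: \<epsilon>_def)
  have "A1 > 0" "A2 > 0" using w by (auto simp: A1_def A2_def)
  then have K: "K > 0" using \<epsilon>(1) m w unfolding K_def by (intro add_pos_pos mult_pos_pos) auto
  define \<mu>0 where "\<mu>0 = min \<mu>a (\<epsilon> / K)"
  have \<mu>0: "\<mu>0 > 0" using e \<epsilon> K by (simp add: \<mu>0_def)
  have main: False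
    if \<omega>: "\<omega> > 0" and \<mu>: "0 < \<mu>" "\<mu> \<le> \<mu>0" and sol: "three_body_solution \<mu> m1 m2 r" and rp: "rel_periodic T' \<alpha>' r"
      and small: "\<bar>T' - T\<bar> + \<bar>\<alpha>'\<bar> \<le> D * \<mu>" and orb: "phase_orbit \<omega> \<mu> m1 m2 r \<subseteq> torus_nbhd \<omega> m1 m2 w1 w2 A1 A2 \<epsilon>" for \<omega> \<mu> r T' \<alpha>'
  proof -
    have "phase_point \<omega> \<mu> m1 m2 r t \<in> phase_orbit \<omega> \<mu> m1 m2 r" for t
      unfolding phase_orbit_def by (rule UN_I[of 0], simp, rule UN_I[of 0], simp, rule range_eqI[of _ _ t]) simp
    then have U: "phase_point \<omega> \<mu> m1 m2 r t \<in> torus_nbhd \<omega> m1 m2 w1 w2 A1 A2 \<epsilon>" for t using orb by blast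
    define c where "c = \<mu> powr (1/3)"
    define X V where "X j t = c *\<^sub>R (r j t - r 0 t)" and "V j t = c *\<^sub>R (velocity r j t - velocity r 0 t)" for j t
    have X: "(\<lambda>t. c *\<^sub>R (r j t - r 0 t)) = X j" "(\<lambda>t. c *\<^sub>R (velocity r j t - velocity r 0 t)) = V j" for j
      by (simp_all add: X_def V_def fun_eq_iff)
    note hel = heliocentric[OF \<mu>(1) sol, folded c_def, unfolded X, folded V_def]
    note nb = phase_point_in_nbhd[OF \<omega> \<mu>(1) m(1,2) U, folded c_def, folded X_def]
    have sp: "cmod (c *\<^sub>R velocity r 1 t) \<le> \<epsilon> + \<bar>w1\<bar> * (A1 + \<epsilon>)" "cmod (c *\<^sub>R velocity r 2 t) \<le> \<epsilon> + \<bar>w2\<bar> * (A2 + \<epsilon>)" for t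
    proof -
      have gen: "cmod y \<le> \<epsilon> + \<bar>w\<bar> * (A + \<epsilon>)" if "cmod (y - \<i> * of_real w * x) \<le> \<epsilon>" "\<bar>cmod x - A\<bar> \<le> \<epsilon>" for x y and w A :: real
      proof -
        have "cmod y \<le> cmod (y - \<i> * of_real w * x) + cmod (\<i> * of_real w * x)"
          using norm_triangle_ineq[of "y - \<i> * of_real w * x" "\<i> * of_real w * x"] by simp
        also have "cmod (\<i> * of_real w * x) = \<bar>w\<bar> * cmod x" by (simp add: norm_mult)
        also have "\<bar>w\<bar> * cmod x \<le> \<bar>w\<bar> * (A + \<epsilon>)" using that(2) by (intro mult_left_mono) auto
        finally show ?thesis using that(1) by linarith
      qed
      show "cmod (c *\<^sub>R velocity r 1 t) \<le> \<epsilon> + \<bar>w1\<bar> * (A1 + \<epsilon>)" "cmod (c *\<^sub>R velocity r 2 t) \<le> \<epsilon> + \<bar>w2\<bar> * (A2 + \<epsilon>)"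
        by (rule gen[OF nb(3) nb(1)], rule gen[OF nb(4) nb(2)])
    qed
    have P: "cmod (\<mu> *\<^sub>R (m1 *\<^sub>R (c *\<^sub>R velocity r 1 t) + m2 *\<^sub>R (c *\<^sub>R velocity r 2 t))) \<le> \<epsilon>" for t
    proof -
      have "cmod (m1 *\<^sub>R (c *\<^sub>R velocity r 1 t) + m2 *\<^sub>R (c *\<^sub>R velocity r 2 t)) \<le>
        cmod (m1 *\<^sub>R (c *\<^sub>R velocity r 1 t)) + cmod (m2 *\<^sub>R (c *\<^sub>R velocity r 2 t))" by (rule norm_triangle_ineq)
      also have "\<dots> = m1 * cmod (c *\<^sub>R velocity r 1 t) + m2 * cmod (c *\<^sub>R velocity r 2 t)"
        using m unfolding norm_scaleR[of m1] norm_scaleR[of m2] by simp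
      also have "\<dots> \<le> K" unfolding K_def using m sp[of t] by (intro add_mono mult_left_mono) auto
      finally have "\<mu> * cmod (m1 *\<^sub>R (c *\<^sub>R velocity r 1 t) + m2 *\<^sub>R (c *\<^sub>R velocity r 2 t)) \<le> \<mu> * K" using \<mu>(1) by simp
      also have "\<mu> * K \<le> \<epsilon>" using \<mu>(2) K by (simp add: \<mu>0_def field_simps)
      finally show ?thesis using \<mu>(1) by simp
    qed
    have close: "cmod (V j t - \<i> * of_real w * X j t) \<le> e" if "j < 3" "cmod (c *\<^sub>R velocity r j t - \<i> * of_real w * X j t) \<le> \<epsilon>" for j t w
    proof -
      have V: "V j t - \<i> * of_real w * X j t = (c *\<^sub>R velocity r j t - \<i> * of_real w * X j t) + \<mu> *\<^sub>R (m1 *\<^sub>R (c *\<^sub>R velocity r 1 t) + m2 *\<^sub>R (c *\<^sub>R velocity r 2 t))"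
        using hel(4)[OF that(1), of t] by simp
      show ?thesis
        unfolding V \<epsilon>(2)[symmetric] using that(2) P by (rule norm_triangle_mono)
    qed
    have "\<bar>cmod (X 1 t) - A1\<bar> \<le> e" "\<bar>cmod (X 2 t) - A2\<bar> \<le> e" for t using nb(1,2)[of t] \<epsilon> by auto
    then have near: "near_circular w1 A1 e (X 1) (V 1)" "near_circular w2 A2 e (X 2) (V 2)"
      unfolding near_circular_def using hel(1)[of 1] hel(1)[of 2] close[of 1, OF _ nb(3)] close[of 2, OF _ nb(4)] by auto
    have ret: "X j (t + T') = cis \<alpha>' * X j t" if "j < 3" for j t
    proof -
      have "r j (t + T') = cis \<alpha>' * r j t" "r 0 (t + T') = cis \<alpha>' * r 0 t" using rp that unfolding rel_periodic_def by auto
      then show ?thesis by (simp add: X_def scaleR_conv_of_real algebra_simps)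
    qed
    have "T' > 0" using rp by (simp add: rel_periodic_def)
    moreover have "\<mu> \<le> \<mu>a" using \<mu>(2) by (simp add: \<mu>0_def)
    ultimately show False
      using h[of \<mu> "X 1" "V 1" "X 2" "V 2" T' \<alpha>'] \<mu>(1) hel(2,3) near small ret[of 1] ret[of 2] by auto
  qed
  show ?thesis
  proof (rule exI[of _ \<mu>0], rule conjI[OF \<mu>0], intro allI impI)
    fix \<omega> :: real assume \<omega>: "\<omega> > 0"
    show "\<exists>U :: phase set.
              open U \<and> circular_torus \<omega> m1 m2 w1 w2 \<subseteq> U \<and> U \<subseteq> phase_space \<and>
              (\<forall>\<mu>. 0 < \<mu> \<and> \<mu> \<le> \<mu>0 \<longrightarrow>
                 \<not> (\<exists>r T' \<alpha>'.
                      three_body_solution \<mu> m1 m2 r \<and>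
                      rel_periodic T' \<alpha>' r \<and>
                      \<bar>T' - T\<bar> + \<bar>\<alpha>'\<bar> \<le> D * \<mu> \<and>
                      phase_orbit \<omega> \<mu> m1 m2 r \<subseteq> U))"
    proof (rule exI[of _ "torus_nbhd \<omega> m1 m2 w1 w2 A1 A2 \<epsilon>"], intro conjI allI impI notI)
      show "torus_nbhd \<omega> m1 m2 w1 w2 A1 A2 \<epsilon> \<subseteq> phase_space" by (simp add: torus_nbhd_def)
      show "open (torus_nbhd \<omega> m1 m2 w1 w2 A1 A2 \<epsilon>)" by (rule open_torus_nbhd)
      show "circular_torus \<omega> m1 m2 w1 w2 \<subseteq> torus_nbhd \<omega> m1 m2 w1 w2 A1 A2 \<epsilon>"
        unfolding A1_def A2_def by (rule circular_torus_subset_nbhd[OF \<omega> m(1,2) w \<epsilon>(1)])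
      fix \<mu> assume \<mu>: "0 < \<mu> \<and> \<mu> \<le> \<mu>0" and "\<exists>r T' \<alpha>'. three_body_solution \<mu> m1 m2 r \<and> rel_periodic T' \<alpha>' r \<and>
          \<bar>T' - T\<bar> + \<bar>\<alpha>'\<bar> \<le> D * \<mu> \<and> phase_orbit \<omega> \<mu> m1 m2 r \<subseteq> torus_nbhd \<omega> m1 m2 w1 w2 A1 A2 \<epsilon>"
      then obtain r T' \<alpha>' where "three_body_solution \<mu> m1 m2 r" "rel_periodic T' \<alpha>' r"
        "\<bar>T' - T\<bar> + \<bar>\<alpha>'\<bar> \<le> D * \<mu>" "phase_orbit \<omega> \<mu> m1 m2 r \<subseteq> torus_nbhd \<omega> m1 m2 w1 w2 A1 A2 \<epsilon>" by blast
      with \<mu> show False by (intro main[OF \<omega>]) auto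
    qed
  qed
qed

theorem corollary2p1:
  fixes m1 m2 \<omega>1 \<omega>2 \<alpha> :: real and k :: int
  assumes "m1 > 0" "m2 > 0" "m1 + m2 = 1"
    and "\<omega>1 \<noteq> 0" "\<omega>2 \<noteq> 0" "\<bar>\<omega>1\<bar> \<noteq> \<bar>\<omega>2\<bar>"
    and "\<alpha> = 2 * pi * (\<omega>1 / \<bar>\<omega>2 - \<omega>1\<bar>) + 2 * pi * of_int k" "- pi < \<alpha>" "\<alpha> \<le> pi"
  shows
    "(\<not> special_resonance \<omega>1 \<omega>2 \<longrightarrow>
        \<alpha> \<noteq> 0 \<and>
        (\<exists>\<mu>0>0. \<forall>\<omega>>0. \<exists>\<Lambda> :: real \<times> real \<times> real \<Rightarrow> phase set.
           smooth_torus_family (parameter_ball \<mu>0 \<omega>1 \<omega>2) \<Lambda> \<and>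
           (\<forall>p \<in> parameter_ball \<mu>0 \<omega>1 \<omega>2. \<Lambda> p \<subseteq> phase_space) \<and>
           \<Lambda> (0, \<omega>1, \<omega>2) = circular_torus \<omega> m1 m2 \<omega>1 \<omega>2 \<and>
           (\<forall>\<mu> v1 v2. (\<mu>, v1, v2) \<in> parameter_ball \<mu>0 \<omega>1 \<omega>2 \<longrightarrow> 0 < \<mu> \<longrightarrow> \<mu> \<le> \<mu>0 \<longrightarrow>
              (\<exists>r T' \<alpha>'. \<exists>k'::int.
                 T' = 2 * pi / \<bar>v2 - v1\<bar> \<and>
                 \<alpha>' = 2 * pi * (v1 / \<bar>v2 - v1\<bar>) + 2 * pi * of_int k' \<and>
                 three_body_solution \<mu> m1 m2 r \<and>
                 symmetric_solution r \<and>
                 rel_periodic T' \<alpha>' r \<and>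
                 \<Lambda> (\<mu>, v1, v2) = phase_orbit \<omega> \<mu> m1 m2 r))))
     \<and>
     (special_resonance \<omega>1 \<omega>2 \<longrightarrow>
        \<alpha> = 0 \<and>
        (\<forall>T>0. \<forall>D>0. (\<omega>2 - \<omega>1) / (2 * pi) * T \<in> \<int> \<longrightarrow>
           (\<exists>\<mu>0>0. \<forall>\<omega>>0. \<exists>U :: phase set.
              open U \<and> circular_torus \<omega> m1 m2 \<omega>1 \<omega>2 \<subseteq> U \<and> U \<subseteq> phase_space \<and>
              (\<forall>\<mu>. 0 < \<mu> \<and> \<mu> \<le> \<mu>0 \<longrightarrow>
                 \<not> (\<exists>r T' \<alpha>'.
                      three_body_solution \<mu> m1 m2 r \<and>
                      rel_periodic T' \<alpha>' r \<and>
                      \<bar>T' - T\<bar> + \<bar>\<alpha>'\<bar> \<le> D * \<mu> \<and>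
                      phase_orbit \<omega> \<mu> m1 m2 r \<subseteq> U)))))"
proof -
  define \<nu> where "\<nu> = \<omega>2 - \<omega>1"
  have \<nu>: "\<nu> \<noteq> 0" using assms(6) by (auto simp: \<nu>_def)
  have res: "special_resonance \<omega>1 \<omega>2 \<longleftrightarrow> \<omega>1 / \<bar>\<nu>\<bar> \<in> \<int>"
    unfolding frequency_ratio_int[OF assms(4-6)] \<nu>_def[symmetric] by (cases "\<nu> > 0") auto
  have \<alpha>: "\<alpha> = 2 * pi * (\<omega>1 / \<bar>\<nu>\<bar> + of_int k)" using assms(7) by (simp add: \<nu>_def distrib_left)
  have zero: "special_resonance \<omega>1 \<omega>2 \<longleftrightarrow> \<alpha> = 0"
  proof
    assume "special_resonance \<omega>1 \<omega>2"
    then obtain n where "\<omega>1 / \<bar>\<nu>\<bar> = of_int n" unfolding res by (auto elim: Ints_cases)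
    then have a: "\<alpha> = (2 * of_int (n + k)) * pi" unfolding \<alpha> by simp
    \<comment> \<open>\<alpha> is an even multiple of \<pi> lying above -\<pi> and not above \<pi>,
      so the multiple is zero.\<close>
    have "(- 1) * pi < (2 * of_int (n + k)) * pi" "(2 * of_int (n + k)) * pi \<le> 1 * pi" using assms(8,9) unfolding a by auto
    then have "(- 1) < 2 * real_of_int (n + k)" "2 * real_of_int (n + k) \<le> 1"
      using pi_gt_zero by (simp_all only: mult_less_cancel_right_pos mult_le_cancel_right_pos)
    then have "real_of_int (n + k) < 1" "real_of_int (- (n + k)) < 1" by simp_all
    then have "n + k < 1" "- (n + k) < 1" by (simp_all only: of_int_less_1_iff)
    then have "n + k = 0" by linarith
    then show "\<alpha> = 0" unfolding a by simp
  next
    assume "\<alpha> = 0"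
    then have "\<omega>1 / \<bar>\<nu>\<bar> = of_int (- k)" unfolding \<alpha> by simp
    then show "special_resonance \<omega>1 \<omega>2" unfolding res by (metis Ints_of_int)
  qed
  have nr: "\<omega>1 / (\<omega>2 - \<omega>1) \<noteq> of_int n" if "\<not> special_resonance \<omega>1 \<omega>2" for n :: int
    using that unfolding frequency_ratio_int[OF assms(4-6)] by (metis Ints_of_int)
  show ?thesis
  proof (intro conjI impI allI)
    assume "\<not> special_resonance \<omega>1 \<omega>2"
    then show "\<alpha> \<noteq> 0" using zero by simp
  next
    assume "special_resonance \<omega>1 \<omega>2"
    then show "\<alpha> = 0" using zero by simp
  qed (rule existence_half[OF assms(3-6) nr] nonexistence_half[OF assms(1-6)], assumption+)+
qed

end
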